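(* Let $A,a,p,q,s,V,\alpha$ satisfy the structural assumptions listed in the context. Let $b\in L^\infty(\mathbb{R}^N)$ with $b>0$ a.e., and let $t\in C(\mathbb{R}^N)$ satisfy $\alpha(x)\le t(x)\le p^*(x)$ for all $x\in\mathbb{R}^N$ and $\{x\in\mathbb{R}^N: t(x)=p^*(x)\}\neq\emptyset$. Let $u_n\rightharpoonup u$ weakly in $X$, with $$A(x,\nabla u_n)+V(x)|u_n|^{\alpha(x)}\overset{*}{\rightharpoonup}\mu,\qquad b|u_n|^{t(x)}\overset{*}{\rightharpoonup}\nu\qquad\text{in }\mathcal{M}(\mathbb{R}^N),$$ and set $$\mu_\infty:=\lim_{R\to\infty}\limsup_{n\to\infty}\int_{\{|x|>R\}}\left[A(x,\nabla u_n)+V(x)|u_n|^{\alpha(x)}\right]dx,\qquad \nu_\infty:=\lim_{R\to\infty}\limsup_{n\to\infty}\int_{\{|x|>R\}}b(x)|u_n|^{t(x)}dx.$$ Then $$\limsup_{n\to\infty}\int_{\mathbb{R}^N}\left[A(x,\nabla u_n)+V(x)|u_n|^{\alpha(x)}\right]dx=\mu(\mathbb{R}^N)+\mu_\infty,\qquad \limsup_{n\to\infty}\int_{\mathbb{R}^N}b(x)|u_n|^{t(x)}dx=\nu(\mathbb{R}^N)+\nu_\infty.$$ Assume in addition that there exist positive real numbers $p_\infty,q_\infty,\alpha_\infty,t_\infty$ such that $p(x)\to p_\infty$, $q(x)\to q_\infty$, $\alpha(x)\to\alpha_\infty$ and $t(x)\to t_\infty$ as $|x|\to\infty$. Then $$S_b\,\nu_\infty^{\frac1{t_\infty}}\le\max\left\{1,M_1^{-\frac1{p_\infty}}\right\}\left(\mu_\infty^{\frac1{p_\infty}}+\mu_\infty^{\frac1{q_\infty}}+\mu_\infty^{\frac1{\alpha_\infty}}\right),$$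 where $S_b:=\inf_{u\in X\setminus\{0\}}\frac{\|u\|}{|u|_{L^{t(\cdot)}(b,\mathbb{R}^N)}}\in(0,\infty)$ and $M_1$ is the constant in the growth estimate (G) of the context.
   Context: **Notation.** $N\ge2$. For $m,n\in C(\mathbb{R}^N)$, $m(\cdot)\ll n(\cdot)$ means $\inf_{x\in\mathbb{R}^N}(n(x)-m(x))>0$. $C^{0,1}_+(\mathbb{R}^N)$ is the set of Lipschitz continuous $r:\mathbb{R}^N\to\mathbb{R}$ with $1\ll r(\cdot)$. $r':=r/(r-1)$ and $p^*:=\frac{Np}{N-p}$ (pointwise). For a measure $\mu$ and a variable exponent $r$, $L^{r(\cdot)}_\mu(\mathbb{R}^N)$ is the space of $\mu$-measurable $u$ with $\int|u|^{r(x)}d\mu<\infty$, with Luxemburg norm $|u|_{L^{r(\cdot)}_\mu}=\inf\{\lambda>0:\int|u/\lambda|^{r(x)}d\mu\le1\}$; $L^{r(\cdot)}(w,\mathbb{R}^N)$ is the case $d\mu=w\,dx$, and $L^{r(\cdot)}(\mathbb{R}^N)$ the case $w\equiv1$. $L^{p(\cdot)}(\mathbb{R}^N)+L^{q(\cdot)}(\mathbb{R}^N)$ is the sum space with norm $\inf\{|v|_{L^{p(\cdot)}}+|w|_{L^{q(\cdot)}}: u=v+w,\ v\in L^{p(\cdot)},\ w\in L^{q(\cdot)}\}$. $\mathcal{M}(\mathbb{R}^N)$ is the space of signed finite Radon measures on $\mathbb{R}^N$, identified with the dual of $C_0(\mathbb{R}^N)$ (the sup-norm completion of $C_c(\mathbb{R}^N)$);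 $\overset{*}{\rightharpoonup}$ is weak-$*$ convergence; an $L^1$ function $g$ is identified with the measure $g\,dx$. **Structural assumptions.** (A1) $A\in C(\mathbb{R}^N\times\mathbb{R}^N)$ is continuously differentiable in the second variable, $a:=\nabla_\xi A$, and $A(x,-\xi)=A(x,\xi)$, $A(x,0)=0$ for all $(x,\xi)$. (A2) $A(x,\cdot)$ is strictly convex for all $x$. (A3) There are constants $N_1,N_2>0$ such that $a(x,\xi)\cdot\xi\ge N_1|\xi|^{p(x)}$ and $|a(x,\xi)|\le N_2|\xi|^{p(x)-1}$ for $|\xi|$ large, and $a(x,\xi)\cdot\xi\ge N_1|\xi|^{q(x)}$ and $|a(x,\xi)|\le N_2|\xi|^{q(x)-1}$ for $|\xi|$ small (thresholds uniform in $x$). (A4) $p,q\in C^{0,1}_+(\mathbb{R}^N)$ and $p(\cdot)\ll q(\cdot)\ll\min\{N,p^*(\cdot)\}$. (A5) $a(x,\xi)\cdot\xi\le s(x)A(x,\xi)$ for all $(x,\xi)$, where $s\in C^{0,1}_+(\mathbb{R}^N)$ and $q(\cdot)\le s(\cdot)\ll p^*(\cdot)$. (A6) For every $\varepsilon\in(0,1)$ there is $\delta(\varepsilon)\in(0,1)$ such that for all $x,u,v\in\mathbb{R}^N$, either $|u-v|\le\varepsilon\max\{|u|,|v|\}$ or $A(x,\frac{u+v}2)\le\frac12(1-\delta(\varepsilon))(A(x,u)+A(x,v))$. (V1) $V\in L^1_{\rm loc}(\mathbb{R}^N)$ and $\operatorname{ess\,inf}V=V_0>0$. (P1) $\alpha\in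 C(\mathbb{R}^N)$, $1\ll\alpha(\cdot)\ll p^*(\cdot)\frac{N-1}N$ and $\alpha(\cdot)\le p^*(\cdot)\frac{q'(\cdot)}{p'(\cdot)}$. **Growth estimate (G).** Under these assumptions there are constants $M_1,M_2>0$, fixed once and for all, such that for all $(x,\xi)$: $M_1|\xi|^{p(x)}\le A(x,\xi)\le a(x,\xi)\cdot\xi\le M_2|\xi|^{p(x)}$ if $|\xi|>1$, and $M_1|\xi|^{q(x)}\le A(x,\xi)\le a(x,\xi)\cdot\xi\le M_2|\xi|^{q(x)}$ if $|\xi|\le1$. **Solution space.** $X:=\{u\in L^{\alpha(\cdot)}(V,\mathbb{R}^N): |\nabla u|\in L^{p(\cdot)}(\mathbb{R}^N)+L^{q(\cdot)}(\mathbb{R}^N)\}$ with norm $\|u\|:=|u|_{L^{\alpha(\cdot)}(V,\mathbb{R}^N)}+\big||\nabla u|\big|_{L^{p(\cdot)}(\mathbb{R}^N)+L^{q(\cdot)}(\mathbb{R}^N)}$; it is a reflexive Banach space, continuously embedded in $L^{r(\cdot)}(\mathbb{R}^N)$ for every continuous $r$ with $\alpha\le r\le p^*$. *)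

theory Defs
  imports "HOL-Probability.Probability"
begin

text \<open>
  The Euclidean space \<open>\<real>\<^sup>N\<close> is a type \<open>'a :: euclidean_space\<close> with \<open>N = DIM('a)\<close>. Functions are
  representatives, not classes modulo null sets; every notion below is insensitive to null sets.
\<close>

subsection \<open>Variable exponents\<close>

text \<open>The infimum is taken in \<^typ>\<open>ereal\<close>, since the difference may be unbounded below.\<close>

definition much_less :: "('a \<Rightarrow> real) \<Rightarrow> ('a \<Rightarrow> real) \<Rightarrow> bool" where
  "much_less m n \<longleftrightarrow> 0 < (INF x. ereal (n x - m x))"

definition lipschitz_exponent :: "('a::euclidean_space \<Rightarrow> real) \<Rightarrow> bool" where
  "lipschitz_exponent r \<longleftrightarrow> (\<exists>L. L-lipschitz_on UNIV r) \<and> much_less (\<lambda>_. 1) r"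

definition conj_exp :: "('a \<Rightarrow> real) \<Rightarrow> 'a \<Rightarrow> real" where
  "conj_exp r x = r x / (r x - 1)"

definition sobolev_exp :: "('a::euclidean_space \<Rightarrow> real) \<Rightarrow> 'a \<Rightarrow> real" where
  "sobolev_exp p x = real DIM('a) * p x / (real DIM('a) - p x)"

subsection \<open>Variable exponent Lebesgue spaces\<close>

definition modular :: "'a measure \<Rightarrow> ('a \<Rightarrow> real) \<Rightarrow> ('a \<Rightarrow> real) \<Rightarrow> ennreal" where
  "modular M r u = (\<integral>\<^sup>+ x. ennreal (\<bar>u x\<bar> powr r x) \<partial>M)"

definition Lvar :: "'a measure \<Rightarrow> ('a \<Rightarrow> real) \<Rightarrow> ('a \<Rightarrow> real) set" where
  "Lvar M r = {u \<in> borel_measurable M. modular M r u < \<infinity>}"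

definition luxemburg :: "'a measure \<Rightarrow> ('a \<Rightarrow> real) \<Rightarrow> ('a \<Rightarrow> real) \<Rightarrow> real" where
  "luxemburg M r u = Inf {c. 0 < c \<and> modular M r (\<lambda>x. u x / c) \<le> 1}"

definition weighted :: "('a::euclidean_space \<Rightarrow> real) \<Rightarrow> 'a measure" where
  "weighted w = density lebesgue (\<lambda>x. ennreal (w x))"

definition sum_decomp ::
  "('a::euclidean_space \<Rightarrow> real) \<Rightarrow> ('a \<Rightarrow> real) \<Rightarrow> ('a \<Rightarrow> real) \<Rightarrow> (('a \<Rightarrow> real) \<times> ('a \<Rightarrow> real)) set" where
  "sum_decomp p q f = {(v, w). v \<in> Lvar lebesgue p \<and> w \<in> Lvar lebesgue q \<and>
     (AE x in lebesgue. f x = v x + w x)}"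

definition sum_space :: "('a::euclidean_space \<Rightarrow> real) \<Rightarrow> ('a \<Rightarrow> real) \<Rightarrow> ('a \<Rightarrow> real) set" where
  "sum_space p q = {f. sum_decomp p q f \<noteq> {}}"

definition sum_norm :: "('a::euclidean_space \<Rightarrow> real) \<Rightarrow> ('a \<Rightarrow> real) \<Rightarrow> ('a \<Rightarrow> real) \<Rightarrow> real" where
  "sum_norm p q f = (INF (v, w) \<in> sum_decomp p q f. luxemburg lebesgue p v + luxemburg lebesgue q w)"

subsection \<open>Weak gradients\<close>

definition locally_integrable ::
  "('a::euclidean_space \<Rightarrow> 'b::{banach, second_countable_topology}) \<Rightarrow> bool" where
  "locally_integrable f \<longleftrightarrow> (\<forall>K. compact K \<longrightarrow> set_integrable lebesgue K f)"

primrec Ck :: "nat \<Rightarrow> ('a::euclidean_space \<Rightarrow> real) \<Rightarrow> bool" where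
  "Ck 0 f \<longleftrightarrow> continuous_on UNIV f"
| "Ck (Suc k) f \<longleftrightarrow> (\<forall>x. f differentiable (at x)) \<and>
     (\<forall>i\<in>Basis. Ck k (\<lambda>x. frechet_derivative f (at x) i))"

definition test_function :: "('a::euclidean_space \<Rightarrow> real) \<Rightarrow> bool" where
  "test_function \<phi> \<longleftrightarrow> (\<forall>k. Ck k \<phi>) \<and> compact (closure {x. \<phi> x \<noteq> 0})"

definition has_weak_gradient :: "('a::euclidean_space \<Rightarrow> real) \<Rightarrow> ('a \<Rightarrow> 'a) \<Rightarrow> bool" where
  "has_weak_gradient u G \<longleftrightarrow> locally_integrable u \<and> locally_integrable G \<and>
     (\<forall>\<phi>. test_function \<phi> \<longrightarrow> (\<forall>i\<in>Basis.
        (LINT x|lebesgue. u x * frechet_derivative \<phi> (at x) i) =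
        - (LINT x|lebesgue. (G x \<bullet> i) * \<phi> x)))"

text \<open>The weak gradient is unique up to null sets; one representative is chosen.\<close>

definition wgrad :: "('a::euclidean_space \<Rightarrow> real) \<Rightarrow> 'a \<Rightarrow> 'a" where
  "wgrad u = (SOME G. has_weak_gradient u G)"

subsection \<open>The solution space\<close>

definition sol_space :: "('a::euclidean_space \<Rightarrow> real) \<Rightarrow> ('a \<Rightarrow> real) \<Rightarrow> ('a \<Rightarrow> real) \<Rightarrow>
    ('a \<Rightarrow> real) \<Rightarrow> ('a \<Rightarrow> real) set" where
  "sol_space V \<alpha> p q = {u \<in> Lvar (weighted V) \<alpha>.
     (\<exists>G. has_weak_gradient u G) \<and> (\<lambda>x. norm (wgrad u x)) \<in> sum_space p q}"

definition sol_norm :: "('a::euclidean_space \<Rightarrow> real) \<Rightarrow> ('a \<Rightarrow> real) \<Rightarrow> ('a \<Rightarrow> real) \<Rightarrow>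
    ('a \<Rightarrow> real) \<Rightarrow> ('a \<Rightarrow> real) \<Rightarrow> real" where
  "sol_norm V \<alpha> p q u = luxemburg (weighted V) \<alpha> u + sum_norm p q (\<lambda>x. norm (wgrad u x))"

text \<open>
  A functional on representatives that is bounded with respect to the norm of the space vanishes
  on functions that are null almost everywhere, hence is a functional on the space of classes.
\<close>

definition bounded_functional ::
  "('a \<Rightarrow> real) set \<Rightarrow> (('a \<Rightarrow> real) \<Rightarrow> real) \<Rightarrow> (('a \<Rightarrow> real) \<Rightarrow> real) \<Rightarrow> bool" where
  "bounded_functional S nrm l \<longleftrightarrow>
     (\<forall>u\<in>S. \<forall>v\<in>S. l (\<lambda>x. u x + v x) = l u + l v) \<and>
     (\<forall>c. \<forall>u\<in>S. l (\<lambda>x. c * u x) = c * l u) \<and>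
     (\<exists>C. \<forall>u\<in>S. \<bar>l u\<bar> \<le> C * nrm u)"

definition weakly_converges ::
  "('a \<Rightarrow> real) set \<Rightarrow> (('a \<Rightarrow> real) \<Rightarrow> real) \<Rightarrow> (nat \<Rightarrow> 'a \<Rightarrow> real) \<Rightarrow> ('a \<Rightarrow> real) \<Rightarrow> bool" where
  "weakly_converges S nrm un u \<longleftrightarrow> (\<forall>n. un n \<in> S) \<and> u \<in> S \<and>
     (\<forall>l. bounded_functional S nrm l \<longrightarrow> (\<lambda>n. l (un n)) \<longlonglongrightarrow> l u)"

text \<open>The best constant, an infimum over the functions of the space that are not null
  almost everywhere.\<close>

definition best_const :: "('a::euclidean_space \<Rightarrow> real) \<Rightarrow> ('a \<Rightarrow> real) \<Rightarrow> ('a \<Rightarrow> real) \<Rightarrow>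
    ('a \<Rightarrow> real) \<Rightarrow> ('a \<Rightarrow> real) \<Rightarrow> ('a \<Rightarrow> real) \<Rightarrow> ereal" where
  "best_const V \<alpha> p q b t =
     (INF u \<in> {u \<in> sol_space V \<alpha> p q. \<not> (AE x in lebesgue. u x = 0)}.
        ereal (sol_norm V \<alpha> p q u / luxemburg (weighted b) t u))"

subsection \<open>Signed measures and weak-star convergence\<close>

text \<open>
  Finite signed Radon measures are real-valued countably additive functions on the Borel sets
  (on a Euclidean space all of these are Radon). Integrals are taken through the
  Jordan decomposition: the positive variation of \<open>E\<close> is the supremum of \<open>m B\<close> over Borel
  \<open>B \<subseteq> E\<close>. Here \<^const>\<open>ennreal\<close> sends negative values to \<open>0\<close>, harmlessly because of \<open>B = {}\<close>.
\<close>

definition signed_measure :: "('a::euclidean_space set \<Rightarrow> real) \<Rightarrow> bool" where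
  "signed_measure m \<longleftrightarrow> (\<forall>F :: nat \<Rightarrow> 'a set. range F \<subseteq> sets borel \<longrightarrow> disjoint_family F \<longrightarrow>
     (\<lambda>n. m (F n)) sums m (\<Union>n. F n))"

definition pos_variation :: "('a::euclidean_space set \<Rightarrow> real) \<Rightarrow> 'a measure" where
  "pos_variation m =
     measure_of UNIV (sets borel) (\<lambda>E. SUP B\<in>{B \<in> sets borel. B \<subseteq> E}. ennreal (m B))"

definition signed_integral :: "('a::euclidean_space set \<Rightarrow> real) \<Rightarrow> ('a \<Rightarrow> real) \<Rightarrow> real" where
  "signed_integral m f = (LINT x|pos_variation m. f x) - (LINT x|pos_variation (\<lambda>E. - m E). f x)"

text \<open>Weak-star convergence of \<open>g n dx\<close> to \<open>m\<close>, tested on \<open>C\<^sub>0\<close>.\<close>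

definition weak_star_converges ::
  "(nat \<Rightarrow> 'a::euclidean_space \<Rightarrow> real) \<Rightarrow> ('a set \<Rightarrow> real) \<Rightarrow> bool" where
  "weak_star_converges g m \<longleftrightarrow> (\<forall>n. integrable lebesgue (g n)) \<and> signed_measure m \<and>
     (\<forall>\<phi>. continuous_on UNIV \<phi> \<and> (\<phi> \<longlongrightarrow> 0) at_infinity \<longrightarrow>
        (\<lambda>n. LINT x|lebesgue. \<phi> x * g n x) \<longlonglongrightarrow> signed_integral m \<phi>)"

definition mass_at_infinity :: "(nat \<Rightarrow> 'a::euclidean_space \<Rightarrow> real) \<Rightarrow> ereal" where
  "mass_at_infinity g =
     Lim at_top (\<lambda>R::real. limsup (\<lambda>n. ereal (LINT x:{x. norm x > R}|lebesgue. g n x)))"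

subsection \<open>Structural assumptions\<close>

definition assm_A1 :: "('a::euclidean_space \<Rightarrow> 'a \<Rightarrow> real) \<Rightarrow> ('a \<Rightarrow> 'a \<Rightarrow> 'a) \<Rightarrow> bool" where
  "assm_A1 A a \<longleftrightarrow> continuous_on UNIV (\<lambda>(x, \<xi>). A x \<xi>) \<and>
     (\<forall>x \<xi>. GDERIV (A x) \<xi> :> a x \<xi>) \<and> (\<forall>x. continuous_on UNIV (a x)) \<and>
     (\<forall>x \<xi>. A x (- \<xi>) = A x \<xi>) \<and> (\<forall>x. A x 0 = 0)"

definition assm_A2 :: "('a::euclidean_space \<Rightarrow> 'a \<Rightarrow> real) \<Rightarrow> bool" where
  "assm_A2 A \<longleftrightarrow> (\<forall>x \<xi> \<eta> \<theta>. \<xi> \<noteq> \<eta> \<longrightarrow> 0 < \<theta> \<longrightarrow> \<theta> < 1 \<longrightarrow>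
     A x ((1 - \<theta>) *\<^sub>R \<xi> + \<theta> *\<^sub>R \<eta>) < (1 - \<theta>) * A x \<xi> + \<theta> * A x \<eta>)"

definition assm_A3 :: "('a::euclidean_space \<Rightarrow> 'a \<Rightarrow> 'a) \<Rightarrow> ('a \<Rightarrow> real) \<Rightarrow> ('a \<Rightarrow> real) \<Rightarrow> bool" where
  "assm_A3 a p q \<longleftrightarrow> (\<exists>N1>0. \<exists>N2>0.
     (\<exists>K>0. \<forall>x \<xi>. norm \<xi> \<ge> K \<longrightarrow>
        a x \<xi> \<bullet> \<xi> \<ge> N1 * norm \<xi> powr p x \<and> norm (a x \<xi>) \<le> N2 * norm \<xi> powr (p x - 1)) \<and>
     (\<exists>k>0. \<forall>x \<xi>. norm \<xi> \<le> k \<longrightarrow>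
        a x \<xi> \<bullet> \<xi> \<ge> N1 * norm \<xi> powr q x \<and> norm (a x \<xi>) \<le> N2 * norm \<xi> powr (q x - 1)))"

definition assm_A4 :: "('a::euclidean_space \<Rightarrow> real) \<Rightarrow> ('a \<Rightarrow> real) \<Rightarrow> bool" where
  "assm_A4 p q \<longleftrightarrow> lipschitz_exponent p \<and> lipschitz_exponent q \<and>
     much_less p q \<and> much_less q (\<lambda>x. min (real DIM('a)) (sobolev_exp p x))"

definition assm_A5 :: "('a::euclidean_space \<Rightarrow> 'a \<Rightarrow> real) \<Rightarrow> ('a \<Rightarrow> 'a \<Rightarrow> 'a) \<Rightarrow>
    ('a \<Rightarrow> real) \<Rightarrow> ('a \<Rightarrow> real) \<Rightarrow> ('a \<Rightarrow> real) \<Rightarrow> bool" where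
  "assm_A5 A a p q s \<longleftrightarrow> (\<forall>x \<xi>. a x \<xi> \<bullet> \<xi> \<le> s x * A x \<xi>) \<and>
     lipschitz_exponent s \<and> (\<forall>x. q x \<le> s x) \<and> much_less s (sobolev_exp p)"

definition assm_A6 :: "('a::euclidean_space \<Rightarrow> 'a \<Rightarrow> real) \<Rightarrow> bool" where
  "assm_A6 A \<longleftrightarrow> (\<forall>\<epsilon>\<in>{0<..<1}. \<exists>\<delta>\<in>{0<..<1}. \<forall>x u v.
     norm (u - v) \<le> \<epsilon> * max (norm u) (norm v) \<or>
     A x ((1/2) *\<^sub>R (u + v)) \<le> 1/2 * (1 - \<delta>) * (A x u + A x v))"

text \<open>The essential infimum of \<open>V\<close> is written as \<open>- esssup (- V)\<close>.\<close>

definition assm_V1 :: "('a::euclidean_space \<Rightarrow> real) \<Rightarrow> bool" where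
  "assm_V1 V \<longleftrightarrow> locally_integrable V \<and> 0 < - esssup lebesgue (\<lambda>x. ereal (- V x))"

definition assm_P1 :: "('a::euclidean_space \<Rightarrow> real) \<Rightarrow> ('a \<Rightarrow> real) \<Rightarrow> ('a \<Rightarrow> real) \<Rightarrow> bool" where
  "assm_P1 p q \<alpha> \<longleftrightarrow> continuous_on UNIV \<alpha> \<and> much_less (\<lambda>_. 1) \<alpha> \<and>
     much_less \<alpha> (\<lambda>x. sobolev_exp p x * ((real DIM('a) - 1) / real DIM('a))) \<and>
     (\<forall>x. \<alpha> x \<le> sobolev_exp p x * (conj_exp q x / conj_exp p x))"

definition structural_assumptions :: "('a::euclidean_space \<Rightarrow> 'a \<Rightarrow> real) \<Rightarrow> ('a \<Rightarrow> 'a \<Rightarrow> 'a) \<Rightarrow>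
    ('a \<Rightarrow> real) \<Rightarrow> ('a \<Rightarrow> real) \<Rightarrow> ('a \<Rightarrow> real) \<Rightarrow> ('a \<Rightarrow> real) \<Rightarrow> ('a \<Rightarrow> real) \<Rightarrow> bool" where
  "structural_assumptions A a p q s V \<alpha> \<longleftrightarrow> assm_A1 A a \<and> assm_A2 A \<and> assm_A3 a p q \<and>
     assm_A4 p q \<and> assm_A5 A a p q s \<and> assm_A6 A \<and> assm_V1 V \<and> assm_P1 p q \<alpha>"

definition growth_estimate :: "('a::euclidean_space \<Rightarrow> 'a \<Rightarrow> real) \<Rightarrow> ('a \<Rightarrow> 'a \<Rightarrow> 'a) \<Rightarrow>
    ('a \<Rightarrow> real) \<Rightarrow> ('a \<Rightarrow> real) \<Rightarrow> real \<Rightarrow> real \<Rightarrow> bool" where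
  "growth_estimate A a p q M1 M2 \<longleftrightarrow> 0 < M1 \<and> 0 < M2 \<and> (\<forall>x \<xi>.
     (let r = (if norm \<xi> > 1 then p x else q x) in
        M1 * norm \<xi> powr r \<le> A x \<xi> \<and> A x \<xi> \<le> a x \<xi> \<bullet> \<xi> \<and> a x \<xi> \<bullet> \<xi> \<le> M2 * norm \<xi> powr r))"

end

theory Submission
  imports Defs "HOL-Computational_Algebra.Polynomial"
begin

text \<open>
  Cutting off at infinity with cutoffs equal to \<open>1\<close> on large balls splits the total mass of the
  energies into \<open>\<mu>(\<real>\<^sup>N)\<close> and the mass that escapes to infinity; no compactness is involved in the first
  two identities.

  For the inequality, \<open>S\<^sub>b\<close> is tested with \<open>\<phi> u\<^sub>n\<close>, where \<open>\<phi>\<close> vanishes on a large ball and is \<open>1\<close>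
  outside a larger one. On the support of \<open>\<phi>\<close> all exponents are nearly constant, so Luxemburg norms
  are powers of modulars up to an error. The only dangerous term is \<open>u\<^sub>n \<nabla>\<phi>\<close>; the modular of \<open>u\<^sub>n\<close> for the
  critical exponent \<open>P = p\<^sup>*\<close> is bounded, and Young's inequality against \<open>|\<nabla>\<phi>|\<close> to the power
  \<open>q P / (P - q) > N\<close> makes it small in \<open>L\<^sup>q\<close>.

  The bound for the critical modular, and with it \<open>S\<^sub>b > 0\<close>, comes from the Gagliardo-Nirenberg
  inequality for \<open>|u|\<close> to the power \<open>\<gamma> = P (N - 1) / N\<close>. The exponent \<open>\<gamma>\<close> is Lipschitz, so differentiating it
  costs \<open>|u|\<^bsup>\<gamma>\<^esup> |ln |u||\<close>, which is controlled by the modulars for \<open>\<alpha>\<close> and \<open>P\<close>; the conditions on \<open>\<alpha>\<close>, \<open>p\<close>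
  and \<open>q\<close> are exactly what Young's inequality needs for \<open>|u|\<^bsup>\<gamma> - 1\<^esup> |\<nabla>u|\<close>. The result is superlinear in
  the modular of \<open>u\<close> for \<open>P\<close>, and a continuity argument along \<open>s u\<close>, \<open>0 \<le> s \<le> 1\<close>, excludes large values.
\<close>

subsection \<open>Smooth functions and test functions\<close>

text \<open>A function of the solution space is not known beforehand to have a finite critical
  modular, so a superlinear inequality cannot be exploited for it directly. The estimates are
  therefore made for the bounded truncation \<open>trunc k 0 u\<close>, whose powers above \<alpha>
  are dominated by the modular for \<alpha>; the truncated modular is then finite and continuous
  along s u, and the resulting bound does not depend on k. Smoothness is needed only along
  coordinate lines: u and the Lipschitz exponent \<gamma> are both mollified, which preserves the
  Lipschitz constant. The gap p << q is what raises the exponent \<open>q P / (P - q)\<close> above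
  N: since 1/p - 1/P = 1/N, a uniform gap between 1/p and 1/q makes 1/q - 1/P smaller than 1/N by a
  fixed amount. A cutoff at scale R has gradient of size 1/R on a ball of volume of order R^N, and
  the surplus in the exponent leaves a negative power of R. At infinity the energy bound holds for
  all large n and the lower mass bound for infinitely many n, so a single u_n satisfying both is
  tested. Its gradient is split where the norm passes 1, as in the growth estimate.\<close>

lemma Ck_SucI:
  assumes "\<And>x. (f has_derivative f' x) (at x)" "\<And>i. i \<in> Basis \<Longrightarrow> Ck k (\<lambda>x. f' x i)"
  shows "Ck (Suc k) f"
proof -
  have "frechet_derivative f (at x) = f' x" for x
    using frechet_derivative_at[OF assms(1)] by simp
  then show ?thesis using assms by (auto simp: differentiable_def)
qed

lemma Ck_SucD: "Ck (Suc k) f \<Longrightarrow> Ck k f"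
proof (induction k arbitrary: f)
  case 0
  then show ?case
    by (auto intro!: differentiable_imp_continuous_on simp: differentiable_on_def intro: differentiable_at_withinI)
next
  case (Suc k)
  have *: "Ck (Suc k) f \<longleftrightarrow> (\<forall>x. f differentiable (at x)) \<and>
     (\<forall>i\<in>Basis. Ck k (\<lambda>x. frechet_derivative f (at x) i))" by simp
  have d: "\<forall>x. f differentiable (at x)" and c: "\<And>i. i \<in> Basis \<Longrightarrow> Ck (Suc k) (\<lambda>x. frechet_derivative f (at x) i)"
    using Suc.prems by auto
  show ?case unfolding * using d Suc.IH[OF c] by blast
qed

lemma Ck_has_derivative: "Ck (Suc k) f \<Longrightarrow> (f has_derivative frechet_derivative f (at x)) (at x)"
  by (simp add: frechet_derivative_works[symmetric])

lemma Ck_partial: "Ck (Suc k) f \<Longrightarrow> i \<in> Basis \<Longrightarrow> Ck k (\<lambda>x. frechet_derivative f (at x) i)"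
  by simp

lemma Ck_const: "Ck k (\<lambda>x. c)"
proof (induction k arbitrary: c)
  case (Suc k)
  show ?case by (rule Ck_SucI[where f'="\<lambda>_ _. 0"]) (use Suc in auto)
qed auto

lemma Ck_add: "Ck k f \<Longrightarrow> Ck k g \<Longrightarrow> Ck k (\<lambda>x. f x + g x)"
proof (induction k arbitrary: f g)
  case (Suc k)
  show ?case
    by (rule Ck_SucI[OF has_derivative_add[OF Ck_has_derivative[OF Suc.prems(1)] Ck_has_derivative[OF Suc.prems(2)]]])
       (intro Suc.IH Ck_partial[OF Suc.prems(1)] Ck_partial[OF Suc.prems(2)])
qed (auto intro: continuous_intros)

lemma Ck_mult: "Ck k f \<Longrightarrow> Ck k g \<Longrightarrow> Ck k (\<lambda>x. f x * g x)"
proof (induction k arbitrary: f g)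
  case (Suc k)
  note f = Suc.prems(1) and g = Suc.prems(2)
  show ?case
    by (rule Ck_SucI[OF has_derivative_mult[OF Ck_has_derivative[OF f] Ck_has_derivative[OF g]]])
       (intro Ck_add Suc.IH Ck_partial[OF f] Ck_partial[OF g] Ck_SucD[OF f] Ck_SucD[OF g])
qed (auto intro: continuous_intros)

lemma Ck_prod: "(\<And>i. i \<in> I \<Longrightarrow> Ck k (f i)) \<Longrightarrow> Ck k (\<lambda>x. \<Prod>i\<in>I. f i x)"
  by (induction I rule: infinite_finite_induct) (auto intro: Ck_const Ck_mult)

lemma Ck_inverse:
  assumes nz: "\<And>x. f x \<noteq> 0"
  shows "Ck k f \<Longrightarrow> Ck k (\<lambda>x. inverse (f x))"
proof (induction k)
  case (Suc k)
  note f = Suc.prems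
  have "((\<lambda>x. inverse (f x)) has_derivative
      (\<lambda>h. - (inverse (f x) * frechet_derivative f (at x) h * inverse (f x)))) (at x)" for x
    by (rule Deriv.has_derivative_inverse[OF nz Ck_has_derivative[OF f]])
  then have "((\<lambda>x. inverse (f x)) has_derivative
      (\<lambda>h. (-1) * (inverse (f x) * frechet_derivative f (at x) h * inverse (f x)))) (at x)" for x by simp
  then show ?case
    by (rule Ck_SucI) (intro Ck_mult Ck_const Suc.IH Ck_SucD[OF f] Ck_partial[OF f])
qed (use nz in \<open>auto intro: continuous_intros\<close>)

lemma Ck_affine: "Ck k f \<Longrightarrow> Ck k (\<lambda>x. f (c *\<^sub>R x + d))"
proof (induction k arbitrary: f)
  case 0
  then have "continuous_on UNIV f" by simp
  then show ?case
    unfolding Ck.simps by (rule continuous_on_compose2) (auto intro!: continuous_intros)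
next
  case (Suc k)
  have "((\<lambda>x. f (c *\<^sub>R x + d)) has_derivative (\<lambda>h. frechet_derivative f (at (c *\<^sub>R x + d)) (c *\<^sub>R h))) (at x)" for x
    by (rule has_derivative_compose[of "\<lambda>x. c *\<^sub>R x + d", OF _ Ck_has_derivative[OF Suc.prems]])
       (auto intro!: derivative_eq_intros)
  then have "((\<lambda>x. f (c *\<^sub>R x + d)) has_derivative (\<lambda>h. c * frechet_derivative f (at (c *\<^sub>R x + d)) h)) (at x)" for x
    using linear_cmul[OF has_derivative_linear[OF Ck_has_derivative[OF Suc.prems]]] by simp
  then show ?case
    by (rule Ck_SucI) (intro Ck_mult Ck_const Suc.IH Ck_partial[OF Suc.prems])
qed

lemma frechet_derivative_affine:
  assumes "Ck (Suc k) f"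
  shows "frechet_derivative (\<lambda>x. f (c *\<^sub>R x + d)) (at x) i = c * frechet_derivative f (at (c *\<^sub>R x + d)) i"
proof -
  have "((\<lambda>x. f (c *\<^sub>R x + d)) has_derivative (\<lambda>h. frechet_derivative f (at (c *\<^sub>R x + d)) (c *\<^sub>R h))) (at x)"
    by (rule has_derivative_compose[of "\<lambda>x. c *\<^sub>R x + d", OF _ Ck_has_derivative[OF assms]])
       (auto intro!: derivative_eq_intros)
  then show ?thesis
    using linear_cmul[OF has_derivative_linear[OF Ck_has_derivative[OF assms]]]
    by (simp add: frechet_derivative_at[symmetric])
qed

lemma Ck_ridge:
  fixes D :: "nat \<Rightarrow> real \<Rightarrow> real" and v :: "'a::euclidean_space"
  assumes D: "\<And>n s. (D n has_real_derivative D (Suc n) s) (at s)"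
  shows "Ck k (\<lambda>x. D n (c + x \<bullet> v))"
proof -
  \<comment> \<open>The chain rule produces the constant factor \<open>i \<bullet> v\<close>;
    carrying a factor \<open>r\<close> through the induction absorbs it.\<close>
  have "Ck k (\<lambda>x. r * D n (c + x \<bullet> v))" for r
  proof (induction k arbitrary: r n)
    case 0
    have "continuous_on UNIV (D n)"
      using D by (meson DERIV_isCont continuous_at_imp_continuous_on)
    then have "continuous_on UNIV (\<lambda>x. D n (c + x \<bullet> v))"
      by (rule continuous_on_compose2) (auto intro!: continuous_intros)
    then show ?case by (auto intro: continuous_intros)
  next
    case (Suc k)
    have "((\<lambda>x. r * D n (c + x \<bullet> v)) has_derivative (\<lambda>h. (r * (h \<bullet> v)) * D (Suc n) (c + x \<bullet> v))) (at x)" for x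
      by (rule has_derivative_eq_rhs[OF has_derivative_mult_right[OF has_derivative_compose[OF _ D[of n, unfolded has_field_derivative_def]]]])
         (auto intro!: derivative_eq_intros simp: fun_eq_iff)
    then show ?case by (rule Ck_SucI) (rule Suc.IH)
  qed
  from this[of 1] show ?thesis by simp
qed

text \<open>The derivatives of \<open>exp (- 1 / s)\<close> are polynomials in \<open>1 / s\<close> times \<open>exp (- 1 / s)\<close>; the recursion
  is the product rule in the variable \<open>1 / s\<close>.\<close>

definition flat_poly :: "nat \<Rightarrow> real poly" where
  "flat_poly n = ((\<lambda>P. [:0, 0, 1:] * (P - pderiv P)) ^^ n) 1"

definition flat :: "nat \<Rightarrow> real \<Rightarrow> real" where
  "flat n s = (if 0 < s then poly (flat_poly n) (1 / s) * exp (- (1 / s)) else 0)"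

lemma poly_exp_at_top: "((\<lambda>y::real. poly P y * exp (- y)) \<longlongrightarrow> 0) at_top"
proof -
  have "((\<lambda>y::real. \<Sum>i\<le>degree P. coeff P i * (y ^ i / exp y)) \<longlongrightarrow> 0) at_top"
    by (intro tendsto_null_sum tendsto_mult_right_zero tendsto_power_div_exp_0)
  then show ?thesis
    by (simp add: poly_altdef sum_distrib_right exp_minus divide_inverse mult.assoc)
qed

lemma flat_has_derivative: "(flat n has_real_derivative flat (Suc n) s) (at s)"
proof -
  consider "0 < s" | "s < 0" | "s = 0" by linarith
  then show ?thesis
  proof cases
    case 1
    have i: "((\<lambda>s. 1 / s) has_real_derivative - (1 / s * (1 / s))) (at s)"
      using 1 by (auto intro!: derivative_eq_intros)
    have e: "((\<lambda>s. exp (- (1 / s))) has_real_derivative exp (- (1 / s)) * (1 / s * (1 / s))) (at s)"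
      using DERIV_fun_exp[OF DERIV_minus[OF i]] by simp
    have "((\<lambda>s. poly (flat_poly n) (1 / s)) has_real_derivative
        poly (pderiv (flat_poly n)) (1 / s) * - (1 / s * (1 / s))) (at s)"
      by (rule DERIV_chain2[OF poly_DERIV i])
    from DERIV_mult[OF this e]
    have "((\<lambda>s. poly (flat_poly n) (1 / s) * exp (- (1 / s))) has_real_derivative flat (Suc n) s) (at s)"
      by (rule DERIV_cong) (use 1 in \<open>simp add: flat_def flat_poly_def algebra_simps\<close>)
    then show ?thesis
    proof (rule has_field_derivative_transform_within_open)
      show "open {0::real<..}" by simp
    qed (use 1 in \<open>auto simp: flat_def\<close>)
  next
    case 2
    have "((\<lambda>s. 0) has_real_derivative flat (Suc n) s) (at s)" using 2 by (simp add: flat_def)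
    then show ?thesis
    proof (rule has_field_derivative_transform_within_open)
      show "open {..<0::real}" by simp
    qed (use 2 in \<open>auto simp: flat_def\<close>)
  next
    case 3
    \<comment> \<open>With y = 1 / h the quotient is again a polynomial in y times exp (- y), the
      extra factor y being the polynomial \<open>[:0, 1:]\<close>.\<close>
    have "((\<lambda>h. flat n h / h) \<longlongrightarrow> 0) (at_right 0)"
    proof -
      have "((\<lambda>h. poly (flat_poly n * [:0, 1:]) (inverse h) * exp (- inverse h)) \<longlongrightarrow> 0) (at_right (0::real))"
        by (rule filterlim_compose[OF poly_exp_at_top filterlim_inverse_at_top_right])
      then show ?thesis
        by (rule Lim_transform_eventually)
           (auto simp: eventually_at_right_field flat_def divide_inverse intro!: exI[of _ 1])
    qed
    moreover have "((\<lambda>h. flat n h / h) \<longlongrightarrow> 0) (at_left 0)"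
      by (rule tendsto_eventually) (auto simp: eventually_at_left_field flat_def intro!: exI[of _ "-1"])
    ultimately have "((\<lambda>h. flat n h / h) \<longlongrightarrow> 0) (at 0)"
      by (simp add: filterlim_split_at)
    then show ?thesis unfolding 3 by (simp add: DERIV_def flat_def)
  qed
qed

lemma flat_0_pos: "0 < flat 0 s \<longleftrightarrow> 0 < s" and flat_0_nonneg: "0 \<le> flat 0 s"
  by (auto simp: flat_def flat_poly_def)

definition smooth_step :: "real \<Rightarrow> real" where
  "smooth_step s = flat 0 s / (flat 0 s + flat 0 (1 - s))"

text \<open>At least one of s and 1 - s is positive, so the quotient defining
  \<open>smooth_step\<close> is smooth everywhere.\<close>

lemma smooth_step_denom: "0 < flat 0 s + flat 0 (1 - s)"
  using flat_0_pos[of s] flat_0_pos[of "1 - s"] flat_0_nonneg[of s] flat_0_nonneg[of "1 - s"] by linarith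

lemma smooth_step_bounds: "0 \<le> smooth_step s" "smooth_step s \<le> 1"
  using smooth_step_denom[of s] flat_0_nonneg[of s] flat_0_nonneg[of "1 - s"]
  by (auto simp: smooth_step_def divide_le_eq_1)

lemma smooth_step_eq_1:
  assumes "1 \<le> s"
  shows "smooth_step s = 1"
proof -
  have "flat 0 (1 - s) = 0" using assms by (simp add: flat_def)
  moreover have "0 < flat 0 s" using assms flat_0_pos[of s] by linarith
  ultimately show ?thesis by (simp add: smooth_step_def)
qed

lemma smooth_step_eq_0: "s \<le> 0 \<Longrightarrow> smooth_step s = 0"
  by (simp add: smooth_step_def flat_def)

lemma Ck_smooth_step: "Ck k (\<lambda>x::'a::euclidean_space. smooth_step (c + x \<bullet> v))"
proof -
  have 1: "Ck k (\<lambda>x::'a. flat 0 (c + x \<bullet> v))" by (rule Ck_ridge[where D=flat, OF flat_has_derivative])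
  have 2: "Ck k (\<lambda>x::'a. flat 0 (1 - (c + x \<bullet> v)))"
    using Ck_ridge[where D=flat, OF flat_has_derivative, of k 0 "1 - c" "- v"] by (simp add: algebra_simps)
  have "Ck k (\<lambda>x::'a. flat 0 (c + x \<bullet> v) * inverse (flat 0 (c + x \<bullet> v) + flat 0 (1 - (c + x \<bullet> v))))"
    by (intro Ck_mult 1 Ck_inverse Ck_add 2) (metis less_irrefl smooth_step_denom)
  then show ?thesis by (simp add: smooth_step_def divide_inverse)
qed

text \<open>A product of functions of one coordinate each, so smoothness reduces to
  \<open>smooth_step\<close>. It is 1 on the cube |x_i| \<le> 1 and 0 outside the cube |x_i| < 2;
  the radius \<open>2 * DIM\<close> in \<open>bump_eq_0\<close> comes from bounding the norm by the
  sum of the absolute coordinates.\<close>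

definition bump :: "'a::euclidean_space \<Rightarrow> real" where
  "bump x = (\<Prod>i\<in>Basis. smooth_step (2 + x \<bullet> i) * smooth_step (2 + x \<bullet> (- i)))"

lemma Ck_bump: "Ck k bump"
  unfolding bump_def by (intro Ck_prod Ck_mult Ck_smooth_step)

lemma bump_bounds: "0 \<le> bump x" "bump x \<le> 1"
  unfolding bump_def
  by (auto intro!: prod_nonneg prod_le_1 mult_nonneg_nonneg mult_le_one smooth_step_bounds)

lemma bump_eq_1: "norm x \<le> 1 \<Longrightarrow> bump x = 1"
  unfolding bump_def
proof (rule prod.neutral, rule ballI)
  fix i :: 'a assume "norm x \<le> 1" "i \<in> Basis"
  then have "\<bar>x \<bullet> i\<bar> \<le> 1" using Basis_le_norm[of i x] by linarith
  then show "smooth_step (2 + x \<bullet> i) * smooth_step (2 + x \<bullet> (- i)) = 1"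
    by (auto simp: smooth_step_eq_1)
qed

lemma bump_eq_0: "2 * real DIM('a) \<le> norm (x::'a::euclidean_space) \<Longrightarrow> bump x = 0"
proof -
  assume x: "2 * real DIM('a) \<le> norm x"
  have "\<exists>i\<in>Basis. 2 \<le> \<bar>x \<bullet> i\<bar>"
  proof (rule ccontr)
    assume "\<not> ?thesis"
    then have "(\<Sum>i\<in>Basis. \<bar>x \<bullet> i\<bar>) < (\<Sum>i\<in>(Basis::'a set). 2)"
      by (intro sum_strict_mono) auto
    then show False using norm_le_l1[of x] x by simp
  qed
  then obtain i where i: "i \<in> Basis" "2 \<le> \<bar>x \<bullet> i\<bar>" by blast
  have "smooth_step (2 + x \<bullet> i) * smooth_step (2 + x \<bullet> (- i)) = 0"
    using i(2) by (cases "0 \<le> x \<bullet> i") (auto simp: smooth_step_eq_0)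
  then show ?thesis unfolding bump_def using i(1) by (intro prod_zero) auto
qed

lemma compact_support_iff: "compact (closure {x. f x \<noteq> (0::real)}) \<longleftrightarrow> (\<exists>R>0. \<forall>x::'a::euclidean_space. R \<le> norm x \<longrightarrow> f x = 0)"
proof
  assume "compact (closure {x. f x \<noteq> 0})"
  then have "bounded {x. f x \<noteq> 0}" 
    using bounded_subset[OF compact_imp_bounded closure_subset] by blast
  then obtain B where "\<And>x. f x \<noteq> 0 \<Longrightarrow> norm x \<le> B" by (auto simp: bounded_iff)
  then show "\<exists>R>0. \<forall>x. R \<le> norm x \<longrightarrow> f x = 0"
    by (intro exI[of _ "\<bar>B\<bar> + 1"]) (force simp: not_le)
next
  assume "\<exists>R>0. \<forall>x. R \<le> norm x \<longrightarrow> f x = 0"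
  then obtain R where "\<And>x. R \<le> norm x \<Longrightarrow> f x = 0" by blast
  then have "bounded {x. f x \<noteq> 0}" unfolding bounded_iff by (intro exI[of _ R]) (meson linear mem_Collect_eq)
  then show "compact (closure {x. f x \<noteq> 0})" by (simp add: compact_closure)
qed

lemma test_function_iff:
  "test_function \<phi> \<longleftrightarrow> (\<forall>k. Ck k \<phi>) \<and> (\<exists>R>0. \<forall>x. R \<le> norm x \<longrightarrow> \<phi> x = 0)"
  unfolding test_function_def compact_support_iff ..

lemma test_function_mult: "(\<And>k. Ck k \<psi>) \<Longrightarrow> test_function \<phi> \<Longrightarrow> test_function (\<lambda>x. \<psi> x * \<phi> x)"
  unfolding test_function_iff by (auto intro: Ck_mult)

lemma test_function_affine:
  assumes \<phi>: "test_function \<phi>" and c: "c \<noteq> 0"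
  shows "test_function (\<lambda>x. \<phi> (c *\<^sub>R x + d))"
proof -
  obtain R where R: "R > 0" "\<And>x. R \<le> norm x \<Longrightarrow> \<phi> x = 0" using \<phi> by (auto simp: test_function_iff)
  have "\<phi> (c *\<^sub>R x + d) = 0" if x: "(R + norm d) / \<bar>c\<bar> + 1 \<le> norm x" for x
  proof (rule R(2))
    have "(R + norm d) / \<bar>c\<bar> \<le> norm x" using x by linarith
    then have "R + norm d \<le> \<bar>c\<bar> * norm x" using c by (simp add: field_simps)
    then show "R \<le> norm (c *\<^sub>R x + d)" using norm_triangle_ineq2[of "c *\<^sub>R x" "- d"] by simp
  qed
  moreover have "(R + norm d) / \<bar>c\<bar> + 1 > 0" using R(1) by (intro add_nonneg_pos divide_nonneg_nonneg) auto
  ultimately show ?thesis using \<phi> unfolding test_function_iff by (blast intro: Ck_affine)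
qed

lemma test_function_bump: "test_function bump"
  unfolding test_function_iff
  using Ck_bump bump_eq_0 by (intro conjI allI exI[of _ "2 * real DIM('a)"]) auto

lemma frechet_derivative_support:
  assumes \<phi>: "\<And>x. R \<le> norm x \<Longrightarrow> \<phi> x = (0::real)" and x: "R < norm (x::'a::euclidean_space)"
  shows "frechet_derivative \<phi> (at x) = (\<lambda>_. 0)"
proof -
  have "((\<lambda>x. 0) has_derivative (\<lambda>_. 0)) (at x)" by simp
  then have "(\<phi> has_derivative (\<lambda>_. 0)) (at x)"
  proof (rule has_derivative_transform_within_open)
    show "open {x::'a. R < norm x}" by (intro open_Collect_less continuous_intros)
  qed (use x \<phi> in auto)
  then show ?thesis using frechet_derivative_at by metis
qed

subsection \<open>Mollification\<close>

lemma nn_integral_lborel_shift: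
  fixes f :: "'a::euclidean_space \<Rightarrow> ennreal"
  assumes [measurable]: "f \<in> borel_measurable borel"
  shows "(\<integral>\<^sup>+x. f (x + h) \<partial>lborel) = (\<integral>\<^sup>+x. f x \<partial>lborel)"
proof -
  have "(\<integral>\<^sup>+x. f x \<partial>lborel) = (\<integral>\<^sup>+x. f x \<partial>distr lborel borel ((+) h))"
    by (subst lborel_distr_plus) (rule refl)
  also have "\<dots> = (\<integral>\<^sup>+x. f (x + h) \<partial>lborel)"
    by (subst nn_integral_distr) (auto simp: add.commute)
  finally show ?thesis by simp
qed

lemma lborel_distr_reflect: "distr lborel borel (\<lambda>y. x - y) = (lborel :: 'a::euclidean_space measure)"
proof -
  have "lborel = density (distr lborel borel (\<lambda>y. x + (-1) *\<^sub>R y)) (\<lambda>_. ennreal (\<bar>-1\<bar> ^ DIM('a)))"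
    by (rule lborel_affine) simp
  then show ?thesis by (simp add: density_1)
qed

lemma integral_lborel_reflect:
  fixes f :: "'a::euclidean_space \<Rightarrow> real"
  assumes [measurable]: "f \<in> borel_measurable borel"
  shows "(LINT y|lborel. f (x - y)) = (LINT y|lborel. f y)"
proof -
  have "(LINT y|lborel. f y) = (LINT y|distr lborel borel (\<lambda>y. x - y). f y)"
    by (subst lborel_distr_reflect) (rule refl)
  also have "\<dots> = (LINT y|lborel. f (x - y))" by (subst integral_distr) auto
  finally show ?thesis by simp
qed

text \<open>Finite measure makes the part of A outside a large ball small, and inner regularity by
  closed sets does the rest; each contributes e / 2.\<close>

lemma compact_inner_approx:
  fixes A :: "'a::euclidean_space set"
  assumes A: "A \<in> sets borel" "emeasure lborel A < \<infinity>" and e: "0 < e"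
  obtains K where "compact K" "K \<subseteq> A" "emeasure lborel (A - K) < ennreal e"
proof -
  have lim: "(\<lambda>n. emeasure lborel (A - cball 0 (real n))) \<longlonglongrightarrow> emeasure lborel (\<Inter>n. A - cball 0 (real n))"
  proof (rule Lim_emeasure_decseq)
    show "decseq (\<lambda>n. A - cball 0 (real n))" by (auto simp: decseq_def)
    fix n
    have "emeasure lborel (A - cball 0 (real n)) \<le> emeasure lborel A" by (rule emeasure_mono) (use A in auto)
    then show "emeasure lborel (A - cball 0 (real n)) \<noteq> \<infinity>" using A(2) by (auto simp: top_unique)
  qed (use A in auto)
  have "(\<Inter>n. A - cball 0 (real n)) = {}" by (auto simp: real_arch_simple)
  then have "(\<lambda>n. emeasure lborel (A - cball 0 (real n))) \<longlonglongrightarrow> 0"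
    using lim by (metis emeasure_empty)
  then have "\<forall>\<^sub>F n in sequentially. emeasure lborel (A - cball 0 (real n)) < ennreal (e/2)"
    by (rule order_tendstoD) (use e in auto)
  then obtain n where n: "emeasure lborel (A - cball 0 (real n)) < ennreal (e/2)"
    using eventually_happens'[OF sequentially_bot] by blast
  have "A \<in> sets lebesgue" using A(1) by auto
  then obtain T where T: "closed T" "T \<subseteq> A" "emeasure lebesgue (A - T) < ennreal (e/2)"
    using sets_lebesgue_inner_closed[of A "e/2"] e half_gt_zero by metis
  show ?thesis
  proof
    show "compact (T \<inter> cball 0 (real n))" using T(1) by (simp add: closed_Int_compact)
    show "T \<inter> cball 0 (real n) \<subseteq> A" using T(2) by auto
    have "A - T \<inter> cball 0 (real n) = (A - T) \<union> (A - cball 0 (real n))" by auto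
    then have "emeasure lborel (A - T \<inter> cball 0 (real n)) \<le> emeasure lborel (A - T) + emeasure lborel (A - cball 0 (real n))"
      using emeasure_subadditive[of "A - T" lborel "A - cball 0 (real n)"] A T by auto
    also have "\<dots> < ennreal (e/2) + ennreal (e/2)"
      using T A n by (intro add_strict_mono) (auto simp: borel_closed)
    also have "\<dots> = ennreal e" using e by (simp flip: ennreal_plus)
    finally show "emeasure lborel (A - T \<inter> cball 0 (real n)) < ennreal e" .
  qed
qed

text \<open>By density it suffices to treat indicators of sets of finite measure, sums and dominated
  limits. A set is squeezed between a compact K and an open U such that K shifted by less than d
  stays inside U.\<close>

lemma translation_L1_continuous:
  fixes f :: "'a::euclidean_space \<Rightarrow> real"
  assumes "integrable lborel f" "0 < e"
  shows "\<exists>d>0. \<forall>h. norm h < d \<longrightarrow> (\<integral>\<^sup>+x. ennreal \<bar>f (x + h) - f x\<bar> \<partial>lborel) \<le> ennreal e"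
  using assms
proof (induction arbitrary: e rule: integrable_induct)
  case (base A c)
  have Ab: "A \<in> sets borel" using base by simp
  \<comment> \<open>\<open>U - K\<close> has measure at most 2 e', it is counted once at x and once
    at x + h, and the result is multiplied by |c|; adding 1 allows c = 0.\<close>
  define e' where "e' = e / (4 * (\<bar>c\<bar> + 1))"
  have e': "e' > 0" using base by (simp add: e'_def)
  obtain U where U: "open U" "A \<subseteq> U" "emeasure lborel (U - A) < ennreal e'"
    using outer_regular_lborel[OF Ab e'] by blast
  obtain K where K: "compact K" "K \<subseteq> A" "emeasure lborel (A - K) < ennreal e'"
    using compact_inner_approx[OF Ab base(2) e'] by blast
  have KU: "K \<subseteq> U" using K U by auto
  obtain d where d: "d > 0" "(\<Union>x\<in>K. ball x d) \<subseteq> U"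
    using compact_subset_open_imp_ball_epsilon_subset[OF K(1) U(1) KU] by blast
  have KUb [measurable]: "U - K \<in> sets borel" using U K by (auto simp: borel_open compact_imp_closed borel_closed)
  have mUK: "emeasure lborel (U - K) \<le> ennreal (2 * e')"
  proof -
    have "U - K = (U - A) \<union> (A - K)" using U K by auto
    then have "emeasure lborel (U - K) \<le> emeasure lborel (U - A) + emeasure lborel (A - K)"
      using emeasure_subadditive[of "U - A" lborel "A - K"] Ab U K
      by (auto simp: borel_open compact_imp_closed borel_closed)
    also have "\<dots> \<le> ennreal e' + ennreal e'" using U K by (intro add_mono) auto
    also have "\<dots> = ennreal (2 * e')" using e' by (simp flip: ennreal_plus)
    finally show ?thesis .
  qed
  show ?case
  proof (intro exI[of _ d] conjI allI impI d)
    fix h :: 'a assume h: "norm h < d"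
    have mv: "x + h \<in> U" if "x \<in> K" for x
      using d(2) that h by (auto intro!: subsetD[OF d(2)] bexI[of _ x] simp: dist_norm)
    have mv': "x \<in> U" if "x + h \<in> K" for x
      using that h by (auto intro!: subsetD[OF d(2)] bexI[of _ "x + h"] simp: dist_norm)
    \<comment> \<open>If x is in A but x + h is not, then either x lies outside K, or x + h lies in
      U by the choice of d; in both cases one of the two points is in U - K. The other case is
      symmetric.\<close>
    have pw: "\<bar>indicator A (x + h) *\<^sub>R c - indicator A x *\<^sub>R c\<bar> \<le>
        \<bar>c\<bar> * (indicator (U - K) (x + h) + indicator (U - K) x)" for x
      using mv[of x] mv'[of x] U(2) K(2) by (auto simp: indicator_def split: if_splits)
    have "(\<integral>\<^sup>+x. ennreal \<bar>indicator A (x + h) *\<^sub>R c - indicator A x *\<^sub>R c\<bar> \<partial>lborel) \<le>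
       (\<integral>\<^sup>+x. ennreal \<bar>c\<bar> * (indicator (U - K) (x + h) + indicator (U - K) x) \<partial>lborel)"
    proof (rule nn_integral_mono)
      fix x
      have "ennreal \<bar>indicator A (x + h) *\<^sub>R c - indicator A x *\<^sub>R c\<bar> \<le>
        ennreal (\<bar>c\<bar> * (indicator (U - K) (x + h) + indicator (U - K) x))" by (rule ennreal_leI[OF pw])
      also have "\<dots> = ennreal \<bar>c\<bar> * (indicator (U - K) (x + h) + indicator (U - K) x)"
        by (subst ennreal_mult) (auto simp: indicator_def)
      finally show "ennreal \<bar>indicator A (x + h) *\<^sub>R c - indicator A x *\<^sub>R c\<bar> \<le>
        ennreal \<bar>c\<bar> * (indicator (U - K) (x + h) + indicator (U - K) x)" .
    qed
    also have "\<dots> = ennreal \<bar>c\<bar> * ((\<integral>\<^sup>+x. indicator (U - K) (x + h) \<partial>lborel) + emeasure lborel (U - K))"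
      by (subst nn_integral_cmult, measurable, subst nn_integral_add) auto
    also have "(\<integral>\<^sup>+x. indicator (U - K) (x + h) \<partial>lborel) = emeasure lborel (U - K)"
      using nn_integral_lborel_shift[of "indicator (U - K)" h] by simp
    also have "ennreal \<bar>c\<bar> * (emeasure lborel (U - K) + emeasure lborel (U - K)) \<le> ennreal \<bar>c\<bar> * (ennreal (2 * e') + ennreal (2 * e'))"
      by (intro mult_left_mono add_mono mUK) auto
    also have "ennreal (2 * e') + ennreal (2 * e') = ennreal (4 * e')" using e' by (simp flip: ennreal_plus)
    also have "ennreal \<bar>c\<bar> * ennreal (4 * e') = ennreal (\<bar>c\<bar> * (4 * e'))" using e' by (intro ennreal_mult[symmetric]) auto
    also have "\<dots> \<le> ennreal e" using base(3) by (intro ennreal_leI) (simp add: e'_def field_simps)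
    finally show "(\<integral>\<^sup>+x. ennreal \<bar>indicator A (x + h) *\<^sub>R c - indicator A x *\<^sub>R c\<bar> \<partial>lborel) \<le> ennreal e" .
  qed
next
  case (add f g)
  from add.IH(1)[of "e/2"] add.prems obtain d1 where d1: "d1 > 0"
    "\<And>h. norm h < d1 \<Longrightarrow> (\<integral>\<^sup>+x. ennreal \<bar>f (x + h) - f x\<bar> \<partial>lborel) \<le> ennreal (e/2)" by auto
  from add.IH(2)[of "e/2"] add.prems obtain d2 where d2: "d2 > 0"
    "\<And>h. norm h < d2 \<Longrightarrow> (\<integral>\<^sup>+x. ennreal \<bar>g (x + h) - g x\<bar> \<partial>lborel) \<le> ennreal (e/2)" by auto
  have [measurable]: "f \<in> borel_measurable borel" "g \<in> borel_measurable borel"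
    using borel_measurable_integrable[OF add.hyps(1)] borel_measurable_integrable[OF add.hyps(2)] by auto
  show ?case
  proof (intro exI[of _ "min d1 d2"] conjI allI impI)
    fix h :: 'a assume h: "norm h < min d1 d2"
    have "(\<integral>\<^sup>+x. ennreal \<bar>f (x + h) + g (x + h) - (f x + g x)\<bar> \<partial>lborel) \<le>
      (\<integral>\<^sup>+x. ennreal \<bar>f (x + h) - f x\<bar> + ennreal \<bar>g (x + h) - g x\<bar> \<partial>lborel)"
      by (intro nn_integral_mono) (auto simp flip: ennreal_plus intro!: ennreal_leI)
    also have "\<dots> = (\<integral>\<^sup>+x. ennreal \<bar>f (x + h) - f x\<bar> \<partial>lborel) + (\<integral>\<^sup>+x. ennreal \<bar>g (x + h) - g x\<bar> \<partial>lborel)"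
      by (rule nn_integral_add) auto
    also have "\<dots> \<le> ennreal (e/2) + ennreal (e/2)" using h by (intro add_mono d1 d2) auto
    also have "\<dots> = ennreal e" using add.prems by (simp flip: ennreal_plus)
    finally show "(\<integral>\<^sup>+x. ennreal \<bar>f (x + h) + g (x + h) - (f x + g x)\<bar> \<partial>lborel) \<le> ennreal e" .
  qed (use d1 d2 in auto)
next
  case (lim f s)
  have [measurable]: "f \<in> borel_measurable borel" "s i \<in> borel_measurable borel" for i
    using borel_measurable_integrable[OF lim.hyps(4)] borel_measurable_integrable[OF lim.hyps(1)] by auto
  have "integrable lborel (\<lambda>x. 2 * norm (f x))" using lim.hyps(4) by simp
  moreover have "norm (2 * norm (f x)) = 2 * norm (f x)" for x by simp
  ultimately have w: "(\<integral>\<^sup>+x. ennreal (2 * norm (f x)) \<partial>lborel) < \<infinity>"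
    by (simp only: integrable_iff_bounded)
  have "(\<lambda>i. \<integral>\<^sup>+x. ennreal (norm (f x - s i x)) \<partial>lborel) \<longlonglongrightarrow> 0"
    by (rule nn_integral_dominated_convergence_norm[where w="\<lambda>x. 2 * norm (f x)"])
       (use lim.hyps w in auto)
  then have "(\<lambda>i. \<integral>\<^sup>+x. ennreal (norm (s i x - f x)) \<partial>lborel) \<longlonglongrightarrow> 0"
    by (simp add: abs_minus_commute)
  then have "\<forall>\<^sub>F i in sequentially. (\<integral>\<^sup>+x. ennreal (norm (s i x - f x)) \<partial>lborel) < ennreal (e/3)"
    by (rule order_tendstoD) (use lim.prems in auto)
  then obtain i where i: "(\<integral>\<^sup>+x. ennreal (norm (s i x - f x)) \<partial>lborel) < ennreal (e/3)"
    using eventually_happens'[OF sequentially_bot] by blast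
  from lim.IH[of "e/3" i] lim.prems obtain d where d: "d > 0"
    "\<And>h. norm h < d \<Longrightarrow> (\<integral>\<^sup>+x. ennreal \<bar>s i (x + h) - s i x\<bar> \<partial>lborel) \<le> ennreal (e/3)" by auto
  show ?case
  proof (intro exI[of _ d] conjI allI impI d(1))
    fix h :: 'a assume h: "norm h < d"
    have "(\<integral>\<^sup>+x. ennreal \<bar>f (x + h) - f x\<bar> \<partial>lborel) \<le>
      (\<integral>\<^sup>+x. ennreal (norm (s i (x + h) - f (x + h))) + ennreal (norm (s i x - f x)) + ennreal \<bar>s i (x + h) - s i x\<bar> \<partial>lborel)"
      by (intro nn_integral_mono) (auto simp flip: ennreal_plus intro!: ennreal_leI)
    also have "\<dots> = (\<integral>\<^sup>+x. ennreal (norm (s i (x + h) - f (x + h))) \<partial>lborel) + (\<integral>\<^sup>+x. ennreal (norm (s i x - f x)) \<partial>lborel)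
       + (\<integral>\<^sup>+x. ennreal \<bar>s i (x + h) - s i x\<bar> \<partial>lborel)"
      by (subst nn_integral_add, simp, simp, subst nn_integral_add) auto
    also have "(\<integral>\<^sup>+x. ennreal (norm (s i (x + h) - f (x + h))) \<partial>lborel) = (\<integral>\<^sup>+x. ennreal (norm (s i x - f x)) \<partial>lborel)"
      by (rule nn_integral_lborel_shift) measurable
    also have "(\<integral>\<^sup>+x. ennreal (norm (s i x - f x)) \<partial>lborel) + (\<integral>\<^sup>+x. ennreal (norm (s i x - f x)) \<partial>lborel)
       + (\<integral>\<^sup>+x. ennreal \<bar>s i (x + h) - s i x\<bar> \<partial>lborel) \<le> ennreal (e/3) + ennreal (e/3) + ennreal (e/3)"
      using h i by (intro add_mono d) auto
    also have "\<dots> = ennreal e" using lim.prems by (simp flip: ennreal_plus)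
    finally show "(\<integral>\<^sup>+x. ennreal \<bar>f (x + h) - f x\<bar> \<partial>lborel) \<le> ennreal e" .
  qed
qed

definition conv :: "('a::euclidean_space \<Rightarrow> real) \<Rightarrow> ('a \<Rightarrow> real) \<Rightarrow> 'a \<Rightarrow> real" where
  "conv k f x = (LINT y|lborel. k (x - y) * f y)"

lemma conv_eq: 
  assumes [measurable]: "k \<in> borel_measurable borel" "f \<in> borel_measurable borel"
  shows "conv k f x = (LINT y|lborel. k y * f (x - y))"
  using integral_lborel_reflect[of "\<lambda>y. k y * f (x - y)" x] by (simp add: conv_def)

text \<open>Since k has mass 1, \<open>conv k f x - f x\<close> is an average of
  \<open>f (x - y) - f x\<close> over the support of k; Tonelli reduces the claim to continuity of
  translations. The radius d depends on f and e alone, hence serves all kernels.\<close>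

lemma conv_L1_approx:
  fixes f :: "'a::euclidean_space \<Rightarrow> real"
  assumes f: "integrable lborel f" and e: "0 < e"
  obtains d where "d > 0" "\<And>(k :: 'a \<Rightarrow> real) C. k \<in> borel_measurable borel \<Longrightarrow> (\<And>y. 0 \<le> k y) \<Longrightarrow> (\<And>y. k y \<le> C) \<Longrightarrow>
    (\<And>y. d \<le> norm y \<Longrightarrow> k y = 0) \<Longrightarrow> integrable lborel k \<Longrightarrow> (LINT y|lborel. k y) = 1 \<Longrightarrow>
    (\<integral>\<^sup>+x. ennreal \<bar>conv k f x - f x\<bar> \<partial>lborel) \<le> ennreal e"
proof -
  obtain d where d: "d > 0" "\<And>h. norm h < d \<Longrightarrow> (\<integral>\<^sup>+x. ennreal \<bar>f (x + h) - f x\<bar> \<partial>lborel) \<le> ennreal e"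
    using translation_L1_continuous[OF f e] by blast
  have [measurable]: "f \<in> borel_measurable borel" using borel_measurable_integrable[OF f] by simp
  show ?thesis
  proof
    fix k :: "'a \<Rightarrow> real" and C assume [measurable]: "k \<in> borel_measurable borel" and k0: "\<And>y. 0 \<le> k y" and kC: "\<And>y. k y \<le> C"
      and kd: "\<And>y. d \<le> norm y \<Longrightarrow> k y = 0" and ki: "integrable lborel k" and k1: "(LINT y|lborel. k y) = 1"
    have nk: "(\<integral>\<^sup>+y. ennreal (k y) \<partial>lborel) = 1"
      using nn_integral_eq_integral[OF ki] k0 k1 by simp
    have pw: "ennreal \<bar>conv k f x - f x\<bar> \<le> (\<integral>\<^sup>+y. ennreal (k y) * ennreal \<bar>f (x - y) - f x\<bar> \<partial>lborel)" for x
    proof -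
      have fx: "integrable lborel (\<lambda>y. f (x - y))"
      proof -
        have "integrable (distr lborel borel (\<lambda>y. x - y)) f" by (subst lborel_distr_reflect) (rule f)
        then show ?thesis by (subst (asm) integrable_distr_eq) auto
      qed
      have i1: "integrable lborel (\<lambda>y. k y * f (x - y))"
      proof (rule Bochner_Integration.integrable_bound[OF integrable_mult_right[OF fx, of C]])
        show "AE y in lborel. norm (k y * f (x - y)) \<le> norm (C * f (x - y))"
        proof (rule AE_I2)
          fix y show "norm (k y * f (x - y)) \<le> norm (C * f (x - y))"
            using k0[of y] kC[of y] by (auto simp: abs_mult intro!: mult_right_mono)
        qed
      qed measurable
      have i2: "integrable lborel (\<lambda>y. k y * f x)" using ki by simp
      have "conv k f x - f x = (LINT y|lborel. k y * f (x - y)) - (LINT y|lborel. k y * f x)"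
        using k1 by (simp add: conv_eq)
      also have "\<dots> = (LINT y|lborel. k y * (f (x - y) - f x))"
        by (subst Bochner_Integration.integral_diff[symmetric, OF i1 i2]) (simp add: algebra_simps)
      finally have "ennreal \<bar>conv k f x - f x\<bar> = ennreal (norm (LINT y|lborel. k y * (f (x - y) - f x)))" by simp
      also have "\<dots> \<le> (\<integral>\<^sup>+y. ennreal (norm (k y * (f (x - y) - f x))) \<partial>lborel)"
        by (rule integral_norm_bound_ennreal) (use Bochner_Integration.integrable_diff[OF i1 i2] in \<open>simp add: algebra_simps\<close>)
      also have "\<dots> = (\<integral>\<^sup>+y. ennreal (k y) * ennreal \<bar>f (x - y) - f x\<bar> \<partial>lborel)"
        by (intro nn_integral_cong) (simp add: abs_mult k0 ennreal_mult)
      finally show ?thesis .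
    qed
    have "(\<integral>\<^sup>+x. ennreal \<bar>conv k f x - f x\<bar> \<partial>lborel) \<le>
        (\<integral>\<^sup>+x. (\<integral>\<^sup>+y. ennreal (k y) * ennreal \<bar>f (x - y) - f x\<bar> \<partial>lborel) \<partial>lborel)"
      by (rule nn_integral_mono) (rule pw)
    also have "\<dots> = (\<integral>\<^sup>+y. (\<integral>\<^sup>+x. ennreal (k y) * ennreal \<bar>f (x - y) - f x\<bar> \<partial>lborel) \<partial>lborel)"
      by (rule lborel_pair.Fubini') measurable
    also have "\<dots> \<le> (\<integral>\<^sup>+y. ennreal (k y) * ennreal e \<partial>lborel)"
    proof (rule nn_integral_mono)
      fix y
      have "(\<integral>\<^sup>+x. ennreal (k y) * ennreal \<bar>f (x - y) - f x\<bar> \<partial>lborel) = ennreal (k y) * (\<integral>\<^sup>+x. ennreal \<bar>f (x - y) - f x\<bar> \<partial>lborel)"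
        by (rule nn_integral_cmult) measurable
      also have "\<dots> \<le> ennreal (k y) * ennreal e"
      proof (cases "d \<le> norm y")
        case False
        then show ?thesis using d(2)[of "- y"] by (intro mult_left_mono) auto
      qed (simp add: kd)
      finally show "(\<integral>\<^sup>+x. ennreal (k y) * ennreal \<bar>f (x - y) - f x\<bar> \<partial>lborel) \<le> ennreal (k y) * ennreal e" .
    qed
    also have "\<dots> = (\<integral>\<^sup>+y. ennreal (k y) \<partial>lborel) * ennreal e"
      by (rule nn_integral_multc) measurable
    also have "\<dots> = ennreal e" by (simp add: nk)
    finally show "(\<integral>\<^sup>+x. ennreal \<bar>conv k f x - f x\<bar> \<partial>lborel) \<le> ennreal e" .
  qed (rule d(1))
qed

section \<open>Convolution with continuous kernels of compact support\<close>

definition compact_kernel :: "('a::euclidean_space \<Rightarrow> real) \<Rightarrow> bool" where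
  "compact_kernel k \<longleftrightarrow> continuous_on UNIV k \<and> (\<exists>R>0. \<forall>x. R \<le> norm x \<longrightarrow> k x = 0)"

lemma compact_kernelE:
  assumes "compact_kernel k"
  obtains R C where "R > 0" "\<And>x. R \<le> norm x \<Longrightarrow> k x = 0" "0 \<le> C" "\<And>x. \<bar>k x\<bar> \<le> C"
    "k \<in> borel_measurable borel"
proof -
  obtain R where R: "R > 0" "\<And>x. R \<le> norm x \<Longrightarrow> k x = 0" and c: "continuous_on UNIV k"
    using assms by (auto simp: compact_kernel_def)
  have "compact (k ` cball 0 R)"
    by (intro compact_continuous_image continuous_on_subset[OF c]) auto
  then obtain B where "\<forall>y\<in>k ` cball 0 R. norm y \<le> B"
    using compact_imp_bounded bounded_iff by metis
  then have B: "\<bar>k x\<bar> \<le> B" if "x \<in> cball 0 R" for x using that by auto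
  have "\<bar>k x\<bar> \<le> max 0 B" for x
    using B[of x] R(2)[of x] by (cases "norm x \<le> R") auto
  then show ?thesis using R c that borel_measurable_continuous_onI[OF c] by (meson max.cobounded1)
qed

lemma compact_kernel_test: "test_function \<phi> \<Longrightarrow> compact_kernel \<phi>"
  unfolding compact_kernel_def test_function_iff using Ck.simps(1) by blast

lemma compact_kernel_partial:
  assumes \<phi>: "test_function \<phi>" and i: "i \<in> Basis"
  shows "compact_kernel (\<lambda>x. frechet_derivative \<phi> (at x) i)"
proof -
  obtain R where R: "R > 0" "\<And>x. R \<le> norm x \<Longrightarrow> \<phi> x = 0" using \<phi> by (auto simp: test_function_iff)
  have "Ck (Suc 0) \<phi>" using \<phi> by (simp only: test_function_iff)
  then have "continuous_on UNIV (\<lambda>x. frechet_derivative \<phi> (at x) i)" using i by simp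
  moreover have "frechet_derivative \<phi> (at x) i = 0" if "R + 1 \<le> norm x" for x
    using frechet_derivative_support[of R \<phi> x] R(2) that by simp
  ultimately show ?thesis unfolding compact_kernel_def using R(1) by (intro conjI exI[of _ "R + 1"]) auto
qed

text \<open>Local integrability on Borel representatives and \<open>lborel\<close>, where shifts and
  Fubini are available. Balls suffice because every compact set lies in one.\<close>

definition locint :: "('a::euclidean_space \<Rightarrow> real) \<Rightarrow> bool" where
  "locint f \<longleftrightarrow> f \<in> borel_measurable borel \<and> (\<forall>R. integrable lborel (\<lambda>x. indicator (cball 0 R) x * f x))"

lemma locint_measurable: "locint f \<Longrightarrow> f \<in> borel_measurable borel"
  by (simp add: locint_def)

lemma integrable_kernel_mult:
  assumes k: "compact_kernel k" and f: "locint f"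
  shows "integrable lborel (\<lambda>y. k y * f y)"
proof -
  obtain R C where R: "R > 0" "\<And>x. R \<le> norm x \<Longrightarrow> k x = 0" and C: "0 \<le> C" "\<And>x. \<bar>k x\<bar> \<le> C"
    and [measurable]: "k \<in> borel_measurable borel" using compact_kernelE[OF k] by metis
  have [measurable]: "f \<in> borel_measurable borel" using f by (rule locint_measurable)
  have "integrable lborel (\<lambda>x. C * (indicator (cball 0 R) x * f x))" using f by (auto simp: locint_def)
  then show ?thesis
  proof (rule Bochner_Integration.integrable_bound)
    show "AE y in lborel. norm (k y * f y) \<le> norm (C * (indicator (cball 0 R) y * f y))"
    proof (rule AE_I2)
      fix y show "norm (k y * f y) \<le> norm (C * (indicator (cball 0 R) y * f y))"
        using R(2)[of y] C by (cases "norm y \<le> R") (auto simp: abs_mult intro!: mult_right_mono)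
    qed
  qed measurable
qed

lemma compact_kernel_reflect: "compact_kernel k \<Longrightarrow> compact_kernel (\<lambda>y. k (x - y))"
proof -
  assume k: "compact_kernel k"
  then obtain R where R: "R > 0" "\<And>x. R \<le> norm x \<Longrightarrow> k x = 0" and c: "continuous_on UNIV k"
    by (auto simp: compact_kernel_def)
  have "continuous_on UNIV (\<lambda>y. k (x - y))"
    by (rule continuous_on_compose2[OF c]) (auto intro!: continuous_intros)
  moreover have "k (x - y) = 0" if "R + norm x \<le> norm y" for y
    using that norm_triangle_ineq2[of y x] by (intro R(2)) (simp add: norm_minus_commute)
  moreover have "R + norm x > 0" using R(1) by (simp add: add_pos_nonneg)
  ultimately show ?thesis unfolding compact_kernel_def by blast
qed

text \<open>Dominated convergence with the common support and bound of the kernels. It gives both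
  the continuity of a convolution and its differentiation under the integral.\<close>

lemma conv_tendsto:
  assumes f: "locint f"
    and [measurable]: "\<And>n. K n \<in> borel_measurable borel" "L \<in> borel_measurable borel"
    and lim: "\<And>y. (\<lambda>n. K n y) \<longlonglongrightarrow> L y"
    and supp: "\<And>n y. R \<le> norm y \<Longrightarrow> K n y = 0" and bd: "\<And>n y. \<bar>K n y\<bar> \<le> C"
  shows "(\<lambda>n. LINT y|lborel. K n y * f y) \<longlonglongrightarrow> (LINT y|lborel. L y * f y)"
proof (rule integral_dominated_convergence[where w="\<lambda>y. C * \<bar>indicator (cball 0 R) y * f y\<bar>"])
  have [measurable]: "f \<in> borel_measurable borel" using f by (rule locint_measurable)
  show "(\<lambda>y. L y * f y) \<in> borel_measurable lborel" "\<And>n. (\<lambda>y. K n y * f y) \<in> borel_measurable lborel" by measurable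
  show "integrable lborel (\<lambda>y. C * \<bar>indicator (cball 0 R) y * f y\<bar>)"
    using f by (auto simp: locint_def simp del: abs_mult)
  show "AE y in lborel. (\<lambda>n. K n y * f y) \<longlonglongrightarrow> L y * f y"
    by (intro AE_I2 tendsto_mult tendsto_const lim)
  show "AE y in lborel. norm (K n y * f y) \<le> C * \<bar>indicator (cball 0 R) y * f y\<bar>" for n
  proof (rule AE_I2)
    fix y show "norm (K n y * f y) \<le> C * \<bar>indicator (cball 0 R) y * f y\<bar>"
      using supp[of y n] bd[of n y] by (cases "norm y \<le> R") (auto simp: abs_mult intro!: mult_right_mono)
  qed
qed

lemma continuous_conv:
  assumes k: "compact_kernel k" and f: "locint f"
  shows "continuous_on UNIV (conv k f)"
proof -
  obtain R C where R: "R > 0" "\<And>x. R \<le> norm x \<Longrightarrow> k x = 0" and C: "0 \<le> C" "\<And>x. \<bar>k x\<bar> \<le> C"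
    and [measurable]: "k \<in> borel_measurable borel" using compact_kernelE[OF k] by metis
  have c: "continuous_on UNIV k" using k by (simp add: compact_kernel_def)
  have "(\<lambda>n. conv k f (X n)) \<longlonglongrightarrow> conv k f x" if X: "X \<longlonglongrightarrow> x" for X x
  proof -
    obtain B where B: "\<And>n. norm (X n) \<le> B" using convergent_imp_Bseq[OF convergentI[OF X]] by (auto simp: Bseq_def)
    show ?thesis unfolding conv_def
  proof (rule conv_tendsto[OF f])
    show "(\<lambda>n. k (X n - y)) \<longlonglongrightarrow> k (x - y)" for y
      by (rule continuous_on_tendsto_compose[OF c]) (auto intro!: tendsto_intros X)
    show "k (X n - y) = 0" if "R + B \<le> norm y" for n y
      using that B[of n] norm_triangle_ineq2[of y "X n"] by (intro R(2)) (simp add: norm_minus_commute)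
    qed (use C in auto)
  qed
  then show ?thesis by (auto simp: continuous_on_sequentially o_def)
qed

text \<open>Differentiability along the lines parallel to i is all that the Gagliardo-Nirenberg
  argument uses, since it integrates along coordinate lines only.\<close>

definition line_deriv :: "('a::euclidean_space \<Rightarrow> real) \<Rightarrow> ('a \<Rightarrow> real) \<Rightarrow> 'a \<Rightarrow> bool" where
  "line_deriv F G i \<longleftrightarrow> (\<forall>x s. ((\<lambda>s. F (x + s *\<^sub>R i)) has_real_derivative G (x + s *\<^sub>R i)) (at s))"

lemma line_derivI:
  assumes "\<And>x. ((\<lambda>h. (F (x + h *\<^sub>R i) - F x) / h) \<longlongrightarrow> G x) (at 0)"
  shows "line_deriv F G i"
  unfolding line_deriv_def DERIV_def
proof (intro allI)
  fix x s
  show "(\<lambda>h. (F (x + (s + h) *\<^sub>R i) - F (x + s *\<^sub>R i)) / h) \<midarrow>0\<rightarrow> G (x + s *\<^sub>R i)"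
    using assms[of "x + s *\<^sub>R i"] by (simp add: algebra_simps)
qed

lemma line_deriv_Ck:
  assumes "Ck (Suc k) \<phi>"
  shows "line_deriv \<phi> (\<lambda>x. frechet_derivative \<phi> (at x) i) i"
  unfolding line_deriv_def
proof (intro allI)
  fix x s
  have "((\<lambda>s. \<phi> (x + s *\<^sub>R i)) has_derivative (\<lambda>h. frechet_derivative \<phi> (at (x + s *\<^sub>R i)) (h *\<^sub>R i))) (at s)"
    by (rule has_derivative_compose[OF _ Ck_has_derivative[OF assms]]) (auto intro!: derivative_eq_intros)
  then show "((\<lambda>s. \<phi> (x + s *\<^sub>R i)) has_real_derivative frechet_derivative \<phi> (at (x + s *\<^sub>R i)) i) (at s)"
    unfolding has_field_derivative_def
    using linear_cmul[OF has_derivative_linear[OF Ck_has_derivative[OF assms]]] by (simp add: mult_commute_abs)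
qed

text \<open>By the mean value theorem the difference quotients of \<phi> are bounded by the supremum
  of its partial derivative, and for bounded steps they have a common support, so the limit may be
  taken inside the integral.\<close>

lemma line_deriv_conv:
  assumes \<phi>: "test_function \<phi>" and i: "i \<in> Basis" and f: "locint f"
  shows "line_deriv (conv \<phi> f) (conv (\<lambda>x. frechet_derivative \<phi> (at x) i) f) i"
proof (rule line_derivI)
  fix x
  let ?D = "\<lambda>x. frechet_derivative \<phi> (at x) i"
  have kD: "compact_kernel ?D" and k\<phi>: "compact_kernel \<phi>"
    using \<phi> i by (auto intro: compact_kernel_partial compact_kernel_test)
  obtain R where R: "R > 0" "\<And>x. R \<le> norm x \<Longrightarrow> \<phi> x = 0" and [measurable]: "\<phi> \<in> borel_measurable borel"
    using compact_kernelE[OF k\<phi>] by metis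
  obtain C where C: "0 \<le> C" "\<And>x. \<bar>?D x\<bar> \<le> C" and [measurable]: "?D \<in> borel_measurable borel"
    using compact_kernelE[OF kD] by metis
  have ld: "line_deriv \<phi> ?D i" using \<phi> by (intro line_deriv_Ck[of 0]) (simp only: test_function_iff)
  have dq: "((\<lambda>h. (\<phi> (z + h *\<^sub>R i) - \<phi> z) / h) \<longlongrightarrow> ?D z) (at 0)" for z
    using ld[unfolded line_deriv_def DERIV_def, rule_format, of z 0] by simp
  have bound: "\<bar>(\<phi> (z + h *\<^sub>R i) - \<phi> z) / h\<bar> \<le> C" for z h
  proof (cases "h = 0")
    case False
    have "\<bar>\<phi> (z + h *\<^sub>R i) - \<phi> (z + 0 *\<^sub>R i)\<bar> \<le> C * \<bar>h - 0\<bar>"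
    proof (rule field_differentiable_bound[where S=UNIV and f'="\<lambda>s. ?D (z + s *\<^sub>R i)", unfolded real_norm_def])
      show "((\<lambda>s. \<phi> (z + s *\<^sub>R i)) has_field_derivative ?D (z + s *\<^sub>R i)) (at s within UNIV)" for s
        using ld by (auto simp: line_deriv_def)
    qed (use C in auto)
    then show ?thesis using False by (simp add: field_simps)
  qed (use C in auto)
  show "((\<lambda>h. (conv \<phi> f (x + h *\<^sub>R i) - conv \<phi> f x) / h) \<longlongrightarrow> conv ?D f x) (at 0)"
  proof (subst LIMSEQ_SEQ_conv[symmetric], intro allI impI, elim conjE)
    fix H :: "nat \<Rightarrow> real" assume H: "\<forall>n. H n \<noteq> 0" "H \<longlonglongrightarrow> 0"
    obtain B where B: "\<And>n. \<bar>H n\<bar> \<le> B" using convergent_imp_Bseq[OF convergentI[OF H(2)]] by (auto simp: Bseq_def)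
    have B0: "0 \<le> B" using B[of 0] by linarith
    have eq: "(conv \<phi> f (x + H n *\<^sub>R i) - conv \<phi> f x) / H n =
       (LINT y|lborel. ((\<phi> ((x - y) + H n *\<^sub>R i) - \<phi> (x - y)) / H n) * f y)" for n
    proof -
      have 1: "integrable lborel (\<lambda>y. \<phi> (x + H n *\<^sub>R i - y) * f y)" "integrable lborel (\<lambda>y. \<phi> (x - y) * f y)"
        by (intro integrable_kernel_mult compact_kernel_reflect k\<phi> f)+
      have "(conv \<phi> f (x + H n *\<^sub>R i) - conv \<phi> f x) / H n =
        (LINT y|lborel. (\<phi> (x + H n *\<^sub>R i - y) * f y - \<phi> (x - y) * f y) / H n)"
        unfolding conv_def using 1 by (subst integral_divide_zero) simp
      also have "\<dots> = (LINT y|lborel. ((\<phi> ((x - y) + H n *\<^sub>R i) - \<phi> (x - y)) / H n) * f y)"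
        by (intro Bochner_Integration.integral_cong) (auto simp: algebra_simps diff_divide_distrib)
      finally show ?thesis .
    qed
    show "(\<lambda>n. (conv \<phi> f (x + H n *\<^sub>R i) - conv \<phi> f x) / H n) \<longlonglongrightarrow> conv ?D f x"
      unfolding eq unfolding conv_def[of _ _ x]
    proof (rule conv_tendsto[OF f])
      show "(\<lambda>n. (\<phi> (x - y + H n *\<^sub>R i) - \<phi> (x - y)) / H n) \<longlonglongrightarrow> ?D (x - y)" for y
        using dq[of "x - y"] H unfolding LIMSEQ_SEQ_conv[symmetric] by blast
      show "(\<phi> (x - y + H n *\<^sub>R i) - \<phi> (x - y)) / H n = 0" if "R + norm x + B \<le> norm y" for n y
      proof -
        have "norm y \<le> norm (x - y) + norm x" using norm_triangle_ineq2[of y x] by (simp add: norm_minus_commute)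
        then have "\<phi> (x - y) = 0" using that B0 by (intro R(2)) linarith
        moreover have "norm (x - y) \<le> norm (x - y + H n *\<^sub>R i) + B"
          using norm_triangle_ineq2[of "x - y" "- (H n *\<^sub>R i)"] B[of n] i by simp
        then have "\<phi> (x - y + H n *\<^sub>R i) = 0"
          using that \<open>norm y \<le> norm (x - y) + norm x\<close> by (intro R(2)) linarith
        ultimately show ?thesis by simp
      qed
      show "\<bar>(\<phi> (x - y + H n *\<^sub>R i) - \<phi> (x - y)) / H n\<bar> \<le> C" for n y by (rule bound)
    qed measurable
  qed
qed

text \<open>The parameter is the inverse of the scale: the support shrinks like
  \<open>2 * DIM / c\<close> as c grows.\<close>

definition mollifier :: "real \<Rightarrow> 'a::euclidean_space \<Rightarrow> real" where
  "mollifier c x = inverse (LINT y|lborel. bump (c *\<^sub>R (y::'a))) * bump (c *\<^sub>R x)"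

lemma test_function_dilate_bump: "c > 0 \<Longrightarrow> test_function (\<lambda>x. bump (c *\<^sub>R x))"
  using test_function_affine[OF test_function_bump, of c 0] by simp

lemma integrable_compact_kernel: "compact_kernel k \<Longrightarrow> integrable lborel k"
proof -
  assume k: "compact_kernel k"
  have "locint (\<lambda>_::'a. 1)"
    unfolding locint_def by (auto intro!: integrable_real_indicator emeasure_bounded_finite)
  from integrable_kernel_mult[OF k this] show ?thesis by simp
qed

lemma bump_integral_pos:
  assumes "c > 0"
  shows "0 < (LINT y|lborel. bump (c *\<^sub>R (y::'a::euclidean_space)))"
proof -
  have i: "integrable lborel (\<lambda>y::'a. bump (c *\<^sub>R y))"
    by (intro integrable_compact_kernel compact_kernel_test test_function_dilate_bump assms)
  have "0 < measure lborel (ball (0::'a) (1/c))"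
    using assms by (simp add: content_ball_pos)
  also have "measure lborel (ball (0::'a) (1/c)) = (LINT y|lborel. indicator (ball (0::'a) (1/c)) y)" by simp
  also have "\<dots> \<le> (LINT y|lborel. bump (c *\<^sub>R (y::'a)))"
  proof (rule integral_mono)
    show "integrable lborel (indicator (ball (0::'a) (1/c)) :: 'a \<Rightarrow> real)"
      by (intro integrable_real_indicator emeasure_bounded_finite) auto
    fix y :: 'a
    show "indicator (ball (0::'a) (1/c)) y \<le> bump (c *\<^sub>R y)"
    proof (cases "y \<in> ball 0 (1/c)")
      case True
      then have "norm (c *\<^sub>R y) \<le> 1" using assms by (simp add: field_simps)
      then show ?thesis using True by (simp add: bump_eq_1)
    qed (simp add: bump_bounds)
  qed (rule i)
  finally show ?thesis .
qed

lemma test_function_mollifier: "c > 0 \<Longrightarrow> test_function (mollifier c)"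
  unfolding mollifier_def[abs_def] by (rule test_function_mult[OF Ck_const test_function_dilate_bump])

lemma mollifier_props:
  assumes c: "c > 0"
  shows "0 \<le> mollifier c x" "(LINT y|lborel. mollifier c (y::'a::euclidean_space)) = 1"
    "2 * real DIM('a) / c \<le> norm (x::'a) \<Longrightarrow> mollifier c x = 0"
proof -
  show "0 \<le> mollifier c x" unfolding mollifier_def
    by (intro mult_nonneg_nonneg bump_bounds) (simp add: less_imp_le[OF bump_integral_pos[OF c]])
  show "(LINT y|lborel. mollifier c (y::'a)) = 1" using bump_integral_pos[OF c, where 'a='a] by (simp add: mollifier_def)
  show "2 * real DIM('a) / c \<le> norm x \<Longrightarrow> mollifier c x = 0"
    using c by (simp add: mollifier_def bump_eq_0 field_simps)
qed

section \<open>Weak partial derivatives on Borel representatives\<close>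

definition weak_partials :: "('a::euclidean_space \<Rightarrow> real) \<Rightarrow> ('a \<Rightarrow> 'a \<Rightarrow> real) \<Rightarrow> bool" where
  "weak_partials u g \<longleftrightarrow> locint u \<and> (\<forall>i\<in>Basis. locint (g i) \<and> (\<forall>\<phi>. test_function \<phi> \<longrightarrow>
     (LINT x|lborel. u x * frechet_derivative \<phi> (at x) i) = - (LINT x|lborel. g i x * \<phi> x)))"

text \<open>The test function is the reflected one, \<open>y \<mapsto> \<phi> (x - y)\<close>: the
  sign of the reflection cancels the sign of the integration by parts.\<close>

lemma conv_weak_partial:
  assumes wp: "weak_partials u g" and i: "i \<in> Basis" and \<phi>: "test_function \<phi>"
  shows "conv (\<lambda>x. frechet_derivative \<phi> (at x) i) u = conv \<phi> (g i)"
proof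
  fix x
  have C1: "Ck (Suc 0) \<phi>" using \<phi> by (simp only: test_function_iff)
  have t: "test_function (\<lambda>y. \<phi> (x - y))"
    using test_function_affine[OF \<phi>, of "-1" x] by simp
  have d: "frechet_derivative (\<lambda>y. \<phi> (x - y)) (at y) i = - frechet_derivative \<phi> (at (x - y)) i" for y
    using frechet_derivative_affine[OF C1, of "-1" x y i] by simp
  have "(LINT y|lborel. u y * frechet_derivative (\<lambda>y. \<phi> (x - y)) (at y) i) = - (LINT y|lborel. g i y * \<phi> (x - y))"
    using wp i t by (simp add: weak_partials_def)
  then have "(LINT y|lborel. u y * frechet_derivative \<phi> (at (x - y)) i) = (LINT y|lborel. g i y * \<phi> (x - y))"
    unfolding d by simp
  then show "conv (\<lambda>x. frechet_derivative \<phi> (at x) i) u x = conv \<phi> (g i) x"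
    unfolding conv_def mult.commute[of "frechet_derivative _ _ _"] mult.commute[of "\<phi> _"] .
qed

lemma conv_cong_local:
  assumes "\<And>y. d \<le> norm y \<Longrightarrow> k y = 0" "\<And>y. norm y \<le> R + d \<Longrightarrow> f y = f' y" "norm x \<le> R"
  shows "conv k f x = conv k f' x"
  unfolding conv_def
proof (rule Bochner_Integration.integral_cong)
  fix y
  have "norm y \<le> norm x + norm (x - y)" using norm_triangle_ineq2[of y x] by (simp add: norm_minus_commute)
  then show "k (x - y) * f y = k (x - y) * f' y"
    using assms(1)[of "x - y"] assms(2)[of y] assms(3) by (cases "d \<le> norm (x - y)") auto
qed simp

text \<open>A kernel supported in the unit ball only sees f within distance 1, so on the ball of
  radius R the function may be cut off at R + 1 and becomes integrable.\<close>

lemma mollifier_L1_local: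
  fixes f :: "'a::euclidean_space \<Rightarrow> real"
  assumes f: "locint f" and e: "0 < e"
  obtains c0 where "c0 > 0" "\<And>c. c0 \<le> c \<Longrightarrow>
    (\<integral>\<^sup>+x. indicator (cball 0 R) x * ennreal \<bar>conv (mollifier c) f x - f x\<bar> \<partial>lborel) \<le> ennreal e"
proof -
  define F where "F x = indicator (cball 0 (R + 1)) x * f x" for x
  have F: "integrable lborel F" unfolding F_def using f unfolding locint_def by blast
  show ?thesis
  proof (rule conv_L1_approx[OF F e])
    fix d
    assume d: "d > 0" "\<And>(k :: 'a \<Rightarrow> real) C. k \<in> borel_measurable borel \<Longrightarrow> (\<And>y. 0 \<le> k y) \<Longrightarrow> (\<And>y. k y \<le> C) \<Longrightarrow>
      (\<And>y. d \<le> norm y \<Longrightarrow> k y = 0) \<Longrightarrow> integrable lborel k \<Longrightarrow> (LINT y|lborel. k y) = 1 \<Longrightarrow>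
      (\<integral>\<^sup>+x. ennreal \<bar>conv k F x - F x\<bar> \<partial>lborel) \<le> ennreal e"
  \<comment> \<open>Chosen so that c \<ge> c0 gives support radius \<open>2 * DIM / c\<close> at
    most \<open>min d 1\<close>: d for the L1 estimate, 1 for the cutoff at R + 1.\<close>
  define c0 where "c0 = 2 * real DIM('a) / min d 1 + 1"
  have c0: "c0 > 0" using d(1) by (simp add: c0_def add_nonneg_pos)
  show ?thesis
  proof
    fix c assume c: "c0 \<le> c"
    then have cp: "c > 0" using c0 by linarith
    have m: "0 < min d 1" using d(1) by simp
    have "2 * real DIM('a) / min d 1 \<le> c" using c by (simp add: c0_def)
    then have "2 * real DIM('a) \<le> c * min d 1" by (simp only: pos_divide_le_eq[OF m])
    then have small: "2 * real DIM('a) / c \<le> min d 1"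
      by (simp only: pos_divide_le_eq[OF cp] mult.commute)
    have k: "compact_kernel (mollifier c :: 'a \<Rightarrow> real)" by (intro compact_kernel_test test_function_mollifier cp)
    obtain C where C: "\<And>x::'a. \<bar>mollifier c x\<bar> \<le> C" and km: "(mollifier c :: 'a \<Rightarrow> real) \<in> borel_measurable borel"
      using compact_kernelE[OF k] by metis
    have z: "mollifier c y = 0" if "min d 1 \<le> norm y" for y :: 'a
      using mollifier_props(3)[OF cp, of y] small that by linarith
    have "(\<integral>\<^sup>+x. indicator (cball 0 R) x * ennreal \<bar>conv (mollifier c) f x - f x\<bar> \<partial>lborel)
       \<le> (\<integral>\<^sup>+x. ennreal \<bar>conv (mollifier c) F x - F x\<bar> \<partial>lborel)"
    proof (rule nn_integral_mono)
      fix x :: 'a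
      show "indicator (cball 0 R) x * ennreal \<bar>conv (mollifier c) f x - f x\<bar> \<le> ennreal \<bar>conv (mollifier c) F x - F x\<bar>"
      proof (cases "x \<in> cball 0 R")
        case True
        then have "conv (mollifier c) f x = conv (mollifier c) F x"
          by (intro conv_cong_local[where d=1 and R=R]) (auto simp: F_def z)
        then show ?thesis using True by (simp add: F_def)
      qed simp
    qed
    also have "\<dots> \<le> ennreal e"
    proof (rule d(2)[where C=C])
      show "mollifier c y \<le> C" for y :: 'a using C[of y] by linarith
    qed (use km mollifier_props[OF cp] z integrable_compact_kernel[OF k] in auto)
    finally show "(\<integral>\<^sup>+x. indicator (cball 0 R) x * ennreal \<bar>conv (mollifier c) f x - f x\<bar> \<partial>lborel) \<le> ennreal e" .
    qed (rule c0)
  qed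
qed

text \<open>The hypothesis makes every mollification of f vanish identically, while these converge
  to f in L1 on balls.\<close>

lemma locint_eq_0:
  fixes f :: "'a::euclidean_space \<Rightarrow> real"
  assumes f: "locint f" and z: "\<And>\<phi>. test_function \<phi> \<Longrightarrow> (LINT x|lborel. f x * \<phi> x) = 0"
  shows "AE x in lborel. f x = 0"
proof -
  have [measurable]: "f \<in> borel_measurable borel" using f by (rule locint_measurable)
  have conv0: "conv (mollifier c) f x = 0" if c: "c > 0" for c x
  proof -
    have "test_function (\<lambda>y. mollifier c (x - y))"
      using test_function_affine[OF test_function_mollifier[OF c], of "-1" x] by simp
    from z[OF this] show ?thesis by (simp add: conv_def mult.commute)
  qed
  have "AE x in lborel. x \<in> cball 0 (real n) \<longrightarrow> f x = 0" for n
  proof -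
    let ?I = "\<integral>\<^sup>+x. indicator (cball 0 (real n)) x * ennreal \<bar>f x\<bar> \<partial>lborel"
    have [measurable]: "cball (0::'a) (real n) \<in> sets borel" by simp
    have "?I \<le> ennreal e" if e: "e > 0" for e
    proof -
      obtain c0 where c0: "c0 > 0" "\<And>c. c0 \<le> c \<Longrightarrow>
        (\<integral>\<^sup>+x. indicator (cball 0 (real n)) x * ennreal \<bar>conv (mollifier c) f x - f x\<bar> \<partial>lborel) \<le> ennreal e"
        using mollifier_L1_local[OF f e] by metis
      from c0(2)[of c0] show ?thesis using conv0[OF c0(1)] by simp
    qed
    then have "?I = 0"
    proof (cases "?I" rule: ennreal_cases)
      case (real r)
      show ?thesis
      proof (rule ccontr)
        assume "?I \<noteq> 0"
        then have "0 < r" using real by (cases "r = 0") auto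
        then show False using \<open>\<And>e. e > 0 \<Longrightarrow> ?I \<le> ennreal e\<close>[of "r/2"] real by (simp add: ennreal_le_iff2)
      qed
    next
      case top
      then show ?thesis using \<open>\<And>e. e > 0 \<Longrightarrow> ?I \<le> ennreal e\<close>[of 1] by (simp add: top_unique)
    qed
    then have "AE x in lborel. indicator (cball 0 (real n)) x * ennreal \<bar>f x\<bar> = 0"
      by (subst (asm) nn_integral_0_iff_AE) auto
    then show ?thesis by eventually_elim (auto simp: indicator_def split: if_splits)
  qed
  then have "AE x in lborel. \<forall>n::nat. x \<in> cball 0 (real n) \<longrightarrow> f x = 0" unfolding AE_all_countable by blast
  then show ?thesis
  proof eventually_elim
    case (elim x)
    then show ?case using real_arch_simple[of "norm x"] by auto
  qed
qed

lemma weak_partials_unique: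
  assumes "weak_partials u g" "weak_partials u g'" and i: "i \<in> Basis"
  shows "AE x in lborel. g i x = g' i x"
proof -
  have l: "locint (g i)" "locint (g' i)" using assms by (auto simp: weak_partials_def)
  have "AE x in lborel. g i x - g' i x = 0"
  proof (rule locint_eq_0)
    show "locint (\<lambda>x. g i x - g' i x)"
      using l unfolding locint_def by (auto simp: right_diff_distrib)
    fix \<phi> :: "'a \<Rightarrow> real" assume t: "test_function \<phi>"
    have "integrable lborel (\<lambda>x. \<phi> x * g i x)" "integrable lborel (\<lambda>x. \<phi> x * g' i x)"
      using l t by (auto intro: integrable_kernel_mult compact_kernel_test)
    moreover have "(LINT x|lborel. g i x * \<phi> x) = (LINT x|lborel. g' i x * \<phi> x)"
      using assms t unfolding weak_partials_def by (metis neg_equal_iff_equal)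
    moreover have "(\<lambda>x. (g i x - g' i x) * \<phi> x) = (\<lambda>x. \<phi> x * g i x - \<phi> x * g' i x)"
      by (simp add: fun_eq_iff algebra_simps)
    ultimately show "(LINT x|lborel. (g i x - g' i x) * \<phi> x) = 0"
      by (simp add: mult.commute)
  qed
  then show ?thesis by eventually_elim simp
qed

text \<open>The product \<psi> \<phi> is again a test function, and testing u with it moves the
  derivative of \<psi> to the other side.\<close>

lemma weak_partials_cong_product:
  assumes wp: "weak_partials u g" and \<psi>: "\<And>k. Ck k \<psi>"
  shows "weak_partials (\<lambda>x. \<psi> x * u x) (\<lambda>i x. \<psi> x * g i x + u x * frechet_derivative \<psi> (at x) i)"
proof -
  have bdmult: "locint (\<lambda>x. \<eta> x * f x)" if f: "locint f" and \<eta>: "continuous_on UNIV \<eta>" for f \<eta> :: "'a \<Rightarrow> real"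
    unfolding locint_def
  proof (intro conjI allI)
    have [measurable]: "f \<in> borel_measurable borel" "\<eta> \<in> borel_measurable borel"
      using f \<eta> by (auto simp: locint_measurable borel_measurable_continuous_onI)
    show "(\<lambda>x. \<eta> x * f x) \<in> borel_measurable borel" by measurable
    fix R
    have [measurable]: "cball (0::'a) R \<in> sets borel" by simp
    have "compact (\<eta> ` cball 0 R)" by (intro compact_continuous_image continuous_on_subset[OF \<eta>]) auto
    then obtain B where "\<forall>y\<in>\<eta> ` cball 0 R. norm y \<le> B" using compact_imp_bounded bounded_iff by metis
    then have B: "\<bar>\<eta> x\<bar> \<le> B" if "x \<in> cball 0 R" for x using that by auto
    have "integrable lborel (\<lambda>x. B * (indicator (cball 0 R) x * f x))" using f by (auto simp: locint_def)
    then show "integrable lborel (\<lambda>x. indicator (cball 0 R) x * (\<eta> x * f x))"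
    proof (rule Bochner_Integration.integrable_bound)
      show "AE x in lborel. norm (indicator (cball 0 R) x * (\<eta> x * f x)) \<le> norm (B * (indicator (cball 0 R) x * f x))"
      proof (rule AE_I2)
        fix x
        show "norm (indicator (cball 0 R) x * (\<eta> x * f x)) \<le> norm (B * (indicator (cball 0 R) x * f x))"
        proof (cases "x \<in> cball 0 R")
          case True
          have "\<bar>\<eta> x\<bar> \<le> \<bar>B\<bar>" using B[OF True] by linarith
          then show ?thesis using True by (simp add: abs_mult mult_right_mono)
        qed simp
      qed
    qed measurable
  qed
  have add: "locint (\<lambda>x. f x + h x)" if "locint f" "locint h" for f h :: "'a \<Rightarrow> real"
    using that unfolding locint_def by (auto simp: distrib_left)
  have \<psi>0: "continuous_on UNIV \<psi>" using \<psi>[of 0] by simp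
  have \<psi>1: "continuous_on UNIV (\<lambda>x. frechet_derivative \<psi> (at x) i)" if "i \<in> Basis" for i
    using \<psi>[of "Suc 0"] that by simp
  have u: "locint u" using wp by (simp add: weak_partials_def)
  show ?thesis unfolding weak_partials_def
  proof (intro conjI ballI allI impI)
    show "locint (\<lambda>x. \<psi> x * u x)" using u \<psi>0 by (rule bdmult)
    fix i :: 'a assume i: "i \<in> Basis"
    have g: "locint (g i)" using wp i by (simp add: weak_partials_def)
    show "locint (\<lambda>x. \<psi> x * g i x + u x * frechet_derivative \<psi> (at x) i)"
      using add[OF bdmult[OF g \<psi>0] bdmult[OF u \<psi>1[OF i]]] by (simp add: mult.commute)
    fix \<phi> :: "'a \<Rightarrow> real" assume t: "test_function \<phi>"
    have t': "test_function (\<lambda>x. \<psi> x * \<phi> x)" by (rule test_function_mult[OF \<psi> t])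
    have C1: "Ck (Suc 0) \<psi>" "Ck (Suc 0) \<phi>" using \<psi> t by (auto simp only: test_function_iff)
    have d: "frechet_derivative (\<lambda>x. \<psi> x * \<phi> x) (at x) i =
        \<psi> x * frechet_derivative \<phi> (at x) i + frechet_derivative \<psi> (at x) i * \<phi> x" for x
      using frechet_derivative_at[OF has_derivative_mult[OF Ck_has_derivative[OF C1(1)] Ck_has_derivative[OF C1(2)]], of x]
      by (metis)
    have k1: "compact_kernel (\<lambda>x. \<psi> x * frechet_derivative \<phi> (at x) i)"
      using compact_kernel_partial[OF t i] \<psi>0 unfolding compact_kernel_def
      by (auto intro!: continuous_intros)
    have k2: "compact_kernel (\<lambda>x. frechet_derivative \<psi> (at x) i * \<phi> x)"
      using compact_kernel_test[OF t] \<psi>1[OF i] unfolding compact_kernel_def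
      by (auto intro!: continuous_intros)
    have "(LINT x|lborel. u x * frechet_derivative (\<lambda>x. \<psi> x * \<phi> x) (at x) i) = - (LINT x|lborel. g i x * (\<psi> x * \<phi> x))"
      using wp i t' by (simp add: weak_partials_def)
    moreover have "(LINT x|lborel. u x * frechet_derivative (\<lambda>x. \<psi> x * \<phi> x) (at x) i) =
        (LINT x|lborel. \<psi> x * u x * frechet_derivative \<phi> (at x) i) + (LINT x|lborel. u x * frechet_derivative \<psi> (at x) i * \<phi> x)"
      unfolding d using integrable_kernel_mult[OF k1 u] integrable_kernel_mult[OF k2 u]
      by (subst Bochner_Integration.integral_add[symmetric]) (auto simp: algebra_simps)
    moreover have "(LINT x|lborel. (\<psi> x * g i x + u x * frechet_derivative \<psi> (at x) i) * \<phi> x) =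
        (LINT x|lborel. g i x * (\<psi> x * \<phi> x)) + (LINT x|lborel. u x * frechet_derivative \<psi> (at x) i * \<phi> x)"
      using integrable_kernel_mult[OF compact_kernel_test[OF t'] g] integrable_kernel_mult[OF k2 u]
      by (subst Bochner_Integration.integral_add[symmetric]) (auto simp: algebra_simps)
    ultimately show "(LINT x|lborel. \<psi> x * u x * frechet_derivative \<phi> (at x) i) =
        - (LINT x|lborel. (\<psi> x * g i x + u x * frechet_derivative \<psi> (at x) i) * \<phi> x)" by simp
  qed
qed

subsection \<open>Weak gradients\<close>

lemma weak_partialsD:
  assumes "weak_partials u g"
  shows "locint u" "i \<in> Basis \<Longrightarrow> locint (g i)"
    "i \<in> Basis \<Longrightarrow> test_function \<phi> \<Longrightarrow>
      (LINT x|lborel. u x * frechet_derivative \<phi> (at x) i) = - (LINT x|lborel. g i x * \<phi> x)"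
  using assms unfolding weak_partials_def by blast+

text \<open>f is the pointwise limit of its restrictions to balls, hence measurable; the completion
  then supplies the Borel representative.\<close>

lemma locally_integrable_locint:
  fixes f :: "'a::euclidean_space \<Rightarrow> real"
  assumes f: "locally_integrable f"
  obtains f' where "locint f'" "f \<in> borel_measurable lebesgue" "AE x in lebesgue. f x = f' x"
proof -
  have si: "integrable lebesgue (\<lambda>x. indicator (cball 0 R) x * f x)" for R
    using f by (auto simp: locally_integrable_def set_integrable_def)
  have fm: "f \<in> borel_measurable lebesgue"
  proof (rule borel_measurable_LIMSEQ_real)
    show "(\<lambda>x. indicator (cball 0 (real n)) x * f x) \<in> borel_measurable lebesgue" for n
      using si by (rule borel_measurable_integrable)
    fix x :: 'a
    obtain n0 where n0: "norm x \<le> real n0" using real_arch_simple by blast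
    show "(\<lambda>n. indicator (cball 0 (real n)) x * f x) \<longlonglongrightarrow> f x"
    proof (rule tendsto_eventually, unfold eventually_sequentially, intro exI[of _ n0] allI impI)
      fix n assume "n0 \<le> n"
      then have "norm x \<le> real n" using n0 by linarith
      then show "indicator (cball 0 (real n)) x * f x = f x" by simp
    qed
  qed
  obtain f' where f'm: "f' \<in> borel_measurable lborel" and ae: "AE x in lborel. f x = f' x"
    using completion_ex_borel_measurable_real[OF fm] by blast
  have ae': "AE x in lebesgue. f x = f' x" using ae by (rule AE_completion)
  have "locint f'"
    unfolding locint_def
  proof (intro conjI allI)
    show b: "f' \<in> borel_measurable borel" using f'm by simp
    fix R
    have [measurable]: "cball (0::'a) R \<in> sets borel" by simp
    have m: "(\<lambda>x. indicator (cball 0 R) x * f' x) \<in> borel_measurable lborel" using f'm by measurable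
    have "integrable lebesgue (\<lambda>x. indicator (cball 0 R) x * f' x)"
      by (rule integrable_cong_AE_imp[OF si[of R]])
         (use ae' measurable_completion[OF m] in \<open>auto elim!: eventually_mono\<close>)
    then show "integrable lborel (\<lambda>x. indicator (cball 0 R) x * f' x)"
      using integrable_completion[OF m] by blast
  qed
  then show ?thesis using that fm ae' by blast
qed

lemma borel_measurable_lebesgueI: "f \<in> borel_measurable borel \<Longrightarrow> f \<in> borel_measurable lebesgue"
  by (rule measurable_completion) simp

lemma integral_lebesgue_cong:
  fixes f f' \<phi> :: "'a::euclidean_space \<Rightarrow> real"
  assumes "f \<in> borel_measurable lebesgue" "f' \<in> borel_measurable borel" "AE x in lebesgue. f x = f' x"
    and "\<phi> \<in> borel_measurable borel"
  shows "(LINT x|lebesgue. f x * \<phi> x) = (LINT x|lborel. f' x * \<phi> x)"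
proof -
  have \<phi>: "\<phi> \<in> borel_measurable lebesgue" using assms(4) by (rule borel_measurable_lebesgueI)
  have m: "(\<lambda>x. f' x * \<phi> x) \<in> borel_measurable lborel" using assms(2,4) by measurable
  have "(LINT x|lebesgue. f x * \<phi> x) = (LINT x|lebesgue. f' x * \<phi> x)"
  proof (rule integral_cong_AE)
    show "(\<lambda>x. f x * \<phi> x) \<in> borel_measurable lebesgue" using assms(1) \<phi> by (rule borel_measurable_times)
    show "(\<lambda>x. f' x * \<phi> x) \<in> borel_measurable lebesgue" using m by (rule measurable_completion)
    show "AE x in lebesgue. f x * \<phi> x = f' x * \<phi> x" using assms(3) by eventually_elim simp
  qed
  also have "\<dots> = (LINT x|lborel. f' x * \<phi> x)" by (rule integral_completion[OF m])
  finally show ?thesis .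
qed

lemma test_function_borel:
  fixes \<phi> :: "'a::euclidean_space \<Rightarrow> real"
  assumes "test_function \<phi>"
  shows "\<phi> \<in> borel_measurable borel" "i \<in> Basis \<Longrightarrow> (\<lambda>x. frechet_derivative \<phi> (at x) i) \<in> borel_measurable borel"
  using compact_kernel_test[OF assms] compact_kernel_partial[OF assms]
  by (auto simp: compact_kernel_def borel_measurable_continuous_onI)

text \<open>The representatives measurable for the completion are replaced by Borel ones, coordinate
  by coordinate; integrals against test functions do not change.\<close>

lemma has_weak_gradient_partials:
  fixes u :: "'a::euclidean_space \<Rightarrow> real"
  assumes w: "has_weak_gradient u G"
  obtains u' g where "weak_partials u' g" "AE x in lebesgue. u x = u' x"
    "AE x in lebesgue. \<forall>i\<in>Basis. G x \<bullet> i = g i x" "G \<in> borel_measurable lebesgue"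
proof -
  obtain u' where u': "locint u'" "u \<in> borel_measurable lebesgue" "AE x in lebesgue. u x = u' x"
    using w locally_integrable_locint unfolding has_weak_gradient_def by metis
  have "\<exists>g'. locint g' \<and> (\<lambda>x. G x \<bullet> i) \<in> borel_measurable lebesgue \<and> (AE x in lebesgue. G x \<bullet> i = g' x)" for i
  proof -
    have "locally_integrable (\<lambda>x. G x \<bullet> i)"
      unfolding locally_integrable_def
    proof (intro allI impI)
      fix K :: "'a set" assume "compact K"
      then have "integrable lebesgue (\<lambda>x. indicator K x *\<^sub>R G x)"
        using w by (auto simp: has_weak_gradient_def locally_integrable_def set_integrable_def)
      then have "integrable lebesgue (\<lambda>x. (indicator K x *\<^sub>R G x) \<bullet> i)" by (rule integrable_inner_left)
      then show "set_integrable lebesgue K (\<lambda>x. G x \<bullet> i)" by (simp add: set_integrable_def)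
    qed
    then show ?thesis using locally_integrable_locint by metis
  qed
  then obtain g where g: "\<And>i. locint (g i)" "\<And>i. (\<lambda>x. G x \<bullet> i) \<in> borel_measurable lebesgue"
      "\<And>i. AE x in lebesgue. G x \<bullet> i = g i x" by metis
  have "weak_partials u' g"
    unfolding weak_partials_def
  proof (intro conjI ballI allI impI u' g)
    fix i :: 'a and \<phi> :: "'a \<Rightarrow> real" assume i: "i \<in> Basis" and t: "test_function \<phi>"
    have "(LINT x|lebesgue. u x * frechet_derivative \<phi> (at x) i) = - (LINT x|lebesgue. (G x \<bullet> i) * \<phi> x)"
      using w i t by (simp add: has_weak_gradient_def)
    then show "(LINT x|lborel. u' x * frechet_derivative \<phi> (at x) i) = - (LINT x|lborel. g i x * \<phi> x)"
      using integral_lebesgue_cong[OF u'(2) locint_measurable[OF u'(1)] u'(3) test_function_borel(2)[OF t i]]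
        integral_lebesgue_cong[OF g(2) locint_measurable[OF g(1)] g(3) test_function_borel(1)[OF t], of i]
      by simp
  qed
  moreover have "AE x in lebesgue. \<forall>i\<in>Basis. G x \<bullet> i = g i x"
    by (rule AE_finite_allI) (auto intro: g)
  moreover have "G \<in> borel_measurable lebesgue"
  proof -
    have "(\<lambda>x. \<Sum>i\<in>Basis. (G x \<bullet> i) *\<^sub>R i) \<in> borel_measurable lebesgue"
      by (intro borel_measurable_sum borel_measurable_scaleR g(2)) auto
    then show ?thesis by (simp add: euclidean_representation)
  qed
  ultimately show ?thesis using u' that by blast
qed

lemma locint_locally_integrable:
  fixes f :: "'a::euclidean_space \<Rightarrow> real"
  assumes f': "locint f'" and fm: "f \<in> borel_measurable lebesgue" and ae: "AE x in lebesgue. f x = f' x"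
  shows "locally_integrable f"
  unfolding locally_integrable_def
proof (intro allI impI)
  fix K :: "'a set" assume K: "compact K"
  then obtain R where "\<forall>x\<in>K. norm x \<le> R" using compact_imp_bounded bounded_iff by metis
  then have R: "K \<subseteq> cball 0 R" by auto
  have Kb: "K \<in> sets lebesgue" using K by (simp add: compact_imp_closed borel_closed)
  have "integrable lborel (\<lambda>x. indicator (cball 0 R) x * f' x)" using f' unfolding locint_def by blast
  then have "integrable lebesgue (\<lambda>x. indicator (cball 0 R) x * f' x)"
    using integrable_completion[OF borel_measurable_integrable] by blast
  then have "integrable lebesgue (\<lambda>x. indicator K x *\<^sub>R (indicator (cball 0 R) x * f' x))"
    by (rule integrable_mult_indicator[OF Kb])
  then show "set_integrable lebesgue K f"
    unfolding set_integrable_def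
  proof (rule integrable_cong_AE_imp)
    show "(\<lambda>x. indicator K x *\<^sub>R f x) \<in> borel_measurable lebesgue"
      using Kb fm by (intro borel_measurable_scaleR borel_measurable_indicator)
    show "AE x in lebesgue. indicator K x *\<^sub>R (indicator (cball 0 R) x * f' x) = indicator K x *\<^sub>R f x"
      using ae by eventually_elim (use R in \<open>auto simp: indicator_def\<close>)
  qed
qed

lemma partials_has_weak_gradient:
  fixes u :: "'a::euclidean_space \<Rightarrow> real"
  assumes wp: "weak_partials u' g" and um: "u \<in> borel_measurable lebesgue" and ae: "AE x in lebesgue. u x = u' x"
  shows "has_weak_gradient u (\<lambda>x. \<Sum>i\<in>Basis. g i x *\<^sub>R i)"
proof -
  let ?G = "\<lambda>x. \<Sum>i\<in>Basis. g i x *\<^sub>R i"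
  note u' = weak_partialsD(1)[OF wp] and g = weak_partialsD(2)[OF wp]
  have gm: "g i \<in> borel_measurable lebesgue" if "i \<in> Basis" for i
    by (rule borel_measurable_lebesgueI[OF locint_measurable[OF g[OF that]]])
  have "locally_integrable ?G"
    unfolding locally_integrable_def
  proof (intro allI impI)
    fix K :: "'a set" assume K: "compact K"
    have "integrable lebesgue (\<lambda>x. \<Sum>i\<in>Basis. (indicator K x *\<^sub>R g i x) *\<^sub>R i)"
    proof (intro Bochner_Integration.integrable_sum integrable_scaleR_left)
      fix i :: 'a assume i: "i \<in> Basis"
      have "locally_integrable (g i)" by (rule locint_locally_integrable[OF g[OF i] gm[OF i]]) simp
      then show "integrable lebesgue (\<lambda>x. indicator K x *\<^sub>R g i x)"
        using K by (simp add: locally_integrable_def set_integrable_def)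
    qed
    then show "set_integrable lebesgue K ?G" by (simp add: set_integrable_def scaleR_sum_right)
  qed
  moreover have "locally_integrable u" by (rule locint_locally_integrable[OF u' um ae])
  moreover have "(LINT x|lebesgue. u x * frechet_derivative \<phi> (at x) i) = - (LINT x|lebesgue. (?G x \<bullet> i) * \<phi> x)"
    if i: "i \<in> Basis" and t: "test_function \<phi>" for \<phi> i
  proof -
    have "?G x \<bullet> i = g i x" for x using i by (simp add: inner_sum_left inner_Basis if_distrib sum.delta cong: if_cong)
    then have "(LINT x|lebesgue. (?G x \<bullet> i) * \<phi> x) = (LINT x|lborel. g i x * \<phi> x)"
      using integral_lebesgue_cong[OF gm[OF i] locint_measurable[OF g[OF i]] AE_I2 test_function_borel(1)[OF t]] by simp
    moreover have "(LINT x|lebesgue. u x * frechet_derivative \<phi> (at x) i) = (LINT x|lborel. u' x * frechet_derivative \<phi> (at x) i)"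
      by (rule integral_lebesgue_cong[OF um locint_measurable[OF u'] ae test_function_borel(2)[OF t i]])
    ultimately show ?thesis using weak_partialsD(3)[OF wp i t] by simp
  qed
  ultimately show ?thesis unfolding has_weak_gradient_def by blast
qed

lemma has_weak_gradient_wgrad: "has_weak_gradient u G \<Longrightarrow> has_weak_gradient u (wgrad u)"
  unfolding wgrad_def by (rule someI[of "has_weak_gradient u"])

text \<open>\<open>wgrad\<close> is a choice among all weak gradients; this is what transfers
  explicitly computed gradients to it.\<close>

lemma has_weak_gradient_unique:
  assumes "has_weak_gradient u G" "has_weak_gradient u G'"
  shows "AE x in lebesgue. G x = G' x"
proof -
  obtain u1 g1 where 1: "weak_partials u1 g1" "AE x in lebesgue. u x = u1 x"
    "AE x in lebesgue. \<forall>i\<in>Basis. G x \<bullet> i = g1 i x" "G \<in> borel_measurable lebesgue"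
    by (rule has_weak_gradient_partials[OF assms(1)])
  obtain u2 g2 where 2: "weak_partials u2 g2" "AE x in lebesgue. u x = u2 x"
    "AE x in lebesgue. \<forall>i\<in>Basis. G' x \<bullet> i = g2 i x" "G' \<in> borel_measurable lebesgue"
    by (rule has_weak_gradient_partials[OF assms(2)])
  have m: "u1 \<in> borel_measurable borel" "u2 \<in> borel_measurable borel"
    using weak_partialsD(1)[OF 1(1)] weak_partialsD(1)[OF 2(1)] by (auto intro: locint_measurable)
  have ae: "AE x in lborel. u2 x = u1 x"
  proof -
    have "AE x in lebesgue. u2 x = u1 x" using 1(2) 2(2) by eventually_elim simp
    then show ?thesis by (simp add: AE_completion_iff)
  qed
  \<comment> \<open>The Borel representatives u1 and u2 of u agree almost everywhere, so the
    partials of u2 are also partials of u1 and uniqueness applies.\<close>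
  have "weak_partials u1 g2"
    unfolding weak_partials_def
  proof (intro conjI ballI allI impI)
    fix i :: 'a and \<phi> :: "'a \<Rightarrow> real" assume i: "i \<in> Basis" and t: "test_function \<phi>"
    have "(LINT x|lborel. u2 x * frechet_derivative \<phi> (at x) i) = (LINT x|lborel. u1 x * frechet_derivative \<phi> (at x) i)"
      by (rule integral_cong_AE) (use m test_function_borel(2)[OF t i] ae in \<open>auto elim!: eventually_mono\<close>)
    then show "(LINT x|lborel. u1 x * frechet_derivative \<phi> (at x) i) = - (LINT x|lborel. g2 i x * \<phi> x)"
      using weak_partialsD(3)[OF 2(1) i t] by simp
  qed (use weak_partialsD(1)[OF 1(1)] weak_partialsD(2)[OF 2(1)] in auto)
  then have "AE x in lebesgue. g1 i x = g2 i x" if "i \<in> Basis" for i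
    using weak_partials_unique[OF 1(1) _ that, of g2] by (simp add: AE_completion_iff)
  then have "AE x in lebesgue. \<forall>i\<in>Basis. g1 i x = g2 i x" by (intro AE_finite_allI) auto
  with 1(3) 2(3) show ?thesis
    by eventually_elim (auto intro: euclidean_eqI)
qed

subsection \<open>The Gagliardo-Nirenberg inequality\<close>

text \<open>The convention \<open>epow x 0 = 1\<close>, even at 0 and \<infinity>, lets factors of
  exponent 0 drop out, as the factor \<open>f x\<close> does in the extremal case of the grid
  inequality.\<close>

definition epow :: "ennreal \<Rightarrow> real \<Rightarrow> ennreal" where
  "epow x r = (if r = 0 then 1 else if x = \<infinity> then \<infinity> else ennreal (enn2real x powr r))"

lemma epow_0 [simp]: "epow x 0 = 1"
  by (simp add: epow_def)

lemma epow_1 [simp]: "epow x 1 = x"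
  by (cases x) (auto simp: epow_def)

lemma epow_top: "0 < r \<Longrightarrow> epow top r = top"
  by (simp add: epow_def)

lemma epow_ennreal: "0 \<le> x \<Longrightarrow> 0 < r \<Longrightarrow> epow (ennreal x) r = ennreal (x powr r)"
  by (simp add: epow_def)

lemma epow_zero: "0 < r \<Longrightarrow> epow 0 r = 0"
  by (simp add: epow_def)

lemma epow_pos: "0 < x \<Longrightarrow> 0 < epow x r"
  by (cases x) (auto simp: epow_def)

lemma epow_add: "0 \<le> r \<Longrightarrow> 0 \<le> s \<Longrightarrow> epow x (r + s) = epow x r * epow x s"
proof (cases x)
  case (real y)
  assume "0 \<le> r" "0 \<le> s"
  then show ?thesis using real
    by (auto simp: epow_def powr_add ennreal_mult)
next
  case top
  assume "0 \<le> r" "0 \<le> s"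
  then show ?thesis using top
    by (auto simp: epow_def ennreal_top_mult)
qed

lemma epow_mono: "x \<le> y \<Longrightarrow> 0 \<le> r \<Longrightarrow> epow x r \<le> epow y r"
  by (cases x; cases y) (auto simp: epow_def powr_mono2 top_unique)

lemma measurable_epow [measurable]:
  assumes [measurable]: "f \<in> borel_measurable M"
  shows "(\<lambda>x. epow (f x) r) \<in> borel_measurable M"
  unfolding epow_def by measurable

text \<open>Jensen's inequality for exp at the points ln (y i); if some y i is 0 the product is
  0.\<close>

lemma weighted_AM_GM:
  fixes w y :: "'i \<Rightarrow> real"
  assumes I: "finite I" "\<And>i. i \<in> I \<Longrightarrow> 0 < w i" "sum w I = 1" "\<And>i. i \<in> I \<Longrightarrow> 0 \<le> y i"
  shows "(\<Prod>i\<in>I. y i powr w i) \<le> (\<Sum>i\<in>I. w i * y i)"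
proof (cases "\<exists>i\<in>I. y i = 0")
  case True
  then have "(\<Prod>i\<in>I. y i powr w i) = 0" using I by (auto simp: prod_zero_iff)
  moreover have "0 \<le> (\<Sum>i\<in>I. w i * y i)"
    by (intro sum_nonneg mult_nonneg_nonneg) (use I less_imp_le in auto)
  ultimately show ?thesis by simp
next
  case False
  then have pos: "0 < y i" if "i \<in> I" for i using I(4)[OF that] that by force
  have ne: "I \<noteq> {}" using I by auto
  have "(\<Prod>i\<in>I. y i powr w i) = (\<Prod>i\<in>I. exp (w i * ln (y i)))"
    by (rule prod.cong) (use pos in \<open>force simp: powr_def\<close>)+
  also have "\<dots> = exp (\<Sum>i\<in>I. w i *\<^sub>R ln (y i))"
    using I(1) by (simp add: exp_sum)
  also have "\<dots> \<le> (\<Sum>i\<in>I. w i * exp (ln (y i)))"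
    by (rule convex_on_sum[where C=UNIV]) (use I ne less_imp_le in \<open>auto intro: exp_convex\<close>)
  also have "\<dots> = (\<Sum>i\<in>I. w i * y i)"
    by (rule sum.cong) (use pos in auto)
  finally show ?thesis .
qed

text \<open>Divide each factor by its integral, apply the weighted AM-GM inequality pointwise and
  integrate: the right side becomes the sum of the weights, which is 1. Zero and infinite integrals
  are settled beforehand.\<close>

lemma nn_integral_Holder_prod:
  fixes f :: "'i \<Rightarrow> 'b \<Rightarrow> ennreal" and w :: "'i \<Rightarrow> real"
  assumes I: "finite I" "\<And>i. i \<in> I \<Longrightarrow> 0 \<le> w i" "sum w I = 1"
    and meas: "\<And>i. i \<in> I \<Longrightarrow> f i \<in> borel_measurable M"
  shows "(\<integral>\<^sup>+x. (\<Prod>i\<in>I. epow (f i x) (w i)) \<partial>M) \<le> (\<Prod>i\<in>I. epow (\<integral>\<^sup>+x. f i x \<partial>M) (w i))"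
proof -
  \<comment> \<open>Factors of weight 0 equal 1 on both sides; \<open>weighted_AM_GM\<close> is for
    positive weights.\<close>
  define J where "J = {i\<in>I. 0 < w i}"
  have J: "finite J" "J \<subseteq> I" "\<And>i. i \<in> J \<Longrightarrow> 0 < w i" unfolding J_def using I by auto
  have z: "w i = 0" if "i \<in> I - J" for i using that I(2)[of i] by (auto simp: J_def)
  have PJ: "(\<Prod>i\<in>I. epow (g i) (w i)) = (\<Prod>i\<in>J. epow (g i) (w i))" for g
    by (rule prod.mono_neutral_right) (use I J z in auto)
  have sJ: "sum w J = 1"
    using I(3) sum.mono_neutral_right[OF I(1) J(2), of w] z by auto
  have mJ: "\<And>i. i \<in> J \<Longrightarrow> f i \<in> borel_measurable M" using meas J by auto
  let ?F = "\<lambda>i. \<integral>\<^sup>+x. f i x \<partial>M"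
  show ?thesis unfolding PJ
  proof (cases "\<exists>i\<in>J. ?F i = 0")
    case True
    then obtain i where i: "i \<in> J" "?F i = 0" by auto
    then have "AE x in M. f i x = 0" using mJ by (simp add: nn_integral_0_iff_AE)
    then have "AE x in M. (\<Prod>i\<in>J. epow (f i x) (w i)) = 0"
    proof eventually_elim
      case (elim x)
      have "epow (f i x) (w i) = 0" using elim J(3)[OF i(1)] by (simp add: epow_zero)
      then show ?case using i J(1) by (auto intro: prod_zero)
    qed
    then have "(\<integral>\<^sup>+x. (\<Prod>i\<in>J. epow (f i x) (w i)) \<partial>M) = 0"
      by (subst nn_integral_0_iff_AE) (use mJ in auto)
    then show "(\<integral>\<^sup>+x. (\<Prod>i\<in>J. epow (f i x) (w i)) \<partial>M) \<le> (\<Prod>i\<in>J. epow (?F i) (w i))" by simp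
  next
    case F0: False
    show "(\<integral>\<^sup>+x. (\<Prod>i\<in>J. epow (f i x) (w i)) \<partial>M) \<le> (\<Prod>i\<in>J. epow (?F i) (w i))"
    proof (cases "\<exists>i\<in>J. ?F i = \<infinity>")
      case True
      then obtain i where i: "i \<in> J" "?F i = \<infinity>" by auto
      have "(\<Prod>i\<in>J. epow (?F i) (w i)) = epow (?F i) (w i) * (\<Prod>i\<in>J-{i}. epow (?F i) (w i))"
        using i J by (meson prod.remove)
      moreover have "(\<Prod>i\<in>J-{i}. epow (?F i) (w i)) \<noteq> 0"
      proof
        assume "(\<Prod>i\<in>J-{i}. epow (?F i) (w i)) = 0"
        then obtain k where "k \<in> J" "epow (?F k) (w k) = 0" using J(1) by (auto simp: prod_zero_iff)
        then show False using F0 epow_pos[of "?F k" "w k"] by (auto simp: zero_less_iff_neq_zero)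
      qed
      ultimately have "(\<Prod>i\<in>J. epow (?F i) (w i)) = \<infinity>"
        using i J(3)[OF i(1)] by (simp add: epow_top ennreal_top_mult)
      then show ?thesis by simp
    next
      case False
      define c where "c i = enn2real (?F i)" for i
      have c: "?F i = ennreal (c i)" "0 < c i" if "i \<in> J" for i
      proof -
        show 1: "?F i = ennreal (c i)" using False that by (auto simp: c_def less_top)
        show "0 < c i" using F0 that 1 by (auto simp: c_def) 
            (metis enn2real_nonneg ennreal_0 less_eq_real_def that 1 c_def)
      qed
      have pw: "(\<Prod>i\<in>J. epow (f i x) (w i)) \<le> (\<Prod>i\<in>J. epow (?F i) (w i)) * (\<Sum>i\<in>J. ennreal (w i / c i) * f i x)" for x
      proof (cases "\<exists>i\<in>J. f i x = \<infinity>")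
        case True
        then obtain i where i: "i \<in> J" "f i x = \<infinity>" by auto
        \<comment> \<open>One infinite value makes the sum infinite, and the constant in front of it
          is nonzero because no integral vanishes; so the bound is \<infinity>.\<close>
        have "(\<Sum>i\<in>J. ennreal (w i / c i) * f i x) = \<infinity>"
        proof -
          have "0 < w i / c i" using c(2)[OF i(1)] J(3)[OF i(1)] by simp
          then have "ennreal (w i / c i) * f i x = top" using i by (auto simp: ennreal_mult_top)
          then show ?thesis using i(1) J(1) by auto
        qed
        moreover have "(\<Prod>i\<in>J. epow (?F i) (w i)) \<noteq> 0"
        proof
          assume "(\<Prod>i\<in>J. epow (?F i) (w i)) = 0"
          then obtain k where "k \<in> J" "epow (?F k) (w k) = 0" using J(1) by (auto simp: prod_zero_iff)
          then show False using F0 epow_pos[of "?F k" "w k"] by (auto simp: zero_less_iff_neq_zero)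
        qed
        ultimately show ?thesis by (metis ennreal_mult_top infinity_ennreal_def top_greatest)
      next
        case fin: False
        define y where "y i = enn2real (f i x)" for i
        have y: "f i x = ennreal (y i)" "0 \<le> y i" if "i \<in> J" for i
          using fin that by (auto simp: y_def less_top)
        have "(\<Prod>i\<in>J. epow (f i x) (w i)) = ennreal (\<Prod>i\<in>J. y i powr w i)"
          using J by (subst prod_ennreal[symmetric]) (auto intro!: prod.cong simp: y epow_ennreal)
        also have "(\<Prod>i\<in>J. y i powr w i) = (\<Prod>i\<in>J. c i powr w i) * (\<Prod>i\<in>J. (y i / c i) powr w i)"
          by (subst prod.distrib[symmetric], rule prod.cong)
             (use y(2) c(2) in \<open>auto simp: powr_divide less_imp_le\<close>, metis less_irrefl powr_eq_0_iff)
        also have "\<dots> \<le> (\<Prod>i\<in>J. c i powr w i) * (\<Sum>i\<in>J. w i * (y i / c i))"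
          by (intro mult_left_mono weighted_AM_GM prod_nonneg) (use J sJ y c in \<open>auto simp: less_imp_le\<close>)
        also have "ennreal \<dots> = ennreal (\<Prod>i\<in>J. c i powr w i) * ennreal (\<Sum>i\<in>J. w i * (y i / c i))"
          by (rule ennreal_mult) (use J y c in \<open>auto intro!: prod_nonneg sum_nonneg simp: less_imp_le\<close>)
        also have "ennreal (\<Prod>i\<in>J. c i powr w i) = (\<Prod>i\<in>J. epow (?F i) (w i))"
          using J by (subst prod_ennreal[symmetric]) (auto intro!: prod.cong simp: c epow_ennreal less_imp_le)
        also have "ennreal (\<Sum>i\<in>J. w i * (y i / c i)) = (\<Sum>i\<in>J. ennreal (w i / c i) * f i x)"
          using J c y by (subst sum_ennreal[symmetric])
             (auto intro!: sum.cong simp: ennreal_mult[symmetric] less_imp_le)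
        finally show ?thesis by (simp add: ennreal_leI)
      qed
      have "(\<integral>\<^sup>+x. (\<Prod>i\<in>J. epow (f i x) (w i)) \<partial>M)
          \<le> (\<integral>\<^sup>+x. (\<Prod>i\<in>J. epow (?F i) (w i)) * (\<Sum>i\<in>J. ennreal (w i / c i) * f i x) \<partial>M)"
        by (intro nn_integral_mono pw)
      also have "\<dots> = (\<Prod>i\<in>J. epow (?F i) (w i)) * (\<Sum>i\<in>J. ennreal (w i / c i) * ?F i)"
        using mJ by (subst nn_integral_cmult, simp, subst nn_integral_sum, simp,
            auto intro!: arg_cong2[where f="(*)"] sum.cong nn_integral_cmult)
      also have "(\<Sum>i\<in>J. ennreal (w i / c i) * ?F i) = (\<Sum>i\<in>J. ennreal (w i))"
        by (rule sum.cong) (use c J in \<open>auto simp: ennreal_mult[symmetric] less_imp_le\<close>, metis less_irrefl)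
      also have "\<dots> = 1" using sJ J by (subst sum_ennreal) (auto simp: less_imp_le)
      finally show ?thesis by simp
    qed
  qed
qed

text \<open>For \<open>p = 1 / (card I - 1)\<close> the factor \<open>f x\<close> disappears and this is Gagliardo's inequality. Keeping
  \<open>p\<close> fixed while \<open>I\<close> grows is what makes the induction (Hoelder in the new variable) close.\<close>

lemma grid_lines_inequality:
  fixes f :: "('i \<Rightarrow> real) \<Rightarrow> ennreal" and p :: real
  assumes "finite I" "0 \<le> p" "(real (card I) - 1) * p \<le> 1"
    and "f \<in> borel_measurable (PiM I (\<lambda>_. lborel))"
  shows "(\<integral>\<^sup>+x. epow (f x) (1 - (real (card I) - 1) * p) *
      (\<Prod>i\<in>I. epow (\<integral>\<^sup>+s. f (x(i:=s)) \<partial>lborel) p) \<partial>PiM I (\<lambda>_. lborel))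
    \<le> epow (\<integral>\<^sup>+x. f x \<partial>PiM I (\<lambda>_. lborel)) (1 + p)"
  using assms
proof (induction I arbitrary: f rule: finite_induct)
  case empty
  interpret product_sigma_finite "\<lambda>_::'i. lborel :: real measure" ..
  show ?case by (simp add: nn_integral_empty)
next
  case (insert j I f)
  interpret product_sigma_finite "\<lambda>_::'i. lborel :: real measure" ..
  let ?L = "lborel :: real measure"
  let ?P = "PiM I (\<lambda>_. ?L)" and ?Q = "PiM (insert j I) (\<lambda>_. ?L)"
  note [measurable] = insert.prems(3)
  define m where "m = real (card I)"
  have m: "real (card (insert j I)) - 1 = m" using insert by (simp add: m_def)
  have mp: "m * p \<le> 1" "0 \<le> p" using insert.prems m by auto
  define F where "F x = (\<integral>\<^sup>+s. f (x(j:=s)) \<partial>?L)" for x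
  have upd1 [measurable]: "(\<lambda>(x, y). x(j := y)) \<in> ?P \<Otimes>\<^sub>M ?L \<rightarrow>\<^sub>M ?Q"
    by (rule measurable_add_dim)
  have F_meas [measurable]: "F \<in> borel_measurable ?P"
    unfolding F_def by measurable
  have inner: "(\<integral>\<^sup>+y. epow (f (x(j:=y))) (1 - m * p) *
      (\<Prod>i\<in>insert j I. epow (\<integral>\<^sup>+s. f (x(j:=y, i:=s)) \<partial>?L) p) \<partial>?L)
     \<le> epow (F x) (1 - (m - 1) * p) * (\<Prod>i\<in>I. epow (\<integral>\<^sup>+s. F (x(i:=s)) \<partial>?L) p)"
    if x: "x \<in> space ?P" for x
  proof -
    have xj: "(\<lambda>y. x(j:=y)) \<in> ?L \<rightarrow>\<^sub>M ?Q"
      using x by (rule measurable_component_update) (fact insert.hyps)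
    then have fx [measurable]: "(\<lambda>y. f (x(j:=y))) \<in> borel_measurable ?L" by measurable
    have upd2: "(\<lambda>(y, s). x(j:=y, i:=s)) \<in> ?L \<Otimes>\<^sub>M ?L \<rightarrow>\<^sub>M ?Q" if i: "i \<in> I" for i
    proof -
      have 1: "(\<lambda>z. x(j := fst z)) \<in> ?L \<Otimes>\<^sub>M ?L \<rightarrow>\<^sub>M ?Q"
        by (rule measurable_compose[OF measurable_fst xj])
      have "(\<lambda>z. (x(j := fst z))(i := snd z)) \<in> ?L \<Otimes>\<^sub>M ?L \<rightarrow>\<^sub>M ?Q"
        by (rule measurable_fun_upd[OF _ 1]) (use i in auto)
      then show ?thesis by (simp add: split_beta')
    qed
    have fm2: "(\<lambda>(y, s). f (x(j:=y, i:=s))) \<in> borel_measurable (?L \<Otimes>\<^sub>M ?L)" if "i \<in> I" for i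
      using measurable_compose[OF upd2[OF that] insert.prems(3)] unfolding split_beta' .
    have swap: "(\<integral>\<^sup>+y. (\<integral>\<^sup>+s. f (x(j:=y, i:=s)) \<partial>?L) \<partial>?L) = (\<integral>\<^sup>+s. F (x(i:=s)) \<partial>?L)" if i: "i \<in> I" for i
    proof -
      have "j \<noteq> i" using i insert by auto
      then have tw: "x(j:=y, i:=s) = x(i:=s, j:=y)" for y s by (simp add: fun_upd_twist)
      show ?thesis
        using lborel_pair.Fubini'[OF fm2[OF i]] by (simp add: F_def tw)
    qed
    \<comment> \<open>Hoelder in the new variable y puts weight 1 - m p on \<open>f\<close> and
      weight p on each of the m older line integrals; the weights sum to 1.\<close>
    define W where "W i = (if i = j then 1 - m * p else p)" for i
    define H where "H i y = (if i = j then f (x(j:=y)) else (\<integral>\<^sup>+s. f (x(j:=y, i:=s)) \<partial>?L))" for i y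
    have Hm: "H i \<in> borel_measurable ?L" if "i \<in> insert j I" for i
    proof (cases "i = j")
      case True
      then have "H i = (\<lambda>y. f (x(j:=y)))" by (simp add: H_def fun_eq_iff)
      then show ?thesis using fx by simp
    next
      case False
      then have "i \<in> I" using that by auto
      note [measurable] = fm2[OF this]
      show ?thesis using False unfolding H_def by simp
    qed
    have H: "(\<integral>\<^sup>+y. (\<Prod>i\<in>insert j I. epow (H i y) (W i)) \<partial>?L)
          \<le> (\<Prod>i\<in>insert j I. epow (\<integral>\<^sup>+y. H i y \<partial>?L) (W i))"
    proof (rule nn_integral_Holder_prod)
      have "(\<Sum>i\<in>I. W i) = (\<Sum>i\<in>I. p)"
        by (rule sum.cong) (use insert.hyps in \<open>auto simp: W_def\<close>)
      then have "sum W (insert j I) = 1 - m * p + (\<Sum>i\<in>I. p)"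
        using insert.hyps by (simp add: W_def)
      then show "sum W (insert j I) = 1" by (simp add: m_def)
    qed (use insert.hyps mp Hm in \<open>auto simp: W_def\<close>)
    have prodH: "(\<Prod>i\<in>insert j I. epow (G i) (W i)) = epow (G j) (1 - m * p) * (\<Prod>i\<in>I. epow (G i) p)" for G
      using insert.hyps by (auto simp: W_def intro!: arg_cong2[where f="(*)"] prod.cong)
    have iI: "i \<noteq> j" if "i \<in> I" for i using that insert.hyps by auto
    have H1: "(\<Prod>i\<in>insert j I. epow (H i y) (W i)) =
        epow (f (x(j:=y))) (1 - m * p) * (\<Prod>i\<in>I. epow (\<integral>\<^sup>+s. f (x(j:=y, i:=s)) \<partial>?L) p)" for y
      unfolding prodH using iI by (auto simp: H_def intro!: arg_cong2[where f="(*)"] prod.cong)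
    have H2: "(\<Prod>i\<in>insert j I. epow (\<integral>\<^sup>+y. H i y \<partial>?L) (W i)) =
        epow (F x) (1 - m * p) * (\<Prod>i\<in>I. epow (\<integral>\<^sup>+s. F (x(i:=s)) \<partial>?L) p)"
      unfolding prodH using iI swap by (auto simp: H_def[abs_def] F_def intro!: arg_cong2[where f="(*)"] prod.cong)
    have pm: "(\<lambda>y. \<Prod>i\<in>insert j I. epow (H i y) (W i)) \<in> borel_measurable ?L"
      using Hm by (intro borel_measurable_prod_ennreal) auto
    \<comment> \<open>The line integral in direction j overwrites the coordinate y and is the
      constant \<open>F x\<close>, so its power p comes out of the integral.\<close>
    have "(\<integral>\<^sup>+y. epow (f (x(j:=y))) (1 - m * p) *
      (\<Prod>i\<in>insert j I. epow (\<integral>\<^sup>+s. f (x(j:=y, i:=s)) \<partial>?L) p) \<partial>?L)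
      = (\<integral>\<^sup>+y. epow (F x) p * (\<Prod>i\<in>insert j I. epow (H i y) (W i)) \<partial>?L)"
      using insert.hyps by (intro nn_integral_cong) (simp add: H1 F_def mult_ac)
    also have "\<dots> = epow (F x) p * (\<integral>\<^sup>+y. (\<Prod>i\<in>insert j I. epow (H i y) (W i)) \<partial>?L)"
      using pm by (rule nn_integral_cmult)
    also have "\<dots> \<le> epow (F x) p * (epow (F x) (1 - m * p) * (\<Prod>i\<in>I. epow (\<integral>\<^sup>+s. F (x(i:=s)) \<partial>?L) p))"
      using H unfolding H2 by (rule mult_left_mono) simp
    also have "\<dots> = epow (F x) (p + (1 - m * p)) * (\<Prod>i\<in>I. epow (\<integral>\<^sup>+s. F (x(i:=s)) \<partial>?L) p)"
      using mp by (simp add: epow_add mult_ac)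
    also have "p + (1 - m * p) = 1 - (m - 1) * p" by (simp add: algebra_simps)
    finally show ?thesis .
  qed
  have big [measurable]: "(\<lambda>x. epow (f x) (1 - m * p) *
      (\<Prod>i\<in>insert j I. epow (\<integral>\<^sup>+s. f (x(i:=s)) \<partial>?L) p)) \<in> borel_measurable ?Q"
  proof -
    have "(\<lambda>x. \<integral>\<^sup>+s. f (x(i:=s)) \<partial>?L) \<in> borel_measurable ?Q" if i: "i \<in> insert j I" for i
    proof -
      have "(\<lambda>z. (fst z)(i := snd z)) \<in> ?Q \<Otimes>\<^sub>M ?L \<rightarrow>\<^sub>M ?Q"
        by (rule measurable_fun_upd[of _ "insert j I"]) (use i in auto)
      then have "(\<lambda>(x, s). f (x(i:=s))) \<in> borel_measurable (?Q \<Otimes>\<^sub>M ?L)"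
        using measurable_compose[OF _ insert.prems(3)] by (simp add: split_beta')
      then show ?thesis by measurable
    qed
    then show ?thesis by (intro borel_measurable_times_ennreal borel_measurable_prod_ennreal measurable_epow insert.prems(3)) auto
  qed
  have "(\<integral>\<^sup>+x. epow (f x) (1 - m * p) * (\<Prod>i\<in>insert j I. epow (\<integral>\<^sup>+s. f (x(i:=s)) \<partial>?L) p) \<partial>?Q)
     = (\<integral>\<^sup>+x. (\<integral>\<^sup>+y. epow (f (x(j:=y))) (1 - m * p) *
      (\<Prod>i\<in>insert j I. epow (\<integral>\<^sup>+s. f (x(j:=y, i:=s)) \<partial>?L) p) \<partial>?L) \<partial>?P)"
    by (rule product_nn_integral_insert[OF insert.hyps big])
  also have "\<dots> \<le> (\<integral>\<^sup>+x. epow (F x) (1 - (m - 1) * p) * (\<Prod>i\<in>I. epow (\<integral>\<^sup>+s. F (x(i:=s)) \<partial>?L) p) \<partial>?P)"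
    by (rule nn_integral_mono) (rule inner)
  also have "\<dots> \<le> epow (\<integral>\<^sup>+x. F x \<partial>?P) (1 + p)"
  proof -
    have "(m - 1) * p \<le> 1" using mp by (simp add: algebra_simps)
    then show ?thesis using insert.IH[OF mp(2) _ F_meas] unfolding m_def by blast
  qed
  also have "(\<integral>\<^sup>+x. F x \<partial>?P) = (\<integral>\<^sup>+x. f x \<partial>?Q)"
    unfolding F_def by (rule product_nn_integral_insert[OF insert.hyps insert.prems(3), symmetric])
  finally show ?case unfolding m .
qed

text \<open>The power h^(N/(N-1)) is a product of N equal factors, and the i-th is bounded by a
  power of the line integral of g in direction i; the grid inequality with p = 1/(N-1) integrates
  that product.\<close>

proposition Gagliardo_Nirenberg:
  fixes h g :: "'a::euclidean_space \<Rightarrow> real"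
  assumes dim: "DIM('a) \<ge> 2"
    and [measurable]: "g \<in> borel_measurable borel" "h \<in> borel_measurable borel"
    and h0: "\<And>x. 0 \<le> h x"
    and line: "\<And>x i. i \<in> Basis \<Longrightarrow> ennreal (h x) \<le> (\<integral>\<^sup>+s. ennreal (g (x + (s - x \<bullet> i) *\<^sub>R i)) \<partial>lborel)"
  shows "(\<integral>\<^sup>+x. ennreal (h x powr (real DIM('a) / (real DIM('a) - 1))) \<partial>lborel)
     \<le> epow (\<integral>\<^sup>+x. ennreal (g x) \<partial>lborel) (real DIM('a) / (real DIM('a) - 1))"
proof -
  interpret product_sigma_finite "\<lambda>_::'a. lborel :: real measure" ..
  define N where "N = real DIM('a)"
  have N: "N \<ge> 2" using dim by (simp add: N_def)
  let ?P = "PiM (Basis :: 'a set) (\<lambda>_. lborel :: real measure)"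
  define T where "T f = (\<Sum>b\<in>Basis. f b *\<^sub>R b)" for f :: "'a \<Rightarrow> real"
  have T [measurable]: "T \<in> ?P \<rightarrow>\<^sub>M borel" unfolding T_def by measurable
  have Ti: "T f \<bullet> i = f i" if "i \<in> Basis" for f i
    using that by (simp add: T_def)
  have Tupd: "T (f(i:=s)) = T f + (s - T f \<bullet> i) *\<^sub>R i" if i: "i \<in> Basis" for f i s
    by (rule euclidean_eqI) (auto simp: Ti i inner_add_left inner_Basis inner_diff_left)
  have int: "(\<integral>\<^sup>+x. F x \<partial>lborel) = (\<integral>\<^sup>+f. F (T f) \<partial>?P)" if [measurable]: "F \<in> borel_measurable borel" for F :: "'a \<Rightarrow> ennreal"
    by (subst lborel_eq, subst nn_integral_distr) (auto simp: T_def[abs_def])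
  let ?p = "1 / (N - 1)"
  have "(\<integral>\<^sup>+x. ennreal (h x powr (N / (N - 1))) \<partial>lborel) = (\<integral>\<^sup>+f. ennreal (h (T f) powr (N / (N - 1))) \<partial>?P)"
    by (rule int) measurable
  also have "\<dots> \<le> (\<integral>\<^sup>+f. epow (ennreal (g (T f))) (1 - (real (card (Basis::'a set)) - 1) * ?p) *
      (\<Prod>i\<in>Basis. epow (\<integral>\<^sup>+s. ennreal (g (T (f(i:=s)))) \<partial>lborel) ?p) \<partial>?P)"
  proof (rule nn_integral_mono)
    fix f
    have "ennreal (h (T f) powr (N / (N - 1))) = (\<Prod>i\<in>(Basis::'a set). epow (ennreal (h (T f))) ?p)"
    proof -
      have "ennreal (h (T f) powr (N / (N - 1))) = ennreal ((h (T f) powr ?p) ^ DIM('a))"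
        using N dim by (cases "h (T f) = 0") (auto simp: powr_power N_def power_0_left)
      also have "\<dots> = (\<Prod>i\<in>(Basis::'a set). epow (ennreal (h (T f))) ?p)"
        using N h0 by (simp add: epow_ennreal ennreal_power)
      finally show ?thesis .
    qed
    also have "\<dots> \<le> (\<Prod>i\<in>Basis. epow (\<integral>\<^sup>+s. ennreal (g (T (f(i:=s)))) \<partial>lborel) ?p)"
      by (rule prod_mono_ennreal) (use line N in \<open>auto simp: Tupd intro!: epow_mono\<close>)
    finally show "ennreal (h (T f) powr (N / (N - 1))) \<le> epow (ennreal (g (T f))) (1 - (real (card (Basis::'a set)) - 1) * ?p) *
      (\<Prod>i\<in>Basis. epow (\<integral>\<^sup>+s. ennreal (g (T (f(i:=s)))) \<partial>lborel) ?p)"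
      using N by (simp add: N_def)
  qed
  also have "\<dots> \<le> epow (\<integral>\<^sup>+f. ennreal (g (T f)) \<partial>?P) (1 + ?p)"
    by (rule grid_lines_inequality) (use N in \<open>auto simp: N_def\<close>)
  also have "(\<integral>\<^sup>+f. ennreal (g (T f)) \<partial>?P) = (\<integral>\<^sup>+x. ennreal (g x) \<partial>lborel)"
    by (rule int[symmetric]) measurable
  also have "1 + ?p = N / (N - 1)" using N by (simp add: field_simps)
  finally show ?thesis by (simp add: N_def)
qed

subsection \<open>The truncation\<close>

text \<open>For \<open>d \<noteq> 0\<close> this is a smooth, positive and bounded replacement of \<open>|s|\<close>, so that it can be raised to a
  variable power; \<open>k \<rightarrow> \<infinity>\<close> and \<open>d \<rightarrow> 0\<close> recover \<open>|s|\<close>.\<close>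

definition trunc :: "real \<Rightarrow> real \<Rightarrow> real \<Rightarrow> real" where
  "trunc k d s = k * sqrt (s\<^sup>2 + d\<^sup>2) / (k + sqrt (s\<^sup>2 + d\<^sup>2))"

definition trunc_deriv :: "real \<Rightarrow> real \<Rightarrow> real \<Rightarrow> real" where
  "trunc_deriv k d s = k\<^sup>2 / (k + sqrt (s\<^sup>2 + d\<^sup>2))\<^sup>2 * (s / sqrt (s\<^sup>2 + d\<^sup>2))"

lemma trunc_nonneg: "0 < k \<Longrightarrow> 0 \<le> trunc k d s"
  by (simp add: trunc_def)

lemma trunc_pos: "0 < k \<Longrightarrow> d \<noteq> 0 \<Longrightarrow> 0 < trunc k d s"
  by (simp add: trunc_def sum_power2_gt_zero_iff add_pos_pos)

lemma trunc_le: "0 < k \<Longrightarrow> trunc k d s \<le> k"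
proof -
  assume k: "0 < k"
  have r: "0 \<le> sqrt (s\<^sup>2 + d\<^sup>2)" by simp
  have "k * sqrt (s\<^sup>2 + d\<^sup>2) \<le> k * (k + sqrt (s\<^sup>2 + d\<^sup>2))" using k by simp
  then show ?thesis unfolding trunc_def using k r by (simp add: pos_divide_le_eq add_pos_nonneg)
qed

lemma trunc_0_le: "0 < k \<Longrightarrow> trunc k 0 s \<le> \<bar>s\<bar>"
  by (simp add: trunc_def pos_divide_le_eq add_pos_nonneg algebra_simps)

lemma trunc_0: "trunc k 0 s = k * \<bar>s\<bar> / (k + \<bar>s\<bar>)"
  by (simp add: trunc_def)

lemma continuous_trunc: "0 < k \<Longrightarrow> continuous_on UNIV (\<lambda>z. trunc k (fst z) (snd z))"
  unfolding trunc_def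
  by (intro continuous_intros ballI) (metis add_pos_nonneg less_irrefl real_sqrt_ge_zero sum_power2_ge_zero)

lemma trunc_tendsto:
  assumes "0 < k" "(d \<longlongrightarrow> d') F" "(s \<longlongrightarrow> s') F"
  shows "((\<lambda>n. trunc k (d n) (s n)) \<longlongrightarrow> trunc k d' s') F"
  using continuous_on_tendsto_compose[OF continuous_trunc[OF assms(1)] tendsto_Pair[OF assms(2,3)]] by simp

lemma trunc_has_derivative:
  assumes "0 < k" "d \<noteq> 0"
  shows "(trunc k d has_real_derivative trunc_deriv k d s) (at s)"
proof -
  have pos: "0 < s\<^sup>2 + d\<^sup>2" using assms by (simp add: sum_power2_gt_zero_iff)
  define r where "r = sqrt (s\<^sup>2 + d\<^sup>2)"
  have r: "0 < r" using pos by (simp add: r_def)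
  have D: "((\<lambda>s. sqrt (s\<^sup>2 + d\<^sup>2)) has_real_derivative s / r) (at s)"
    using pos by (auto intro!: derivative_eq_intros simp: r_def field_simps)
  have "((\<lambda>s. k * sqrt (s\<^sup>2 + d\<^sup>2) / (k + sqrt (s\<^sup>2 + d\<^sup>2))) has_real_derivative
      ((k * (s / r)) * (k + r) - (k * r) * (0 + s / r)) / ((k + r) * (k + r))) (at s)"
    unfolding r_def[symmetric]
    by (rule DERIV_divide[OF DERIV_cmult[OF D] DERIV_add[OF DERIV_const D], folded r_def]) (use assms r in auto)
  moreover have "((k * (s / r)) * (k + r) - (k * r) * (0 + s / r)) / ((k + r) * (k + r)) = trunc_deriv k d s"
  proof -
    have "(k * (s / r)) * (k + r) - (k * r) * (0 + s / r) = k * k * (s / r)"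
      using r by (simp add: field_simps)
    then show ?thesis unfolding trunc_deriv_def r_def[symmetric] by (simp only: power2_eq_square times_divide_eq_left)
  qed
  ultimately show ?thesis unfolding trunc_def[abs_def] by simp
qed

text \<open>Truncating does not increase the gradient, uniformly in k and d, so the bounds survive
  both limits.\<close>

lemma trunc_deriv_le: "0 < k \<Longrightarrow> \<bar>trunc_deriv k d s\<bar> \<le> 1"
proof -
  assume k: "0 < k"
  have "k\<^sup>2 \<le> (k + sqrt (s\<^sup>2 + d\<^sup>2))\<^sup>2" using k by (intro power_mono) auto
  then have 1: "\<bar>k\<^sup>2 / (k + sqrt (s\<^sup>2 + d\<^sup>2))\<^sup>2\<bar> \<le> 1"
    using k by (simp add: divide_le_eq_1)
  have "\<bar>s\<bar> \<le> sqrt (s\<^sup>2 + d\<^sup>2)" by (rule real_le_rsqrt) simp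
  then have 2: "\<bar>s / sqrt (s\<^sup>2 + d\<^sup>2)\<bar> \<le> 1"
    by (simp add: divide_le_eq_1 order_less_le)
  show ?thesis unfolding trunc_deriv_def abs_mult using mult_mono[OF 1 2] by simp
qed

lemma continuous_trunc_deriv: "0 < k \<Longrightarrow> d \<noteq> 0 \<Longrightarrow> continuous_on UNIV (trunc_deriv k d)"
  unfolding trunc_deriv_def
  by (intro continuous_intros ballI)
     (metis add_pos_nonneg less_irrefl real_sqrt_ge_zero sum_power2_ge_zero zero_less_power,
      metis real_sqrt_eq_zero_cancel_iff sum_power2_eq_zero_iff)

subsection \<open>One-dimensional estimates\<close>

lemma FTC_nn_integral_bound:
  fixes f f' G :: "real \<Rightarrow> real"
  assumes f: "\<And>s. (f has_real_derivative f' s) (at s)" and c: "continuous_on UNIV f'"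
    and z: "\<And>s. s \<le> M \<Longrightarrow> f s = 0" and le: "\<And>s. \<bar>f' s\<bar> \<le> G s"
  shows "ennreal (f t) \<le> (\<integral>\<^sup>+s. ennreal (G s) \<partial>lborel)"
proof -
  \<comment> \<open>The minimum keeps a \<le> t also when t is below M, and f vanishes at a in
    either case.\<close>
  define a where "a = min M t"
  have cont: "isCont f' x" for x using c by (simp add: continuous_on_eq_continuous_at)
  have at: "a \<le> t" by (simp add: a_def)
  have int: "integrable lborel (\<lambda>x. f' x * indicator {a..t} x)"
    using borel_integrable_atLeastAtMost'[OF continuous_on_subset[OF c subset_UNIV], of a t]
    by (simp add: set_integrable_def mult.commute)
  have eq: "(LINT x|lborel. f' x * indicator {a..t} x) = f t - f a"
    by (rule integral_FTC_Icc_real[OF at f cont])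
  have "ennreal (f t) \<le> ennreal (norm (LINT x|lborel. f' x * indicator {a..t} x))"
    unfolding eq using z[of a] by (intro ennreal_leI) (simp add: a_def)
  also have "\<dots> \<le> (\<integral>\<^sup>+x. ennreal (norm (f' x * indicator {a..t} x)) \<partial>lborel)"
    by (rule integral_norm_bound_ennreal[OF int])
  also have "\<dots> \<le> (\<integral>\<^sup>+s. ennreal (G s) \<partial>lborel)"
  proof (intro nn_integral_mono ennreal_leI)
    fix s show "norm (f' s * indicator {a..t} s) \<le> G s"
      using le[of s] abs_ge_zero[of "f' s"] by (auto simp: indicator_def simp del: abs_ge_zero)
  qed
  finally show ?thesis .
qed

lemma has_derivative_exp_ln:
  fixes a b c :: "real \<Rightarrow> real"
  assumes "(a has_real_derivative a') (at s)" "(b has_real_derivative b') (at s)"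
    "(c has_real_derivative c') (at s)" "0 < c s"
  shows "((\<lambda>s. a s * exp (b s * ln (c s))) has_real_derivative
    a' * exp (b s * ln (c s)) + a s * (exp (b s * ln (c s)) * (b' * ln (c s) + b s * (c' / c s)))) (at s)"
  using assms by (auto intro!: derivative_eq_intros simp: field_simps)

text \<open>A logarithm is absorbed by a power k, upwards for t \<ge> 1 and downwards for t < 1.
  This pays for differentiating a variable exponent.\<close>

lemma powr_abs_ln_le:
  fixes t :: real
  assumes k: "0 < k" and t: "0 < t" and g: "a + k \<le> g" "g + k \<le> b"
  shows "t powr g * \<bar>ln t\<bar> \<le> (1 / k) * (t powr a + t powr b)"
proof (cases "1 \<le> t")
  case True
  have "k * ln t \<le> t powr k" using ln_bound[of "t powr k"] t by (simp add: ln_powr)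
  then have "\<bar>ln t\<bar> \<le> (1/k) * t powr k" using True k by (simp add: field_simps)
  then have "t powr g * \<bar>ln t\<bar> \<le> t powr g * ((1/k) * t powr k)" by (intro mult_left_mono) auto
  also have "\<dots> = (1/k) * t powr (g + k)" by (simp add: powr_add)
  also have "\<dots> \<le> (1/k) * (t powr a + t powr b)"
    using k True g by (intro mult_left_mono) (auto intro: add_increasing powr_mono)
  finally show ?thesis .
next
  case False
  have "k * ln (1/t) \<le> (1/t) powr k" using ln_bound[of "(1/t) powr k"] t by (simp add: ln_powr)
  then have "\<bar>ln t\<bar> \<le> (1/k) * t powr (- k)"
    using False k t by (simp add: field_simps ln_div powr_minus powr_divide)
  then have "t powr g * \<bar>ln t\<bar> \<le> t powr g * ((1/k) * t powr (- k))" by (intro mult_left_mono) auto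
  also have "\<dots> = (1/k) * t powr (g - k)" by (simp add: powr_diff powr_minus field_simps)
  also have "\<dots> \<le> (1/k) * (t powr a + t powr b)"
    using k False g t by (intro mult_left_mono) (auto intro!: add_increasing2 powr_mono')
  finally show ?thesis .
qed

subsection \<open>The modular Sobolev inequality\<close>

text \<open>\<open>P\<close> is the critical exponent and \<open>\<gamma>\<close> the exponent for which Gagliardo-Nirenberg applied to
  \<open>|u|\<close> to the power \<open>\<gamma>\<close> yields the modular for \<open>P\<close>; \<open>young_p\<close> and \<open>young_q\<close> say that the conjugate powers of
  \<open>|u|\<^bsup>\<gamma> - 1\<^esup>\<close> lie between those for \<open>\<alpha>\<close> and \<open>P\<close>.\<close>

locale exponents =
  fixes p q \<alpha> \<gamma> P :: "'a::euclidean_space \<Rightarrow> real" and L \<kappa> Pm :: real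
  assumes dim: "DIM('a) \<ge> 2" and \<kappa>: "0 < \<kappa>" and L: "0 \<le> L"
    and \<gamma>_lip: "\<And>x y. \<bar>\<gamma> x - \<gamma> y\<bar> \<le> L * norm (x - y)"
    and cont: "continuous_on UNIV p" "continuous_on UNIV q" "continuous_on UNIV \<alpha>"
    and \<alpha>1: "\<And>x. 1 + \<kappa> \<le> \<alpha> x" and \<alpha>\<gamma>: "\<And>x. \<alpha> x + \<kappa> \<le> \<gamma> x" and \<gamma>P: "\<And>x. \<gamma> x + \<kappa> \<le> P x"
    and PPm: "\<And>x. P x \<le> Pm" and P\<gamma>: "\<And>x. P x = \<gamma> x * (real DIM('a) / (real DIM('a) - 1))"
    and p1: "\<And>x. 1 < p x" and q1: "\<And>x. 1 < q x"
    and young_p: "\<And>x. (\<gamma> x - 1) * (p x / (p x - 1)) = P x"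
    and young_q: "\<And>x. \<alpha> x \<le> (\<gamma> x - 1) * (q x / (q x - 1))" "\<And>x. (\<gamma> x - 1) * (q x / (q x - 1)) \<le> P x"
begin

lemma \<gamma>_cont: "continuous_on UNIV \<gamma>"
proof (rule lipschitz_on_continuous_on)
  show "L-lipschitz_on UNIV \<gamma>"
    by (rule lipschitz_onI) (use \<gamma>_lip L in \<open>auto simp: dist_norm\<close>)
qed

lemma P_cont: "continuous_on UNIV P"
  unfolding P\<gamma>[abs_def] by (intro continuous_intros \<gamma>_cont)

lemma exps_measurable [measurable]:
  "p \<in> borel_measurable borel" "q \<in> borel_measurable borel" "\<alpha> \<in> borel_measurable borel"
  "\<gamma> \<in> borel_measurable borel" "P \<in> borel_measurable borel"
  using cont \<gamma>_cont P_cont by (auto intro: borel_measurable_continuous_onI)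

text \<open>Gagliardo-Nirenberg for the product of \<eta> and T^\<Gamma>, which the cutoff makes
  vanish at the far end of every line. Its derivative has three terms, according to whether the
  cutoff, the exponent or the base is differentiated; they are the three terms of the integrand on
  the right.\<close>

lemma regularized_Sobolev:
  assumes k: "0 < k" and d: "d \<noteq> 0"
    and \<Gamma>: "continuous_on UNIV \<Gamma>" "\<And>i. i \<in> Basis \<Longrightarrow> line_deriv \<Gamma> (D\<Gamma> i) i"
      "\<And>i. i \<in> Basis \<Longrightarrow> continuous_on UNIV (D\<Gamma> i)" "\<And>i x. i \<in> Basis \<Longrightarrow> \<bar>D\<Gamma> i x\<bar> \<le> L"
      "\<And>x. \<alpha> x + \<kappa> / 2 \<le> \<Gamma> x" "\<And>x. \<Gamma> x + \<kappa> / 2 \<le> P x"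
    and U: "continuous_on UNIV U" "\<And>i. i \<in> Basis \<Longrightarrow> line_deriv U (W i) i"
      "\<And>i. i \<in> Basis \<Longrightarrow> continuous_on UNIV (W i)"
    and \<eta>: "test_function \<eta>" "\<And>x. 0 \<le> \<eta> x"
  defines "T \<equiv> \<lambda>x. trunc k d (U x)"
  shows "(\<integral>\<^sup>+x. ennreal ((\<eta> x * T x powr \<Gamma> x) powr (real DIM('a) / (real DIM('a) - 1))) \<partial>lborel)
    \<le> epow (\<integral>\<^sup>+x. ennreal ((\<Sum>i\<in>Basis. \<bar>frechet_derivative \<eta> (at x) i\<bar>) * T x powr \<Gamma> x +
          \<eta> x * (L * (2 / \<kappa>) * (T x powr \<alpha> x + T x powr P x) + Pm * T x powr (\<Gamma> x - 1) * (\<Sum>i\<in>Basis. \<bar>W i x\<bar>))) \<partial>lborel)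
        (real DIM('a) / (real DIM('a) - 1))"
proof (rule Gagliardo_Nirenberg[OF dim])
  let ?D = "\<lambda>i x. frechet_derivative \<eta> (at x) i"
  let ?g = "\<lambda>x. (\<Sum>i\<in>Basis. \<bar>?D i x\<bar>) * T x powr \<Gamma> x +
          \<eta> x * (L * (2 / \<kappa>) * (T x powr \<alpha> x + T x powr P x) + Pm * T x powr (\<Gamma> x - 1) * (\<Sum>i\<in>Basis. \<bar>W i x\<bar>))"
  have Tpos: "0 < T x" for x unfolding T_def by (rule trunc_pos[OF k d])
  have Tc: "continuous_on UNIV T"
  proof -
    have "continuous_on UNIV (trunc k d)"
      by (intro continuous_at_imp_continuous_on ballI DERIV_isCont[OF trunc_has_derivative[OF k d]])
    then show ?thesis unfolding T_def by (rule continuous_on_compose2) (use U in auto)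
  qed
  have \<eta>c: "continuous_on UNIV \<eta>" and Dc: "\<And>i. i \<in> Basis \<Longrightarrow> continuous_on UNIV (?D i)"
    using compact_kernel_test[OF \<eta>(1)] compact_kernel_partial[OF \<eta>(1)] by (auto simp: compact_kernel_def)
  have ne: "T x \<noteq> 0" for x using Tpos[of x] by simp
  note cs = continuous_on_powr[OF Tc]
  have hc: "continuous_on UNIV (\<lambda>x. \<eta> x * T x powr \<Gamma> x)"
    by (intro continuous_on_mult \<eta>c cs \<Gamma>(1)) (use ne in auto)
  have gc: "continuous_on UNIV ?g"
    by (intro continuous_on_add continuous_on_mult continuous_on_sum continuous_on_rabs Dc cs \<Gamma>(1)
        \<eta>c continuous_on_const cont P_cont U continuous_on_diff) (use ne in auto)
  show "(\<lambda>x. \<eta> x * T x powr \<Gamma> x) \<in> borel_measurable borel" using hc by (rule borel_measurable_continuous_onI)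
  show "?g \<in> borel_measurable borel" using gc by (rule borel_measurable_continuous_onI)
  show "0 \<le> \<eta> x * T x powr \<Gamma> x" for x using \<eta>(2) by simp
  fix x i :: 'a assume i: "i \<in> Basis"
  define y where "y = x - (x \<bullet> i) *\<^sub>R i"
  have yi: "y + s *\<^sub>R i = x + (s - x \<bullet> i) *\<^sub>R i" for s by (simp add: y_def algebra_simps)
  let ?z = "\<lambda>s. y + s *\<^sub>R i"
  define E where "E x = exp (\<Gamma> x * ln (T x))" for x
  have ET: "T x powr \<Gamma> x = E x" for x using ne[of x] by (simp add: powr_def E_def)
  have ldT: "((\<lambda>s. T (?z s)) has_real_derivative trunc_deriv k d (U (?z s)) * W i (?z s)) (at s)" for s
    unfolding T_def
    by (rule DERIV_chain2[OF trunc_has_derivative[OF k d]]) (use U(2)[OF i] in \<open>simp add: line_deriv_def\<close>)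
  have ld\<eta>: "((\<lambda>s. \<eta> (?z s)) has_real_derivative ?D i (?z s)) (at s)" for s
    using line_deriv_Ck[of 0 \<eta> i] \<eta>(1) unfolding test_function_iff line_deriv_def by blast
  have ld\<Gamma>: "((\<lambda>s. \<Gamma> (?z s)) has_real_derivative D\<Gamma> i (?z s)) (at s)" for s
    using \<Gamma>(2)[OF i] by (simp add: line_deriv_def)
  define H where "H x = ?D i x * E x + \<eta> x * (E x * (D\<Gamma> i x * ln (T x) + \<Gamma> x * (trunc_deriv k d (U x) * W i x / T x)))" for x
  have hd: "((\<lambda>s. \<eta> (?z s) * T (?z s) powr \<Gamma> (?z s)) has_real_derivative H (?z s)) (at s)" for s
    unfolding ET unfolding E_def H_def
    by (rule has_derivative_exp_ln[OF ld\<eta> ld\<Gamma> ldT Tpos])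
  have Ec: "continuous_on UNIV E" unfolding E_def by (intro continuous_intros \<Gamma>(1) Tc) (use ne in auto)
  have "continuous_on UNIV (\<lambda>x. trunc_deriv k d (U x))"
    by (rule continuous_on_compose2[OF continuous_trunc_deriv[OF k d] U(1)]) auto
  then have Hc: "continuous_on UNIV H" unfolding H_def
    by (intro continuous_on_add continuous_on_mult continuous_on_divide continuous_on_ln \<eta>c Dc[OF i] Ec Tc \<Gamma>(1) \<Gamma>(3)[OF i] U(3)[OF i])
       (use ne Tpos in auto)
  have Hle: "\<bar>H x\<bar> \<le> ?g x" for x
  proof -
    have E0: "0 < E x" by (simp add: E_def)
    have 1: "\<bar>?D i x * E x\<bar> \<le> (\<Sum>i\<in>Basis. \<bar>?D i x\<bar>) * E x"
      using E0 i by (auto simp: abs_mult intro!: mult_right_mono member_le_sum)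
    \<comment> \<open>The exponent \<Gamma> keeps distance \<kappa> / 2 from \<alpha> and P; this is
      the power spent on the logarithm and the origin of the factor 2 / \<kappa>.\<close>
    have 2: "\<bar>E x * (D\<Gamma> i x * ln (T x))\<bar> \<le> L * (2 / \<kappa>) * (T x powr \<alpha> x + T x powr P x)"
    proof -
      have "\<bar>E x * (D\<Gamma> i x * ln (T x))\<bar> = \<bar>D\<Gamma> i x\<bar> * (T x powr \<Gamma> x * \<bar>ln (T x)\<bar>)"
        unfolding ET using E0 by (simp add: abs_mult)
      also have "\<dots> \<le> L * ((1 / (\<kappa> / 2)) * (T x powr \<alpha> x + T x powr P x))"
        by (intro mult_mono \<Gamma>(4)[OF i] powr_abs_ln_le) (use \<kappa> L Tpos \<Gamma>(5,6) in auto)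
      finally show ?thesis by (simp only: divide_divide_eq_right mult.assoc mult_1_left)
    qed
    have G0: "0 \<le> \<Gamma> x" "\<Gamma> x \<le> Pm" using \<Gamma>(5,6)[of x] \<alpha>1[of x] PPm[of x] \<kappa> by linarith+
    have 3: "\<bar>E x * (\<Gamma> x * (trunc_deriv k d (U x) * W i x / T x))\<bar> \<le> Pm * T x powr (\<Gamma> x - 1) * (\<Sum>i\<in>Basis. \<bar>W i x\<bar>)"
    proof -
      have "\<bar>E x * (\<Gamma> x * (trunc_deriv k d (U x) * W i x / T x))\<bar> =
         (\<Gamma> x * (E x / T x)) * (\<bar>trunc_deriv k d (U x)\<bar> * \<bar>W i x\<bar>)"
        using E0 G0(1) Tpos[of x] by (simp add: abs_mult)
      also have "E x / T x = T x powr (\<Gamma> x - 1)"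
        using Tpos[of x] by (simp add: powr_diff ET)
      also have "(\<Gamma> x * T x powr (\<Gamma> x - 1)) * (\<bar>trunc_deriv k d (U x)\<bar> * \<bar>W i x\<bar>) \<le>
        (Pm * T x powr (\<Gamma> x - 1)) * (1 * (\<Sum>i\<in>Basis. \<bar>W i x\<bar>))"
        using G0 i by (intro mult_mono trunc_deriv_le[OF k]) (auto intro!: member_le_sum mult_nonneg_nonneg sum_nonneg)
      finally show ?thesis by simp
    qed
    have "\<bar>H x\<bar> \<le> \<bar>?D i x * E x\<bar> + \<eta> x * \<bar>E x * (D\<Gamma> i x * ln (T x)) + E x * (\<Gamma> x * (trunc_deriv k d (U x) * W i x / T x))\<bar>"
    proof -
      have eq: "H x = ?D i x * E x + \<eta> x * (E x * (D\<Gamma> i x * ln (T x)) + E x * (\<Gamma> x * (trunc_deriv k d (U x) * W i x / T x)))"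
        unfolding H_def distrib_left ..
      have tri: "\<bar>X + \<eta> x * Z\<bar> \<le> \<bar>X\<bar> + \<eta> x * \<bar>Z\<bar>" for X Z
        using abs_triangle_ineq[of X "\<eta> x * Z"] \<eta>(2)[of x] by (simp add: abs_mult)
      show ?thesis unfolding eq by (rule tri)
    qed
    also have "\<dots> \<le> \<bar>?D i x * E x\<bar> + \<eta> x * (\<bar>E x * (D\<Gamma> i x * ln (T x))\<bar> + \<bar>E x * (\<Gamma> x * (trunc_deriv k d (U x) * W i x / T x))\<bar>)"
      using \<eta>(2)[of x] by (intro add_left_mono mult_left_mono abs_triangle_ineq)
    also have "\<dots> \<le> ?g x"
      unfolding ET by (rule add_mono[OF 1 mult_left_mono[OF add_mono[OF 2 3] \<eta>(2)]])
    finally show ?thesis .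
  qed
  obtain R where R: "R > 0" "\<And>x. R \<le> norm x \<Longrightarrow> \<eta> x = 0" using \<eta>(1) by (auto simp: test_function_iff)
  have "ennreal (\<eta> (?z (x \<bullet> i)) * T (?z (x \<bullet> i)) powr \<Gamma> (?z (x \<bullet> i))) \<le> (\<integral>\<^sup>+s. ennreal (?g (?z s)) \<partial>lborel)"
  proof (rule FTC_nn_integral_bound[OF hd])
    show "continuous_on UNIV (\<lambda>s. H (?z s))"
      by (rule continuous_on_compose2[OF Hc]) (auto intro!: continuous_intros)
    show "\<eta> (?z s) * T (?z s) powr \<Gamma> (?z s) = 0" if "s \<le> - R" for s
    proof -
      have "?z s \<bullet> i = s" using i by (simp add: y_def inner_add_left inner_diff_left inner_Basis)
      then have "R \<le> \<bar>?z s \<bullet> i\<bar>" using that by linarith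
      then have "R \<le> norm (?z s)" using Basis_le_norm[OF i, of "?z s"] by linarith
      then show ?thesis by (simp add: R)
    qed
    show "\<bar>H (?z s)\<bar> \<le> ?g (?z s)" for s by (rule Hle)
  qed
  then show "ennreal (\<eta> x * T x powr \<Gamma> x) \<le> (\<integral>\<^sup>+s. ennreal (?g (x + (s - x \<bullet> i) *\<^sub>R i)) \<partial>lborel)"
    unfolding yi by simp
qed

end

section \<open>Mollified data and the passage to the limit\<close>

lemma tendsto_epow:
  assumes c: "(c \<longlongrightarrow> a) F" and a: "a < top" and r: "0 < r"
  shows "((\<lambda>n. epow (c n) r) \<longlongrightarrow> epow a r) F"
proof -
  obtain a' where a': "a = ennreal a'" "0 \<le> a'" using a by (cases a) auto
  have "\<forall>\<^sub>F n in F. c n < top" using order_tendstoD(2)[OF c a] .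
  then have ev: "\<forall>\<^sub>F n in F. ennreal (enn2real (c n) powr r) = epow (c n) r"
    by eventually_elim (use r in \<open>auto simp: epow_def less_top\<close>)
  have "((\<lambda>n. enn2real (c n)) \<longlongrightarrow> a') F"
    using tendsto_enn2real[OF c[unfolded a'(1)]] a'(2) by simp
  then have "((\<lambda>n. enn2real (c n) powr r) \<longlongrightarrow> a' powr r) F"
    by (rule tendsto_powr'[OF _ tendsto_const]) (use r in auto)
  then have "((\<lambda>n. ennreal (enn2real (c n) powr r)) \<longlongrightarrow> ennreal (a' powr r)) F" by (rule tendsto_ennrealI)
  also have "ennreal (a' powr r) = epow a r" using a' r by (simp add: epow_ennreal)
  finally have "((\<lambda>n. ennreal (enn2real (c n) powr r)) \<longlongrightarrow> epow a r) F" .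
  then show ?thesis using ev by (rule Lim_transform_eventually)
qed

lemma locint_continuous:
  fixes f :: "'a::euclidean_space \<Rightarrow> real"
  assumes f: "continuous_on UNIV f"
  shows "locint f"
  unfolding locint_def
proof (intro conjI allI)
  show "f \<in> borel_measurable borel" using f by (rule borel_measurable_continuous_onI)
  fix R
  have "integrable lborel (\<lambda>x. indicator (cball 0 R) x *\<^sub>R f x)"
    by (rule borel_integrable_compact) (use f in \<open>auto intro: continuous_on_subset\<close>)
  then show "integrable lborel (\<lambda>x. indicator (cball 0 R) x * f x)" by simp
qed

lemma kernel_average_diff:
  assumes k: "compact_kernel k" "\<And>y. 0 \<le> k y" "(LINT y|lborel. k y) = 1"
    and f: "locint f" "locint h" and B: "\<And>y. k y \<noteq> 0 \<Longrightarrow> \<bar>f y - h y\<bar> \<le> B"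
  shows "\<bar>(LINT y|lborel. k y * f y) - (LINT y|lborel. k y * h y)\<bar> \<le> B"
proof -
  have i: "integrable lborel (\<lambda>y. k y * f y)" "integrable lborel (\<lambda>y. k y * h y)"
    using k(1) f by (auto intro: integrable_kernel_mult)
  have d: "integrable lborel (\<lambda>y. k y * (f y - h y))"
    using Bochner_Integration.integrable_diff[OF i] by (simp add: right_diff_distrib)
  have ki: "integrable lborel k" by (rule integrable_compact_kernel[OF k(1)])
  have "(LINT y|lborel. k y * f y) - (LINT y|lborel. k y * h y) = (LINT y|lborel. k y * (f y - h y))"
    by (subst Bochner_Integration.integral_diff[symmetric, OF i]) (simp add: right_diff_distrib)
  also have "\<bar>\<dots>\<bar> \<le> (LINT y|lborel. \<bar>k y * (f y - h y)\<bar>)" by (rule integral_abs_bound)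
  also have "\<dots> \<le> (LINT y|lborel. B * k y)"
  proof (rule integral_mono)
    show "integrable lborel (\<lambda>y. \<bar>k y * (f y - h y)\<bar>)" using d by (rule integrable_abs)
    show "integrable lborel (\<lambda>y. B * k y)" using ki by simp
    fix y show "\<bar>k y * (f y - h y)\<bar> \<le> B * k y"
      using k(2)[of y] B[of y] by (cases "k y = 0") (auto simp: abs_mult mult.commute intro!: mult_right_mono)
  qed
  also have "\<dots> = B" using k(3) by simp
  finally show ?thesis .
qed

lemma line_deriv_le_Lipschitz:
  assumes ld: "line_deriv F G i" and i: "norm i = 1" and L: "\<And>x y. \<bar>F x - F y\<bar> \<le> L * norm (x - y)"
  shows "\<bar>G x\<bar> \<le> L"
proof -
  have "((\<lambda>h. (F (x + h *\<^sub>R i) - F x) / h) \<longlongrightarrow> G x) (at 0)"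
    using ld[unfolded line_deriv_def DERIV_def, rule_format, of x 0] by simp
  then have "((\<lambda>h. \<bar>(F (x + h *\<^sub>R i) - F x) / h\<bar>) \<longlongrightarrow> \<bar>G x\<bar>) (at 0)" by (rule tendsto_rabs)
  then show ?thesis
  proof (rule tendsto_upperbound)
    show "\<forall>\<^sub>F h in at 0. \<bar>(F (x + h *\<^sub>R i) - F x) / h\<bar> \<le> L"
      unfolding eventually_at_filter
    proof (rule always_eventually, intro allI impI)
      fix h :: real assume "h \<noteq> 0"
      then show "\<bar>(F (x + h *\<^sub>R i) - F x) / h\<bar> \<le> L"
        using L[of "x + h *\<^sub>R i" x] i by (simp add: pos_divide_le_eq)
    qed
  qed simp
qed

text \<open>An average of translates has the same Lipschitz constant, which therefore bounds the
  partial derivatives; and it differs from \<gamma> by at most L times the radius of the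
  kernel.\<close>

lemma mollified_Lipschitz:
  fixes \<gamma> :: "'a::euclidean_space \<Rightarrow> real"
  assumes lip: "\<And>x y. \<bar>\<gamma> x - \<gamma> y\<bar> \<le> L * norm (x - y)" and L: "0 \<le> L" and c: "0 < c"
    and \<gamma>: "continuous_on UNIV \<gamma>"
  defines "\<Gamma> \<equiv> conv (mollifier c) \<gamma>"
    and "D \<equiv> \<lambda>i. conv (\<lambda>x. frechet_derivative (mollifier c) (at x) i) \<gamma>"
  shows "continuous_on UNIV \<Gamma>" "i \<in> Basis \<Longrightarrow> line_deriv \<Gamma> (D i) i" "i \<in> Basis \<Longrightarrow> continuous_on UNIV (D i)"
    "i \<in> Basis \<Longrightarrow> \<bar>D i x\<bar> \<le> L" "\<bar>\<Gamma> x - \<gamma> x\<bar> \<le> L * (2 * real DIM('a) / c)"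
proof -
  let ?k = "mollifier c :: 'a \<Rightarrow> real"
  have t: "test_function ?k" using c by (rule test_function_mollifier)
  have k: "compact_kernel ?k" by (rule compact_kernel_test[OF t])
  have km: "?k \<in> borel_measurable borel" using test_function_borel(1)[OF t] .
  have \<gamma>l: "locint \<gamma>" by (rule locint_continuous[OF \<gamma>])
  have \<gamma>m: "\<gamma> \<in> borel_measurable borel" by (rule locint_measurable[OF \<gamma>l])
  show "continuous_on UNIV \<Gamma>" unfolding \<Gamma>_def by (rule continuous_conv[OF k \<gamma>l])
  show ld: "line_deriv \<Gamma> (D i) i" if "i \<in> Basis" for i
    unfolding \<Gamma>_def D_def by (rule line_deriv_conv[OF t that \<gamma>l])
  show "i \<in> Basis \<Longrightarrow> continuous_on UNIV (D i)"
    unfolding D_def by (intro continuous_conv compact_kernel_partial t \<gamma>l)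
  have sh: "locint (\<lambda>y. \<gamma> (z - y))" for z
    by (intro locint_continuous continuous_on_compose2[OF \<gamma>]) (auto intro!: continuous_intros)
  have \<Gamma>eq: "\<Gamma> z = (LINT y|lborel. ?k y * \<gamma> (z - y))" for z
    unfolding \<Gamma>_def by (rule conv_eq[OF km \<gamma>m])
  have Lip: "\<bar>\<Gamma> y - \<Gamma> z\<bar> \<le> L * norm (y - z)" for y z
    unfolding \<Gamma>eq
  proof (rule kernel_average_diff[OF k mollifier_props(1)[OF c] mollifier_props(2)[OF c] sh sh])
    fix v show "\<bar>\<gamma> (y - v) - \<gamma> (z - v)\<bar> \<le> L * norm (y - z)" using lip[of "y - v" "z - v"] by simp
  qed
  show "\<bar>D i x\<bar> \<le> L" if i: "i \<in> Basis"
    by (rule line_deriv_le_Lipschitz[OF ld[OF i] _ Lip]) (use i in simp)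
  have "(LINT y|lborel. ?k y * \<gamma> x) = \<gamma> x" using mollifier_props(2)[OF c, where 'a='a] by simp
  then have "\<bar>\<Gamma> x - \<gamma> x\<bar> = \<bar>(LINT y|lborel. ?k y * \<gamma> (x - y)) - (LINT y|lborel. ?k y * \<gamma> x)\<bar>"
    by (simp only: \<Gamma>eq)
  also have "\<dots> \<le> L * (2 * real DIM('a) / c)"
  proof (rule kernel_average_diff[OF k mollifier_props(1)[OF c] mollifier_props(2)[OF c] sh])
    show "locint (\<lambda>y::'a. \<gamma> x)" by (intro locint_continuous continuous_intros)
    fix y :: 'a assume "?k y \<noteq> 0"
    then have "norm y \<le> 2 * real DIM('a) / c" using mollifier_props(3)[OF c, of y] by linarith
    from mult_left_mono[OF this L] show "\<bar>\<gamma> (x - y) - \<gamma> x\<bar> \<le> L * (2 * real DIM('a) / c)"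
      using lip[of "x - y" x] by simp
  qed
  finally show "\<bar>\<Gamma> x - \<gamma> x\<bar> \<le> L * (2 * real DIM('a) / c)" .
qed

context exponents
begin

text \<open>One scale per n is taken beyond all thresholds for u, its partials and \<gamma>; then a
  subsequence turns L1 convergence of u on the ball into convergence almost everywhere, as the
  nonlinear terms require.\<close>

lemma mollified_sequence:
  fixes u :: "'a \<Rightarrow> real"
  assumes wp: "weak_partials u g"
  obtains U W \<Gamma> D where
    "\<And>n. continuous_on UNIV (U n)" "\<And>n i. i \<in> Basis \<Longrightarrow> continuous_on UNIV (W n i)"
    "\<And>n i. i \<in> Basis \<Longrightarrow> line_deriv (U n) (W n i) i"
    "\<And>n. continuous_on UNIV (\<Gamma> n)" "\<And>n i. i \<in> Basis \<Longrightarrow> continuous_on UNIV (D n i)"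
    "\<And>n i. i \<in> Basis \<Longrightarrow> line_deriv (\<Gamma> n) (D n i) i" "\<And>n i x. i \<in> Basis \<Longrightarrow> \<bar>D n i x\<bar> \<le> L"
    "\<And>n x. \<alpha> x + \<kappa> / 2 \<le> \<Gamma> n x" "\<And>n x. \<Gamma> n x + \<kappa> / 2 \<le> P x" "\<And>x. (\<lambda>n. \<Gamma> n x) \<longlonglongrightarrow> \<gamma> x"
    "AE x in lborel. norm x \<le> R \<longrightarrow> (\<lambda>n. U n x) \<longlonglongrightarrow> u x"
    "\<And>i. i \<in> Basis \<Longrightarrow> (\<lambda>n. \<integral>\<^sup>+x. indicator (cball 0 R) x * ennreal \<bar>W n i x - g i x\<bar> \<partial>lborel) \<longlonglongrightarrow> 0"
proof -
  note lu = weak_partialsD(1)[OF wp] and lg = weak_partialsD(2)[OF wp]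
  have um [measurable]: "u \<in> borel_measurable borel" by (rule locint_measurable[OF lu])
  have [measurable]: "cball (0::'a) R \<in> sets borel" by simp
  have ex: "\<exists>c0>0. \<forall>c\<ge>c0. (\<integral>\<^sup>+x. indicator (cball 0 R) x * ennreal \<bar>conv (mollifier c) f x - f x\<bar> \<partial>lborel) \<le> ennreal (1 / (real n + 1))"
    if "locint f" for f :: "'a \<Rightarrow> real" and n
  proof -
    have "0 < 1 / (real n + 1)" by (simp add: add_nonneg_pos)
    from that this show ?thesis
    proof (rule mollifier_L1_local[where R=R])
      fix c0 :: real assume "c0 > 0" "\<And>c. c0 \<le> c \<Longrightarrow>
        (\<integral>\<^sup>+x. indicator (cball 0 R) x * ennreal \<bar>conv (mollifier c) f x - f x\<bar> \<partial>lborel) \<le> ennreal (1 / (real n + 1))"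
      then show ?thesis by blast
    qed
  qed
  define Q where "Q n c \<longleftrightarrow> 0 < c \<and> L * (2 * real DIM('a) / c) \<le> min (\<kappa> / 2) (1 / (real n + 1)) \<and>
     (\<integral>\<^sup>+x. indicator (cball 0 R) x * ennreal \<bar>conv (mollifier c) u x - u x\<bar> \<partial>lborel) \<le> ennreal (1 / (real n + 1)) \<and>
     (\<forall>i\<in>Basis. (\<integral>\<^sup>+x. indicator (cball 0 R) x * ennreal \<bar>conv (mollifier c) (g i) x - g i x\<bar> \<partial>lborel) \<le> ennreal (1 / (real n + 1)))" for n :: nat and c
  have "\<exists>c. Q n c" for n
  proof -
    obtain c1 where c1: "c1 > 0" "\<And>c. c \<ge> c1 \<Longrightarrow> (\<integral>\<^sup>+x. indicator (cball 0 R) x * ennreal \<bar>conv (mollifier c) u x - u x\<bar> \<partial>lborel) \<le> ennreal (1 / (real n + 1))"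
      using ex[OF lu] by blast
    have "\<forall>i\<in>Basis. \<exists>c0. \<forall>c\<ge>c0. (\<integral>\<^sup>+x. indicator (cball 0 R) x * ennreal \<bar>conv (mollifier c) (g i) x - g i x\<bar> \<partial>lborel) \<le> ennreal (1 / (real n + 1))"
      using ex[OF lg] by blast
    then obtain c2 where c2: "\<And>i c. i \<in> Basis \<Longrightarrow> c \<ge> c2 i \<Longrightarrow> (\<integral>\<^sup>+x. indicator (cball 0 R) x * ennreal \<bar>conv (mollifier c) (g i) x - g i x\<bar> \<partial>lborel) \<le> ennreal (1 / (real n + 1))"
      by metis
    define m where "m = min (\<kappa> / 2) (1 / (real n + 1))"
    have m: "m > 0" using \<kappa> by (simp add: m_def)
    define c where "c = max c1 (Max (insert 0 (c2 ` Basis))) + 2 * real DIM('a) * L / m"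
    have "0 \<le> 2 * real DIM('a) * L / m" using L m by simp
    then have cc: "c \<ge> c1" "\<And>i. i \<in> Basis \<Longrightarrow> c \<ge> c2 i"
      unfolding c_def by (auto intro!: add_increasing2 max.coboundedI2)
    have cp: "c > 0" using cc(1) c1(1) by linarith
    have "2 * real DIM('a) * L / m \<le> c" using c1(1) unfolding c_def by linarith
    then have "2 * real DIM('a) * L \<le> c * m" by (simp only: pos_divide_le_eq[OF m])
    then have "L * (2 * real DIM('a) / c) \<le> m" using cp by (simp add: pos_divide_le_eq mult_ac)
    then have "Q n c" unfolding Q_def m_def[symmetric]
      by (intro conjI ballI cp c1(2)[OF cc(1)] c2[OF _ cc(2)])
    then show ?thesis ..
  qed
  then obtain c where Qc: "\<And>n. Q n (c n)" by metis
  have c: "\<And>n. 0 < c n" "\<And>n::nat. L * (2 * real DIM('a) / c n) \<le> min (\<kappa> / 2) (1 / (real n + 1))"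
     "\<And>n. (\<integral>\<^sup>+x. indicator (cball 0 R) x * ennreal \<bar>conv (mollifier (c n)) u x - u x\<bar> \<partial>lborel) \<le> ennreal (1 / (real n + 1))"
     "\<And>n i. i \<in> Basis \<Longrightarrow> (\<integral>\<^sup>+x. indicator (cball 0 R) x * ennreal \<bar>conv (mollifier (c n)) (g i) x - g i x\<bar> \<partial>lborel) \<le> ennreal (1 / (real n + 1))"
    using Qc unfolding Q_def by blast+
  have t: "test_function (mollifier (c n) :: 'a \<Rightarrow> real)" for n by (rule test_function_mollifier[OF c(1)])
  note k = compact_kernel_test[OF t]
  define U where "U n = conv (mollifier (c n)) u" for n
  define F where "F n x = indicator (cball 0 R) x * (U n x - u x)" for n x
  have Uc: "continuous_on UNIV (U n)" for n unfolding U_def by (rule continuous_conv[OF k lu])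
  have [measurable]: "U n \<in> borel_measurable borel" for n using Uc by (rule borel_measurable_continuous_onI)
  have Fn: "(\<integral>\<^sup>+x. ennreal (norm (F n x)) \<partial>lborel) \<le> ennreal (1 / (real n + 1))" for n
  proof -
    have "ennreal (norm (F n x)) = indicator (cball 0 R) x * ennreal \<bar>conv (mollifier (c n)) u x - u x\<bar>" for x
      by (auto simp: F_def U_def indicator_def)
    then show ?thesis using c(3)[of n] by simp
  qed
  have Fi: "integrable lborel (F n)" for n
  proof (rule integrableI_bounded)
    show "F n \<in> borel_measurable lborel" unfolding F_def by measurable
    show "(\<integral>\<^sup>+x. ennreal (norm (F n x)) \<partial>lborel) < \<infinity>" using Fn[of n] by (rule le_less_trans) simp
  qed
  have F0: "(\<lambda>n. LINT x|lborel. norm (F n x)) \<longlonglongrightarrow> 0"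
  proof (rule tendsto_sandwich[where f="\<lambda>_. 0" and h="\<lambda>n. 1 / (real n + 1)"])
    show "\<forall>\<^sub>F n in sequentially. (LINT x|lborel. norm (F n x)) \<le> 1 / (real n + 1)"
    proof (rule always_eventually, rule allI)
      fix n
      have "ennreal (LINT x|lborel. norm (F n x)) = (\<integral>\<^sup>+x. ennreal (norm (F n x)) \<partial>lborel)"
        by (rule nn_integral_eq_integral[symmetric]) (use Fi in auto)
      with Fn[of n] have "ennreal (LINT x|lborel. norm (F n x)) \<le> ennreal (1 / (real n + 1))" by (simp only:)
      then show "(LINT x|lborel. norm (F n x)) \<le> 1 / (real n + 1)" by (subst (asm) ennreal_le_iff) auto
    qed
    show "(\<lambda>n. 1 / (real n + 1)) \<longlonglongrightarrow> 0" using LIMSEQ_inverse_real_of_nat by (simp add: inverse_eq_divide add.commute)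
  qed auto
  obtain r where r: "strict_mono (r :: nat \<Rightarrow> nat)" "AE x in lborel. (\<lambda>n. F (r n) x) \<longlonglongrightarrow> 0"
    using tendsto_L1_AE_subseq[OF Fi F0] by blast
  \<comment> \<open>Passing to the subsequence keeps the rates because r n \<ge> n.\<close>
  have rn: "1 / (real (r n) + 1) \<le> 1 / (real n + 1)" for n
    using seq_suble[OF r(1), of n] by (simp add: frac_le)
  have lim0: "(\<lambda>n. ennreal (1 / (real n + 1))) \<longlonglongrightarrow> 0"
    using tendsto_ennrealI[of "\<lambda>n. 1 / (real n + 1)" 0] LIMSEQ_inverse_real_of_nat by (simp add: inverse_eq_divide add.commute)
  note ml = mollified_Lipschitz[OF \<gamma>_lip L c(1) \<gamma>_cont]
  have \<Gamma>\<gamma>: "\<bar>conv (mollifier (c n)) \<gamma> x - \<gamma> x\<bar> \<le> min (\<kappa> / 2) (1 / (real n + 1))" for n x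
    using ml(5)[of n x] c(2)[of n] by linarith
  show ?thesis
  proof (rule that[of "\<lambda>n. U (r n)" "\<lambda>n i. conv (mollifier (c (r n))) (g i)" "\<lambda>n. conv (mollifier (c (r n))) \<gamma>"
        "\<lambda>n i. conv (\<lambda>x. frechet_derivative (mollifier (c (r n))) (at x) i) \<gamma>"])
    show "continuous_on UNIV (U (r n))" for n by (rule Uc)
    show "continuous_on UNIV (conv (mollifier (c (r n))) (g i))" if "i \<in> Basis" for n i
      by (rule continuous_conv[OF k lg[OF that]])
    show "line_deriv (U (r n)) (conv (mollifier (c (r n))) (g i)) i" if i: "i \<in> Basis" for n i
      using line_deriv_conv[OF t[of "r n"] i lu] unfolding conv_weak_partial[OF wp i t] U_def .
    show "\<alpha> x + \<kappa> / 2 \<le> conv (mollifier (c (r n))) \<gamma> x" for n x using \<Gamma>\<gamma>[of "r n" x] \<alpha>\<gamma>[of x] by linarith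
    show "conv (mollifier (c (r n))) \<gamma> x + \<kappa> / 2 \<le> P x" for n x using \<Gamma>\<gamma>[of "r n" x] \<gamma>P[of x] by linarith
    show "(\<lambda>n. conv (mollifier (c (r n))) \<gamma> x) \<longlonglongrightarrow> \<gamma> x" for x
    proof (rule LIM_zero_cancel, rule Lim_null_comparison)
      show "\<forall>\<^sub>F n in sequentially. norm (conv (mollifier (c (r n))) \<gamma> x - \<gamma> x) \<le> 1 / (real n + 1)"
        using \<Gamma>\<gamma>[of "r _" x] rn by (intro always_eventually allI) (metis min.boundedE order_trans real_norm_def)
      show "(\<lambda>n. 1 / (real n + 1)) \<longlonglongrightarrow> 0" using LIMSEQ_inverse_real_of_nat by (simp add: inverse_eq_divide add.commute)
    qed
    show "AE x in lborel. norm x \<le> R \<longrightarrow> (\<lambda>n. U (r n) x) \<longlonglongrightarrow> u x"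
      using r(2) by eventually_elim (auto simp: F_def LIM_zero_iff)
    show "(\<lambda>n. \<integral>\<^sup>+x. indicator (cball 0 R) x * ennreal \<bar>conv (mollifier (c (r n))) (g i) x - g i x\<bar> \<partial>lborel) \<longlonglongrightarrow> 0"
      if i: "i \<in> Basis" for i
    proof (rule tendsto_sandwich[OF _ _ tendsto_const lim0])
      show "\<forall>\<^sub>F n in sequentially. (\<integral>\<^sup>+x. indicator (cball 0 R) x * ennreal \<bar>conv (mollifier (c (r n))) (g i) x - g i x\<bar> \<partial>lborel) \<le> ennreal (1 / (real n + 1))"
        by (intro always_eventually allI order_trans[OF c(4)[OF i]] ennreal_leI rn)
    qed auto
    show "continuous_on UNIV (conv (mollifier (c (r n))) \<gamma>)" for n by (rule ml(1))
    show "continuous_on UNIV (conv (\<lambda>x. frechet_derivative (mollifier (c (r n))) (at x) i) \<gamma>)" if "i \<in> Basis" for n i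
      by (rule ml(3)[OF that])
    show "line_deriv (conv (mollifier (c (r n))) \<gamma>) (conv (\<lambda>x. frechet_derivative (mollifier (c (r n))) (at x) i) \<gamma>) i" if "i \<in> Basis" for n i
      by (rule ml(2)[OF that])
    show "\<bar>conv (\<lambda>x. frechet_derivative (mollifier (c (r n))) (at x) i) \<gamma> x\<bar> \<le> L" if "i \<in> Basis" for n i x
      by (rule ml(4)[OF that])
  qed
qed

lemma powr_exp_bound:
  assumes "0 < k" "0 \<le> t" "t \<le> k" "0 \<le> e" "e \<le> Pm"
  shows "t powr e \<le> max 1 k powr Pm"
proof -
  have "t powr e \<le> max 1 k powr e" using assms by (intro powr_mono2) auto
  also have "\<dots> \<le> max 1 k powr Pm" using assms by (intro powr_mono) auto
  finally show ?thesis .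
qed

text \<open>With k fixed all powers of the truncation are bounded by one constant K and everything
  lives on one ball, so the right side converges by dominated convergence; the left side is handled
  by Fatou's lemma.\<close>

lemma Sobolev_trunc_cutoff:
  fixes u :: "'a \<Rightarrow> real"
  assumes k: "0 < k" and wp: "weak_partials u g"
    and \<eta>: "test_function \<eta>" "\<And>x. 0 \<le> \<eta> x" "\<And>x. \<eta> x \<le> 1"
  defines "T \<equiv> \<lambda>x. trunc k 0 (u x)" and "\<rho> \<equiv> real DIM('a) / (real DIM('a) - 1)"
  shows "(\<integral>\<^sup>+x. ennreal ((\<eta> x * T x powr \<gamma> x) powr \<rho>) \<partial>lborel)
    \<le> epow (\<integral>\<^sup>+x. ennreal ((\<Sum>i\<in>Basis. \<bar>frechet_derivative \<eta> (at x) i\<bar>) * T x powr \<gamma> x +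
          \<eta> x * (L * (2 / \<kappa>) * (T x powr \<alpha> x + T x powr P x) + Pm * T x powr (\<gamma> x - 1) * (\<Sum>i\<in>Basis. \<bar>g i x\<bar>))) \<partial>lborel) \<rho>"
proof -
  define S where "S x = (\<Sum>i\<in>Basis. \<bar>frechet_derivative \<eta> (at x) i\<bar>)" for x
  define B where "B = L * (2 / \<kappa>)"
  have B: "0 \<le> B" using L \<kappa> by (simp add: B_def)
  have \<rho>: "1 < \<rho>" using dim by (simp add: \<rho>_def)
  have Pm0: "0 \<le> Pm" using \<alpha>1[of 0] \<alpha>\<gamma>[of 0] \<gamma>P[of 0] PPm[of 0] \<kappa> by linarith
  note lu = weak_partialsD(1)[OF wp] and lg = weak_partialsD(2)[OF wp]
  have [measurable]: "u \<in> borel_measurable borel" by (rule locint_measurable[OF lu])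
  have gm [measurable]: "i \<in> Basis \<Longrightarrow> g i \<in> borel_measurable borel" for i by (rule locint_measurable[OF lg])
  have [measurable]: "\<eta> \<in> borel_measurable borel" by (rule test_function_borel(1)[OF \<eta>(1)])
  have Sm [measurable]: "S \<in> borel_measurable borel"
    unfolding S_def by (intro borel_measurable_sum borel_measurable_abs test_function_borel(2)[OF \<eta>(1)])
  have Tm: "(\<lambda>x. trunc k (d::real) (f x)) \<in> borel_measurable borel" if "f \<in> borel_measurable borel" for f :: "'a \<Rightarrow> real" and d
    unfolding trunc_def using that by measurable
  have [measurable]: "T \<in> borel_measurable borel" unfolding T_def by (rule Tm) measurable
  obtain R0 where R0: "R0 > 0" "\<And>x. R0 \<le> norm x \<Longrightarrow> \<eta> x = 0" using \<eta>(1) by (auto simp: test_function_iff)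
  define R where "R = R0 + 1"
  have \<eta>R: "\<eta> x = 0" if "R < norm x" for x using R0 that by (simp add: R_def)
  have SR: "S x = 0" if "R < norm x" for x
    using frechet_derivative_support[of R0 \<eta> x] R0(2) that by (simp add: S_def R_def)
  have S0: "0 \<le> S x" for x by (simp add: S_def sum_nonneg)
  have "\<exists>C. \<forall>i\<in>Basis. \<forall>x. \<bar>frechet_derivative \<eta> (at x) i\<bar> \<le> C i"
  proof -
    have "\<forall>i\<in>(Basis::'a set). \<exists>C. \<forall>x. \<bar>frechet_derivative \<eta> (at x) i\<bar> \<le> C"
      using compact_kernelE[OF compact_kernel_partial[OF \<eta>(1)]] by metis
    then show ?thesis by (rule bchoice)
  qed
  then obtain CS where CS: "\<And>i x. i \<in> Basis \<Longrightarrow> \<bar>frechet_derivative \<eta> (at x) i\<bar> \<le> CS i" by blast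
  define SC where "SC = (\<Sum>i\<in>Basis. CS i)"
  have SC: "S x \<le> SC" for x unfolding S_def SC_def by (intro sum_mono CS)
  have SC0: "0 \<le> SC" using S0[of 0] SC[of 0] by linarith
  define K where "K = max 1 k powr Pm"
  have K: "0 \<le> K" by (simp add: K_def)
  show ?thesis
  proof (rule mollified_sequence[OF wp, of R])
  fix U :: "nat \<Rightarrow> 'a \<Rightarrow> real" and W \<Gamma> D assume ms:
    "\<And>n. continuous_on UNIV (U n)" "\<And>n i. i \<in> Basis \<Longrightarrow> continuous_on UNIV (W n i)"
    "\<And>n i. i \<in> Basis \<Longrightarrow> line_deriv (U n) (W n i) i"
    "\<And>n. continuous_on UNIV (\<Gamma> n)" "\<And>n i. i \<in> Basis \<Longrightarrow> continuous_on UNIV (D n i)"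
    "\<And>n i. i \<in> Basis \<Longrightarrow> line_deriv (\<Gamma> n) (D n i) i" "\<And>n i x. i \<in> Basis \<Longrightarrow> \<bar>D n i x\<bar> \<le> L"
    "\<And>n x. \<alpha> x + \<kappa> / 2 \<le> \<Gamma> n x" "\<And>n x. \<Gamma> n x + \<kappa> / 2 \<le> P x" "\<And>x. (\<lambda>n. \<Gamma> n x) \<longlonglongrightarrow> \<gamma> x"
    "AE x in lborel. norm x \<le> R \<longrightarrow> (\<lambda>n. U n x) \<longlonglongrightarrow> u x"
    "\<And>i. i \<in> Basis \<Longrightarrow> (\<lambda>n. \<integral>\<^sup>+x. indicator (cball 0 R) x * ennreal \<bar>W n i x - g i x\<bar> \<partial>lborel) \<longlonglongrightarrow> 0"
  have [measurable]: "U n \<in> borel_measurable borel" "\<Gamma> n \<in> borel_measurable borel" for n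
    using ms(1,4) by (auto intro: borel_measurable_continuous_onI)
  have Wm [measurable]: "i \<in> Basis \<Longrightarrow> W n i \<in> borel_measurable borel" for n i
    using ms(2) by (rule borel_measurable_continuous_onI)
  have [measurable]: "cball (0::'a) R \<in> sets borel" by simp
  define t where "t n x = trunc k (1 / (real n + 1)) (U n x)" for n x
  have tm [measurable]: "t n \<in> borel_measurable borel" for n unfolding t_def by (rule Tm) measurable
  have tk: "0 < t n x" "t n x \<le> k" for n x
    unfolding t_def using k by (auto intro!: trunc_pos trunc_le)
  have \<Gamma>b: "1 \<le> \<Gamma> n x" "\<Gamma> n x \<le> Pm" for n x
    using ms(8)[of x n] ms(9)[of n x] \<alpha>1[of x] PPm[of x] \<kappa> by linarith+
  have \<gamma>b: "1 < \<gamma> x" "\<gamma> x \<le> Pm" "0 < \<alpha> x" "\<alpha> x \<le> Pm" "0 < P x" for x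
    using \<alpha>1[of x] \<alpha>\<gamma>[of x] \<gamma>P[of x] PPm[of x] \<kappa> by linarith+
  have tlim: "AE x in lborel. norm x \<le> R \<longrightarrow> (\<lambda>n. t n x) \<longlonglongrightarrow> T x"
    using ms(11)
  proof eventually_elim
    case (elim x)
    show ?case
    proof
      assume "norm x \<le> R"
      moreover have "(\<lambda>n. 1 / (real n + 1)) \<longlonglongrightarrow> 0"
        using LIMSEQ_inverse_real_of_nat by (simp add: inverse_eq_divide add.commute)
      ultimately show "(\<lambda>n. t n x) \<longlonglongrightarrow> T x"
        unfolding t_def T_def using elim k by (intro trunc_tendsto) auto
    qed
  qed
  have powlim: "(\<lambda>n. t n x powr e n) \<longlonglongrightarrow> T x powr e0" if "(\<lambda>n. t n x) \<longlonglongrightarrow> T x" "e \<longlonglongrightarrow> e0" "0 < e0" for x e e0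
    by (rule tendsto_powr'[OF that(1,2)]) (use that(3) less_imp_le[OF tk(1)] in auto)
  \<comment> \<open>The integrand for step n with the limit partials \<open>g i\<close> in place of
    the mollified \<open>W n i\<close>. It has a majorant that does not depend on n; the error of
    the replacement is at most \<open>b n\<close>, which tends to 0.\<close>
  define a where "a n x = S x * t n x powr \<Gamma> n x +
          \<eta> x * (B * (t n x powr \<alpha> x + t n x powr P x) + Pm * t n x powr (\<Gamma> n x - 1) * (\<Sum>i\<in>Basis. \<bar>g i x\<bar>))" for n x
  define a0 where "a0 x = S x * T x powr \<gamma> x +
          \<eta> x * (B * (T x powr \<alpha> x + T x powr P x) + Pm * T x powr (\<gamma> x - 1) * (\<Sum>i\<in>Basis. \<bar>g i x\<bar>))" for x
  define w where "w x = indicator (cball 0 R) x * (SC * K + B * (K + K) + Pm * K * (\<Sum>i\<in>Basis. \<bar>g i x\<bar>))" for x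
  have sgm [measurable]: "(\<lambda>x. \<Sum>i\<in>Basis. \<bar>g i x\<bar>) \<in> borel_measurable borel"
    by (intro borel_measurable_sum borel_measurable_abs gm)
  have am [measurable]: "a n \<in> borel_measurable borel" for n unfolding a_def by measurable
  have a0m [measurable]: "a0 \<in> borel_measurable borel" unfolding a0_def by measurable
  have a_nonneg: "0 \<le> a n x" for n x
    unfolding a_def using S0 \<eta>(2) B Pm0 by (intro add_nonneg_nonneg mult_nonneg_nonneg sum_nonneg) auto
  have aw: "a n x \<le> w x" for n x
  proof (cases "norm x \<le> R")
    case True
    have 1: "S x * t n x powr \<Gamma> n x \<le> SC * K"
      unfolding K_def using SC S0 SC0 \<Gamma>b[of n x] tk[of n x] k by (intro mult_mono powr_exp_bound) auto
    have 2: "t n x powr e \<le> K" if "0 \<le> e" "e \<le> Pm" for e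
      unfolding K_def using that tk[of n x] k by (intro powr_exp_bound) auto
    have 3: "B * (t n x powr \<alpha> x + t n x powr P x) + Pm * t n x powr (\<Gamma> n x - 1) * (\<Sum>i\<in>Basis. \<bar>g i x\<bar>)
       \<le> B * (K + K) + Pm * K * (\<Sum>i\<in>Basis. \<bar>g i x\<bar>)"
      using B Pm0 \<gamma>b[of x] \<Gamma>b[of n x] PPm[of x]
      by (intro add_mono mult_left_mono mult_right_mono 2 sum_nonneg) auto
    have 4: "0 \<le> B * (t n x powr \<alpha> x + t n x powr P x) + Pm * t n x powr (\<Gamma> n x - 1) * (\<Sum>i\<in>Basis. \<bar>g i x\<bar>)"
      using B Pm0 by (intro add_nonneg_nonneg mult_nonneg_nonneg sum_nonneg) auto
    have "a n x \<le> SC * K + 1 * (B * (K + K) + Pm * K * (\<Sum>i\<in>Basis. \<bar>g i x\<bar>))"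
      unfolding a_def using \<eta>(2,3) 4 by (intro add_mono mult_mono 1 3) auto
    then show ?thesis using True by (simp add: w_def)
  next
    case False
    then show ?thesis using \<eta>R[of x] SR[of x] by (simp add: a_def w_def)
  qed
  have wfin: "(\<integral>\<^sup>+x. ennreal (w x) \<partial>lborel) < \<infinity>"
  proof -
    have i1: "integrable lborel (\<lambda>x::'a. indicator (cball 0 R) x * (SC * K + B * (K + K)))"
      using locint_continuous[OF continuous_on_const, of "SC * K + B * (K + K)"] unfolding locint_def by blast
    have i2: "integrable lborel (\<lambda>x. indicator (cball 0 R) x * g i x)" if "i \<in> Basis" for i
      using lg[OF that] unfolding locint_def by blast
    have i3: "integrable lborel (\<lambda>x. \<Sum>i\<in>Basis. \<bar>indicator (cball 0 R) x * g i x\<bar>)"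
      by (intro Bochner_Integration.integrable_sum integrable_abs i2)
    have i4: "integrable lborel (\<lambda>x. Pm * K * (\<Sum>i\<in>Basis. \<bar>indicator (cball 0 R) x * g i x\<bar>))"
      using i3 by (rule integrable_mult_right)
    have "integrable lborel (\<lambda>x. indicator (cball 0 R) x * (SC * K + B * (K + K)) + Pm * K * (\<Sum>i\<in>Basis. \<bar>indicator (cball 0 R) x * g i x\<bar>))"
      by (rule Bochner_Integration.integrable_add[OF i1 i4])
    also have "(\<lambda>x. indicator (cball 0 R) x * (SC * K + B * (K + K)) + Pm * K * (\<Sum>i\<in>Basis. \<bar>indicator (cball 0 R) x * g i x\<bar>)) = w"
      by (auto simp: w_def fun_eq_iff indicator_def)
    finally have "integrable lborel w" .
    then have "(\<integral>\<^sup>+x. ennreal (norm (w x)) \<partial>lborel) < \<infinity>" by (simp add: integrable_iff_bounded)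
    moreover have "norm (w x) = w x" for x using order_trans[OF a_nonneg aw, of x] by simp
    ultimately show ?thesis by simp
  qed
  have alim: "(\<lambda>n. \<integral>\<^sup>+x. ennreal (a n x) \<partial>lborel) \<longlonglongrightarrow> (\<integral>\<^sup>+x. ennreal (a0 x) \<partial>lborel)"
  proof (rule nn_integral_dominated_convergence[where w="\<lambda>x. ennreal (w x)"])
    show "AE x in lborel. (\<lambda>n. ennreal (a n x)) \<longlonglongrightarrow> ennreal (a0 x)"
      using tlim
    proof eventually_elim
      case (elim x)
      show ?case
      proof (cases "norm x \<le> R")
        case True
        with elim have t: "(\<lambda>n. t n x) \<longlonglongrightarrow> T x" by simp
        have g1: "(\<lambda>n. \<Gamma> n x - 1) \<longlonglongrightarrow> \<gamma> x - 1" by (intro tendsto_intros ms(10))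
        have "(\<lambda>n. a n x) \<longlonglongrightarrow> a0 x"
          unfolding a_def a0_def
          by (intro tendsto_add tendsto_mult tendsto_const powlim[OF t ms(10)] powlim[OF t tendsto_const] powlim[OF t g1])
             (use \<gamma>b[of x] in auto)
        then show ?thesis by (rule tendsto_ennrealI)
      next
        case False
        then show ?thesis using \<eta>R[of x] SR[of x] by (simp add: a_def a0_def)
      qed
    qed
    show "(\<lambda>x. ennreal (w x)) \<in> borel_measurable lborel" unfolding w_def by measurable
  qed (use wfin aw in \<open>auto intro: ennreal_leI\<close>)
  define b where "b n = (\<Sum>i\<in>Basis. ennreal (Pm * K) * (\<integral>\<^sup>+x. indicator (cball 0 R) x * ennreal \<bar>W n i x - g i x\<bar> \<partial>lborel))" for n
  have blim: "b \<longlonglongrightarrow> 0"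
  proof -
    have "b \<longlonglongrightarrow> (\<Sum>i\<in>(Basis::'a set). ennreal (Pm * K) * 0)"
      unfolding b_def by (intro tendsto_sum ennreal_tendsto_cmult ms(12)) auto
    then show ?thesis by simp
  qed
  define X where "X n = (\<integral>\<^sup>+x. ennreal ((\<eta> x * t n x powr \<Gamma> n x) powr \<rho>) \<partial>lborel)" for n
  have Xle: "X n \<le> epow ((\<integral>\<^sup>+x. ennreal (a n x) \<partial>lborel) + b n) \<rho>" for n
  proof -
    have nz: "1 / (real n + 1) \<noteq> 0" by simp
    have "X n \<le> epow (\<integral>\<^sup>+x. ennreal (S x * t n x powr \<Gamma> n x +
          \<eta> x * (B * (t n x powr \<alpha> x + t n x powr P x) + Pm * t n x powr (\<Gamma> n x - 1) * (\<Sum>i\<in>Basis. \<bar>W n i x\<bar>))) \<partial>lborel) \<rho>"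
      unfolding X_def t_def S_def B_def \<rho>_def
      by (rule regularized_Sobolev[OF k nz ms(4) ms(6) ms(5) ms(7) ms(8) ms(9) ms(1) ms(3) ms(2) \<eta>(1,2)])
    also have "\<dots> \<le> epow ((\<integral>\<^sup>+x. ennreal (a n x) \<partial>lborel) + b n) \<rho>"
    proof (rule epow_mono)
      have "(\<integral>\<^sup>+x. ennreal (S x * t n x powr \<Gamma> n x +
          \<eta> x * (B * (t n x powr \<alpha> x + t n x powr P x) + Pm * t n x powr (\<Gamma> n x - 1) * (\<Sum>i\<in>Basis. \<bar>W n i x\<bar>))) \<partial>lborel)
        \<le> (\<integral>\<^sup>+x. ennreal (a n x) + (\<Sum>i\<in>Basis. ennreal (Pm * K) * (indicator (cball 0 R) x * ennreal \<bar>W n i x - g i x\<bar>)) \<partial>lborel)"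
      proof (rule nn_integral_mono)
        fix x
        have e: "\<eta> x * (Pm * t n x powr (\<Gamma> n x - 1)) \<le> indicator (cball 0 R) x * (Pm * K)"
        proof (cases "norm x \<le> R")
          case True
          have "t n x powr (\<Gamma> n x - 1) \<le> K"
            unfolding K_def using \<Gamma>b[of n x] tk[of n x] k by (intro powr_exp_bound) auto
          then have "\<eta> x * (Pm * t n x powr (\<Gamma> n x - 1)) \<le> 1 * (Pm * K)"
            using \<eta>(2,3) Pm0 by (intro mult_mono mult_left_mono) auto
          then show ?thesis using True by simp
        qed (simp add: \<eta>R)
        have s: "(\<Sum>i\<in>Basis. \<bar>W n i x\<bar>) \<le> (\<Sum>i\<in>Basis. \<bar>g i x\<bar>) + (\<Sum>i\<in>Basis. \<bar>W n i x - g i x\<bar>)"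
          by (subst sum.distrib[symmetric], rule sum_mono) linarith
        have "S x * t n x powr \<Gamma> n x + \<eta> x * (B * (t n x powr \<alpha> x + t n x powr P x) + Pm * t n x powr (\<Gamma> n x - 1) * (\<Sum>i\<in>Basis. \<bar>W n i x\<bar>))
          = S x * t n x powr \<Gamma> n x + \<eta> x * (B * (t n x powr \<alpha> x + t n x powr P x)) + \<eta> x * (Pm * t n x powr (\<Gamma> n x - 1)) * (\<Sum>i\<in>Basis. \<bar>W n i x\<bar>)"
          by (simp add: algebra_simps)
        also have "\<dots> \<le> S x * t n x powr \<Gamma> n x + \<eta> x * (B * (t n x powr \<alpha> x + t n x powr P x)) + \<eta> x * (Pm * t n x powr (\<Gamma> n x - 1)) * ((\<Sum>i\<in>Basis. \<bar>g i x\<bar>) + (\<Sum>i\<in>Basis. \<bar>W n i x - g i x\<bar>))"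
          using s \<eta>(2) Pm0 by (intro add_left_mono mult_left_mono) auto
        also have "\<dots> = a n x + \<eta> x * (Pm * t n x powr (\<Gamma> n x - 1)) * (\<Sum>i\<in>Basis. \<bar>W n i x - g i x\<bar>)"
          by (simp add: a_def algebra_simps)
        also have "\<dots> \<le> a n x + indicator (cball 0 R) x * (Pm * K) * (\<Sum>i\<in>Basis. \<bar>W n i x - g i x\<bar>)"
          using e by (intro add_left_mono mult_right_mono sum_nonneg) auto
        finally have le: "S x * t n x powr \<Gamma> n x + \<eta> x * (B * (t n x powr \<alpha> x + t n x powr P x) + Pm * t n x powr (\<Gamma> n x - 1) * (\<Sum>i\<in>Basis. \<bar>W n i x\<bar>))
          \<le> a n x + (\<Sum>i\<in>Basis. (Pm * K) * (indicator (cball 0 R) x * \<bar>W n i x - g i x\<bar>))"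
          by (simp add: sum_distrib_left mult_ac)
        have "ennreal (a n x + (\<Sum>i\<in>Basis. (Pm * K) * (indicator (cball 0 R) x * \<bar>W n i x - g i x\<bar>)))
          = ennreal (a n x) + (\<Sum>i\<in>Basis. ennreal ((Pm * K) * (indicator (cball 0 R) x * \<bar>W n i x - g i x\<bar>)))"
          using a_nonneg Pm0 K by (subst ennreal_plus) (auto intro!: sum_nonneg simp: sum_ennreal)
        also have "\<dots> = ennreal (a n x) + (\<Sum>i\<in>Basis. ennreal (Pm * K) * (indicator (cball 0 R) x * ennreal \<bar>W n i x - g i x\<bar>))"
          using Pm0 K by (intro arg_cong2[where f="(+)"] sum.cong refl) (auto simp: ennreal_mult indicator_def)
        finally show "ennreal (S x * t n x powr \<Gamma> n x + \<eta> x * (B * (t n x powr \<alpha> x + t n x powr P x) + Pm * t n x powr (\<Gamma> n x - 1) * (\<Sum>i\<in>Basis. \<bar>W n i x\<bar>)))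
          \<le> ennreal (a n x) + (\<Sum>i\<in>Basis. ennreal (Pm * K) * (indicator (cball 0 R) x * ennreal \<bar>W n i x - g i x\<bar>))"
          using ennreal_leI[OF le] by simp
      qed
      also have "\<dots> = (\<integral>\<^sup>+x. ennreal (a n x) \<partial>lborel) + (\<Sum>i\<in>Basis. (\<integral>\<^sup>+x. ennreal (Pm * K) * (indicator (cball 0 R) x * ennreal \<bar>W n i x - g i x\<bar>) \<partial>lborel))"
      proof -
        have m: "(\<lambda>x. ennreal (Pm * K) * (indicator (cball 0 R) x * ennreal \<bar>W n i x - g i x\<bar>)) \<in> borel_measurable lborel" if "i \<in> Basis" for i
          using Wm[OF that, of n] gm[OF that] by measurable
        show ?thesis using m by (subst nn_integral_add) (auto simp: nn_integral_sum intro!: borel_measurable_sum)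
      qed
      also have "\<dots> = (\<integral>\<^sup>+x. ennreal (a n x) \<partial>lborel) + b n"
        unfolding b_def
      proof (intro arg_cong2[where f="(+)"] sum.cong refl nn_integral_cmult)
        fix i :: 'a assume "i \<in> Basis"
        from Wm[OF this, of n] gm[OF this]
        show "(\<lambda>x. indicator (cball 0 R) x * ennreal \<bar>W n i x - g i x\<bar>) \<in> borel_measurable lborel" by measurable
      qed
      finally show "(\<integral>\<^sup>+x. ennreal (S x * t n x powr \<Gamma> n x +
          \<eta> x * (B * (t n x powr \<alpha> x + t n x powr P x) + Pm * t n x powr (\<Gamma> n x - 1) * (\<Sum>i\<in>Basis. \<bar>W n i x\<bar>))) \<partial>lborel)
        \<le> (\<integral>\<^sup>+x. ennreal (a n x) \<partial>lborel) + b n" .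
    qed (use \<rho> in auto)
    finally show ?thesis .
  qed
  have a0fin: "(\<integral>\<^sup>+x. ennreal (a0 x) \<partial>lborel) < top"
  proof -
    have "(\<integral>\<^sup>+x. ennreal (a0 x) \<partial>lborel) \<le> (\<integral>\<^sup>+x. ennreal (w x) \<partial>lborel)"
      using alim by (rule LIMSEQ_le_const2) (use aw in \<open>auto intro!: nn_integral_mono ennreal_leI\<close>)
    then show ?thesis using wfin by (auto simp: le_less_trans)
  qed
  have elim: "(\<lambda>n. epow ((\<integral>\<^sup>+x. ennreal (a n x) \<partial>lborel) + b n) \<rho>) \<longlonglongrightarrow> epow (\<integral>\<^sup>+x. ennreal (a0 x) \<partial>lborel) \<rho>"
    by (rule tendsto_epow) (use tendsto_add[OF alim blim] a0fin \<rho> in auto)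
  have "(\<integral>\<^sup>+x. ennreal ((\<eta> x * T x powr \<gamma> x) powr \<rho>) \<partial>lborel) = (\<integral>\<^sup>+x. liminf (\<lambda>n. ennreal ((\<eta> x * t n x powr \<Gamma> n x) powr \<rho>)) \<partial>lborel)"
  proof (rule nn_integral_cong_AE)
    show "AE x in lborel. ennreal ((\<eta> x * T x powr \<gamma> x) powr \<rho>) = liminf (\<lambda>n. ennreal ((\<eta> x * t n x powr \<Gamma> n x) powr \<rho>))"
      using tlim
    proof eventually_elim
      case (elim x)
      have "(\<lambda>n. ennreal ((\<eta> x * t n x powr \<Gamma> n x) powr \<rho>)) \<longlonglongrightarrow> ennreal ((\<eta> x * T x powr \<gamma> x) powr \<rho>)"
      proof (cases "norm x \<le> R")
        case True
        with elim have t: "(\<lambda>n. t n x) \<longlonglongrightarrow> T x" by simp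
        have "(\<lambda>n. \<eta> x * t n x powr \<Gamma> n x) \<longlonglongrightarrow> \<eta> x * T x powr \<gamma> x"
          by (intro tendsto_mult tendsto_const powlim[OF t ms(10)]) (use \<gamma>b[of x] in auto)
        then show ?thesis
          by (intro tendsto_ennrealI tendsto_powr'[OF _ tendsto_const]) (use \<rho> \<eta>(2) in auto)
      qed (simp add: \<eta>R)
      from lim_imp_Liminf[OF sequentially_bot this] show ?case by (rule sym)
    qed
  qed
  also have "\<dots> \<le> liminf (\<lambda>n. X n)"
    unfolding X_def by (rule nn_integral_liminf) measurable
  also have "\<dots> \<le> liminf (\<lambda>n. epow ((\<integral>\<^sup>+x. ennreal (a n x) \<partial>lborel) + b n) \<rho>)"
    by (intro Liminf_mono always_eventually allI Xle)
  also have "\<dots> = epow (\<integral>\<^sup>+x. ennreal (a0 x) \<partial>lborel) \<rho>"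
    by (rule lim_imp_Liminf[OF _ elim]) simp
  finally show ?thesis unfolding a0_def S_def B_def .
  qed
qed

end

section \<open>Removal of the cutoff and Young's inequality\<close>

lemma powr_Young:
  fixes t v p e :: real
  assumes "0 \<le> t" "0 \<le> v" "1 < p"
  shows "t powr e * v \<le> t powr (e * (p / (p - 1))) + v powr p"
proof -
  have q: "p / (p - 1) > 1" "1 / p + 1 / (p / (p - 1)) = 1" using assms(3) by (auto simp: field_simps)
  have "v * t powr e \<le> v powr p / p + (t powr e) powr (p / (p - 1)) / (p / (p - 1))"
    by (rule Youngs_inequality[OF assms(3) q]) (use assms in auto)
  also have "\<dots> \<le> v powr p + (t powr e) powr (p / (p - 1))"
  proof -
    have le: "X / r \<le> X" if "0 \<le> X" "1 < r" for X r :: real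
      using that mult_left_mono[of 1 r X] by (simp add: pos_divide_le_eq)
    then show ?thesis using assms(3) q(1) by (intro add_mono le) auto
  qed
  finally show ?thesis by (simp add: powr_powr mult.commute add.commute)
qed

lemma powr_between:
  fixes t :: real
  assumes "0 \<le> t" "a \<le> e" "e \<le> b"
  shows "t powr e \<le> t powr a + t powr b"
proof (cases "1 \<le> t")
  case True
  then have "t powr e \<le> t powr b" using assms by (intro powr_mono) auto
  then show ?thesis by (simp add: add_increasing)
next
  case False
  then have "t powr e \<le> t powr a" using assms by (intro powr_mono') auto
  then show ?thesis by (simp add: add_increasing2)
qed

lemma weak_partials_scale: "weak_partials u g \<Longrightarrow> weak_partials (\<lambda>x. c * u x) (\<lambda>i x. c * g i x)"
  using weak_partials_cong_product[of u g "\<lambda>_. c"] by (simp add: Ck_const frechet_derivative_const)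

context exponents
begin

text \<open>Below 1 a larger exponent gives a smaller power, above 1 the truncation is bounded.
  Hence the modular for \<alpha> alone makes the truncated modulars for \<gamma> and P finite, with
  a constant depending on k.\<close>

lemma trunc_powr_le:
  assumes k: "0 < k" and e: "\<alpha> x \<le> e" "e \<le> Pm"
  shows "trunc k 0 s powr e \<le> max 1 k powr Pm * \<bar>s\<bar> powr \<alpha> x"
proof (cases "\<bar>s\<bar> \<le> 1")
  case True
  have \<alpha>: "0 < \<alpha> x" using \<alpha>1[of x] \<kappa> by linarith
  have "trunc k 0 s powr e \<le> \<bar>s\<bar> powr e"
    by (rule powr_mono2) (use k e \<alpha> in \<open>auto intro: trunc_nonneg trunc_0_le\<close>)
  also have "\<dots> \<le> 1 * \<bar>s\<bar> powr \<alpha> x" using True e by (simp add: powr_mono')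
  also have "\<dots> \<le> max 1 k powr Pm * \<bar>s\<bar> powr \<alpha> x"
    using e \<alpha> by (intro mult_right_mono ge_one_powr_ge_zero) auto
  finally show ?thesis .
next
  case False
  have \<alpha>: "0 < \<alpha> x" using \<alpha>1[of x] \<kappa> by linarith
  have "trunc k 0 s powr e \<le> max 1 k powr Pm"
    by (rule powr_exp_bound) (use k e \<alpha> in \<open>auto intro: trunc_nonneg trunc_le\<close>)
  also have "\<dots> \<le> max 1 k powr Pm * \<bar>s\<bar> powr \<alpha> x"
    using False \<alpha> ge_one_powr_ge_zero[of "\<bar>s\<bar>" "\<alpha> x"] by (simp add: mult_le_cancel_left1)
  finally show ?thesis .
qed

lemma exp_le_Pm: "0 < \<alpha> x" "\<alpha> x \<le> Pm" "\<alpha> x \<le> \<gamma> x" "\<gamma> x \<le> Pm" "\<alpha> x \<le> P x" "0 < P x" "1 < \<gamma> x"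
  using \<alpha>1[of x] \<alpha>\<gamma>[of x] \<gamma>P[of x] PPm[of x] \<kappa> by linarith+

lemma trunc_measurable [measurable]:
  assumes [measurable]: "u \<in> borel_measurable M"
  shows "(\<lambda>x. trunc k d (u x)) \<in> borel_measurable M"
  unfolding trunc_def by measurable

text \<open>Dilating the bump by 1 / (n + 1) makes the term with the gradient of the cutoff at most
  that factor times a fixed multiple of the integral of T^\<gamma>, which is finite thanks to the
  truncation; the term disappears in the limit.\<close>

lemma Sobolev_trunc:
  fixes u :: "'a \<Rightarrow> real"
  assumes k: "0 < k" and wp: "weak_partials u g"
    and fin: "(\<integral>\<^sup>+x. ennreal (\<bar>u x\<bar> powr \<alpha> x) \<partial>lborel) < \<infinity>"
  defines "T \<equiv> \<lambda>x. trunc k 0 (u x)" and "\<rho> \<equiv> real DIM('a) / (real DIM('a) - 1)"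
  shows "(\<integral>\<^sup>+x. ennreal (T x powr P x) \<partial>lborel)
    \<le> epow (\<integral>\<^sup>+x. ennreal (L * (2 / \<kappa>) * (T x powr \<alpha> x + T x powr P x) + Pm * T x powr (\<gamma> x - 1) * (\<Sum>i\<in>Basis. \<bar>g i x\<bar>)) \<partial>lborel) \<rho>"
proof -
  define A where "A x = L * (2 / \<kappa>) * (T x powr \<alpha> x + T x powr P x) + Pm * T x powr (\<gamma> x - 1) * (\<Sum>i\<in>Basis. \<bar>g i x\<bar>)" for x
  have \<rho>: "1 < \<rho>" using dim by (simp add: \<rho>_def)
  have [measurable]: "u \<in> borel_measurable borel" by (rule locint_measurable[OF weak_partialsD(1)[OF wp]])
  have gm: "i \<in> Basis \<Longrightarrow> g i \<in> borel_measurable borel" for i by (rule locint_measurable[OF weak_partialsD(2)[OF wp]])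
  have sgm [measurable]: "(\<lambda>x. \<Sum>i\<in>Basis. \<bar>g i x\<bar>) \<in> borel_measurable borel"
    by (intro borel_measurable_sum borel_measurable_abs gm)
  have [measurable]: "T \<in> borel_measurable borel" unfolding T_def by measurable
  have Am [measurable]: "A \<in> borel_measurable borel" unfolding A_def by measurable
  have Pm0: "0 \<le> Pm" using exp_le_Pm(1,2)[of 0] by linarith
  have A0: "0 \<le> A x" for x unfolding A_def using L \<kappa> Pm0 by (intro add_nonneg_nonneg mult_nonneg_nonneg sum_nonneg) auto
  show ?thesis unfolding A_def[symmetric]
  proof (cases "(\<integral>\<^sup>+x. ennreal (A x) \<partial>lborel) = top")
    case True
    then show "(\<integral>\<^sup>+x. ennreal (T x powr P x) \<partial>lborel) \<le> epow (\<integral>\<^sup>+x. ennreal (A x) \<partial>lborel) \<rho>"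
      using \<rho> by (simp add: epow_top)
  next
    case Afin: False
    define Z where "Z = (\<integral>\<^sup>+x. ennreal (T x powr \<gamma> x) \<partial>lborel)"
    have Zfin: "Z < top"
    proof -
      have "Z \<le> (\<integral>\<^sup>+x. ennreal (max 1 k powr Pm) * ennreal (\<bar>u x\<bar> powr \<alpha> x) \<partial>lborel)"
        unfolding Z_def T_def
        by (intro nn_integral_mono) (use trunc_powr_le[OF k] exp_le_Pm in \<open>simp add: ennreal_mult[symmetric] ennreal_leI\<close>)
      also have "\<dots> = ennreal (max 1 k powr Pm) * (\<integral>\<^sup>+x. ennreal (\<bar>u x\<bar> powr \<alpha> x) \<partial>lborel)"
        by (rule nn_integral_cmult) measurable
      also have "\<dots> < top" using fin by (simp add: ennreal_mult_less_top)
      finally show ?thesis .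
    qed
    have "\<forall>i\<in>(Basis::'a set). \<exists>C. \<forall>x. \<bar>frechet_derivative bump (at x) i\<bar> \<le> C"
      using compact_kernelE[OF compact_kernel_partial[OF test_function_bump]] by metis
    from bchoice[OF this] obtain CS where CS: "\<And>i (x::'a). i \<in> Basis \<Longrightarrow> \<bar>frechet_derivative bump (at x) i\<bar> \<le> CS i" by blast
    define C where "C = (\<Sum>i\<in>(Basis::'a set). CS i)"
    define c where "c n = 1 / (real n + 1)" for n
    have c: "0 < c n" for n by (simp add: c_def add_nonneg_pos)
    define \<eta> where "\<eta> n x = bump (c n *\<^sub>R (x::'a))" for n x
    have \<eta>t: "test_function (\<eta> n)" for n unfolding \<eta>_def by (rule test_function_dilate_bump[OF c])
    have \<eta>01: "0 \<le> \<eta> n x" "\<eta> n x \<le> 1" for n x unfolding \<eta>_def by (rule bump_bounds)+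
    have S: "(\<Sum>i\<in>Basis. \<bar>frechet_derivative (\<eta> n) (at x) i\<bar>) \<le> c n * C" for n x
    proof -
      have "frechet_derivative (\<eta> n) (at x) i = c n * frechet_derivative bump (at (c n *\<^sub>R x)) i" for i
        using frechet_derivative_affine[OF Ck_bump, of "c n" 0 x i] unfolding \<eta>_def by simp
      then have "(\<Sum>i\<in>Basis. \<bar>frechet_derivative (\<eta> n) (at x) i\<bar>) = c n * (\<Sum>i\<in>Basis. \<bar>frechet_derivative bump (at (c n *\<^sub>R x)) i\<bar>)"
        using c[of n] by (simp add: abs_mult sum_distrib_left)
      also have "\<dots> \<le> c n * C" unfolding C_def using c[of n] by (intro mult_left_mono sum_mono CS) auto
      finally show ?thesis .
    qed
    have C0: "0 \<le> C" using S[of 0 0] c[of 0] sum_nonneg[of Basis "\<lambda>i. \<bar>frechet_derivative (\<eta> 0) (at 0) i\<bar>"]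
      by (simp add: c_def) (meson abs_ge_zero order_trans sum_nonneg)
    have Xle: "(\<integral>\<^sup>+x. ennreal ((\<eta> n x * T x powr \<gamma> x) powr \<rho>) \<partial>lborel)
        \<le> epow (ennreal (c n * C) * Z + (\<integral>\<^sup>+x. ennreal (A x) \<partial>lborel)) \<rho>" for n
    proof -
      have "(\<integral>\<^sup>+x. ennreal ((\<eta> n x * T x powr \<gamma> x) powr \<rho>) \<partial>lborel) \<le>
        epow (\<integral>\<^sup>+x. ennreal ((\<Sum>i\<in>Basis. \<bar>frechet_derivative (\<eta> n) (at x) i\<bar>) * T x powr \<gamma> x + \<eta> n x * A x) \<partial>lborel) \<rho>"
        unfolding A_def T_def \<rho>_def by (rule Sobolev_trunc_cutoff[OF k wp \<eta>t \<eta>01])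
      also have "\<dots> \<le> epow (\<integral>\<^sup>+x. ennreal (c n * C) * ennreal (T x powr \<gamma> x) + ennreal (A x) \<partial>lborel) \<rho>"
      proof (intro epow_mono nn_integral_mono)
        fix x
        have "(\<Sum>i\<in>Basis. \<bar>frechet_derivative (\<eta> n) (at x) i\<bar>) * T x powr \<gamma> x + \<eta> n x * A x \<le> c n * C * T x powr \<gamma> x + 1 * A x"
          using S \<eta>01 A0 by (intro add_mono mult_right_mono) auto
        then show "ennreal ((\<Sum>i\<in>Basis. \<bar>frechet_derivative (\<eta> n) (at x) i\<bar>) * T x powr \<gamma> x + \<eta> n x * A x)
           \<le> ennreal (c n * C) * ennreal (T x powr \<gamma> x) + ennreal (A x)"
          using A0[of x] C0 c[of n] by (simp add: ennreal_mult[symmetric] ennreal_plus[symmetric] ennreal_leI del: ennreal_plus)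
      qed (use \<rho> in auto)
      also have "(\<integral>\<^sup>+x. ennreal (c n * C) * ennreal (T x powr \<gamma> x) + ennreal (A x) \<partial>lborel) = ennreal (c n * C) * Z + (\<integral>\<^sup>+x. ennreal (A x) \<partial>lborel)"
        unfolding Z_def by (subst nn_integral_add) (auto simp: nn_integral_cmult)
      finally show ?thesis .
    qed
    have clim: "(\<lambda>n. ennreal (c n * C) * Z + (\<integral>\<^sup>+x. ennreal (A x) \<partial>lborel)) \<longlonglongrightarrow> 0 + (\<integral>\<^sup>+x. ennreal (A x) \<partial>lborel)"
    proof (intro tendsto_add tendsto_const)
      obtain z where z: "Z = ennreal z" "0 \<le> z" using Zfin by (cases Z) auto
      have "c \<longlonglongrightarrow> 0" unfolding c_def using LIMSEQ_inverse_real_of_nat by (simp add: inverse_eq_divide add.commute)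
      then have "(\<lambda>n. c n * C * z) \<longlonglongrightarrow> 0 * C * z" by (intro tendsto_mult tendsto_const)
      then have "(\<lambda>n. ennreal (c n * C * z)) \<longlonglongrightarrow> ennreal 0" by (intro tendsto_ennrealI) simp
      then show "(\<lambda>n. ennreal (c n * C) * Z) \<longlonglongrightarrow> 0"
        using z C0 less_imp_le[OF c] by (simp add: ennreal_mult)
    qed
    have elim: "(\<lambda>n. epow (ennreal (c n * C) * Z + (\<integral>\<^sup>+x. ennreal (A x) \<partial>lborel)) \<rho>) \<longlonglongrightarrow> epow (\<integral>\<^sup>+x. ennreal (A x) \<partial>lborel) \<rho>"
      by (rule tendsto_epow) (use clim Afin \<rho> in \<open>auto simp: less_top\<close>)
    have "(\<integral>\<^sup>+x. ennreal (T x powr P x) \<partial>lborel) = (\<integral>\<^sup>+x. liminf (\<lambda>n. ennreal ((\<eta> n x * T x powr \<gamma> x) powr \<rho>)) \<partial>lborel)"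
    proof (rule nn_integral_cong)
      fix x :: 'a
      obtain n0 where n0: "norm x \<le> real n0" using real_arch_simple by blast
      have "\<forall>\<^sub>F n in sequentially. ennreal ((\<eta> n x * T x powr \<gamma> x) powr \<rho>) = ennreal (T x powr P x)"
        unfolding eventually_sequentially
      proof (intro exI[of _ n0] allI impI)
        fix n assume "n0 \<le> n"
        then have "norm (c n *\<^sub>R x) \<le> 1" using n0 by (simp add: c_def pos_divide_le_eq)
        then have "\<eta> n x = 1" by (simp add: \<eta>_def bump_eq_1)
        then show "ennreal ((\<eta> n x * T x powr \<gamma> x) powr \<rho>) = ennreal (T x powr P x)"
          by (simp add: powr_powr P\<gamma> \<rho>_def)
      qed
      then have "(\<lambda>n. ennreal ((\<eta> n x * T x powr \<gamma> x) powr \<rho>)) \<longlonglongrightarrow> ennreal (T x powr P x)" by (rule tendsto_eventually)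
      from lim_imp_Liminf[OF sequentially_bot this]
      show "ennreal (T x powr P x) = liminf (\<lambda>n. ennreal ((\<eta> n x * T x powr \<gamma> x) powr \<rho>))" by (rule sym)
    qed
    also have "\<dots> \<le> liminf (\<lambda>n. \<integral>\<^sup>+x. ennreal ((\<eta> n x * T x powr \<gamma> x) powr \<rho>) \<partial>lborel)"
    proof (rule nn_integral_liminf)
      fix n
      have [measurable]: "\<eta> n \<in> borel_measurable borel" by (rule test_function_borel(1)[OF \<eta>t])
      show "(\<lambda>x. ennreal ((\<eta> n x * T x powr \<gamma> x) powr \<rho>)) \<in> borel_measurable lborel" by measurable
    qed
    also have "\<dots> \<le> liminf (\<lambda>n. epow (ennreal (c n * C) * Z + (\<integral>\<^sup>+x. ennreal (A x) \<partial>lborel)) \<rho>)"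
      by (intro Liminf_mono always_eventually allI Xle)
    also have "\<dots> = epow (\<integral>\<^sup>+x. ennreal (A x) \<partial>lborel) \<rho>"
      by (rule lim_imp_Liminf[OF _ elim]) simp
    finally show "(\<integral>\<^sup>+x. ennreal (T x powr P x) \<partial>lborel) \<le> epow (\<integral>\<^sup>+x. ennreal (A x) \<partial>lborel) \<rho>" .
  qed
qed

text \<open>Young's inequality with exponent p against v and with exponent q against w. By
  \<open>young_p\<close> the first conjugate power is exactly T^P; by \<open>young_q\<close> the
  second lies between T^\<alpha> and T^P, and T^\<alpha> is bounded by the same power of
  |u|.\<close>

lemma Sobolev_trunc_Young:
  fixes u v w :: "'a \<Rightarrow> real"
  assumes k: "0 < k" and wp: "weak_partials u g"
    and [measurable]: "v \<in> borel_measurable borel" "w \<in> borel_measurable borel"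
    and vw: "\<And>x. 0 \<le> v x" "\<And>x. 0 \<le> w x" "AE x in lborel. (\<Sum>i\<in>Basis. \<bar>g i x\<bar>) \<le> v x + w x"
    and le: "(\<integral>\<^sup>+x. ennreal (\<bar>u x\<bar> powr \<alpha> x) \<partial>lborel) \<le> ennreal d" "(\<integral>\<^sup>+x. ennreal (v x powr p x) \<partial>lborel) \<le> ennreal d"
      "(\<integral>\<^sup>+x. ennreal (w x powr q x) \<partial>lborel) \<le> ennreal d"
  shows "(\<integral>\<^sup>+x. ennreal (trunc k 0 (u x) powr P x) \<partial>lborel)
    \<le> epow (ennreal (L * (2 / \<kappa>) + 2 * Pm) * ((\<integral>\<^sup>+x. ennreal (trunc k 0 (u x) powr P x) \<partial>lborel) + ennreal d + ennreal d + ennreal d))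
        (real DIM('a) / (real DIM('a) - 1))"
proof -
  define T where "T x = trunc k 0 (u x)" for x
  define B where "B = L * (2 / \<kappa>)"
  define M where "M = B + 2 * Pm"
  have [measurable]: "u \<in> borel_measurable borel" by (rule locint_measurable[OF weak_partialsD(1)[OF wp]])
  have [measurable]: "T \<in> borel_measurable borel" unfolding T_def by measurable
  have B: "0 \<le> B" using L \<kappa> by (simp add: B_def)
  have Pm0: "0 \<le> Pm" using exp_le_Pm(1,2)[of 0] by linarith
  have T0: "0 \<le> T x" for x unfolding T_def using k by (rule trunc_nonneg)
  have T1: "T x \<le> \<bar>u x\<bar>" for x unfolding T_def using k by (rule trunc_0_le)
  have pw: "B * (T x powr \<alpha> x + T x powr P x) + Pm * T x powr (\<gamma> x - 1) * s
      \<le> M * (T x powr P x + \<bar>u x\<bar> powr \<alpha> x + v x powr p x + w x powr q x)" if s: "s \<le> v x + w x" for x s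
  proof -
    define a where "a = T x powr \<alpha> x"
    define b where "b = T x powr P x"
    define U where "U = \<bar>u x\<bar> powr \<alpha> x"
    have aU: "a \<le> U" unfolding a_def U_def using T0[of x] T1[of x] exp_le_Pm(1)[of x] by (intro powr_mono2) auto
    have nn: "0 \<le> a" "0 \<le> b" by (auto simp: a_def b_def)
    have "T x powr (\<gamma> x - 1) * v x \<le> b + v x powr p x"
      using powr_Young[OF T0[of x] vw(1)[of x] p1[of x], of "\<gamma> x - 1"] by (simp only: young_p b_def)
    moreover have "T x powr (\<gamma> x - 1) * w x \<le> (a + b) + w x powr q x"
      using powr_Young[OF T0[of x] vw(2)[of x] q1[of x], of "\<gamma> x - 1"] powr_between[OF T0[of x] young_q[of x]]
      unfolding a_def b_def by linarith
    moreover have "T x powr (\<gamma> x - 1) * s \<le> T x powr (\<gamma> x - 1) * v x + T x powr (\<gamma> x - 1) * w x"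
      using mult_left_mono[OF s, of "T x powr (\<gamma> x - 1)"] by (simp add: distrib_left)
    ultimately have "T x powr (\<gamma> x - 1) * s \<le> 2 * (b + U + v x powr p x + w x powr q x)"
      using aU nn by (smt (verit) powr_ge_zero)
    then have 1: "Pm * (T x powr (\<gamma> x - 1) * s) \<le> Pm * (2 * (b + U + v x powr p x + w x powr q x))"
      by (rule mult_left_mono[OF _ Pm0])
    have "a + b \<le> b + U + v x powr p x + w x powr q x" using aU by (smt (verit) powr_ge_zero)
    then have 2: "B * (a + b) \<le> B * (b + U + v x powr p x + w x powr q x)" by (rule mult_left_mono[OF _ B])
    from 1 2 show ?thesis unfolding M_def a_def b_def U_def by (simp add: algebra_simps)
  qed
  have fin: "(\<integral>\<^sup>+x. ennreal (\<bar>u x\<bar> powr \<alpha> x) \<partial>lborel) < \<infinity>" using le(1) by (simp add: le_less_trans)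
  have "(\<integral>\<^sup>+x. ennreal (T x powr P x) \<partial>lborel)
    \<le> epow (\<integral>\<^sup>+x. ennreal (B * (T x powr \<alpha> x + T x powr P x) + Pm * T x powr (\<gamma> x - 1) * (\<Sum>i\<in>Basis. \<bar>g i x\<bar>)) \<partial>lborel) (real DIM('a) / (real DIM('a) - 1))"
    unfolding T_def B_def by (rule Sobolev_trunc[OF k wp fin])
  also have "\<dots> \<le> epow (ennreal M * ((\<integral>\<^sup>+x. ennreal (T x powr P x) \<partial>lborel) + ennreal d + ennreal d + ennreal d)) (real DIM('a) / (real DIM('a) - 1))"
  proof (rule epow_mono)
    have "(\<integral>\<^sup>+x. ennreal (B * (T x powr \<alpha> x + T x powr P x) + Pm * T x powr (\<gamma> x - 1) * (\<Sum>i\<in>Basis. \<bar>g i x\<bar>)) \<partial>lborel)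
      \<le> (\<integral>\<^sup>+x. ennreal M * (ennreal (T x powr P x) + ennreal (\<bar>u x\<bar> powr \<alpha> x) + ennreal (v x powr p x) + ennreal (w x powr q x)) \<partial>lborel)"
    proof (rule nn_integral_mono_AE)
      show "AE x in lborel. ennreal (B * (T x powr \<alpha> x + T x powr P x) + Pm * T x powr (\<gamma> x - 1) * (\<Sum>i\<in>Basis. \<bar>g i x\<bar>))
        \<le> ennreal M * (ennreal (T x powr P x) + ennreal (\<bar>u x\<bar> powr \<alpha> x) + ennreal (v x powr p x) + ennreal (w x powr q x))"
        using vw(3)
      proof eventually_elim
        case (elim x)
        have "0 \<le> M" using B Pm0 by (simp add: M_def)
        then have "ennreal M * (ennreal (T x powr P x) + ennreal (\<bar>u x\<bar> powr \<alpha> x) + ennreal (v x powr p x) + ennreal (w x powr q x))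
          = ennreal (M * (T x powr P x + \<bar>u x\<bar> powr \<alpha> x + v x powr p x + w x powr q x))"
          by (simp add: ennreal_mult ennreal_plus[symmetric] del: ennreal_plus)
        then show ?case using ennreal_leI[OF pw[OF elim]] by simp
      qed
    qed
    also have "\<dots> = ennreal M * ((\<integral>\<^sup>+x. ennreal (T x powr P x) \<partial>lborel) + (\<integral>\<^sup>+x. ennreal (\<bar>u x\<bar> powr \<alpha> x) \<partial>lborel)
       + (\<integral>\<^sup>+x. ennreal (v x powr p x) \<partial>lborel) + (\<integral>\<^sup>+x. ennreal (w x powr q x) \<partial>lborel))"
      by (simp add: nn_integral_cmult nn_integral_add)
    also have "\<dots> \<le> ennreal M * ((\<integral>\<^sup>+x. ennreal (T x powr P x) \<partial>lborel) + ennreal d + ennreal d + ennreal d)"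
      by (intro mult_left_mono add_mono le order_refl) auto
    finally show "(\<integral>\<^sup>+x. ennreal (B * (T x powr \<alpha> x + T x powr P x) + Pm * T x powr (\<gamma> x - 1) * (\<Sum>i\<in>Basis. \<bar>g i x\<bar>)) \<partial>lborel) \<le> \<dots>" .
  qed (use dim in auto)
  finally show ?thesis unfolding T_def M_def B_def .
qed

text \<open>Let \<open>J s\<close> be the truncated \<open>P\<close>-modular of \<open>s u\<close>. Since \<open>\<rho> > 1\<close>, the inequality above cannot hold
  when \<open>J s\<close> equals a certain small \<open>i\<close>; as \<open>J\<close> is continuous and \<open>J 0 = 0\<close>, it stays below \<open>i\<close>.\<close>

theorem modular_Sobolev:
  obtains d where "d > 0" "\<And>(u :: 'a \<Rightarrow> real) g v w. weak_partials u g \<Longrightarrow>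
    v \<in> borel_measurable borel \<Longrightarrow> w \<in> borel_measurable borel \<Longrightarrow> (\<And>x. 0 \<le> v x) \<Longrightarrow> (\<And>x. 0 \<le> w x) \<Longrightarrow>
    (AE x in lborel. (\<Sum>i\<in>Basis. \<bar>g i x\<bar>) \<le> v x + w x) \<Longrightarrow>
    (\<integral>\<^sup>+x. ennreal (\<bar>u x\<bar> powr \<alpha> x) \<partial>lborel) \<le> ennreal d \<Longrightarrow>
    (\<integral>\<^sup>+x. ennreal (v x powr p x) \<partial>lborel) \<le> ennreal d \<Longrightarrow>
    (\<integral>\<^sup>+x. ennreal (w x powr q x) \<partial>lborel) \<le> ennreal d \<Longrightarrow>
    (\<integral>\<^sup>+x. ennreal (\<bar>u x\<bar> powr P x) \<partial>lborel) \<le> 1"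
proof -
  define \<rho> where "\<rho> = real DIM('a) / (real DIM('a) - 1)"
  have \<rho>: "1 < \<rho>" using dim by (simp add: \<rho>_def)
  have Pm0: "0 < Pm" using exp_le_Pm(1,2)[of 0] by linarith
  define M where "M = L * (2 / \<kappa>) + 2 * Pm"
  have M: "0 < M" using L \<kappa> Pm0 by (simp add: M_def add_nonneg_pos)
  define N where "N = (2 * M) powr \<rho>"
  have N: "0 < N" using M by (simp add: N_def)
  \<comment> \<open>Small enough that N i^(\<rho> - 1) < 1 with N = (2 M)^\<rho>, that is (2 M
    i)^\<rho> < i; at the value i the inequality would say the opposite.\<close>
  define i where "i = min 1 ((N + 1) powr (- 1 / (\<rho> - 1)))"
  have i: "0 < i" "i \<le> 1" using N by (auto simp: i_def)
  have "i powr (\<rho> - 1) \<le> ((N + 1) powr (- 1 / (\<rho> - 1))) powr (\<rho> - 1)"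
    using \<rho> i(1) by (intro powr_mono2) (auto simp: i_def)
  also have "\<dots> = (N + 1) powr (- 1)" using \<rho> by (simp only: powr_powr) simp
  also have "\<dots> = 1 / (N + 1)" using N by (simp add: powr_minus_divide)
  finally have "i powr (\<rho> - 1) \<le> 1 / (N + 1)" .
  from mult_left_mono[OF this less_imp_le[OF N]] have "N * i powr (\<rho> - 1) \<le> N / (N + 1)" by simp
  also have "\<dots> < 1" using N by simp
  finally have "N * i powr (\<rho> - 1) * i < 1 * i" using i(1) by (intro mult_strict_right_mono)
  moreover have "(M * (2 * i)) powr \<rho> = N * i powr (\<rho> - 1) * i"
  proof -
    have "(M * (2 * i)) powr \<rho> = N * i powr ((\<rho> - 1) + 1)"
      using M i(1) powr_mult[of "2 * M" i \<rho>] unfolding N_def by (simp add: mult_ac)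
    also have "i powr ((\<rho> - 1) + 1) = i powr (\<rho> - 1) * i" using i(1) by (subst powr_add) simp
    finally show ?thesis by simp
  qed
  ultimately have istar: "(M * (2 * i)) powr \<rho> < i" by simp
  \<comment> \<open>The threshold is i / 3: three modulars of this size add up to i, so with J s = i
    the bracket in the inequality is 2 i.\<close>
  show ?thesis
  proof (rule that[of "i / 3"])
    show "0 < i / 3" using i by simp
    fix u :: "'a \<Rightarrow> real" and g v w
    assume wp: "weak_partials u g" and [measurable]: "v \<in> borel_measurable borel" "w \<in> borel_measurable borel"
      and vw: "\<And>x. 0 \<le> v x" "\<And>x. 0 \<le> w x" "AE x in lborel. (\<Sum>i\<in>Basis. \<bar>g i x\<bar>) \<le> v x + w x"
      and le: "(\<integral>\<^sup>+x. ennreal (\<bar>u x\<bar> powr \<alpha> x) \<partial>lborel) \<le> ennreal (i/3)" "(\<integral>\<^sup>+x. ennreal (v x powr p x) \<partial>lborel) \<le> ennreal (i/3)"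
      "(\<integral>\<^sup>+x. ennreal (w x powr q x) \<partial>lborel) \<le> ennreal (i/3)"
    have [measurable]: "u \<in> borel_measurable borel" by (rule locint_measurable[OF weak_partialsD(1)[OF wp]])
    have ui: "integrable lborel (\<lambda>x. \<bar>u x\<bar> powr \<alpha> x)"
      by (rule integrableI_bounded) (use le(1) in \<open>auto simp: le_less_trans\<close>)
    have main: "(\<integral>\<^sup>+x. ennreal (trunc k 0 (u x) powr P x) \<partial>lborel) \<le> 1" if k: "0 < k" for k
    proof -
      define J where "J s = (LINT x|lborel. trunc k 0 (s * u x) powr P x)" for s :: real
      define K where "K = max 1 k powr Pm"
      have dom: "trunc k 0 (s * u x) powr P x \<le> K * \<bar>u x\<bar> powr \<alpha> x" if s: "0 \<le> s" "s \<le> 1" for s x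
      proof -
        have "trunc k 0 (s * u x) powr P x \<le> K * \<bar>s * u x\<bar> powr \<alpha> x"
          unfolding K_def by (rule trunc_powr_le[OF k]) (use exp_le_Pm PPm in auto)
        also have "\<dots> \<le> K * \<bar>u x\<bar> powr \<alpha> x"
          using s exp_le_Pm(1)[of x] unfolding K_def
          by (intro mult_left_mono powr_mono2) (auto simp: abs_mult mult_left_le_one_le)
        finally show ?thesis .
      qed
      have Ki: "integrable lborel (\<lambda>x. K * \<bar>u x\<bar> powr \<alpha> x)" using ui by simp
      have Ji: "integrable lborel (\<lambda>x. trunc k 0 (s * u x) powr P x)" if s: "0 \<le> s" "s \<le> 1" for s
      proof (rule Bochner_Integration.integrable_bound[OF Ki])
        show "AE x in lborel. norm (trunc k 0 (s * u x) powr P x) \<le> norm (K * \<bar>u x\<bar> powr \<alpha> x)"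
          by (rule AE_I2) (use dom[OF s] in \<open>simp add: order_trans[OF _ abs_ge_self]\<close>)
      qed measurable
      have Jnn: "(\<integral>\<^sup>+x. ennreal (trunc k 0 (s * u x) powr P x) \<partial>lborel) = ennreal (J s)" if "0 \<le> s" "s \<le> 1" for s
        unfolding J_def using Ji[OF that] by (intro nn_integral_eq_integral) auto
      have cont: "continuous_on {0..1} J"
        unfolding continuous_on_sequentially o_def
      proof (intro allI ballI impI)
        fix X :: "nat \<Rightarrow> real" and s assume X: "(\<forall>n. X n \<in> {0..1}) \<and> X \<longlonglongrightarrow> s"
        show "(\<lambda>n. J (X n)) \<longlonglongrightarrow> J s"
          unfolding J_def
        proof (rule integral_dominated_convergence[OF _ _ Ki])
          show "AE x in lborel. (\<lambda>n. trunc k 0 (X n * u x) powr P x) \<longlonglongrightarrow> trunc k 0 (s * u x) powr P x"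
          proof (rule AE_I2)
            fix x
            have "(\<lambda>n. trunc k 0 (X n * u x)) \<longlonglongrightarrow> trunc k 0 (s * u x)"
              using X by (intro trunc_tendsto[OF k] tendsto_intros) auto
            then show "(\<lambda>n. trunc k 0 (X n * u x) powr P x) \<longlonglongrightarrow> trunc k 0 (s * u x) powr P x"
              by (rule tendsto_powr'[OF _ tendsto_const]) (use exp_le_Pm(6)[of x] trunc_nonneg[OF k] in auto)
          qed
          show "AE x in lborel. norm (trunc k 0 (X n * u x) powr P x) \<le> K * \<bar>u x\<bar> powr \<alpha> x" for n
            by (rule AE_I2) (use dom[of "X n"] X in auto)
        qed measurable
      qed
      have ne: "J s \<noteq> i" if s: "0 \<le> s" "s \<le> 1" for s
      proof
        assume Js: "J s = i"
        have wps: "weak_partials (\<lambda>x. s * u x) (\<lambda>i x. s * g i x)" by (rule weak_partials_scale[OF wp])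
        have small: "(s * y) powr e \<le> y powr e" if "0 \<le> y" "0 \<le> e" for y e
          using s that by (intro powr_mono2) (auto simp: mult_left_le_one_le)
        have "ennreal i \<le> epow (ennreal M * (ennreal i + ennreal (i/3) + ennreal (i/3) + ennreal (i/3))) \<rho>"
          unfolding Js[symmetric] unfolding Jnn[OF s, symmetric] unfolding Js M_def \<rho>_def
        proof (rule Sobolev_trunc_Young[OF k wps, of "\<lambda>x. s * v x" "\<lambda>x. s * w x"])
          show "AE x in lborel. (\<Sum>i\<in>Basis. \<bar>s * g i x\<bar>) \<le> s * v x + s * w x"
            using vw(3)
          proof eventually_elim
            case (elim x)
            have "(\<Sum>i\<in>Basis. \<bar>s * g i x\<bar>) = s * (\<Sum>i\<in>Basis. \<bar>g i x\<bar>)"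
              using s by (simp add: abs_mult sum_distrib_left)
            also have "\<dots> \<le> s * (v x + w x)" using elim s by (intro mult_left_mono) auto
            finally show ?case by (simp add: distrib_left)
          qed
          have "(\<integral>\<^sup>+x. ennreal (\<bar>s * u x\<bar> powr \<alpha> x) \<partial>lborel) \<le> (\<integral>\<^sup>+x. ennreal (\<bar>u x\<bar> powr \<alpha> x) \<partial>lborel)"
            by (intro nn_integral_mono ennreal_leI) (use s small exp_le_Pm(1) in \<open>simp add: abs_mult less_imp_le\<close>)
          then show "(\<integral>\<^sup>+x. ennreal (\<bar>s * u x\<bar> powr \<alpha> x) \<partial>lborel) \<le> ennreal (i/3)" using le(1) by (rule order_trans)
          have "(\<integral>\<^sup>+x. ennreal ((s * v x) powr p x) \<partial>lborel) \<le> (\<integral>\<^sup>+x. ennreal (v x powr p x) \<partial>lborel)"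
            by (intro nn_integral_mono ennreal_leI small vw) (use p1 less_imp_le less_trans zero_less_one in metis)
          then show "(\<integral>\<^sup>+x. ennreal ((s * v x) powr p x) \<partial>lborel) \<le> ennreal (i/3)" using le(2) by (rule order_trans)
          have "(\<integral>\<^sup>+x. ennreal ((s * w x) powr q x) \<partial>lborel) \<le> (\<integral>\<^sup>+x. ennreal (w x powr q x) \<partial>lborel)"
            by (intro nn_integral_mono ennreal_leI small vw) (use q1 less_imp_le less_trans zero_less_one in metis)
          then show "(\<integral>\<^sup>+x. ennreal ((s * w x) powr q x) \<partial>lborel) \<le> ennreal (i/3)" using le(3) by (rule order_trans)
        qed (use s vw in auto)
        also have "ennreal M * (ennreal i + ennreal (i/3) + ennreal (i/3) + ennreal (i/3)) = ennreal (M * (2 * i))"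
          using M i(1) by (simp add: ennreal_mult[symmetric] ennreal_plus[symmetric] del: ennreal_plus)
        also have "epow (ennreal (M * (2 * i))) \<rho> = ennreal ((M * (2 * i)) powr \<rho>)"
          using M i(1) \<rho> by (intro epow_ennreal) auto
        finally have "i \<le> (M * (2 * i)) powr \<rho>" by (subst (asm) ennreal_le_iff) auto
        with istar show False by simp
      qed
      have "J 1 < i"
      proof (rule ccontr)
        assume "\<not> J 1 < i"
        moreover have "J 0 = 0" unfolding J_def trunc_0 by simp
        ultimately obtain s where "0 \<le> s" "s \<le> 1" "J s = i"
          using IVT'[of J 0 i 1] cont i(1) by auto
        then show False using ne by blast
      qed
      then have "ennreal (J 1) \<le> ennreal 1" using i(2) by (intro ennreal_leI) simp
      then show ?thesis using Jnn[of 1] by simp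
    qed
    \<comment> \<open>The bound 1 is the same for every truncation level, so Fatou's lemma lets the
      level tend to infinity.\<close>
    have "(\<integral>\<^sup>+x. ennreal (\<bar>u x\<bar> powr P x) \<partial>lborel) = (\<integral>\<^sup>+x. liminf (\<lambda>n. ennreal (trunc (real n + 1) 0 (u x) powr P x)) \<partial>lborel)"
    proof (rule nn_integral_cong)
      fix x
      have "(\<lambda>n. 1 / (real n + 1)) \<longlonglongrightarrow> 0" using LIMSEQ_inverse_real_of_nat by (simp add: inverse_eq_divide add.commute)
      then have "(\<lambda>n. \<bar>u x\<bar> / (1 + \<bar>u x\<bar> * (1 / (real n + 1)))) \<longlonglongrightarrow> \<bar>u x\<bar> / (1 + \<bar>u x\<bar> * 0)"
        by (intro tendsto_intros) auto
      moreover have "\<bar>u x\<bar> / (1 + \<bar>u x\<bar> * (1 / (real n + 1))) = trunc (real n + 1) 0 (u x)" for n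
        by (simp add: trunc_0 field_simps)
      ultimately have "(\<lambda>n. trunc (real n + 1) 0 (u x)) \<longlonglongrightarrow> \<bar>u x\<bar>" by simp
      then have "(\<lambda>n. trunc (real n + 1) 0 (u x) powr P x) \<longlonglongrightarrow> \<bar>u x\<bar> powr P x"
        by (rule tendsto_powr'[OF _ tendsto_const]) (use exp_le_Pm(6)[of x] in \<open>auto intro!: always_eventually trunc_nonneg\<close>)
      then have "(\<lambda>n. ennreal (trunc (real n + 1) 0 (u x) powr P x)) \<longlonglongrightarrow> ennreal (\<bar>u x\<bar> powr P x)" by (rule tendsto_ennrealI)
      from lim_imp_Liminf[OF sequentially_bot this]
      show "ennreal (\<bar>u x\<bar> powr P x) = liminf (\<lambda>n. ennreal (trunc (real n + 1) 0 (u x) powr P x))" by (rule sym)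
    qed
    also have "\<dots> \<le> liminf (\<lambda>n. \<integral>\<^sup>+x. ennreal (trunc (real n + 1) 0 (u x) powr P x) \<partial>lborel)"
      by (rule nn_integral_liminf) measurable
    also have "\<dots> \<le> liminf (\<lambda>n. 1)"
      by (intro Liminf_mono always_eventually allI main) (simp add: add_nonneg_pos)
    also have "\<dots> = 1" by (simp add: Liminf_const)
    finally show "(\<integral>\<^sup>+x. ennreal (\<bar>u x\<bar> powr P x) \<partial>lborel) \<le> 1" .
  qed
qed

end

subsection \<open>The Luxemburg norm\<close>

text \<open>Exponents are at least 1, so the factor c^(- r x) is at most 1 / c. Used to scale a
  finite modular below a prescribed bound.\<close>

lemma modular_scale_le:
  assumes [measurable]: "u \<in> borel_measurable M" "r \<in> borel_measurable M"
    and r: "\<And>x. 1 \<le> r x" and c: "1 \<le> c"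
  shows "modular M r (\<lambda>x. u x / c) \<le> ennreal (1 / c) * modular M r u"
proof -
  have "modular M r (\<lambda>x. u x / c) \<le> (\<integral>\<^sup>+x. ennreal (1 / c) * ennreal (\<bar>u x\<bar> powr r x) \<partial>M)"
    unfolding modular_def
  proof (rule nn_integral_mono)
    fix x
    have "c powr 1 \<le> c powr r x" using r c by (intro powr_mono) auto
    then have "1 / c powr r x \<le> 1 / c" using c by (simp add: frac_le)
    then have "\<bar>u x\<bar> powr r x * (1 / c powr r x) \<le> \<bar>u x\<bar> powr r x * (1 / c)" by (rule mult_left_mono) simp
    then have "\<bar>u x / c\<bar> powr r x \<le> 1 / c * \<bar>u x\<bar> powr r x"
      using c by (simp add: powr_divide mult.commute)
    then show "ennreal (\<bar>u x / c\<bar> powr r x) \<le> ennreal (1 / c) * ennreal (\<bar>u x\<bar> powr r x)"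
      using c by (simp add: ennreal_mult[symmetric] ennreal_leI)
  qed
  also have "\<dots> = ennreal (1 / c) * modular M r u"
    unfolding modular_def by (rule nn_integral_cmult) measurable
  finally show ?thesis .
qed

lemma modular_mono:
  assumes "\<And>x. 0 \<le> r x" "AE x in M. \<bar>u x\<bar> \<le> \<bar>v x\<bar>"
  shows "modular M r u \<le> modular M r v"
  unfolding modular_def
  by (rule nn_integral_mono_AE) (use assms in \<open>auto elim!: eventually_mono intro!: ennreal_leI powr_mono2\<close>)

lemma modular_antimono_scale:
  assumes "\<And>x. 0 \<le> r x" "0 < c" "c \<le> d"
  shows "modular M r (\<lambda>x. u x / d) \<le> modular M r (\<lambda>x. u x / c)"
  by (rule modular_mono) (use assms in \<open>auto intro!: divide_left_mono\<close>)

lemma luxemburg_le: "0 < c \<Longrightarrow> modular M r (\<lambda>x. u x / c) \<le> 1 \<Longrightarrow> luxemburg M r u \<le> c"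
  unfolding luxemburg_def by (rule cInf_lower) (auto intro!: bdd_belowI[of _ 0])

context
  fixes M :: "'b measure" and r :: "'b \<Rightarrow> real"
  assumes rm: "r \<in> borel_measurable M" and r1: "\<And>x. 1 \<le> r x"
begin

text \<open>The real \<open>Inf\<close> says nothing about an empty set; a divisor at least 1 and at
  least the modular provides a member.\<close>

lemma luxemburg_set_nonempty:
  assumes u: "u \<in> Lvar M r"
  shows "\<exists>c>0. modular M r (\<lambda>x. u x / c) \<le> 1"
proof -
  obtain m where m: "modular M r u = ennreal m" "0 \<le> m" using u by (cases "modular M r u") (auto simp: Lvar_def)
  define c where "c = max 1 m"
  have "modular M r (\<lambda>x. u x / c) \<le> ennreal (1 / c) * modular M r u"
    by (rule modular_scale_le) (use u rm r1 in \<open>auto simp: Lvar_def c_def\<close>)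
  also have "\<dots> = ennreal (1 / c * m)" using m by (simp add: ennreal_mult[symmetric] c_def)
  also have "\<dots> \<le> ennreal 1" by (rule ennreal_leI) (use m in \<open>auto simp: c_def divide_le_eq\<close>)
  finally show ?thesis by (intro exI[of _ c]) (auto simp: c_def)
qed

lemma luxemburg_nonneg: "u \<in> Lvar M r \<Longrightarrow> 0 \<le> luxemburg M r u"
  unfolding luxemburg_def by (rule cInf_greatest) (use luxemburg_set_nonempty in auto)

text \<open>Any c strictly above the infimum exceeds some admissible divisor, and the modular
  decreases in the divisor. The strict inequality avoids the question whether the infimum is
  attained.\<close>

lemma modular_le_1:
  assumes u: "u \<in> Lvar M r" and c: "luxemburg M r u < c"
  shows "modular M r (\<lambda>x. u x / c) \<le> 1"
proof -
  obtain d where d: "0 < d" "modular M r (\<lambda>x. u x / d) \<le> 1" "d < c"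
    using cInf_lessD[OF _ c[unfolded luxemburg_def]] luxemburg_set_nonempty[OF u] by auto
  have "modular M r (\<lambda>x. u x / c) \<le> modular M r (\<lambda>x. u x / d)"
    by (rule modular_antimono_scale) (use r1 d order_trans[OF zero_le_one r1] in auto)
  then show ?thesis using d(2) by (rule order_trans)
qed

lemma Lvar_mono:
  assumes v: "v \<in> Lvar M r" and u: "u \<in> borel_measurable M" "AE x in M. \<bar>u x\<bar> \<le> \<bar>v x\<bar>"
  shows "u \<in> Lvar M r"
  using modular_mono[of r u v M] order_trans[OF zero_le_one r1] v u by (auto simp: Lvar_def le_less_trans)

lemma luxemburg_mono:
  assumes v: "v \<in> Lvar M r" and u: "AE x in M. \<bar>u x\<bar> \<le> \<bar>v x\<bar>"
  shows "luxemburg M r u \<le> luxemburg M r v"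
proof (rule field_le_epsilon)
  fix e :: real assume e: "0 < e"
  let ?c = "luxemburg M r v + e"
  have c: "0 < ?c" using luxemburg_nonneg[OF v] e by linarith
  have "modular M r (\<lambda>x. u x / ?c) \<le> modular M r (\<lambda>x. v x / ?c)"
    by (rule modular_mono)
       (use c u order_trans[OF zero_le_one r1] in \<open>auto elim!: eventually_mono intro!: divide_right_mono\<close>)
  also have "\<dots> \<le> 1" by (rule modular_le_1[OF v]) (use e in simp)
  finally show "luxemburg M r u \<le> ?c" by (rule luxemburg_le[OF c])
qed

text \<open>Convexity of the power with weights a / (a + b) and b / (a + b). A vanishing argument is
  treated apart, by the scaling inequality for factors in (0, 1].\<close>

lemma powr_convex_comb:
  fixes x y a b e :: real
  assumes "0 \<le> x" "0 \<le> y" "0 < a" "0 < b" "1 \<le> e"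
  shows "((x + y) / (a + b)) powr e \<le> a / (a + b) * (x / a) powr e + b / (a + b) * (y / b) powr e"
proof -
  have scale: "(\<theta> * z) powr e \<le> \<theta> * z powr e" if "0 < \<theta>" "\<theta> \<le> 1" "0 \<le> z" for \<theta> z :: real
  proof -
    have "\<theta> powr e \<le> \<theta> powr 1" using that assms(5) by (intro powr_mono') auto
    then show ?thesis using that by (simp add: powr_mult mult_right_mono)
  qed
  consider "x = 0" | "y = 0" | "0 < x" "0 < y" using assms by linarith
  then show ?thesis
  proof cases
    case 1
    then show ?thesis using scale[of "b / (a + b)" "y / b"] assms by simp
  next
    case 2
    then show ?thesis using scale[of "a / (a + b)" "x / a"] assms by simp
  next
    case 3
    have eq: "1 - b / (a + b) = a / (a + b)" using assms by (simp add: field_simps)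
    moreover have "(x + y) / (a + b) = (1 - b / (a + b)) * (x / a) + b / (a + b) * (y / b)"
      unfolding eq using assms by (simp add: add_divide_distrib)
    moreover have "((1 - b / (a + b)) *\<^sub>R (x / a) + (b / (a + b)) *\<^sub>R (y / b)) powr e
       \<le> (1 - b / (a + b)) * (x / a) powr e + b / (a + b) * (y / b) powr e"
      by (rule convex_onD[OF powr_convex[OF assms(5)]]) (use assms 3 in auto)
    ultimately show ?thesis by simp
  qed
qed

lemma luxemburg_add_aux:
  assumes u: "u \<in> Lvar M r" and v: "v \<in> Lvar M r" and a: "0 < a" "0 < b"
    and le: "modular M r (\<lambda>x. u x / a) \<le> 1" "modular M r (\<lambda>x. v x / b) \<le> 1"
  shows "modular M r (\<lambda>x. (u x + v x) / (a + b)) \<le> 1"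
proof -
  have [measurable]: "u \<in> borel_measurable M" "v \<in> borel_measurable M" "r \<in> borel_measurable M"
    using u v rm by (auto simp: Lvar_def)
  have "modular M r (\<lambda>x. (u x + v x) / (a + b)) \<le>
    (\<integral>\<^sup>+x. ennreal (a / (a + b)) * ennreal (\<bar>u x / a\<bar> powr r x) + ennreal (b / (a + b)) * ennreal (\<bar>v x / b\<bar> powr r x) \<partial>M)"
    unfolding modular_def
  proof (rule nn_integral_mono)
    fix x
    have "\<bar>(u x + v x) / (a + b)\<bar> powr r x \<le> ((\<bar>u x\<bar> + \<bar>v x\<bar>) / (a + b)) powr r x"
      by (intro powr_mono2) (use a order_trans[OF zero_le_one r1] in \<open>auto intro: divide_right_mono\<close>)
    also have "\<dots> \<le> a / (a + b) * (\<bar>u x\<bar> / a) powr r x + b / (a + b) * (\<bar>v x\<bar> / b) powr r x"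
      by (rule powr_convex_comb) (use a r1 in auto)
    finally show "ennreal (\<bar>(u x + v x) / (a + b)\<bar> powr r x) \<le>
       ennreal (a / (a + b)) * ennreal (\<bar>u x / a\<bar> powr r x) + ennreal (b / (a + b)) * ennreal (\<bar>v x / b\<bar> powr r x)"
      using a by (simp add: ennreal_mult[symmetric] ennreal_plus[symmetric] ennreal_leI del: ennreal_plus)
  qed
  also have "\<dots> = ennreal (a / (a + b)) * modular M r (\<lambda>x. u x / a) + ennreal (b / (a + b)) * modular M r (\<lambda>x. v x / b)"
    unfolding modular_def by (subst nn_integral_add) (auto simp: nn_integral_cmult)
  also have "\<dots> \<le> ennreal (a / (a + b)) * 1 + ennreal (b / (a + b)) * 1"
    by (intro add_mono mult_left_mono le) auto
  also have "\<dots> = 1"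
    using a by (simp add: ennreal_plus[symmetric] add_divide_distrib[symmetric] del: ennreal_plus)
  finally show ?thesis .
qed

text \<open>A bounded exponent makes undoing the division by c cost at most a constant
  factor.\<close>

lemma Lvar_scale_iff:
  assumes "0 < c" "u \<in> borel_measurable M" "modular M r (\<lambda>x. u x / c) < \<infinity>" and R: "\<And>x. r x \<le> R"
  shows "u \<in> Lvar M r"
proof -
  have [measurable]: "u \<in> borel_measurable M" "r \<in> borel_measurable M" using assms rm by auto
  have "modular M r u \<le> (\<integral>\<^sup>+x. ennreal (max 1 c powr R) * ennreal (\<bar>u x / c\<bar> powr r x) \<partial>M)"
    unfolding modular_def
  proof (rule nn_integral_mono)
    fix x
    have "\<bar>u x\<bar> powr r x = c powr r x * \<bar>u x / c\<bar> powr r x"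
      using assms(1) by (simp add: powr_divide)
    also have "\<dots> \<le> max 1 c powr R * \<bar>u x / c\<bar> powr r x"
    proof (intro mult_right_mono)
      have "c powr r x \<le> max 1 c powr r x" using assms(1) order_trans[OF zero_le_one r1[of x]] by (intro powr_mono2) auto
      also have "\<dots> \<le> max 1 c powr R" using R by (intro powr_mono) auto
      finally show "c powr r x \<le> max 1 c powr R" .
    qed simp
    finally show "ennreal (\<bar>u x\<bar> powr r x) \<le> ennreal (max 1 c powr R) * ennreal (\<bar>u x / c\<bar> powr r x)"
      by (simp add: ennreal_mult[symmetric] ennreal_leI)
  qed
  also have "\<dots> = ennreal (max 1 c powr R) * modular M r (\<lambda>x. u x / c)"
    unfolding modular_def by (rule nn_integral_cmult) measurable
  also have "\<dots> < \<infinity>" using assms(3) by (simp add: ennreal_mult_less_top)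
  finally show ?thesis using assms(2) by (simp add: Lvar_def)
qed

lemma Lvar_add:
  assumes u: "u \<in> Lvar M r" and v: "v \<in> Lvar M r" and R: "\<And>x. r x \<le> R"
  shows "(\<lambda>x. u x + v x) \<in> Lvar M r"
proof -
  obtain a b where ab: "0 < a" "modular M r (\<lambda>x. u x / a) \<le> 1" "0 < b" "modular M r (\<lambda>x. v x / b) \<le> 1"
    using luxemburg_set_nonempty[OF u] luxemburg_set_nonempty[OF v] by blast
  have "modular M r (\<lambda>x. (u x + v x) / (a + b)) \<le> 1" using luxemburg_add_aux[OF u v ab(1,3,2,4)] .
  then have "modular M r (\<lambda>x. (u x + v x) / (a + b)) < \<infinity>" by (rule le_less_trans) simp
  from Lvar_scale_iff[OF _ _ this R] show ?thesis using u v ab by (auto simp: Lvar_def)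
qed

lemma luxemburg_add:
  assumes u: "u \<in> Lvar M r" and v: "v \<in> Lvar M r"
  shows "luxemburg M r (\<lambda>x. u x + v x) \<le> luxemburg M r u + luxemburg M r v"
proof (rule field_le_epsilon)
  fix e :: real assume e: "0 < e"
  let ?a = "luxemburg M r u + e / 2" and ?b = "luxemburg M r v + e / 2"
  have ab: "0 < ?a" "0 < ?b" using luxemburg_nonneg[OF u] luxemburg_nonneg[OF v] e by linarith+
  have "modular M r (\<lambda>x. (u x + v x) / (?a + ?b)) \<le> 1"
    by (rule luxemburg_add_aux[OF u v ab modular_le_1[OF u] modular_le_1[OF v]]) (use e in auto)
  then have "luxemburg M r (\<lambda>x. u x + v x) \<le> ?a + ?b" by (rule luxemburg_le[rotated]) (use ab in linarith)
  then show "luxemburg M r (\<lambda>x. u x + v x) \<le> luxemburg M r u + luxemburg M r v + e" by simp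
qed

text \<open>For c at least m^(1/a) and m^(1/b) one has m \<le> c^(r x) whenever r x is in [a, b].
  The exponent is controlled only where u is nonzero, which makes the estimate usable for functions
  supported far out.\<close>

lemma luxemburg_le_modular:
  assumes u: "u \<in> borel_measurable M" and m: "modular M r u \<le> ennreal m" "0 < m"
    and s: "AE x in M. u x \<noteq> 0 \<longrightarrow> a \<le> r x \<and> r x \<le> b" and ab: "0 < a" "a \<le> b"
  shows "luxemburg M r u \<le> max (m powr (1 / a)) (m powr (1 / b))"
proof -
  have [measurable]: "u \<in> borel_measurable M" "r \<in> borel_measurable M" using u rm by auto
  define c where "c = max (m powr (1 / a)) (m powr (1 / b))"
  have c: "0 < c" using m by (simp add: c_def less_max_iff_disj)
  have cm: "m \<le> c powr e" if e: "a \<le> e" "e \<le> b" for e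
  proof -
    have ep: "0 < e" using e ab by linarith
    have "m powr (1 / e) \<le> c"
    proof (cases "1 \<le> m")
      case True
      then have "m powr (1 / e) \<le> m powr (1 / a)" using e ab by (intro powr_mono) (auto simp: frac_le)
      then show ?thesis by (simp add: c_def)
    next
      case False
      then have "m powr (1 / e) \<le> m powr (1 / b)" using e ab ep m by (intro powr_mono') (auto simp: frac_le)
      then show ?thesis by (simp add: c_def)
    qed
    then have "(m powr (1 / e)) powr e \<le> c powr e" using ep by (intro powr_mono2) auto
    then show ?thesis using ep m by (simp add: powr_powr)
  qed
  have "modular M r (\<lambda>x. u x / c) \<le> (\<integral>\<^sup>+x. ennreal (1 / m) * ennreal (\<bar>u x\<bar> powr r x) \<partial>M)"
    unfolding modular_def
  proof (rule nn_integral_mono_AE)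
    show "AE x in M. ennreal (\<bar>u x / c\<bar> powr r x) \<le> ennreal (1 / m) * ennreal (\<bar>u x\<bar> powr r x)"
      using s
    proof eventually_elim
      case (elim x)
      show ?case
      proof (cases "u x = 0")
        case False
        then have "m \<le> c powr r x" using elim cm by blast
        then have "1 / c powr r x \<le> 1 / m" using m by (simp add: frac_le)
        then have "\<bar>u x\<bar> powr r x * (1 / c powr r x) \<le> \<bar>u x\<bar> powr r x * (1 / m)" by (rule mult_left_mono) simp
        then have "\<bar>u x / c\<bar> powr r x \<le> 1 / m * \<bar>u x\<bar> powr r x"
          using c by (simp add: powr_divide mult.commute)
        then show ?thesis using m by (simp add: ennreal_mult[symmetric] ennreal_leI)
      qed simp
    qed
  qed
  also have "\<dots> = ennreal (1 / m) * modular M r u" unfolding modular_def by (rule nn_integral_cmult) measurable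
  also have "\<dots> \<le> ennreal (1 / m) * ennreal m" by (intro mult_left_mono m) simp
  also have "\<dots> = 1" using m by (simp add: ennreal_mult[symmetric])
  finally show ?thesis using luxemburg_le[OF c] unfolding c_def by blast
qed

lemma luxemburg_ge_modular:
  assumes u: "u \<in> Lvar M r" and m: "ennreal m \<le> modular M r u" "0 < m"
    and s: "AE x in M. u x \<noteq> 0 \<longrightarrow> a \<le> r x \<and> r x \<le> b" and ab: "0 < a" "a \<le> b"
  shows "min (m powr (1 / a)) (m powr (1 / b)) \<le> luxemburg M r u"
proof (rule ccontr)
  assume neg: "\<not> ?thesis"
  define c where "c = min (m powr (1 / a)) (m powr (1 / b))"
  have c: "0 < c" using m by (simp add: c_def)
  have "luxemburg M r u < c" using neg unfolding c_def by (simp only: not_le)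
  then obtain d where d: "luxemburg M r u < d" "d < c" using dense by blast
  have d0: "0 < d" using luxemburg_nonneg[OF u] d(1) by linarith
  have md: "modular M r (\<lambda>x. u x / d) \<le> 1" by (rule modular_le_1[OF u d(1)])
  have [measurable]: "u \<in> borel_measurable M" "r \<in> borel_measurable M" using u rm by (auto simp: Lvar_def)
  have cm: "c powr e \<le> m" if e: "a \<le> e" "e \<le> b" for e
  proof -
    have ep: "0 < e" using e ab by linarith
    have "c \<le> m powr (1 / e)"
    proof (cases "1 \<le> m")
      case True
      then have "m powr (1 / b) \<le> m powr (1 / e)" using e ab ep by (intro powr_mono) (auto simp: frac_le)
      then show ?thesis by (simp add: c_def)
    next
      case False
      then have "m powr (1 / a) \<le> m powr (1 / e)" using e ab ep m by (intro powr_mono') (auto simp: frac_le)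
      then show ?thesis by (simp add: c_def)
    qed
    then have "c powr e \<le> (m powr (1 / e)) powr e" using ep c by (intro powr_mono2) auto
    then show ?thesis using ep m by (simp add: powr_powr)
  qed
  \<comment> \<open>A divisor d < c leaves a gain: as r \<ge> 1, d^r \<le> (d / c) c^r \<le> (d / c)
    m, which keeps the modular strictly below m.\<close>
  have "modular M r u \<le> (\<integral>\<^sup>+x. ennreal (d / c * m) * ennreal (\<bar>u x / d\<bar> powr r x) \<partial>M)"
    unfolding modular_def
  proof (rule nn_integral_mono_AE)
    show "AE x in M. ennreal (\<bar>u x\<bar> powr r x) \<le> ennreal (d / c * m) * ennreal (\<bar>u x / d\<bar> powr r x)"
      using s
    proof eventually_elim
      case (elim x)
      show ?case
      proof (cases "u x = 0")
        case False
        then have cmx: "c powr r x \<le> m" using elim cm by blast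
        have "(d / c) powr r x \<le> (d / c) powr 1" using d d0 c r1 by (intro powr_mono') auto
        then have "(d / c) powr r x * c powr r x \<le> d / c * m"
          using cmx d0 c by (intro mult_mono) auto
        then have "d powr r x \<le> d / c * m" using c d0 by (simp add: powr_divide)
        then have "d powr r x * \<bar>u x / d\<bar> powr r x \<le> d / c * m * \<bar>u x / d\<bar> powr r x" by (rule mult_right_mono) simp
        then have "\<bar>u x\<bar> powr r x \<le> d / c * m * \<bar>u x / d\<bar> powr r x" using d0 by (simp add: powr_divide)
        then show ?thesis using m d0 c by (simp add: ennreal_mult[symmetric] ennreal_leI)
      qed simp
    qed
  qed
  also have "\<dots> = ennreal (d / c * m) * modular M r (\<lambda>x. u x / d)" unfolding modular_def by (rule nn_integral_cmult) measurable
  also have "\<dots> \<le> ennreal (d / c * m) * 1" by (intro mult_left_mono md) simp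
  finally have "ennreal m \<le> ennreal (d / c * m)" using m(1) by (simp add: order_trans)
  then have "m \<le> d / c * m" using d0 c m by (subst (asm) ennreal_le_iff) auto
  then show False using d c m by (simp add: field_simps)
qed

end

text \<open>\<open>sum_norm\<close> asks for an exact decomposition while estimates give f \<le> v +
  w; the pair \<open>min f v\<close> and \<open>f - min f v\<close> is exact and dominated by v and
  w.\<close>

lemma sum_norm_le:
  fixes f v w :: "'a::euclidean_space \<Rightarrow> real"
  assumes pq: "p \<in> borel_measurable lebesgue" "\<And>x. 1 \<le> p x" "q \<in> borel_measurable lebesgue" "\<And>x. 1 \<le> q x"
    and f: "f \<in> borel_measurable lebesgue" "\<And>x. 0 \<le> f x" "AE x in lebesgue. f x \<le> v x + w x"
    and v: "v \<in> Lvar lebesgue p" "\<And>x. 0 \<le> v x" and w: "w \<in> Lvar lebesgue q" "\<And>x. 0 \<le> w x"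
  shows "f \<in> sum_space p q" "sum_norm p q f \<le> luxemburg lebesgue p v + luxemburg lebesgue q w"
proof -
  define v' where "v' x = min (f x) (v x)" for x
  define w' where "w' x = f x - v' x" for x
  have vm: "v \<in> borel_measurable lebesgue" using v(1) by (simp add: Lvar_def)
  have v'm: "v' \<in> borel_measurable lebesgue" unfolding v'_def using f(1) vm by measurable
  have w'm: "w' \<in> borel_measurable lebesgue" unfolding w'_def using f(1) v'm by (rule borel_measurable_diff)
  have v'le: "AE x in lebesgue. \<bar>v' x\<bar> \<le> \<bar>v x\<bar>" using f(2) v(2) by (auto simp: v'_def min_def)
  have w'le: "AE x in lebesgue. \<bar>w' x\<bar> \<le> \<bar>w x\<bar>"
    using f(3)
  proof eventually_elim
    case (elim x) then show ?case using w(2)[of x] by (auto simp: v'_def w'_def min_def)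
  qed
  have L: "v' \<in> Lvar lebesgue p" "w' \<in> Lvar lebesgue q"
    using Lvar_mono[OF pq(1,2) v(1) v'm v'le] Lvar_mono[OF pq(3,4) w(1) w'm w'le] by auto
  have mem: "(v', w') \<in> sum_decomp p q f" using L by (simp add: sum_decomp_def w'_def)
  then show "f \<in> sum_space p q" by (auto simp: sum_space_def)
  have "sum_norm p q f \<le> luxemburg lebesgue p v' + luxemburg lebesgue q w'"
    unfolding sum_norm_def
  proof (rule cINF_lower2[OF _ mem])
    show "bdd_below ((\<lambda>(v, w). luxemburg lebesgue p v + luxemburg lebesgue q w) ` sum_decomp p q f)"
      by (rule bdd_belowI[of _ 0])
         (use luxemburg_nonneg[OF pq(1,2)] luxemburg_nonneg[OF pq(3,4)] in \<open>auto simp: sum_decomp_def\<close>)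
  qed simp
  also have "\<dots> \<le> luxemburg lebesgue p v + luxemburg lebesgue q w"
    by (intro add_mono luxemburg_mono[OF pq(1,2) v(1) v'le] luxemburg_mono[OF pq(3,4) w(1) w'le])
  finally show "sum_norm p q f \<le> luxemburg lebesgue p v + luxemburg lebesgue q w" .
qed

lemma sum_norm_nonneg:
  assumes pq: "p \<in> borel_measurable lebesgue" "\<And>x. 1 \<le> p x" "q \<in> borel_measurable lebesgue" "\<And>x. 1 \<le> q x"
    and f: "f \<in> sum_space p q"
  shows "0 \<le> sum_norm p q f"
  unfolding sum_norm_def
  by (rule cINF_greatest)
     (use f luxemburg_nonneg[OF pq(1,2)] luxemburg_nonneg[OF pq(3,4)] in \<open>auto simp: sum_decomp_def sum_space_def\<close>)

lemma sum_norm_less: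
  assumes f: "f \<in> sum_space p q" "sum_norm p q f < c"
  obtains v w where "v \<in> Lvar lebesgue p" "w \<in> Lvar lebesgue q" "AE x in lebesgue. f x = v x + w x"
    "luxemburg lebesgue p v + luxemburg lebesgue q w < c"
proof -
  have "\<exists>y\<in>(\<lambda>(v, w). luxemburg lebesgue p v + luxemburg lebesgue q w) ` sum_decomp p q f. y < c"
    by (rule cInf_lessD) (use f in \<open>auto simp: sum_norm_def sum_space_def\<close>)
  then show ?thesis using that by (auto simp: sum_decomp_def)
qed

subsection \<open>Signed measures and mass at infinity\<close>

text \<open>The constant sequence \<open>m {}\<close> has to be summable.\<close>

lemma signed_measure_empty: "signed_measure m \<Longrightarrow> m {} = 0"
proof -
  assume "signed_measure m"
  then have "(\<lambda>n. m {}) sums m (\<Union>n::nat. {})"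
    unfolding signed_measure_def by (elim allE[of _ "\<lambda>_. {}"]) (auto simp: disjoint_family_on_def)
  then show "m {} = 0" by (simp add: sums_summable summable_const_iff[THEN iffD1])
qed

lemma signed_measure_Un:
  assumes m: "signed_measure m" and A: "A \<in> sets borel" "B \<in> sets borel" "A \<inter> B = {}"
  shows "m (A \<union> B) = m A + m B"
proof -
  define F where "F n = (if n = 0 then A else if n = Suc 0 then B else {})" for n :: nat
  have "disjoint_family F"
    unfolding disjoint_family_on_def F_def using A(3) by (simp add: Int_commute)
  moreover have "range F \<subseteq> sets borel" using A by (auto simp: F_def)
  ultimately have "(\<lambda>n. m (F n)) sums m (\<Union>n. F n)"
    using m unfolding signed_measure_def by blast
  moreover have "(\<Union>n. F n) = A \<union> B" by (auto simp: F_def split: if_splits)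
  moreover have "(\<lambda>n. m (F n)) sums (\<Sum>n\<in>{0, Suc 0}. m (F n))"
    by (rule sums_finite) (auto simp: F_def signed_measure_empty[OF m])
  ultimately show ?thesis by (auto simp: F_def dest: sums_unique2)
qed

lemma signed_measure_Diff:
  assumes m: "signed_measure m" and A: "A \<in> sets borel" "B \<in> sets borel" "B \<subseteq> A"
  shows "m (A - B) = m A - m B"
  using signed_measure_Un[OF m, of B "A - B"] A by (auto simp: Un_absorb1)

text \<open>The differences \<open>E n - E (Suc n)\<close> partition the first set minus the
  intersection, and their measures telescope.\<close>

lemma signed_measure_decreasing:
  assumes m: "signed_measure m" and E: "\<And>n. E n \<in> sets borel" "\<And>n. E (Suc n) \<subseteq> E n"
  shows "(\<lambda>n. m (E n)) \<longlonglongrightarrow> m (\<Inter>n. E n)"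
proof -
  have dec: "decseq E" using E by (simp add: decseq_SucI)
  have "(\<lambda>n. m (E n - E (Suc n))) sums m (\<Union>n. E n - E (Suc n))"
  proof -
    have "disjoint_family (\<lambda>n. E n - E (Suc n))"
      unfolding disjoint_family_on_def
    proof (intro ballI impI)
      fix i j :: nat assume "i \<noteq> j"
      then have "E j \<subseteq> E (Suc i) \<or> E i \<subseteq> E (Suc j)"
        using decseqD[OF dec, of "Suc i" j] decseqD[OF dec, of "Suc j" i] by linarith
      then show "(E i - E (Suc i)) \<inter> (E j - E (Suc j)) = {}" by auto
    qed
    moreover have "range (\<lambda>n. E n - E (Suc n)) \<subseteq> sets borel"
      using E(1) by (intro image_subsetI sets.Diff)
    ultimately show ?thesis using m[unfolded signed_measure_def, rule_format] by simp
  qed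
  moreover have "(\<Union>n. E n - E (Suc n)) = E 0 - (\<Inter>n. E n)"
  proof (rule set_eqI)
    fix x
    show "x \<in> (\<Union>n. E n - E (Suc n)) \<longleftrightarrow> x \<in> E 0 - (\<Inter>n. E n)"
    proof
      assume "x \<in> E 0 - (\<Inter>n. E n)"
      then have x: "x \<in> E 0" "\<exists>n. x \<notin> E n" by auto
      define n where "n = (LEAST n. x \<notin> E n)"
      have n: "x \<notin> E n" unfolding n_def using x(2) by (rule LeastI_ex)
      then obtain k where k: "n = Suc k" using x(1) by (cases n) auto
      then have "x \<in> E k" using not_less_Least[of k "\<lambda>n. x \<notin> E n"] by (auto simp: n_def)
      then show "x \<in> (\<Union>n. E n - E (Suc n))" using n k by auto
    qed (use dec in \<open>auto simp: decseq_def\<close>)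
  qed
  moreover have "m (E n - E (Suc n)) = m (E n) - m (E (Suc n))" for n
    by (rule signed_measure_Diff[OF m]) (use E in auto)
  moreover have "m (E 0 - (\<Inter>n. E n)) = m (E 0) - m (\<Inter>n. E n)"
    by (rule signed_measure_Diff[OF m]) (use E in auto)
  ultimately have "(\<lambda>n. \<Sum>i<n. m (E i) - m (E (Suc i))) \<longlonglongrightarrow> m (E 0) - m (\<Inter>n. E n)"
    by (simp add: sums_def)
  then have "(\<lambda>n. m (E 0) - m (E n)) \<longlonglongrightarrow> m (E 0) - m (\<Inter>n. E n)"
    by (simp add: sum_lessThan_telescope'[of "\<lambda>n. m (E n)"])
  from tendsto_diff[OF tendsto_const[of "m (E 0)"] this]
  show ?thesis unfolding diff_diff_eq2 add_diff_cancel_left' .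
qed

lemma signed_measure_uminus: "signed_measure m \<Longrightarrow> signed_measure (\<lambda>E. - m E)"
  unfolding signed_measure_def by (auto intro: sums_minus)

text \<open>A set with subsets of arbitrarily large measure contains one with the same property and
  with |m| as large as desired; iterating gives a decreasing sequence with |m (E n)| \<ge> n,
  against continuity from above.\<close>

lemma signed_measure_bounded_above:
  fixes m :: "'a::euclidean_space set \<Rightarrow> real"
  assumes m: "signed_measure m"
  obtains C where "\<And>B. B \<in> sets borel \<Longrightarrow> m B \<le> C"
proof -
  define unb where "unb E \<longleftrightarrow> E \<in> sets borel \<and> (\<forall>C. \<exists>B\<in>sets borel. B \<subseteq> E \<and> m B > C)" for E
  have step: "\<exists>E'. unb E' \<and> E' \<subseteq> E \<and> \<bar>m E'\<bar> \<ge> K" if E: "unb E" for E K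
  proof -
    \<comment> \<open>The margin |m E| + |K| makes both B and E - B large in absolute value, so it
      does not matter which of them inherits the unboundedness.\<close>
    obtain B where B: "B \<in> sets borel" "B \<subseteq> E" "m B > \<bar>m E\<bar> + \<bar>K\<bar>" using E unfolding unb_def by blast
    have Eb: "E \<in> sets borel" using E by (simp add: unb_def)
    have d: "m (E - B) = m E - m B" using signed_measure_Diff[OF m Eb B(1,2)] .
    have "unb B \<or> unb (E - B)"
    proof (rule ccontr)
      assume "\<not> (unb B \<or> unb (E - B))"
      moreover have "E - B \<in> sets borel" using B Eb by auto
      ultimately have "\<exists>C. \<forall>D\<in>sets borel. D \<subseteq> B \<longrightarrow> m D \<le> C" "\<exists>C. \<forall>D\<in>sets borel. D \<subseteq> E - B \<longrightarrow> m D \<le> C"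
        using B(1) unfolding unb_def by (meson not_le)+
      then obtain C1 C2 where C: "\<forall>D\<in>sets borel. D \<subseteq> B \<longrightarrow> m D \<le> C1" "\<forall>D\<in>sets borel. D \<subseteq> E - B \<longrightarrow> m D \<le> C2"
        by blast
      obtain D where D: "D \<in> sets borel" "D \<subseteq> E" "m D > C1 + C2" using E unfolding unb_def by blast
      have DB: "D \<inter> B \<in> sets borel" "D - B \<in> sets borel" using D B by auto
      have "m (D \<inter> B \<union> (D - B)) = m (D \<inter> B) + m (D - B)"
        by (rule signed_measure_Un[OF m DB]) blast
      then have "m D = m (D \<inter> B) + m (D - B)" by (simp add: Int_Diff_Un)
      moreover have "m (D \<inter> B) \<le> C1" by (rule C(1)[rule_format, OF DB(1)]) simp
      moreover have "m (D - B) \<le> C2" by (rule C(2)[rule_format, OF DB(2)]) (use D(2) in auto)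
      ultimately show False using D by simp
    qed
    moreover have "\<bar>m B\<bar> \<ge> K" using B(3) by linarith
    moreover have "\<bar>m (E - B)\<bar> \<ge> K" unfolding d using B(3) by linarith
    ultimately show ?thesis using B(2) by (metis Diff_subset)
  qed
  have "\<not> unb UNIV"
  proof
    assume U: "unb UNIV"
    have "\<exists>E. \<forall>n. (unb (E n) \<and> \<bar>m (E n)\<bar> \<ge> real n) \<and> E (Suc n) \<subseteq> E n"
    proof (rule dependent_nat_choice)
      show "\<exists>x. unb x \<and> real 0 \<le> \<bar>m x\<bar>" using U by auto
    next
      fix x n assume "unb x \<and> real n \<le> \<bar>m x\<bar>"
      then show "\<exists>y. (unb y \<and> real (Suc n) \<le> \<bar>m y\<bar>) \<and> y \<subseteq> x" using step[of x "real (Suc n)"] by blast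
    qed
    then obtain E where E: "\<And>n. unb (E n)" "\<And>n. \<bar>m (E n)\<bar> \<ge> real n" "\<And>n. E (Suc n) \<subseteq> E n" by blast
    have "(\<lambda>n. m (E n)) \<longlonglongrightarrow> m (\<Inter>n. E n)"
      by (rule signed_measure_decreasing[OF m]) (use E in \<open>auto simp: unb_def\<close>)
    then have "Bseq (\<lambda>n. m (E n))" by (rule convergent_imp_Bseq[OF convergentI])
    then obtain K where K: "\<And>n. \<bar>m (E n)\<bar> \<le> K" by (auto simp: Bseq_def)
    obtain n where "real n > K" using reals_Archimedean2 by blast
    then show False using K[of n] E(2)[of n] by linarith
  qed
  then have "\<exists>C. \<forall>B\<in>sets borel. m B \<le> C" unfolding unb_def by (simp add: not_less)
  then show ?thesis using that by blast
qed

lemma ennreal_add_le: "ennreal (c + d) \<le> ennreal c + ennreal d"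
  by (cases "0 \<le> c"; cases "0 \<le> d")
     (auto simp flip: ennreal_plus simp: ennreal_neg intro!: ennreal_leI)

text \<open>The set function inside \<open>pos_variation\<close>, studied on its own because
  \<open>measure_of\<close> returns it only once it is known to be countably additive.\<close>

definition upper_variation :: "('a::euclidean_space set \<Rightarrow> real) \<Rightarrow> 'a set \<Rightarrow> ennreal" where
  "upper_variation m E = (SUP B\<in>{B \<in> sets borel. B \<subseteq> E}. ennreal (m B))"

lemma upper_variation_upper: "B \<in> sets borel \<Longrightarrow> B \<subseteq> E \<Longrightarrow> ennreal (m B) \<le> upper_variation m E"
  unfolding upper_variation_def by (rule SUP_upper) auto

lemma upper_variation_mono: "E \<subseteq> E' \<Longrightarrow> upper_variation m E \<le> upper_variation m E'"
  unfolding upper_variation_def by (rule SUP_subset_mono) auto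

lemma upper_variation_finite: "signed_measure m \<Longrightarrow> upper_variation m E < \<infinity>"
proof -
  assume m: "signed_measure m"
  obtain C where C: "\<And>B. B \<in> sets borel \<Longrightarrow> m B \<le> C" using signed_measure_bounded_above[OF m] by blast
  have "upper_variation m E \<le> ennreal C" unfolding upper_variation_def by (rule SUP_least) (use C in \<open>auto intro: ennreal_leI\<close>)
  then show ?thesis by (simp add: le_less_trans)
qed

text \<open>Subsets of A and of B have disjoint unions, whose measures add. A negative measure
  counts as 0, and then the other set alone gives the bound.\<close>

lemma upper_variation_add_le:
  assumes m: "signed_measure m" and AB: "A \<inter> B = {}"
  shows "upper_variation m A + upper_variation m B \<le> upper_variation m (A \<union> B)"
proof -
  have e: "ennreal (m D) + ennreal (m E) \<le> upper_variation m (A \<union> B)"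
    if D: "D \<in> sets borel" "D \<subseteq> A" "E \<in> sets borel" "E \<subseteq> B" for D E
  proof -
    have "m (D \<union> E) = m D + m E" using D AB by (intro signed_measure_Un[OF m]) auto
    moreover have "ennreal (m (D \<union> E)) \<le> upper_variation m (A \<union> B)" "ennreal (m D) \<le> upper_variation m (A \<union> B)" "ennreal (m E) \<le> upper_variation m (A \<union> B)"
      using D by (auto intro!: upper_variation_upper)
    ultimately show ?thesis
      by (cases "0 \<le> m D"; cases "0 \<le> m E") (auto simp: ennreal_plus[symmetric] ennreal_neg simp del: ennreal_plus)
  qed
  have "upper_variation m A + upper_variation m B = (SUP D\<in>{D \<in> sets borel. D \<subseteq> A}. ennreal (m D) + upper_variation m B)"
    unfolding upper_variation_def[of m A] by (rule ennreal_SUP_add_left[symmetric]) (use upper_variation_finite[of m] in auto)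
  also have "\<dots> \<le> upper_variation m (A \<union> B)"
  proof (rule SUP_least)
    fix D assume D: "D \<in> {D \<in> sets borel. D \<subseteq> A}"
    have "ennreal (m D) + upper_variation m B = (SUP E\<in>{E \<in> sets borel. E \<subseteq> B}. ennreal (m D) + ennreal (m E))"
      unfolding upper_variation_def[of m B] by (subst ennreal_SUP_add_right) auto
    also have "\<dots> \<le> upper_variation m (A \<union> B)" by (rule SUP_least) (use D e in auto)
    finally show "ennreal (m D) + upper_variation m B \<le> upper_variation m (A \<union> B)" .
  qed
  finally show ?thesis .
qed

lemma upper_variation_sum_le:
  fixes F :: "nat \<Rightarrow> 'a::euclidean_space set"
  assumes m: "signed_measure m" and F: "disjoint_family F"
  shows "(\<Sum>i<n. upper_variation m (F i)) \<le> upper_variation m (\<Union>i<n. F i)"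
proof (induction n)
  case (Suc n)
  have "(\<Sum>i<Suc n. upper_variation m (F i)) \<le> upper_variation m (\<Union>i<n. F i) + upper_variation m (F n)" using Suc by (simp add: add_right_mono)
  also have "\<dots> \<le> upper_variation m ((\<Union>i<n. F i) \<union> F n)"
  proof (rule upper_variation_add_le[OF m])
    have "F i \<inter> F n = {}" if "i < n" for i using F that by (simp add: disjoint_family_on_def)
    then show "(\<Union>i<n. F i) \<inter> F n = {}" by blast
  qed
  also have "(\<Union>i<n. F i) \<union> F n = (\<Union>i<Suc n. F i)" by (auto simp: lessThan_Suc)
  finally show ?case .
qed simp

text \<open>One inequality is finite superadditivity. For the other a set B in the union is cut
  along the F i; \<open>m\<close> is countably additive and each piece is bounded by the variation
  of its F i.\<close>

lemma upper_variation_countably_additive: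
  assumes m: "signed_measure m"
  shows "countably_additive (sets borel) (upper_variation m)"
  unfolding countably_additive_def
proof (intro allI impI antisym)
  fix F :: "nat \<Rightarrow> 'a set" assume F: "range F \<subseteq> sets borel" "disjoint_family F" "(\<Union>i. F i) \<in> sets borel"
  show "(\<Sum>i. upper_variation m (F i)) \<le> upper_variation m (\<Union>i. F i)"
  proof (rule suminf_le_const)
    show "(\<Sum>i<n. upper_variation m (F i)) \<le> upper_variation m (\<Union>i. F i)" for n
      by (rule order_trans[OF upper_variation_sum_le[OF m F(2)]]) (auto intro: upper_variation_mono)
  qed simp
  show "upper_variation m (\<Union>i. F i) \<le> (\<Sum>i. upper_variation m (F i))"
    unfolding upper_variation_def[of m "\<Union>i. F i"]
  proof (rule SUP_least)
    fix B assume B: "B \<in> {B \<in> sets borel. B \<subseteq> (\<Union>i. F i)}"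
    have "(\<lambda>i. m (B \<inter> F i)) sums m (\<Union>i. B \<inter> F i)"
    proof -
      have "range (\<lambda>i. B \<inter> F i) \<subseteq> sets borel" using B F by auto
      moreover have "disjoint_family (\<lambda>i. B \<inter> F i)" using F(2) by (auto simp: disjoint_family_on_def)
      ultimately show ?thesis using m unfolding signed_measure_def by blast
    qed
    moreover have "(\<Union>i. B \<inter> F i) = B" using B by auto
    ultimately have "(\<lambda>n. ennreal (\<Sum>i<n. m (B \<inter> F i))) \<longlonglongrightarrow> ennreal (m B)"
      by (intro tendsto_ennrealI) (simp add: sums_def)
    moreover have "ennreal (\<Sum>i<n. m (B \<inter> F i)) \<le> (\<Sum>i. upper_variation m (F i))" for n
    proof -
      have "ennreal (\<Sum>i<n. m (B \<inter> F i)) \<le> (\<Sum>i<n. ennreal (m (B \<inter> F i)))"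
      proof (induction n)
        case (Suc n)
        have "ennreal (\<Sum>i<Suc n. m (B \<inter> F i)) \<le> ennreal (\<Sum>i<n. m (B \<inter> F i)) + ennreal (m (B \<inter> F n))"
          unfolding sum.lessThan_Suc by (rule ennreal_add_le)
        then show ?case using Suc by (simp add: order_trans[OF _ add_right_mono])
      qed simp
      also have "\<dots> \<le> (\<Sum>i<n. upper_variation m (F i))" using B F by (intro sum_mono upper_variation_upper) auto
      also have "\<dots> \<le> (\<Sum>i. upper_variation m (F i))" by (rule sum_le_suminf) auto
      finally show ?thesis .
    qed
    ultimately show "ennreal (m B) \<le> (\<Sum>i. upper_variation m (F i))" by (auto intro: LIMSEQ_le_const2)
  qed
qed

lemma sets_pos_variation: "sets (pos_variation m) = sets borel"
  unfolding pos_variation_def using sets.sigma_sets_eq[of "borel :: 'a measure"] by simp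

lemma space_pos_variation: "space (pos_variation m) = UNIV"
  unfolding pos_variation_def by simp

lemma emeasure_pos_variation:
  assumes m: "signed_measure m" and E: "E \<in> sets borel"
  shows "emeasure (pos_variation m) E = (SUP B\<in>{B \<in> sets borel. B \<subseteq> E}. ennreal (m B))"
proof -
  have "emeasure (pos_variation m) E = upper_variation m E"
  proof (rule emeasure_measure_of)
    show "pos_variation m = measure_of UNIV (sets borel) (upper_variation m)" by (simp add: pos_variation_def upper_variation_def[abs_def])
    have "upper_variation m {} = 0"
    proof -
      have "{B \<in> sets borel. B \<subseteq> {}} = {{} :: 'a set}" by auto
      then show ?thesis unfolding upper_variation_def by (simp add: signed_measure_empty[OF m])
    qed
    then show "positive (sets (pos_variation m)) (upper_variation m)" by (simp add: positive_def)
    show "countably_additive (sets (pos_variation m)) (upper_variation m)" using upper_variation_countably_additive[OF m] sets_pos_variation[of m] by simp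
  qed (use E sets_pos_variation in auto)
  then show ?thesis by (simp add: upper_variation_def)
qed

lemma finite_measure_pos_variation: "signed_measure m \<Longrightarrow> finite_measure (pos_variation m)"
proof (rule finite_measureI)
  assume m: "signed_measure m"
  have "emeasure (pos_variation m) UNIV = upper_variation m UNIV"
    unfolding upper_variation_def by (rule emeasure_pos_variation[OF m]) simp
  then show "emeasure (pos_variation m) (space (pos_variation m)) \<noteq> \<infinity>"
    using upper_variation_finite[OF m, of UNIV] by (simp add: space_pos_variation)
qed

text \<open>Passing to complements, m B = m UNIV - m (UNIV - B), turns upper bounds for the one
  variation into upper bounds for the other, in both directions.\<close>

lemma measure_pos_variation:
  assumes m: "signed_measure m"
  shows "measure (pos_variation m) UNIV - measure (pos_variation (\<lambda>E. - m E)) UNIV = m UNIV"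
proof -
  note m' = signed_measure_uminus[OF m]
  let ?p = "measure (pos_variation m) UNIV" and ?n = "measure (pos_variation (\<lambda>E. - m E)) UNIV"
  have sup: "emeasure (pos_variation k) UNIV = (SUP B\<in>sets borel. ennreal (k B))" if "signed_measure k" for k :: "'a set \<Rightarrow> real"
    using emeasure_pos_variation[OF that, of UNIV] by simp
  have em: "emeasure (pos_variation k) UNIV = ennreal (measure (pos_variation k) UNIV)" if "signed_measure k" for k :: "'a set \<Rightarrow> real"
    using finite_measure.emeasure_eq_measure[OF finite_measure_pos_variation[OF that]] .
  have up: "k B \<le> measure (pos_variation k) UNIV" if k: "signed_measure k" and B: "B \<in> sets borel" for k :: "'a set \<Rightarrow> real" and B
  proof -
    have "ennreal (k B) \<le> ennreal (measure (pos_variation k) UNIV)"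
      unfolding em[OF k, symmetric] sup[OF k] by (rule SUP_upper) (use B in auto)
    then have "k B \<le> measure (pos_variation k) UNIV \<or> k B \<le> 0" by (auto simp: ennreal_le_iff2)
    then show ?thesis using measure_nonneg[of "pos_variation k" UNIV] by linarith
  qed
  have lub: "measure (pos_variation k) UNIV \<le> c" if k: "signed_measure k" and c: "\<And>B. B \<in> sets borel \<Longrightarrow> k B \<le> c" for k :: "'a set \<Rightarrow> real" and c
  proof -
    have "0 \<le> c" using c[of "{}"] signed_measure_empty[OF k] by simp
    moreover have "ennreal (measure (pos_variation k) UNIV) \<le> ennreal c"
      unfolding em[OF k, symmetric] sup[OF k] by (rule SUP_least) (use c in \<open>auto intro: ennreal_leI\<close>)
    ultimately show ?thesis by simp
  qed
  have compl: "m (UNIV - B) = m UNIV - m B" if "B \<in> sets borel" for B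
    using signed_measure_Diff[OF m, of UNIV B] that by auto
  have "?p \<le> m UNIV + ?n"
  proof (rule lub[OF m])
    fix B :: "'a set" assume "B \<in> sets borel"
    then show "m B \<le> m UNIV + ?n" using up[OF m', of "UNIV - B"] compl[of B] by simp
  qed
  moreover have "?n \<le> ?p - m UNIV"
  proof (rule lub[OF m'])
    fix B :: "'a set" assume "B \<in> sets borel"
    then show "- m B \<le> ?p - m UNIV" using up[OF m, of "UNIV - B"] compl[of B] by simp
  qed
  ultimately show ?thesis by simp
qed

text \<open>Both variations are finite, so dominated convergence applies to each, and their total
  masses differ by m UNIV.\<close>

lemma signed_integral_tendsto_mass:
  fixes \<phi> :: "nat \<Rightarrow> 'a::euclidean_space \<Rightarrow> real"
  assumes m: "signed_measure m"
    and \<phi>: "\<And>n. continuous_on UNIV (\<phi> n)" "\<And>n x. \<bar>\<phi> n x\<bar> \<le> 1" "\<And>x. (\<lambda>n. \<phi> n x) \<longlonglongrightarrow> 1"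
  shows "(\<lambda>n. signed_integral m (\<phi> n)) \<longlonglongrightarrow> m UNIV"
proof -
  have *: "(\<lambda>n. LINT x|pos_variation k. \<phi> n x) \<longlonglongrightarrow> measure (pos_variation k) UNIV" if k: "signed_measure k" for k
  proof -
    interpret finite_measure "pos_variation k" using k by (rule finite_measure_pos_variation)
    have meas: "\<phi> n \<in> borel_measurable (pos_variation k)" for n
    proof -
      have "\<phi> n \<in> borel_measurable borel" using \<phi>(1) by (rule borel_measurable_continuous_onI)
      then show ?thesis using measurable_cong_sets[OF sets_pos_variation refl] by blast
    qed
    have "(\<lambda>n. LINT x|pos_variation k. \<phi> n x) \<longlonglongrightarrow> (LINT x|pos_variation k. 1)"
      by (rule integral_dominated_convergence[where w="\<lambda>_. 1"]) (use meas \<phi> in auto)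
    then show ?thesis by (simp add: space_pos_variation)
  qed
  show ?thesis
    unfolding signed_integral_def measure_pos_variation[OF m, symmetric]
    by (intro tendsto_diff * m signed_measure_uminus)
qed

text \<open>Continuity and bounded support are what testing on the space of continuous functions
  vanishing at infinity requires; \<open>bump\<close> serves where derivatives are taken.\<close>

definition cutoff :: "real \<Rightarrow> 'a::euclidean_space \<Rightarrow> real" where
  "cutoff R x = max 0 (min 1 (R + 1 - norm x))"

lemma cutoff_bounds: "0 \<le> cutoff R x" "cutoff R x \<le> 1"
  by (auto simp: cutoff_def)

lemma abs_cutoff_le: "\<bar>cutoff R x\<bar> \<le> 1"
  by (auto simp: cutoff_def)

lemma cutoff_eq_1: "norm x \<le> R \<Longrightarrow> cutoff R x = 1"
  by (auto simp: cutoff_def)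

lemma cutoff_eq_0: "R + 1 \<le> norm x \<Longrightarrow> cutoff R x = 0"
  by (auto simp: cutoff_def)

lemma continuous_cutoff: "continuous_on UNIV (cutoff R)"
  unfolding cutoff_def by (intro continuous_intros)

lemma cutoff_at_infinity: "(cutoff R \<longlongrightarrow> 0) at_infinity"
proof (rule tendsto_eventually)
  show "\<forall>\<^sub>F x in at_infinity. cutoff R x = 0"
    unfolding eventually_at_infinity by (rule exI[of _ "R + 1"]) (auto intro: cutoff_eq_0)
qed

lemma measurable_cutoff [measurable]: "cutoff R \<in> borel_measurable borel"
  by (rule borel_measurable_continuous_onI) (rule continuous_cutoff)

lemma cutoff_tendsto_1: "(\<lambda>n. cutoff (real n) x) \<longlonglongrightarrow> 1"
proof (rule tendsto_eventually)
  obtain n0 where "norm x \<le> real n0" using real_arch_simple by blast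
  then show "\<forall>\<^sub>F n in sequentially. cutoff (real n) x = 1"
    unfolding eventually_sequentially by (intro exI[of _ n0]) (auto intro!: cutoff_eq_1)
qed

lemma integrable_bounded_mult:
  fixes f g :: "'b \<Rightarrow> real"
  assumes f: "f \<in> borel_measurable M" "\<And>x. \<bar>f x\<bar> \<le> C" and g: "integrable M g"
  shows "integrable M (\<lambda>x. f x * g x)"
proof (rule Bochner_Integration.integrable_bound[of M "\<lambda>x. C * g x"])
  show "AE x in M. norm (f x * g x) \<le> norm (C * g x)"
  proof (rule AE_I2)
    fix x
    have "\<bar>f x\<bar> \<le> \<bar>C\<bar>" using f(2)[of x] by linarith
    then show "norm (f x * g x) \<le> norm (C * g x)" by (simp add: abs_mult mult_right_mono)
  qed
qed (use f g in auto)

text \<open>If the integrals were unbounded, so would be those against some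
  \<open>\<Sum>k. 2\<^bsup>-k\<^esup> cutoff (\<rho> k)\<close>, which belongs to \<open>C\<^sub>0\<close>.\<close>

lemma weak_star_converges_bounded:
  fixes g :: "nat \<Rightarrow> 'a::euclidean_space \<Rightarrow> real"
  assumes ws: "weak_star_converges g m" and nonneg: "\<And>n. AE x in lebesgue. 0 \<le> g n x"
  obtains C where "\<And>n. (LINT x|lebesgue. g n x) \<le> C"
proof (rule ccontr)
  assume "\<not> thesis"
  then have unb: "\<exists>n. (LINT x|lebesgue. g n x) > C" for C using that by (meson not_le)
  have int: "integrable lebesgue (g n)" for n using ws by (simp add: weak_star_converges_def)
  have cm: "cutoff R \<in> borel_measurable lebesgue" for R :: real
    by (rule measurable_completion) simp
  have icut: "integrable lebesgue (\<lambda>x. cutoff R x * g n x)" for R n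
    by (rule integrable_bounded_mult[where C=1]) (use cm abs_cutoff_le int in auto)
  have lim: "(\<lambda>R. LINT x|lebesgue. cutoff (real R) x * g n x) \<longlonglongrightarrow> (LINT x|lebesgue. g n x)" for n
  proof (rule integral_dominated_convergence[where w="\<lambda>x. \<bar>g n x\<bar>"])
    show "AE x in lebesgue. (\<lambda>R. cutoff (real R) x * g n x) \<longlonglongrightarrow> g n x"
      using tendsto_mult[OF cutoff_tendsto_1 tendsto_const] by force
    show "AE x in lebesgue. norm (cutoff (real R) x * g n x) \<le> \<bar>g n x\<bar>" for R
      by (rule AE_I2) (simp add: abs_mult mult_left_le_one_le abs_cutoff_le)
  qed (use int icut borel_measurable_integrable in auto)
  \<comment> \<open>The k-th weight is 2^(-k), so 4^k leaves a contribution of at least 2^k from the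
    k-th term alone; the other terms are nonnegative.\<close>
  have "\<exists>n \<rho>. (LINT x|lebesgue. cutoff (real \<rho>) x * g n x) > 4 ^ k" for k :: nat
  proof -
    obtain n where "(LINT x|lebesgue. g n x) > 4 ^ k" using unb by blast
    then have "\<forall>\<^sub>F R in sequentially. (LINT x|lebesgue. cutoff (real R) x * g n x) > 4 ^ k"
      using lim[of n] order_tendstoD(1) by blast
    then show ?thesis using eventually_happens'[OF sequentially_bot] by blast
  qed
  then obtain n \<rho> where n\<rho>: "\<And>k. (LINT x|lebesgue. cutoff (real (\<rho> k)) x * g (n k) x) > 4 ^ k" by metis
  define \<phi> where "\<phi> x = (\<Sum>k. (1/2) ^ k * cutoff (real (\<rho> k)) x)" for x :: 'a
  have bnd: "\<bar>(1/2) ^ k * cutoff (real (\<rho> k)) x\<bar> \<le> (1/2) ^ k" for k and x :: 'a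
    by (auto simp: abs_mult mult_left_le abs_cutoff_le)
  have sg: "summable (\<lambda>k. (1/2::real) ^ k)" by (rule summable_geometric) simp
  have sm: "summable (\<lambda>k. (1/2) ^ k * cutoff (real (\<rho> k)) x)" for x :: 'a
    by (rule summable_comparison_test'[OF sg]) (use bnd in auto)
  have unif: "uniform_limit UNIV (\<lambda>K x. \<Sum>k<K. (1/2) ^ k * cutoff (real (\<rho> k)) x) \<phi> sequentially"
    unfolding \<phi>_def by (rule Weierstrass_m_test[OF _ sg]) (use bnd in auto)
  have cont: "continuous_on UNIV \<phi>"
    by (rule uniform_limit_theorem[OF _ unif]) 
       (auto intro!: always_eventually continuous_intros continuous_on_sum continuous_cutoff)
  have van: "(\<phi> \<longlongrightarrow> 0) at_infinity"
  proof (rule tendstoI)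
    fix e :: real assume e: "e > 0"
    obtain K where K: "\<And>x. dist (\<Sum>k<K. (1/2) ^ k * cutoff (real (\<rho> k)) x) (\<phi> x) < e / 2"
      using uniform_limitD[OF unif, of "e/2"] e eventually_happens'[OF sequentially_bot] by auto
    have "((\<lambda>x. \<Sum>k<K. (1/2) ^ k * cutoff (real (\<rho> k)) x) \<longlongrightarrow> 0) (at_infinity :: 'a filter)"
      by (intro tendsto_null_sum tendsto_mult_right_zero cutoff_at_infinity)
    then have "\<forall>\<^sub>F x in (at_infinity :: 'a filter). dist (\<Sum>k<K. (1/2) ^ k * cutoff (real (\<rho> k)) x) 0 < e / 2"
      by (rule tendstoD) (use e in simp)
    then show "\<forall>\<^sub>F x in (at_infinity :: 'a filter). dist (\<phi> x) 0 < e"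
    proof eventually_elim
      case (elim x)
      then show ?case using K[of x] unfolding dist_real_def by linarith
    qed
  qed
  have "(\<lambda>i. LINT x|lebesgue. \<phi> x * g i x) \<longlonglongrightarrow> signed_integral m \<phi>"
    using ws cont van by (auto simp: weak_star_converges_def)
  then have "Bseq (\<lambda>i. LINT x|lebesgue. \<phi> x * g i x)" by (rule convergent_imp_Bseq[OF convergentI])
  then obtain K where K: "\<And>i. \<bar>LINT x|lebesgue. \<phi> x * g i x\<bar> \<le> K" by (auto simp: Bseq_def)
  have \<phi>b: "\<bar>\<phi> x\<bar> \<le> 2" for x
  proof -
    have "\<bar>\<phi> x\<bar> \<le> (\<Sum>k. (1/2) ^ k)" unfolding \<phi>_def real_norm_def[symmetric]
      by (rule norm_suminf_le[OF _ sg]) (use bnd in auto)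
    then show ?thesis using suminf_geometric[of "1/2::real"] by simp
  qed
  have \<phi>m: "\<phi> \<in> borel_measurable lebesgue"
    by (rule measurable_completion) (use cont borel_measurable_continuous_onI in auto)
  have "2 ^ k \<le> K" for k :: nat
  proof -
    have i\<phi>: "integrable lebesgue (\<lambda>x. \<phi> x * g (n k) x)"
      using \<phi>m \<phi>b int by (rule integrable_bounded_mult)
    have "2 ^ k = (1/2::real) ^ k * 4 ^ k" by (simp add: power_mult_distrib[symmetric])
    also have "\<dots> \<le> (1/2) ^ k * (LINT x|lebesgue. cutoff (real (\<rho> k)) x * g (n k) x)"
      using n\<rho>[of k] by (intro mult_left_mono) auto
    also have "\<dots> = (LINT x|lebesgue. (1/2) ^ k * (cutoff (real (\<rho> k)) x * g (n k) x))" by simp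
    also have "\<dots> \<le> (LINT x|lebesgue. \<phi> x * g (n k) x)"
    proof (rule integral_mono_AE)
      show "AE x in lebesgue. (1/2) ^ k * (cutoff (real (\<rho> k)) x * g (n k) x) \<le> \<phi> x * g (n k) x"
        using nonneg[of "n k"]
      proof eventually_elim
        case (elim x)
        have "(1/2) ^ k * cutoff (real (\<rho> k)) x = (\<Sum>i\<in>{k}. (1/2) ^ i * cutoff (real (\<rho> i)) x)" by simp
        also have "\<dots> \<le> \<phi> x"
          unfolding \<phi>_def by (rule sum_le_suminf[OF sm]) (auto simp: cutoff_bounds intro!: mult_nonneg_nonneg)
        finally show ?case using elim by (simp add: mult.assoc[symmetric] mult_right_mono)
      qed
    qed (use icut i\<phi> in auto)
    finally show ?thesis using K[of "n k"] by linarith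
  qed
  moreover obtain k :: nat where "2 ^ k > K" using real_arch_pow[of 2 K] by auto
  ultimately show False by (meson not_le)
qed

text \<open>The tails decrease in R, so the limit in the definition exists and is the infimum;
  without existence \<open>Lim\<close> would carry no information.\<close>

lemma mass_at_infinity_props:
  fixes g :: "nat \<Rightarrow> 'a::euclidean_space \<Rightarrow> real"
  assumes int: "\<And>n. integrable lebesgue (g n)" and nonneg: "\<And>n. AE x in lebesgue. 0 \<le> g n x"
    and C: "\<And>n. (LINT x|lebesgue. g n x) \<le> C"
  defines "T \<equiv> \<lambda>R::real. limsup (\<lambda>n. ereal (LINT x:{x. norm x > R}|lebesgue. g n x))"
  shows "(T \<longlongrightarrow> mass_at_infinity g) at_top"
    and "mass_at_infinity g \<le> T R" and "0 \<le> mass_at_infinity g" and "mass_at_infinity g < \<infinity>"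
proof -
  have sm: "{x::'a. norm x > R} \<in> sets lebesgue" for R
    by (rule sets_completionI_sets) (auto intro: borel_measurable_pred_less)
  have si: "set_integrable lebesgue {x::'a. norm x > R} (g n)" for R n
    using integrable_mult_indicator[OF sm int] by (simp add: set_integrable_def)
  have anti: "(LINT x:{x. norm x > R'}|lebesgue. g n x) \<le> (LINT x:{x. norm x > R}|lebesgue. g n x)" if "R \<le> R'" for R R' n
    unfolding set_lebesgue_integral_def
    by (rule integral_mono_AE) 
       (use si nonneg[of n] that in \<open>auto simp: set_integrable_def indicator_def elim!: eventually_mono\<close>)
  have le: "(LINT x:{x. norm x > R}|lebesgue. g n x) \<le> C" for R n
  proof -
    have "(LINT x:{x. norm x > R}|lebesgue. g n x) \<le> (LINT x|lebesgue. g n x)"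
      unfolding set_lebesgue_integral_def
      by (rule integral_mono_AE) 
         (use si int nonneg[of n] in \<open>auto simp: set_integrable_def indicator_def elim!: eventually_mono\<close>)
    then show ?thesis using C[of n] by linarith
  qed
  have ge: "0 \<le> (LINT x:{x. norm x > R}|lebesgue. g n x)" for R n
    unfolding set_lebesgue_integral_def
    by (rule integral_nonneg_AE) (use nonneg[of n] in \<open>auto simp: indicator_def elim!: eventually_mono\<close>)
  have Tanti: "T R' \<le> T R" if "R \<le> R'" for R R'
    unfolding T_def by (rule Limsup_mono) (use anti that in auto)
  have T0: "0 \<le> T R" for R unfolding T_def
    by (rule le_Limsup) (use ge in \<open>auto simp: zero_ereal_def\<close>)
  have TC: "T R \<le> ereal C" for R unfolding T_def
    by (rule Limsup_bounded) (use le in auto)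
  have lim: "(T \<longlongrightarrow> (INF R. T R)) at_top"
  proof (rule order_tendstoI)
    fix a assume "a < (INF R. T R)"
    then show "\<forall>\<^sub>F R in at_top. a < T R" by (auto intro!: always_eventually elim: less_le_trans[OF _ INF_lower])
  next
    fix a assume "(INF R. T R) < a"
    then obtain R where R: "T R < a" by (auto simp: INF_less_iff)
    show "\<forall>\<^sub>F R in at_top. T R < a"
      using eventually_ge_at_top[of R] by eventually_elim (use R Tanti in \<open>auto intro: le_less_trans\<close>)
  qed
  have eq: "mass_at_infinity g = (INF R. T R)"
    unfolding mass_at_infinity_def T_def[symmetric] using lim by (intro tendsto_Lim) auto
  show "(T \<longlongrightarrow> mass_at_infinity g) at_top" using lim eq by simp
  show "mass_at_infinity g \<le> T R" unfolding eq by (rule INF_lower) simp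
  show "0 \<le> mass_at_infinity g" unfolding eq by (rule INF_greatest) (rule T0)
  have "mass_at_infinity g \<le> ereal C" unfolding eq by (rule INF_lower2[of 0]) (use TC in auto)
  then show "mass_at_infinity g < \<infinity>" by auto
qed

text \<open>The part cut off at R converges by weak-star convergence, so the limsup of the sum
  splits. The remainder lies between the masses outside the balls of radius R + 1 and R; then R
  tends to infinity.\<close>

proposition limsup_total_mass:
  fixes g :: "nat \<Rightarrow> 'a::euclidean_space \<Rightarrow> real"
  assumes ws: "weak_star_converges g m" and nonneg: "\<And>n. AE x in lebesgue. 0 \<le> g n x"
  shows "limsup (\<lambda>n. ereal (LINT x|lebesgue. g n x)) = ereal (m UNIV) + mass_at_infinity g"
proof -
  obtain C where C: "\<And>n. (LINT x|lebesgue. g n x) \<le> C"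
    using weak_star_converges_bounded[OF ws nonneg] by blast
  have int: "integrable lebesgue (g n)" for n using ws by (simp add: weak_star_converges_def)
  have m: "signed_measure m" using ws by (simp add: weak_star_converges_def)
  have cm: "cutoff R \<in> borel_measurable lebesgue" for R :: real
    by (rule measurable_completion) simp
  have icut: "integrable lebesgue (\<lambda>x. cutoff R x * g n x)" for R n
    by (rule integrable_bounded_mult[where C=1]) (use cm abs_cutoff_le int in auto)
  define T where "T R = limsup (\<lambda>n. ereal (LINT x:{x. norm x > R}|lebesgue. g n x))" for R :: real
  note mass = mass_at_infinity_props[of g, OF int nonneg C, folded T_def]
  let ?a = "limsup (\<lambda>n. ereal (LINT x|lebesgue. g n x))"
  have sm: "{x::'a. norm x > R} \<in> sets lebesgue" for R
    by (rule sets_completionI_sets) (auto intro: borel_measurable_pred_less)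
  have si: "set_integrable lebesgue {x::'a. norm x > R} (g n)" for R n
    using integrable_mult_indicator[OF sm int] by (simp add: set_integrable_def)
  define d where "d R n = (LINT x|lebesgue. (1 - cutoff R x) * g n x)" for R n
  have id: "integrable lebesgue (\<lambda>x. (1 - cutoff R x) * g n x)" for R n
    using Bochner_Integration.integrable_diff[OF int icut] by (simp add: algebra_simps)
  have dle: "d R n \<le> (LINT x:{x. norm x > R}|lebesgue. g n x)" for R n
    unfolding d_def set_lebesgue_integral_def
  proof (rule integral_mono_AE)
    show "AE x in lebesgue. (1 - cutoff R x) * g n x \<le> indicator {x. R < norm x} x *\<^sub>R g n x"
      using nonneg[of n]
    proof eventually_elim
      case (elim x)
      have "(1 - cutoff R x) * g n x \<le> 1 * g n x"
        by (rule mult_right_mono) (use elim cutoff_bounds(1)[of R x] in auto)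
      then show ?case using cutoff_eq_1[of x R] by (auto simp: indicator_def not_less)
    qed
  qed (use id si in \<open>auto simp: set_integrable_def\<close>)
  have dge: "d R n \<ge> (LINT x:{x. norm x > R + 1}|lebesgue. g n x)" for R n
    unfolding d_def set_lebesgue_integral_def
  proof (rule integral_mono_AE)
    show "AE x in lebesgue. indicator {x. R + 1 < norm x} x *\<^sub>R g n x \<le> (1 - cutoff R x) * g n x"
      using nonneg[of n]
    proof eventually_elim
      case (elim x)
      have "0 \<le> (1 - cutoff R x) * g n x"
        by (rule mult_nonneg_nonneg) (use elim cutoff_bounds(2)[of R x] in auto)
      then show ?case using cutoff_eq_0[of R x] by (auto simp: indicator_def)
    qed
  qed (use id si in \<open>auto simp: set_integrable_def\<close>)
  have split: "?a = ereal (signed_integral m (cutoff R)) + limsup (\<lambda>n. ereal (d R n))" for R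
  proof -
    have "(LINT x|lebesgue. g n x) = (LINT x|lebesgue. cutoff R x * g n x) + d R n" for n
      unfolding d_def by (subst Bochner_Integration.integral_add[symmetric]) (use icut id in \<open>auto simp: algebra_simps\<close>)
    moreover have "(\<lambda>n. ereal (LINT x|lebesgue. cutoff R x * g n x)) \<longlonglongrightarrow> ereal (signed_integral m (cutoff R))"
      using ws continuous_cutoff cutoff_at_infinity by (auto simp: weak_star_converges_def)
    ultimately show ?thesis
      using ereal_limsup_lim_add[of "\<lambda>n. ereal (LINT x|lebesgue. cutoff R x * g n x)" _ "\<lambda>n. ereal (d R n)"] by simp
  qed
  have up: "?a \<le> ereal (signed_integral m (cutoff R)) + T R" for R
    unfolding split[of R] T_def by (intro add_left_mono Limsup_mono always_eventually allI) (use dle in auto)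
  have lo: "ereal (signed_integral m (cutoff R)) + T (R + 1) \<le> ?a" for R
    unfolding split[of R] T_def by (intro add_left_mono Limsup_mono always_eventually allI) (use dge in auto)
  have s: "(\<lambda>n. ereal (signed_integral m (cutoff (real n)))) \<longlonglongrightarrow> ereal (m UNIV)"
    by (intro tendsto_ereal signed_integral_tendsto_mass[OF m])
       (use continuous_cutoff cutoff_tendsto_1 abs_cutoff_le in auto)
  have fin: "\<bar>mass_at_infinity g\<bar> \<noteq> \<infinity>" using mass(3,4) by auto
  have t: "(\<lambda>n. T (real n)) \<longlonglongrightarrow> mass_at_infinity g" "(\<lambda>n. T (real n + 1)) \<longlonglongrightarrow> mass_at_infinity g"
    using filterlim_compose[OF mass(1) filterlim_real_sequentially]
      filterlim_compose[OF mass(1) filterlim_tendsto_add_at_top[OF tendsto_const[of 1] filterlim_real_sequentially]]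
    by (simp_all add: add.commute)
  have "(\<lambda>n. ereal (signed_integral m (cutoff (real n))) + T (real n)) \<longlonglongrightarrow> ereal (m UNIV) + mass_at_infinity g"
    by (rule tendsto_add_ereal) (use fin s t in auto)
  then have "?a \<le> ereal (m UNIV) + mass_at_infinity g"
    by (rule LIMSEQ_le_const) (use up in auto)
  moreover have "(\<lambda>n. ereal (signed_integral m (cutoff (real n))) + T (real n + 1)) \<longlonglongrightarrow> ereal (m UNIV) + mass_at_infinity g"
    by (rule tendsto_add_ereal) (use fin s t in auto)
  then have "ereal (m UNIV) + mass_at_infinity g \<le> ?a"
    by (rule LIMSEQ_le_const2) (use lo in auto)
  ultimately show ?thesis by (rule antisym)
qed

subsection \<open>The embedding of the solution space\<close>

lemma much_lessD:
  assumes "much_less m n"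
  obtains c where "0 < c" "\<And>x. m x + c \<le> n x"
proof -
  have "0 < (INF x. ereal (n x - m x))" using assms by (simp add: much_less_def)
  then obtain c where c: "0 < ereal c" "ereal c < (INF x. ereal (n x - m x))"
    using ereal_dense2[of 0 "INF x. ereal (n x - m x)"] by (auto simp: zero_ereal_def)
  have "ereal c \<le> ereal (n x - m x)" for x
    by (rule order_trans[OF less_imp_le[OF c(2)] INF_lower]) simp
  then have "m x + c \<le> n x" for x by (simp add: algebra_simps)
  with c(1) that show ?thesis by auto
qed

text \<open>With \<gamma> = P (N - 1) / N one finds \<gamma> - 1 = N (p - 1) / (N - p), so that
  (\<gamma> - 1) p' = P, and the condition \<alpha> \<le> P q' / p' becomes \<alpha> \<le> (\<gamma>
  - 1) q'.\<close>

lemma exponents_structural: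
  fixes p q \<alpha> :: "'a::euclidean_space \<Rightarrow> real"
  assumes dim: "DIM('a) \<ge> 2" and A4: "assm_A4 p q" and P1: "assm_P1 p q \<alpha>"
  obtains \<gamma> L \<kappa> Pm where "exponents p q \<alpha> \<gamma> (sobolev_exp p) L \<kappa> Pm"
    "\<And>x. p x \<le> q x" "\<And>x. q x + \<kappa> \<le> sobolev_exp p x" "\<And>x. (real DIM('a) + \<kappa>) * (sobolev_exp p x - q x) \<le> q x * sobolev_exp p x"
proof -
  define N where "N = real DIM('a)"
  have N: "N \<ge> 2" using dim by (simp add: N_def)
  obtain Lp where Lp: "Lp-lipschitz_on UNIV p" using A4 by (auto simp: assm_A4_def lipschitz_exponent_def)
  obtain Lq where Lq: "Lq-lipschitz_on UNIV q" using A4 by (auto simp: assm_A4_def lipschitz_exponent_def)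
  obtain c1 where c1: "0 < c1" "\<And>x. 1 + c1 \<le> p x"
    using A4 much_lessD[of "\<lambda>_. 1" p] unfolding assm_A4_def lipschitz_exponent_def by metis
  obtain c2 where c2: "0 < c2" "\<And>x. p x + c2 \<le> q x" using A4 much_lessD unfolding assm_A4_def by metis
  obtain c3 where c3: "0 < c3" "\<And>x. q x + c3 \<le> min N (sobolev_exp p x)"
    using A4 much_lessD unfolding assm_A4_def N_def by metis
  obtain c4 where c4: "0 < c4" "\<And>x. 1 + c4 \<le> \<alpha> x"
    using P1 much_lessD[of "\<lambda>_. 1" \<alpha>] unfolding assm_P1_def by metis
  obtain c5 where c5: "0 < c5" "\<And>x. \<alpha> x + c5 \<le> sobolev_exp p x * ((N - 1) / N)"
    using P1 much_lessD unfolding assm_P1_def N_def by metis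
  have \<alpha>q: "\<alpha> x \<le> sobolev_exp p x * (conj_exp q x / conj_exp p x)" for x using P1 by (simp add: assm_P1_def)
  define P where "P = sobolev_exp p"
  define \<gamma> where "\<gamma> x = P x * ((N - 1) / N)" for x
  have P: "P x = N * p x / (N - p x)" for x by (simp add: P_def sobolev_exp_def N_def)
  have pN: "p x + c3 \<le> N" "1 < p x" "1 < q x" "p x \<le> q x" "0 < N - p x" for x
    using c1(1) c1(2)[of x] c2(1) c2(2)[of x] c3(1) c3(2)[of x] by linarith+
  have \<gamma>: "\<gamma> x = (N - 1) * p x / (N - p x)" for x using N by (simp add: \<gamma>_def P)
  have Pge1: "1 \<le> P x" for x
  proof -
    have "N - p x \<le> N * p x" using pN(2)[of x] N mult_left_mono[of 1 "p x" N] by linarith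
    then show ?thesis using pN(5)[of x] by (simp add: P pos_le_divide_eq)
  qed
  have PN: "P x \<le> N * N / c3" for x
    unfolding P by (rule frac_le) (use N pN[of x] c3(1) in auto)
  \<comment> \<open>One gap for all strict inequalities; 1 / N serves P - \<gamma> = P / N, and c2
    is the gap between p and q.\<close>
  define \<kappa> where "\<kappa> = min (min c4 c5) (min (1 / N) (min c2 c3))"
  have \<kappa>: "0 < \<kappa>" "\<kappa> \<le> c4" "\<kappa> \<le> c5" "\<kappa> \<le> 1 / N" "\<kappa> \<le> c3" "\<kappa> \<le> c2" using c4 c5 c3(1) c2(1) N by (auto simp: \<kappa>_def)
  \<comment> \<open>The difference of \<gamma> at two points is (N - 1) N (p x - p y) over (N - p x)
    (N - p y), and both factors of the denominator are at least c3.\<close>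
  define L where "L = (N - 1) * N * Lp / (c3 * c3)"
  have Lp0: "0 \<le> Lp" using Lp lipschitz_on_nonneg by blast
  have gam1: "\<gamma> x - 1 = N * (p x - 1) / (N - p x)" for x
    using pN(5)[of x] by (simp add: \<gamma> field_simps)
  have lip: "\<bar>\<gamma> x - \<gamma> y\<bar> \<le> L * norm (x - y)" for x y
  proof -
    have "\<gamma> x - \<gamma> y = (N - 1) * N * (p x - p y) / ((N - p x) * (N - p y))"
      using pN(5)[of x] pN(5)[of y] by (simp add: \<gamma> field_simps)
    then have "\<bar>\<gamma> x - \<gamma> y\<bar> = (N - 1) * N * \<bar>p x - p y\<bar> / ((N - p x) * (N - p y))"
      using N pN(5)[of x] pN(5)[of y] by (simp add: abs_mult)
    also have "\<dots> \<le> (N - 1) * N * (Lp * norm (x - y)) / (c3 * c3)"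
    proof (rule frac_le)
      have "\<bar>p x - p y\<bar> \<le> Lp * norm (x - y)"
        using lipschitz_onD[OF Lp, of x y] by (simp add: dist_norm)
      then show "(N - 1) * N * \<bar>p x - p y\<bar> \<le> (N - 1) * N * (Lp * norm (x - y))"
        using N by (intro mult_left_mono) auto
      show "c3 * c3 \<le> (N - p x) * (N - p y)" using pN(1)[of x] pN(1)[of y] c3(1) by (intro mult_mono) auto
    qed (use N Lp0 c3(1) in auto)
    finally show ?thesis by (simp add: L_def mult.assoc)
  qed
  have ex: "exponents p q \<alpha> \<gamma> P L \<kappa> (N * N / c3)"
  proof
    show "DIM('a) \<ge> 2" by (rule dim)
    show "0 \<le> L" using N Lp0 c3(1) by (simp add: L_def)
    show "continuous_on UNIV p" "continuous_on UNIV q" using Lp Lq lipschitz_on_continuous_on by blast+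
    show "continuous_on UNIV \<alpha>" using P1 by (simp add: assm_P1_def)
    fix x
    show "1 + \<kappa> \<le> \<alpha> x" using c4(2)[of x] \<kappa>(2) by linarith
    show "\<alpha> x + \<kappa> \<le> \<gamma> x" using c5(2)[of x] \<kappa>(3) by (simp add: \<gamma>_def P_def)
    show "\<gamma> x + \<kappa> \<le> P x"
    proof -
      have "P x - \<gamma> x = P x / N" using N by (simp add: \<gamma>_def field_simps)
      moreover have "1 / N \<le> P x / N" using Pge1[of x] N by (simp add: divide_right_mono)
      ultimately show ?thesis using \<kappa>(4) by linarith
    qed
    show "P x = \<gamma> x * (real DIM('a) / (real DIM('a) - 1))" using N by (simp add: \<gamma>_def N_def)
    show "1 < p x" "1 < q x" using pN by auto
    show y: "(\<gamma> x - 1) * (p x / (p x - 1)) = P x" using pN(2)[of x] by (simp add: gam1 P)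
    have g: "P x * ((p x - 1) / p x) = \<gamma> x - 1" using pN(2)[of x] by (simp add: gam1 P)
    have "P x * (conj_exp q x / conj_exp p x) = P x * ((p x - 1) / p x) * (q x / (q x - 1))"
      using pN(2,3)[of x] by (simp add: conj_exp_def mult_ac)
    also have "\<dots> = (\<gamma> x - 1) * (q x / (q x - 1))" by (simp only: g)
    finally show "\<alpha> x \<le> (\<gamma> x - 1) * (q x / (q x - 1))" using \<alpha>q[of x] by (simp add: P_def)
    have "q x / (q x - 1) \<le> p x / (p x - 1)" using pN(2,3,4)[of x] by (simp add: frac_le_eq divide_le_0_iff field_simps)
    moreover have "0 \<le> \<gamma> x - 1" using N pN(2,5)[of x] by (simp add: gam1)
    ultimately have "(\<gamma> x - 1) * (q x / (q x - 1)) \<le> (\<gamma> x - 1) * (p x / (p x - 1))" by (rule mult_left_mono)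
    then show "(\<gamma> x - 1) * (q x / (q x - 1)) \<le> P x" using y by simp
  qed (use \<kappa> lip PN in auto)
  show ?thesis
  proof (rule that[OF ex[unfolded P_def]])
    show "p x \<le> q x" for x by (rule pN)
    show "q x + \<kappa> \<le> sobolev_exp p x" for x using c3(2)[of x] \<kappa>(5) by linarith
    show "(real DIM('a) + \<kappa>) * (sobolev_exp p x - q x) \<le> q x * sobolev_exp p x" for x
    proof -
      have pos: "0 < p x" "0 < q x" "0 < P x" "0 < N" using pN(2,3)[of x] Pge1[of x] N by linarith+
      \<comment> \<open>Here p << q enters: 1/p - 1/q \<ge> \<kappa> / N^2 and 1/p = 1/P + 1/N, so
        (N + \<kappa>) (1/q - 1/P) \<le> (N^2 - \<kappa>^2) / N^2 \<le> 1.\<close>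
      have "\<kappa> / (N * N) \<le> (q x - p x) / (p x * q x)"
      proof (rule frac_le)
        have "q x < N" using c3(1) c3(2)[of x] by linarith
        then show "p x * q x \<le> N * N" using pos pN(5)[of x] by (intro mult_mono) auto
      qed (use \<kappa> c2(2)[of x] pN(4)[of x] pos in auto)
      also have "\<dots> = 1 / p x - 1 / q x" using pos by (simp add: field_simps)
      also have "1 / p x = 1 / P x + 1 / N" using pos pN(5)[of x] by (simp add: P field_simps)
      finally have "1 / q x - 1 / P x \<le> (N - \<kappa>) / (N * N)" using pos by (simp add: diff_divide_distrib)
      then have "(N + \<kappa>) * (1 / q x - 1 / P x) \<le> (N + \<kappa>) * ((N - \<kappa>) / (N * N))"
        using \<kappa>(1) pos(4) by (intro mult_left_mono) auto
      also have "\<dots> = (N * N - \<kappa> * \<kappa>) / (N * N)" by (simp add: algebra_simps)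
      also have "\<dots> \<le> 1" using pos(4) \<kappa>(1) by (simp add: divide_le_eq_1)
      finally have "(q x * P x) * ((N + \<kappa>) * (1 / q x - 1 / P x)) \<le> (q x * P x) * 1"
        using pos by (intro mult_left_mono) auto
      moreover have "(q x * P x) * ((N + \<kappa>) * (1 / q x - 1 / P x)) = (N + \<kappa>) * (P x - q x)"
        using pos by (simp add: field_simps)
      ultimately have "(N + \<kappa>) * (P x - q x) \<le> q x * P x" by (simp only: mult_1_right)
      then show ?thesis by (simp only: P_def N_def)
    qed
  qed
qed

lemma has_weak_gradient_scale:
  fixes u :: "'a::euclidean_space \<Rightarrow> real"
  assumes "has_weak_gradient u G"
  shows "has_weak_gradient (\<lambda>x. c * u x) (\<lambda>x. c *\<^sub>R G x)"
  unfolding has_weak_gradient_def locally_integrable_def set_integrable_def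
proof (intro conjI allI impI ballI)
  have h: "\<And>K. compact K \<Longrightarrow> integrable lebesgue (\<lambda>x. indicat_real K x *\<^sub>R u x)"
    "\<And>K. compact K \<Longrightarrow> integrable lebesgue (\<lambda>x. indicat_real K x *\<^sub>R G x)"
    using assms unfolding has_weak_gradient_def locally_integrable_def set_integrable_def by blast+
  fix K :: "'a set" assume K: "compact K"
  have "integrable lebesgue (\<lambda>x. c * (indicat_real K x *\<^sub>R u x))" by (intro integrable_mult_right h K)
  then show "integrable lebesgue (\<lambda>x. indicat_real K x *\<^sub>R (c * u x))" by (simp add: mult.left_commute)
  have "integrable lebesgue (\<lambda>x. c *\<^sub>R (indicat_real K x *\<^sub>R G x))" by (intro integrable_scaleR_right h K)
  then show "integrable lebesgue (\<lambda>x. indicat_real K x *\<^sub>R c *\<^sub>R G x)" by (simp add: mult.commute)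
next
  fix \<phi> :: "'a \<Rightarrow> real" and i :: 'a assume "test_function \<phi>" "i \<in> Basis"
  then have "(LINT x|lebesgue. u x * frechet_derivative \<phi> (at x) i) = - (LINT x|lebesgue. (G x \<bullet> i) * \<phi> x)"
    using assms unfolding has_weak_gradient_def by blast
  then show "(LINT x|lebesgue. c * u x * frechet_derivative \<phi> (at x) i) = - (LINT x|lebesgue. (c *\<^sub>R G x \<bullet> i) * \<phi> x)"
    by (simp add: mult.assoc)
qed

lemma measurable_weighted: "(f \<in> borel_measurable (weighted w)) = (f \<in> borel_measurable lebesgue)"
  by (simp add: weighted_def)

lemma modular_weighted:
  assumes "w \<in> borel_measurable lebesgue" "u \<in> borel_measurable lebesgue" "r \<in> borel_measurable borel"
  shows "modular (weighted w) r u = (\<integral>\<^sup>+x. ennreal (w x) * ennreal (\<bar>u x\<bar> powr r x) \<partial>lebesgue)"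
proof -
  have [measurable]: "r \<in> borel_measurable lebesgue" using assms(3) by (rule borel_measurable_lebesgueI)
  note [measurable] = assms(1,2)
  show ?thesis unfolding modular_def weighted_def by (rule nn_integral_density) measurable
qed

lemma lebesgue_AE_borel_abs:
  fixes v :: "'a::euclidean_space \<Rightarrow> real"
  assumes "v \<in> borel_measurable lebesgue" "\<And>x. 0 \<le> v x"
  obtains v' where "v' \<in> borel_measurable borel" "\<And>x. 0 \<le> v' x" "AE x in lborel. v x = v' x"
proof -
  obtain v1 where v1: "v1 \<in> borel_measurable lborel" "AE x in lborel. v x = v1 x"
    using completion_ex_borel_measurable_real[OF assms(1)] by blast
  have m: "(\<lambda>x. \<bar>v1 x\<bar>) \<in> borel_measurable borel" using v1(1) by simp
  have "AE x in lborel. v x = \<bar>v1 x\<bar>"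
    using v1(2)
  proof eventually_elim
    case (elim x) then show ?case using assms(2)[of x] by simp
  qed
  with m that show ?thesis by auto
qed

context exponents
begin

text \<open>Dividing by a large constant brings the three modulars below the threshold of
  \<open>modular_Sobolev\<close>; the constant is common to all u. The extra factor N in
  \<open>K\<close> pays for bounding the sum of the absolute partials by N times the norm of the
  gradient.\<close>

lemma Sobolev_bounded:
  assumes m: "0 \<le> m"
  shows "\<exists>K\<ge>1. \<forall>(u :: 'a \<Rightarrow> real) G v w. has_weak_gradient u G \<longrightarrow> v \<in> borel_measurable lebesgue \<longrightarrow> w \<in> borel_measurable lebesgue \<longrightarrow>
    (\<forall>x. 0 \<le> v x) \<longrightarrow> (\<forall>x. 0 \<le> w x) \<longrightarrow> (AE x in lebesgue. norm (G x) \<le> v x + w x) \<longrightarrow>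
    modular lebesgue \<alpha> u \<le> ennreal m \<longrightarrow> modular lebesgue p v \<le> ennreal m \<longrightarrow> modular lebesgue q w \<le> ennreal m \<longrightarrow>
    modular lebesgue P (\<lambda>x. u x / K) \<le> 1"
proof (rule modular_Sobolev)
  fix d :: real
  assume d: "d > 0" and S: "\<And>(u :: 'a \<Rightarrow> real) g v w. weak_partials u g \<Longrightarrow>
    v \<in> borel_measurable borel \<Longrightarrow> w \<in> borel_measurable borel \<Longrightarrow> (\<And>x. 0 \<le> v x) \<Longrightarrow> (\<And>x. 0 \<le> w x) \<Longrightarrow>
    (AE x in lborel. (\<Sum>i\<in>Basis. \<bar>g i x\<bar>) \<le> v x + w x) \<Longrightarrow>
    (\<integral>\<^sup>+x. ennreal (\<bar>u x\<bar> powr \<alpha> x) \<partial>lborel) \<le> ennreal d \<Longrightarrow>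
    (\<integral>\<^sup>+x. ennreal (v x powr p x) \<partial>lborel) \<le> ennreal d \<Longrightarrow>
    (\<integral>\<^sup>+x. ennreal (w x powr q x) \<partial>lborel) \<le> ennreal d \<Longrightarrow>
    (\<integral>\<^sup>+x. ennreal (\<bar>u x\<bar> powr P x) \<partial>lborel) \<le> 1"
  define N where "N = real DIM('a)"
  define K0 where "K0 = m / d + 1"
  define K where "K = N * K0"
  have N: "1 \<le> N" using dim by (simp add: N_def)
  have K0: "1 \<le> K0" using m d by (simp add: K0_def)
  have K: "1 \<le> K" using mult_mono[OF N K0] N by (simp add: K_def)
  have mK0: "1 / K0 * m \<le> d"
  proof -
    have "m \<le> d * K0" using d by (simp add: K0_def distrib_left)
    then show ?thesis using K0 by (simp add: pos_divide_le_eq)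
  qed
  have mK: "1 / K * m \<le> d"
  proof -
    have "1 / K \<le> 1 / K0" using N K0 mult_right_mono[OF N, of K0] by (intro divide_left_mono) (auto simp: K_def)
    then have "1 / K * m \<le> 1 / K0 * m" by (rule mult_right_mono[OF _ m])
    then show ?thesis using mK0 by linarith
  qed
  have scale: "modular lborel r (\<lambda>x. f x / c) \<le> ennreal d"
    if f: "f \<in> borel_measurable borel" "r \<in> borel_measurable borel" "\<And>x. 1 \<le> r x" and c: "1 \<le> c" "1 / c * m \<le> d" and le: "modular lborel r f \<le> ennreal m"
    for f r :: "'a \<Rightarrow> real" and c
  proof -
    have "modular lborel r (\<lambda>x. f x / c) \<le> ennreal (1 / c) * modular lborel r f"
      by (rule modular_scale_le) (use f c in auto)
    also have "\<dots> \<le> ennreal (1 / c) * ennreal m" by (intro mult_left_mono le) simp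
    also have "\<dots> = ennreal (1 / c * m)" using c m by (intro ennreal_mult[symmetric]) auto
    also have "\<dots> \<le> ennreal d" using c(2) by (rule ennreal_leI)
    finally show ?thesis .
  qed
  show ?thesis
  proof (intro exI[of _ K] conjI K allI impI)
    fix u :: "'a \<Rightarrow> real" and G v w
    assume uG: "has_weak_gradient u G" and vw: "v \<in> borel_measurable lebesgue" "w \<in> borel_measurable lebesgue"
      "\<forall>x. 0 \<le> v x" "\<forall>x. 0 \<le> w x" "AE x in lebesgue. norm (G x) \<le> v x + w x"
      and le: "modular lebesgue \<alpha> u \<le> ennreal m" "modular lebesgue p v \<le> ennreal m" "modular lebesgue q w \<le> ennreal m"
    obtain u' g where u': "weak_partials u' g" "AE x in lebesgue. u x = u' x"
      "AE x in lebesgue. \<forall>i\<in>Basis. G x \<bullet> i = g i x" "G \<in> borel_measurable lebesgue"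
      by (rule has_weak_gradient_partials[OF uG])
    obtain v' where v': "v' \<in> borel_measurable borel" "\<And>x. 0 \<le> v' x" "AE x in lborel. v x = v' x"
      using lebesgue_AE_borel_abs[OF vw(1)] vw(3) by metis
    obtain w' where w': "w' \<in> borel_measurable borel" "\<And>x. 0 \<le> w' x" "AE x in lborel. w x = w' x"
      using lebesgue_AE_borel_abs[OF vw(2)] vw(4) by metis
    have u'm: "u' \<in> borel_measurable borel" by (rule locint_measurable[OF weak_partialsD(1)[OF u'(1)]])
    have u'ae: "AE x in lborel. u x = u' x" using u'(2) by (simp add: AE_completion_iff)
    have cong: "modular lebesgue r f = modular lborel r f'" if "AE x in lborel. f x = f' x" for r f f' :: "'a \<Rightarrow> real"
      unfolding modular_def nn_integral_completion
      by (rule nn_integral_cong_AE) (use that in \<open>auto elim!: eventually_mono\<close>)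
    have "AE x in lebesgue. norm (G x) \<le> v' x + w' x"
      using vw(5) AE_completion[OF v'(3)] AE_completion[OF w'(3)] by eventually_elim simp
    with u'(3) have "AE x in lebesgue. (\<Sum>i\<in>Basis. \<bar>1 / K * g i x\<bar>) \<le> v' x / K0 + w' x / K0"
    proof eventually_elim
      case (elim x)
      have "(\<Sum>i\<in>Basis. \<bar>1 / K * g i x\<bar>) = (\<Sum>i\<in>Basis. 1 / K * \<bar>G x \<bullet> i\<bar>)"
        using elim(1) K by (intro sum.cong) (auto simp: abs_mult)
      also have "\<dots> \<le> (\<Sum>i\<in>(Basis::'a set). 1 / K * (v' x + w' x))"
        using elim(2) K by (intro sum_mono mult_left_mono order_trans[OF Basis_le_norm]) auto
      also have "\<dots> = N * (1 / K * (v' x + w' x))" by (simp add: N_def)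
      also have "\<dots> = (v' x + w' x) / K0"
      proof -
        have "N \<noteq> 0" "K0 \<noteq> 0" using N K0 by auto
        then show ?thesis by (simp add: K_def)
      qed
      also have "\<dots> = v' x / K0 + w' x / K0" by (rule add_divide_distrib)
      finally show ?case .
    qed
    then have g: "AE x in lborel. (\<Sum>i\<in>Basis. \<bar>1 / K * g i x\<bar>) \<le> v' x / K0 + w' x / K0" by (simp add: AE_completion_iff)
    have a1: "1 \<le> \<alpha> x" "1 \<le> p x" "1 \<le> q x" for x using \<alpha>1[of x] \<kappa> p1[of x] q1[of x] by linarith+
    have "modular lborel P (\<lambda>x. 1 / K * u' x) \<le> 1"
      unfolding modular_def
    proof (rule S[OF weak_partials_scale[OF u'(1)] _ _ _ _ g])
      show "(\<integral>\<^sup>+x. ennreal (\<bar>1 / K * u' x\<bar> powr \<alpha> x) \<partial>lborel) \<le> ennreal d"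
        using scale[OF u'm exps_measurable(3) a1(1) K mK] le(1) unfolding cong[OF u'ae] by (simp add: modular_def)
      show "(\<integral>\<^sup>+x. ennreal ((v' x / K0) powr p x) \<partial>lborel) \<le> ennreal d"
        using scale[OF v'(1) exps_measurable(1) a1(2) K0 mK0] le(2) v'(2) K0 unfolding cong[OF v'(3)] by (simp add: modular_def)
      show "(\<integral>\<^sup>+x. ennreal ((w' x / K0) powr q x) \<partial>lborel) \<le> ennreal d"
        using scale[OF w'(1) exps_measurable(2) a1(3) K0 mK0] le(3) w'(2) K0 unfolding cong[OF w'(3)] by (simp add: modular_def)
    qed (use v' w' K0 in auto)
    moreover have "AE x in lborel. u x / K = 1 / K * u' x" using u'ae by eventually_elim simp
    ultimately show "modular lebesgue P (\<lambda>x. u x / K) \<le> 1" using cong by metis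
  qed
qed

end

text \<open>The integral of a partial derivative of \<phi> vanishes because the convolution of
  \<phi> with 1, being constantly the integral of \<phi>, has derivative 0. Combined with the
  product rule this yields weak gradients of smooth functions.\<close>

lemma weak_partials_const: "weak_partials (\<lambda>_::'a::euclidean_space. 1) (\<lambda>_ _. 0)"
  unfolding weak_partials_def
proof (intro conjI ballI allI impI)
  have one: "locint (\<lambda>_::'a. 1)"
    unfolding locint_def
  proof (intro conjI allI)
    fix R :: real
    have "emeasure lborel (cball (0::'a) R) < \<infinity>" by (rule emeasure_lborel_cball_finite)
    then show "integrable lborel (\<lambda>x. indicat_real (cball (0::'a) R) x * 1)" by simp
  qed simp
  then show "locint (\<lambda>_::'a. 1)" .
  show "locint (\<lambda>_::'a. 0)" by (simp add: locint_def)
  fix i :: 'a and \<phi> :: "'a \<Rightarrow> real"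
  assume i: "i \<in> Basis" and \<phi>: "test_function \<phi>"
  let ?D = "\<lambda>x. frechet_derivative \<phi> (at x) i"
  have c: "conv k (\<lambda>_. 1) x = (LINT y|lborel. k y)" if "k \<in> borel_measurable borel" for k :: "'a \<Rightarrow> real" and x
    using integral_lborel_reflect[OF that, of x] by (simp add: conv_def)
  have "((\<lambda>s. conv \<phi> (\<lambda>_. 1) (0 + s *\<^sub>R i)) has_real_derivative conv ?D (\<lambda>_. 1) (0 + 0 *\<^sub>R i)) (at 0)"
    using line_deriv_conv[OF \<phi> i one] unfolding line_deriv_def by blast
  then have "((\<lambda>s::real. LINT y|lborel. \<phi> y) has_real_derivative (LINT y|lborel. ?D y)) (at 0)"
    by (simp only: c[OF test_function_borel(1)[OF \<phi>]] c[OF test_function_borel(2)[OF \<phi> i]])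
  then have "(LINT y|lborel. ?D y) = 0" by (rule DERIV_unique) simp
  then show "(LINT x|lborel. 1 * ?D x) = - (LINT x|lborel. 0 * \<phi> x)" by simp
qed

text \<open>Norm 0 means that u / c has modular at most 1 for every c > 0; by scaling the modular of
  u is at most c for all c \<le> 1, hence 0, and b > 0 gives u = 0 almost everywhere.\<close>

lemma luxemburg_pos:
  fixes r b u :: "'a::euclidean_space \<Rightarrow> real"
  assumes r: "r \<in> borel_measurable borel" "\<And>x. 1 \<le> r x"
    and b: "b \<in> borel_measurable lebesgue" "AE x in lebesgue. 0 < b x"
    and u: "u \<in> Lvar (weighted b) r" and nz: "\<not> (AE x in lebesgue. u x = 0)"
  shows "0 < luxemburg (weighted b) r u"
proof (rule ccontr)
  assume neg: "\<not> ?thesis"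
  have rm: "r \<in> borel_measurable (weighted b)" using r(1) by (simp add: measurable_weighted borel_measurable_lebesgueI)
  have um: "u \<in> borel_measurable lebesgue" using u by (simp add: Lvar_def measurable_weighted)
  have le: "modular (weighted b) r u \<le> ennreal c" if c: "0 < c" "c \<le> 1" for c
  proof -
    have "modular (weighted b) r u = modular (weighted b) r (\<lambda>x. (u x / c) / (1 / c))" using c by simp
    also have "\<dots> \<le> ennreal (1 / (1 / c)) * modular (weighted b) r (\<lambda>x. u x / c)"
      by (rule modular_scale_le) (use um rm r c in \<open>auto simp: measurable_weighted\<close>)
    also have "\<dots> \<le> ennreal (1 / (1 / c)) * 1"
      by (intro mult_left_mono modular_le_1[OF rm r(2) u]) (use neg c in auto)
    finally show ?thesis using c by simp
  qed
  have "modular (weighted b) r u \<le> 0"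
  proof (rule ccontr)
    assume "\<not> ?thesis"
    then have "0 < modular (weighted b) r u" by (simp only: not_le)
    then obtain z where z: "0 < z" "z < modular (weighted b) r u" using dense by blast
    then obtain y where y: "z = ennreal y" "0 < y" by (cases z) auto
    have "ennreal (min 1 y) \<le> z" using y by (simp add: ennreal_leI)
    moreover have "modular (weighted b) r u \<le> ennreal (min 1 y)" by (rule le) (use y in auto)
    ultimately show False using z(2) by (meson leD order_trans)
  qed
  then have z: "(\<integral>\<^sup>+x. ennreal (b x) * ennreal (\<bar>u x\<bar> powr r x) \<partial>lebesgue) = 0"
    using modular_weighted[OF b(1) um r(1)] by simp
  have [measurable]: "r \<in> borel_measurable lebesgue" using r(1) by (rule borel_measurable_lebesgueI)
  note [measurable] = b(1) um
  have "(\<lambda>x. ennreal (b x) * ennreal (\<bar>u x\<bar> powr r x)) \<in> borel_measurable lebesgue" by measurable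
  from z[unfolded nn_integral_0_iff_AE[OF this]]
  have "AE x in lebesgue. u x = 0"
    using b(2)
  proof eventually_elim
    case (elim x)
    then show ?case by (cases "u x = 0") (auto simp: ennreal_mult[symmetric])
  qed
  then show False using nz by blast
qed

lemma luxemburg_null:
  fixes r b u :: "'a::euclidean_space \<Rightarrow> real"
  assumes "b \<in> borel_measurable lebesgue" "AE x in lebesgue. u x = 0"
  shows "luxemburg (weighted b) r u \<le> 0"
proof (rule field_le_epsilon)
  fix e :: real assume e: "0 < e"
  have "AE x in weighted b. ennreal (\<bar>u x / e\<bar> powr r x) = 0"
    unfolding weighted_def by (subst AE_density) (use assms in \<open>auto elim!: eventually_mono\<close>)
  then have "modular (weighted b) r (\<lambda>x. u x / e) = (\<integral>\<^sup>+x. 0 \<partial>weighted b)"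
    unfolding modular_def by (rule nn_integral_cong_AE)
  then show "luxemburg (weighted b) r u \<le> 0 + e" using luxemburg_le[OF e, of "weighted b" r u] by simp
qed

text \<open>The essential bounds on V and b appear as constants \<open>V0\<close> and
  \<open>bm\<close>. The assumption \<open>decay\<close> says
  \<open>q P / (P - q) \<ge> N + \<kappa>\<close>; it is the exponent met when the gradient of a
  dilated cutoff is estimated.\<close>

locale weights = exponents p q \<alpha> \<gamma> P L \<kappa> Pm
  for p q \<alpha> \<gamma> P :: "'a::euclidean_space \<Rightarrow> real" and L \<kappa> Pm :: real +
  fixes V b t :: "'a \<Rightarrow> real" and V0 bm :: real
  assumes V: "V \<in> borel_measurable lebesgue" "locally_integrable V" "0 < V0" "AE x in lebesgue. V0 \<le> V x"
    and b: "b \<in> borel_measurable lebesgue" "AE x in lebesgue. 0 < b x" "0 \<le> bm" "AE x in lebesgue. b x \<le> bm"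
    and t: "t \<in> borel_measurable borel" "\<And>x. \<alpha> x \<le> t x" "\<And>x. t x \<le> P x"
    and pq: "\<And>x. p x \<le> q x" and qP: "\<And>x. q x + \<kappa> \<le> P x"
    and decay: "\<And>x. (real DIM('a) + \<kappa>) * (P x - q x) \<le> q x * P x"
begin

abbreviation X where "X \<equiv> sol_space V \<alpha> p q"
abbreviation X_norm where "X_norm \<equiv> sol_norm V \<alpha> p q"

lemma exponents_ge1: "1 \<le> p x" "1 \<le> q x" "1 \<le> \<alpha> x" "1 \<le> P x" "1 \<le> t x"
  using p1[of x] q1[of x] \<alpha>1[of x] \<kappa> exp_le_Pm(5)[of x] t(2)[of x] by linarith+

lemma exponents_le_Pm: "p x \<le> Pm" "q x \<le> Pm" "\<alpha> x \<le> Pm" "P x \<le> Pm" "t x \<le> Pm" "1 \<le> Pm"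
  using pq[of x] qP[of x] \<kappa> PPm[of x] exp_le_Pm(2)[of x] t(3)[of x] exponents_ge1(4)[of x] by linarith+

lemma exponents_measurable_lebesgue:
  "p \<in> borel_measurable lebesgue" "q \<in> borel_measurable lebesgue" "\<alpha> \<in> borel_measurable lebesgue"
  "P \<in> borel_measurable lebesgue" "t \<in> borel_measurable lebesgue"
  using exps_measurable t(1) by (auto intro: borel_measurable_lebesgueI)

lemma exponents_measurable_weighted:
  "\<alpha> \<in> borel_measurable (weighted w)" "t \<in> borel_measurable (weighted w)"
  using exponents_measurable_lebesgue by (auto simp: measurable_weighted)

lemma modular_V_bound:
  assumes u: "u \<in> borel_measurable lebesgue"
  shows "modular lebesgue \<alpha> u \<le> ennreal (1 / V0) * modular (weighted V) \<alpha> u"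
proof -
  note [measurable] = V(1) u exponents_measurable_lebesgue
  have "modular lebesgue \<alpha> u \<le> (\<integral>\<^sup>+x. ennreal (1 / V0) * (ennreal (V x) * ennreal (\<bar>u x\<bar> powr \<alpha> x)) \<partial>lebesgue)"
    unfolding modular_def
  proof (rule nn_integral_mono_AE)
    show "AE x in lebesgue. ennreal (\<bar>u x\<bar> powr \<alpha> x) \<le> ennreal (1 / V0) * (ennreal (V x) * ennreal (\<bar>u x\<bar> powr \<alpha> x))"
      using V(4)
    proof eventually_elim
      case (elim x)
      have "1 * (\<bar>u x\<bar> powr \<alpha> x) \<le> V x / V0 * (\<bar>u x\<bar> powr \<alpha> x)"
        using elim V(3) by (intro mult_right_mono) auto
      then have "\<bar>u x\<bar> powr \<alpha> x \<le> 1 / V0 * (V x * \<bar>u x\<bar> powr \<alpha> x)" by simp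
      then show ?case using elim V(3) by (simp add: ennreal_mult[symmetric] ennreal_leI del: times_divide_eq_left)
    qed
  qed
  also have "\<dots> = ennreal (1 / V0) * modular (weighted V) \<alpha> u"
    by (simp add: modular_weighted[OF V(1) u exps_measurable(3)] nn_integral_cmult)
  finally show ?thesis .
qed

lemma modular_b_bound:
  assumes u: "u \<in> borel_measurable lebesgue"
  shows "modular (weighted b) t u \<le> ennreal bm * (modular lebesgue \<alpha> u + modular lebesgue P u)"
proof -
  note [measurable] = b(1) u exponents_measurable_lebesgue
  have "modular (weighted b) t u \<le> (\<integral>\<^sup>+x. ennreal bm * (ennreal (\<bar>u x\<bar> powr \<alpha> x) + ennreal (\<bar>u x\<bar> powr P x)) \<partial>lebesgue)"
    unfolding modular_weighted[OF b(1) u t(1)]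
  proof (rule nn_integral_mono_AE)
    show "AE x in lebesgue. ennreal (b x) * ennreal (\<bar>u x\<bar> powr t x) \<le> ennreal bm * (ennreal (\<bar>u x\<bar> powr \<alpha> x) + ennreal (\<bar>u x\<bar> powr P x))"
      using b(4)
    proof eventually_elim
      case (elim x)
      have "ennreal (\<bar>u x\<bar> powr t x) \<le> ennreal (\<bar>u x\<bar> powr \<alpha> x) + ennreal (\<bar>u x\<bar> powr P x)"
        using powr_between[of "\<bar>u x\<bar>" "\<alpha> x" "t x" "P x"] t(2,3) by (simp add: ennreal_plus[symmetric] ennreal_leI del: ennreal_plus)
      then show ?case using elim by (intro mult_mono ennreal_leI) auto
    qed
  qed
  also have "\<dots> = ennreal bm * (modular lebesgue \<alpha> u + modular lebesgue P u)"
    unfolding modular_def by (subst nn_integral_cmult) (auto simp: nn_integral_add)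
  finally show ?thesis .
qed

lemma X_props:
  assumes u: "u \<in> X"
  shows "u \<in> Lvar (weighted V) \<alpha>" "u \<in> borel_measurable lebesgue" "has_weak_gradient u (wgrad u)"
    "(\<lambda>x. norm (wgrad u x)) \<in> sum_space p q"
  using u has_weak_gradient_wgrad by (auto simp: sol_space_def Lvar_def measurable_weighted)

lemma X_norm_nonneg:
  assumes u: "u \<in> X" shows "0 \<le> X_norm u"
  unfolding sol_norm_def
  using luxemburg_nonneg[OF exponents_measurable_weighted(1) exponents_ge1(3) X_props(1)[OF u]]
    sum_norm_nonneg[OF exponents_measurable_lebesgue(1) exponents_ge1(1) exponents_measurable_lebesgue(2) exponents_ge1(2) X_props(4)[OF u]]
  by simp

text \<open>For any l above the norm the modulars of u / l and of its gradient parts are at most m,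
  so \<open>Sobolev_bounded\<close> gives a K common to all u; the modular for t is then bounded by
  those for \<alpha> and P. Letting l decrease to the norm covers norm 0 as well.\<close>

proposition embedding:
  obtains C where "0 < C" "\<And>u. u \<in> X \<Longrightarrow> u \<in> Lvar (weighted b) t"
    "\<And>u. u \<in> X \<Longrightarrow> luxemburg (weighted b) t u \<le> C * X_norm u"
proof -
  \<comment> \<open>The gradient parts have modular at most 1, and u / l at most 1 / V0 because the
    norm weighs u with V.\<close>
  define m where "m = max 1 (1 / V0)"
  have m: "1 \<le> m" "1 / V0 \<le> m" by (auto simp: m_def)
  have m0: "0 \<le> m" using m by simp
  obtain K where K: "K \<ge> 1" and S: "\<forall>(u :: 'a \<Rightarrow> real) G v w. has_weak_gradient u G \<longrightarrow> v \<in> borel_measurable lebesgue \<longrightarrow> w \<in> borel_measurable lebesgue \<longrightarrow>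
    (\<forall>x. 0 \<le> v x) \<longrightarrow> (\<forall>x. 0 \<le> w x) \<longrightarrow> (AE x in lebesgue. norm (G x) \<le> v x + w x) \<longrightarrow>
    modular lebesgue \<alpha> u \<le> ennreal m \<longrightarrow> modular lebesgue p v \<le> ennreal m \<longrightarrow> modular lebesgue q w \<le> ennreal m \<longrightarrow>
    modular lebesgue P (\<lambda>x. u x / K) \<le> 1"
    using Sobolev_bounded[OF m0] by blast
  define C1 where "C1 = max 1 (bm * (m + 1))"
  have C1: "1 \<le> C1" "bm * (m + 1) \<le> C1" by (auto simp: C1_def)
  have KC: "0 < K * C1" using K C1 by simp
  have key: "modular (weighted b) t (\<lambda>x. u x / (l * (K * C1))) \<le> 1" if u: "u \<in> X" and l: "X_norm u < l" for u l
  proof -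
    note um = X_props(2)[OF u]
    have luxV: "0 \<le> luxemburg (weighted V) \<alpha> u"
      by (rule luxemburg_nonneg[OF exponents_measurable_weighted(1) exponents_ge1(3) X_props(1)[OF u]])
    have sn: "0 \<le> sum_norm p q (\<lambda>x. norm (wgrad u x))"
      by (rule sum_norm_nonneg[OF exponents_measurable_lebesgue(1) exponents_ge1(1) exponents_measurable_lebesgue(2) exponents_ge1(2) X_props(4)[OF u]])
    have l0: "0 < l" using X_norm_nonneg[OF u] l by linarith
    have lV: "luxemburg (weighted V) \<alpha> u < l" using l sn by (simp add: sol_norm_def)
    have ls: "sum_norm p q (\<lambda>x. norm (wgrad u x)) < l" using l luxV by (simp add: sol_norm_def)
    obtain v w where v: "v \<in> Lvar lebesgue p" and w: "w \<in> Lvar lebesgue q"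
      and vw: "AE x in lebesgue. norm (wgrad u x) = v x + w x" "luxemburg lebesgue p v + luxemburg lebesgue q w < l"
      by (rule sum_norm_less[OF X_props(4)[OF u] ls])
    have vm: "v \<in> borel_measurable lebesgue" "w \<in> borel_measurable lebesgue" using v w by (auto simp: Lvar_def)
    have lv: "luxemburg lebesgue p v < l" "luxemburg lebesgue q w < l"
      using vw(2) luxemburg_nonneg[OF exponents_measurable_lebesgue(1) exponents_ge1(1) v]
        luxemburg_nonneg[OF exponents_measurable_lebesgue(2) exponents_ge1(2) w] by linarith+
    have one: "1 \<le> ennreal m" using m(1) by simp
    have mv: "modular lebesgue p (\<lambda>x. \<bar>v x\<bar> / l) \<le> ennreal m"
      using order_trans[OF modular_le_1[OF exponents_measurable_lebesgue(1) exponents_ge1(1) v lv(1)] one] l0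
      by (simp add: modular_def abs_divide)
    have mw: "modular lebesgue q (\<lambda>x. \<bar>w x\<bar> / l) \<le> ennreal m"
      using order_trans[OF modular_le_1[OF exponents_measurable_lebesgue(2) exponents_ge1(2) w lv(2)] one] l0
      by (simp add: modular_def abs_divide)
    have ma: "modular lebesgue \<alpha> (\<lambda>x. u x / l) \<le> ennreal m"
    proof -
      have "modular lebesgue \<alpha> (\<lambda>x. u x / l) \<le> ennreal (1 / V0) * modular (weighted V) \<alpha> (\<lambda>x. u x / l)"
        by (rule modular_V_bound) (use um in measurable)
      also have "\<dots> \<le> ennreal (1 / V0) * 1"
        by (intro mult_left_mono modular_le_1[OF exponents_measurable_weighted(1) exponents_ge1(3) X_props(1)[OF u] lV]) simp
      also have "\<dots> \<le> ennreal m" using m(2) by (simp add: ennreal_leI)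
      finally show ?thesis .
    qed
    have G: "has_weak_gradient (\<lambda>x. u x / l) (\<lambda>x. (1 / l) *\<^sub>R wgrad u x)"
      using has_weak_gradient_scale[OF X_props(3)[OF u], of "1 / l"] by simp
    have Gvw: "AE x in lebesgue. norm ((1 / l) *\<^sub>R wgrad u x) \<le> \<bar>v x\<bar> / l + \<bar>w x\<bar> / l"
      using vw(1)
    proof eventually_elim
      case (elim x)
      then show ?case using l0 by (simp add: add_divide_distrib[symmetric] divide_right_mono)
    qed
    have vlm: "(\<lambda>x. \<bar>v x\<bar> / l) \<in> borel_measurable lebesgue" "(\<lambda>x. \<bar>w x\<bar> / l) \<in> borel_measurable lebesgue"
      using vm by measurable
    have mP: "modular lebesgue P (\<lambda>x. (u x / l) / K) \<le> 1"
      using S[rule_format, OF G vlm _ _ Gvw ma mv mw] l0 by simp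
    have "modular lebesgue \<alpha> (\<lambda>x. (u x / l) / K) \<le> modular lebesgue \<alpha> (\<lambda>x. (u x / l) / 1)"
      by (rule modular_antimono_scale) (use K order_trans[OF zero_le_one exponents_ge1(3)] in auto)
    then have ma': "modular lebesgue \<alpha> (\<lambda>x. (u x / l) / K) \<le> ennreal m" using ma by simp
    have "modular (weighted b) t (\<lambda>x. (u x / l) / K) \<le> ennreal bm * (modular lebesgue \<alpha> (\<lambda>x. (u x / l) / K) + modular lebesgue P (\<lambda>x. (u x / l) / K))"
      by (rule modular_b_bound) (use um in measurable)
    also have "\<dots> \<le> ennreal bm * (ennreal m + ennreal 1)" using ma' mP by (intro mult_left_mono add_mono) auto
    also have "\<dots> = ennreal (bm * (m + 1))" using b(3) m0 by (simp add: ennreal_mult)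
    also have "\<dots> \<le> ennreal C1" using C1(2) by (rule ennreal_leI)
    finally have mb: "modular (weighted b) t (\<lambda>x. (u x / l) / K) \<le> ennreal C1" .
    have "modular (weighted b) t (\<lambda>x. ((u x / l) / K) / C1) \<le> ennreal (1 / C1) * modular (weighted b) t (\<lambda>x. (u x / l) / K)"
    proof (rule modular_scale_le)
      show "(\<lambda>x. u x / l / K) \<in> borel_measurable (weighted b)" unfolding measurable_weighted using um by measurable
    qed (use exponents_measurable_weighted(2) exponents_ge1(5) C1(1) in auto)
    also have "\<dots> \<le> ennreal (1 / C1) * ennreal C1" by (intro mult_left_mono mb) simp
    also have "\<dots> = 1" using C1(1) by (simp add: ennreal_mult[symmetric])
    finally show ?thesis by (simp only: divide_divide_eq_left mult.assoc)
  qed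
  show ?thesis
  proof (rule that[OF KC])
    fix u assume u: "u \<in> X"
    have l: "0 < (X_norm u + 1) * (K * C1)" by (rule mult_pos_pos[OF _ KC]) (use X_norm_nonneg[OF u] in linarith)
    have "modular (weighted b) t (\<lambda>x. u x / ((X_norm u + 1) * (K * C1))) \<le> 1" by (rule key[OF u]) simp
    then have "modular (weighted b) t (\<lambda>x. u x / ((X_norm u + 1) * (K * C1))) < \<infinity>" by (rule le_less_trans) simp
    from Lvar_scale_iff[OF exponents_measurable_weighted(2) exponents_ge1(5) l _ this exponents_le_Pm(5)]
    show "u \<in> Lvar (weighted b) t" using X_props(2)[OF u] by (simp add: measurable_weighted)
    have "luxemburg (weighted b) t u / (K * C1) \<le> X_norm u"
    proof (rule dense_ge)
      fix l assume l: "X_norm u < l"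
      have "0 < l * (K * C1)" by (rule mult_pos_pos[OF _ KC]) (use l X_norm_nonneg[OF u] in linarith)
      then have "luxemburg (weighted b) t u \<le> l * (K * C1)" using key[OF u l] by (rule luxemburg_le)
      then show "luxemburg (weighted b) t u / (K * C1) \<le> l" using KC by (simp only: pos_divide_le_eq)
    qed
    then show "luxemburg (weighted b) t u \<le> K * C1 * X_norm u" using KC by (simp only: pos_divide_le_eq mult.commute)
  qed
qed

text \<open>A nonzero member of the space keeps the infimum in \<open>best_const\<close> finite. Its
  support is bounded, V is integrable on balls, and the whole gradient is put in the p-part of the
  sum space.\<close>

lemma bump_in_X: "(bump :: 'a \<Rightarrow> real) \<in> X"
proof -
  let ?D = "\<lambda>i (x::'a). frechet_derivative bump (at x) i"
  have "weak_partials (\<lambda>x::'a. bump x * 1) (\<lambda>i x. bump x * 0 + 1 * ?D i x)"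
    by (rule weak_partials_cong_product[OF weak_partials_const Ck_bump])
  then have wp: "weak_partials (bump :: 'a \<Rightarrow> real) ?D" by simp
  have bm: "(bump :: 'a \<Rightarrow> real) \<in> borel_measurable borel" by (rule test_function_borel(1)[OF test_function_bump])
  have bml: "(bump :: 'a \<Rightarrow> real) \<in> borel_measurable lebesgue" by (rule borel_measurable_lebesgueI[OF bm])
  have G: "has_weak_gradient bump (\<lambda>x. \<Sum>i\<in>Basis. ?D i x *\<^sub>R i)"
    by (rule partials_has_weak_gradient[OF wp bml]) simp
  obtain C R where CR: "0 \<le> C" "0 < R" "\<And>x. (\<Sum>i\<in>Basis. \<bar>?D i x\<bar>) \<le> C" "\<And>x i. i \<in> Basis \<Longrightarrow> R \<le> norm x \<Longrightarrow> ?D i x = 0"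
    "\<And>x::'a. R \<le> norm x \<Longrightarrow> bump x = 0"
  proof -
    have "\<exists>R>0. \<exists>C\<ge>0. (\<forall>x. \<bar>?D i x\<bar> \<le> C) \<and> (\<forall>x. R \<le> norm x \<longrightarrow> ?D i x = 0)" if i: "i \<in> Basis" for i
      using compact_kernelE[OF compact_kernel_partial[OF test_function_bump i]] by metis
    then obtain Rf Cf where f: "\<And>i. i \<in> Basis \<Longrightarrow> 0 < Rf i" "\<And>i. i \<in> Basis \<Longrightarrow> 0 \<le> Cf i"
      "\<And>i x. i \<in> Basis \<Longrightarrow> \<bar>?D i x\<bar> \<le> Cf i" "\<And>i x. i \<in> Basis \<Longrightarrow> Rf i \<le> norm x \<Longrightarrow> ?D i x = 0" by metis
    define R where "R = 2 * real DIM('a) + (\<Sum>i\<in>Basis. Rf i)"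
    have s: "0 \<le> (\<Sum>i\<in>(Basis::'a set). Rf i)" using f(1) by (intro sum_nonneg) (auto intro: less_imp_le)
    have RfR: "Rf i \<le> R" if "i \<in> Basis" for i
    proof -
      have "Rf i \<le> (\<Sum>i\<in>(Basis::'a set). Rf i)" using that f(1) by (intro member_le_sum) (auto intro: less_imp_le)
      then show ?thesis by (simp add: R_def)
    qed
    show ?thesis
    proof (rule that[of "\<Sum>i\<in>Basis. Cf i" R])
      show "0 < R" using s dim by (simp add: R_def)
      show "0 \<le> (\<Sum>i\<in>(Basis::'a set). Cf i)" using f(2) by (intro sum_nonneg)
      show "(\<Sum>i\<in>Basis. \<bar>?D i x\<bar>) \<le> (\<Sum>i\<in>(Basis::'a set). Cf i)" for x using f(3) by (intro sum_mono)
      show "i \<in> Basis \<Longrightarrow> R \<le> norm x \<Longrightarrow> ?D i x = 0" for i x using f(4)[of i x] RfR[of i] by linarith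
      show "R \<le> norm x \<Longrightarrow> bump x = 0" for x :: 'a using bump_eq_0[of x] s by (simp add: R_def)
    qed
  qed
  have pos: "0 \<le> p x" "0 \<le> q x" for x using exponents_ge1(1,2)[of x] by linarith+
  define C' where "C' = max 1 C"
  have wg: "AE x::'a in lebesgue. norm (wgrad bump x) \<le> C' * indicat_real (cball 0 R) x"
    using has_weak_gradient_unique[OF has_weak_gradient_wgrad[OF G] G]
  proof eventually_elim
    case (elim x)
    have "norm (wgrad bump x) \<le> (\<Sum>i\<in>Basis. \<bar>?D i x\<bar>)"
      unfolding elim by (rule order_trans[OF norm_sum]) (simp add: sum_mono)
    moreover have "(\<Sum>i\<in>Basis. \<bar>?D i x\<bar>) = 0" if "R \<le> norm x" using CR(4)[OF _ that] by simp
    ultimately show ?case using CR(3)[of x] by (cases "norm x \<le> R") (auto simp: C'_def)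
  qed
  have gm: "(wgrad bump :: 'a \<Rightarrow> 'a) \<in> borel_measurable lebesgue" by (rule has_weak_gradient_partials[OF has_weak_gradient_wgrad[OF G]]) assumption
  have L: "(\<lambda>x. norm (wgrad bump x)) \<in> Lvar lebesgue p"
  proof -
    have "modular lebesgue p (\<lambda>x. norm (wgrad bump x)) \<le> (\<integral>\<^sup>+x. ennreal (C' powr Pm) * indicator (cball (0::'a) R) x \<partial>lebesgue)"
      unfolding modular_def
    proof (rule nn_integral_mono_AE)
      show "AE x in lebesgue. ennreal (\<bar>norm (wgrad bump x)\<bar> powr p x) \<le> ennreal (C' powr Pm) * indicator (cball (0::'a) R) x"
        using wg
      proof eventually_elim
        case (elim x)
        show ?case
        proof (cases "x \<in> cball 0 R")
          case True
          have "norm (wgrad bump x) powr p x \<le> C' powr p x" using elim True pos(1)[of x] by (intro powr_mono2) auto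
          also have "\<dots> \<le> C' powr Pm" using exponents_le_Pm(1) by (intro powr_mono) (auto simp: C'_def)
          finally show ?thesis using True by (simp add: ennreal_leI)
        qed (use elim in auto)
      qed
    qed
    also have "\<dots> = ennreal (C' powr Pm) * emeasure lborel (cball (0::'a) R)"
      unfolding nn_integral_completion by (rule nn_integral_cmult_indicator) simp
    also have "\<dots> < \<infinity>" using emeasure_lborel_cball_finite[of "0::'a" R] by (simp add: ennreal_mult_less_top)
    finally show ?thesis using gm by (simp add: Lvar_def)
  qed
  have "(\<lambda>_. 0) \<in> Lvar lebesgue q" by (simp add: Lvar_def modular_def)
  then have ss: "(\<lambda>x. norm (wgrad bump x)) \<in> sum_space p q"
    by (intro sum_norm_le(1)[OF exponents_measurable_lebesgue(1) exponents_ge1(1) exponents_measurable_lebesgue(2) exponents_ge1(2) _ _ _ L _])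
       (use gm in auto)
  have iV: "integrable lebesgue (\<lambda>x. indicat_real (cball 0 R) x * V x)"
    using V(2) unfolding locally_integrable_def set_integrable_def by auto
  have "modular (weighted V) \<alpha> bump \<le> (\<integral>\<^sup>+x. ennreal (norm (indicat_real (cball 0 R) x * V x)) \<partial>lebesgue)"
    unfolding modular_weighted[OF V(1) bml exps_measurable(3)]
  proof (rule nn_integral_mono)
    fix x :: 'a
    show "ennreal (V x) * ennreal (\<bar>bump x\<bar> powr \<alpha> x) \<le> ennreal (norm (indicat_real (cball 0 R) x * V x))"
    proof (cases "norm x \<le> R")
      case True
      have "bump x powr \<alpha> x \<le> 1 powr \<alpha> x" using bump_bounds[of x] exponents_ge1(3)[of x] by (intro powr_mono2) auto
      then have "ennreal (V x) * ennreal (\<bar>bump x\<bar> powr \<alpha> x) \<le> ennreal \<bar>V x\<bar> * ennreal 1"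
        using bump_bounds[of x] by (intro mult_mono ennreal_leI) auto
      then show ?thesis using True by simp
    qed (use CR(5)[of x] in simp)
  qed
  also have "\<dots> < \<infinity>" using iV unfolding integrable_iff_bounded by blast
  finally have "(bump :: 'a \<Rightarrow> real) \<in> Lvar (weighted V) \<alpha>" using bml by (simp add: Lvar_def measurable_weighted)
  with G ss show ?thesis by (auto simp: sol_space_def)
qed

lemma bump_nonzero: "\<not> (AE x in lebesgue. (bump :: 'a \<Rightarrow> real) x = 0)"
proof
  assume "AE x in lebesgue. (bump :: 'a \<Rightarrow> real) x = 0"
  then have "AE x in lborel. (bump :: 'a \<Rightarrow> real) x = 0" by (simp add: AE_completion_iff)
  then have "(LINT x|lborel. (bump :: 'a \<Rightarrow> real) x) = 0" by (rule integral_eq_zero_AE)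
  then show False using bump_integral_pos[of 1, where ?'a = 'a] by simp
qed

text \<open>By the embedding each quotient is at least 1 / C, the denominators being positive for
  functions that are not null; \<open>bump\<close> shows that the infimum is not over an empty
  set.\<close>

lemma best_const_pos_finite: "best_const V \<alpha> p q b t \<in> {0<..<\<infinity>}"
proof (rule embedding)
  fix C assume C: "0 < C" "\<And>u. u \<in> X \<Longrightarrow> u \<in> Lvar (weighted b) t"
    "\<And>u. u \<in> X \<Longrightarrow> luxemburg (weighted b) t u \<le> C * X_norm u"
  have "ereal (1 / C) \<le> best_const V \<alpha> p q b t"
    unfolding best_const_def
  proof (rule INF_greatest)
    fix u assume u: "u \<in> {u \<in> X. \<not> (AE x in lebesgue. u x = 0)}"
    then have "0 < luxemburg (weighted b) t u"
      using luxemburg_pos[OF t(1) exponents_ge1(5) b(1,2) C(2)] by blast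
    then show "ereal (1 / C) \<le> ereal (X_norm u / luxemburg (weighted b) t u)"
      using C(1) C(3)[of u] u by (simp add: field_simps)
  qed
  then have "0 < best_const V \<alpha> p q b t" by (rule less_le_trans[rotated]) (use C(1) in simp)
  moreover have "best_const V \<alpha> p q b t < \<infinity>"
    unfolding best_const_def
    by (rule le_less_trans[OF INF_lower[of bump]]) (use bump_in_X bump_nonzero in auto)
  ultimately show ?thesis by simp
qed

text \<open>Null functions are left out of the infimum, and for them the left side is at most
  0.\<close>

lemma best_const_le:
  assumes u: "u \<in> X"
  shows "real_of_ereal (best_const V \<alpha> p q b t) * luxemburg (weighted b) t u \<le> X_norm u"
proof (cases "AE x in lebesgue. u x = 0")
  case True
  have "0 \<le> real_of_ereal (best_const V \<alpha> p q b t)"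
    using best_const_pos_finite by (intro real_of_ereal_pos) auto
  then have "real_of_ereal (best_const V \<alpha> p q b t) * luxemburg (weighted b) t u \<le> 0"
    using luxemburg_null[OF b(1) True] by (rule mult_nonneg_nonpos)
  then show ?thesis using X_norm_nonneg[OF u] by linarith
next
  case False
  have "best_const V \<alpha> p q b t \<le> ereal (X_norm u / luxemburg (weighted b) t u)"
    unfolding best_const_def by (rule INF_lower) (use u False in auto)
  then have le: "real_of_ereal (best_const V \<alpha> p q b t) \<le> X_norm u / luxemburg (weighted b) t u"
    using best_const_pos_finite by (cases "best_const V \<alpha> p q b t") auto
  have "u \<in> Lvar (weighted b) t" by (rule embedding) (use u in blast)
  then have "0 < luxemburg (weighted b) t u" using luxemburg_pos[OF t(1) exponents_ge1(5) b(1,2)] False by blast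
  then show ?thesis using le by (simp add: pos_le_divide_eq)
qed

end

subsection \<open>Cutting off at infinity\<close>

definition tail :: "real \<Rightarrow> 'a::euclidean_space \<Rightarrow> real" where
  "tail R x = 1 - bump ((1 / R) *\<^sub>R x)"

text \<open>Dominates the norm of the gradient of \<open>tail R\<close>; it is at most a constant
  over R and vanishes outside the ball of radius \<open>2 * DIM * R\<close>.\<close>

definition tail_slope :: "real \<Rightarrow> 'a::euclidean_space \<Rightarrow> real" where
  "tail_slope R x = (\<Sum>i\<in>Basis. \<bar>frechet_derivative (tail R) (at x) i\<bar>)"

lemma tail_bounds: "0 \<le> tail R x" "tail R x \<le> 1"
  using bump_bounds[of "(1 / R) *\<^sub>R x"] by (auto simp: tail_def)

lemma tail_eq_0: "0 < R \<Longrightarrow> norm x \<le> R \<Longrightarrow> tail R x = 0"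
  by (simp add: tail_def bump_eq_1)

lemma tail_eq_1: "0 < R \<Longrightarrow> 2 * real DIM('a) * R \<le> norm (x::'a::euclidean_space) \<Longrightarrow> tail R x = 1"
  by (simp add: tail_def bump_eq_0 pos_le_divide_eq)

lemma Ck_tail: "Ck k (tail R)"
proof -
  have "Ck k (\<lambda>x. 1 + (- 1) * bump ((1 / R) *\<^sub>R x + 0))"
    by (intro Ck_add Ck_mult Ck_const Ck_affine Ck_bump)
  then show ?thesis by (simp add: tail_def[abs_def])
qed

lemma tail_derivative:
  assumes R: "0 < R"
  shows "frechet_derivative (tail R) (at x) i = - (1 / R) * frechet_derivative bump (at ((1 / R) *\<^sub>R x)) i"
proof -
  have C: "Ck (Suc 0) (\<lambda>x::'a. bump ((1 / R) *\<^sub>R x + 0))" by (rule Ck_affine[OF Ck_bump])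
  have "((\<lambda>x. 1 - bump ((1 / R) *\<^sub>R x + 0)) has_derivative
     (\<lambda>h. 0 - frechet_derivative (\<lambda>x. bump ((1 / R) *\<^sub>R x + 0)) (at x) h)) (at x)"
    by (intro has_derivative_diff has_derivative_const Ck_has_derivative[OF C])
  then have "frechet_derivative (tail R) (at x) = (\<lambda>h. - frechet_derivative (\<lambda>x. bump ((1 / R) *\<^sub>R x + 0)) (at x) h)"
    unfolding tail_def[abs_def] by (intro frechet_derivative_at[symmetric]) simp
  then show ?thesis using frechet_derivative_affine[OF Ck_bump, of "1 / R" 0 x i] by simp
qed

lemma tail_slope_bound:
  obtains C where "0 \<le> C" "\<And>R (x::'a::euclidean_space). 0 < R \<Longrightarrow> tail_slope R x \<le> C / R"
proof -
  have "\<exists>C. \<forall>x. \<bar>frechet_derivative bump (at x) i\<bar> \<le> C" if i: "i \<in> (Basis :: 'a set)" for i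
    using compact_kernelE[OF compact_kernel_partial[OF test_function_bump i]] by metis
  then obtain Cf where Cf: "\<And>i x. i \<in> (Basis :: 'a set) \<Longrightarrow> \<bar>frechet_derivative bump (at x) i\<bar> \<le> Cf i" by metis
  show ?thesis
  proof (rule that[of "\<Sum>i\<in>(Basis :: 'a set). Cf i"])
    show "0 \<le> (\<Sum>i\<in>(Basis :: 'a set). Cf i)"
      using Cf by (intro sum_nonneg) (meson abs_ge_zero order_trans)
    fix R :: real and x :: 'a assume R: "0 < R"
    have "tail_slope R x = (\<Sum>i\<in>(Basis :: 'a set). 1 / R * \<bar>frechet_derivative bump (at ((1 / R) *\<^sub>R x)) i\<bar>)"
      unfolding tail_slope_def using R by (intro sum.cong) (auto simp: tail_derivative abs_mult)
    also have "\<dots> \<le> (\<Sum>i\<in>(Basis :: 'a set). 1 / R * Cf i)" using R Cf by (intro sum_mono mult_left_mono) auto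
    finally show "tail_slope R x \<le> (\<Sum>i\<in>(Basis :: 'a set). Cf i) / R"
      by (simp add: sum_divide_distrib)
  qed
qed

lemma tail_slope_nonneg: "0 \<le> tail_slope R x"
  by (simp add: tail_slope_def sum_nonneg)

lemma tail_slope_eq_0:
  assumes R: "0 < R" and x: "2 * real DIM('a) * R < norm (x::'a::euclidean_space)"
  shows "tail_slope R x = 0"
proof -
  have "2 * real DIM('a) < norm ((1 / R) *\<^sub>R x)" using R x by (simp add: pos_less_divide_eq)
  from frechet_derivative_support[of "2 * real DIM('a)" bump, OF bump_eq_0 this] show ?thesis
    unfolding tail_slope_def tail_derivative[OF R] by simp
qed

lemma measurable_tail: "tail R \<in> borel_measurable lebesgue"
  using Ck_tail[of 0 R] by (intro borel_measurable_lebesgueI borel_measurable_continuous_onI) simp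

lemma measurable_tail_slope: "tail_slope R \<in> borel_measurable lebesgue"
  unfolding tail_slope_def[abs_def]
  using Ck_partial[OF Ck_tail[of "Suc 0" R]]
  by (intro borel_measurable_lebesgueI borel_measurable_sum borel_measurable_abs borel_measurable_continuous_onI) simp

text \<open>Either the term with y^P already dominates, or y^(P - q) \<le> D^q / \<epsilon>, which
  bounds y by a power of D; with r = q / (P - q) the exponents of D add up to q + q r = q P / (P -
  q).\<close>

lemma power_gap_Young:
  fixes y D \<epsilon> q P :: real
  assumes y: "0 \<le> y" and D: "0 \<le> D" and \<epsilon>: "0 < \<epsilon>" and q: "0 < q" "q < P"
  shows "(y * D) powr q \<le> \<epsilon> * y powr P + (1 / \<epsilon>) powr (q / (P - q)) * D powr (q * P / (P - q))"
proof (cases "D powr q \<le> \<epsilon> * y powr (P - q)")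
  case True
  have "(y * D) powr q = y powr q * D powr q" using y D by (simp add: powr_mult)
  also have "\<dots> \<le> y powr q * (\<epsilon> * y powr (P - q))" using True by (intro mult_left_mono) auto
  also have "\<dots> = \<epsilon> * (y powr q * y powr (P - q))" by simp
  also have "\<dots> = \<epsilon> * y powr P" by (simp add: powr_add[symmetric])
  finally show ?thesis by (simp add: add_increasing2)
next
  case False
  define r where "r = q / (P - q)"
  have r: "0 < r" using q by (simp add: r_def)
  have e: "q + q * r = q * P / (P - q)" using q by (simp add: r_def field_simps)
  have "y powr (P - q) \<le> 1 / \<epsilon> * D powr q" using False \<epsilon> by (simp add: pos_le_divide_eq mult.commute)
  then have "(y powr (P - q)) powr r \<le> (1 / \<epsilon> * D powr q) powr r" using r by (intro powr_mono2) auto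
  then have "y powr q \<le> (1 / \<epsilon>) powr r * D powr (q * r)" using \<epsilon> q unfolding powr_mult powr_powr by (simp add: r_def)
  then have "y powr q * D powr q \<le> (1 / \<epsilon>) powr r * D powr (q * r) * D powr q" by (rule mult_right_mono) simp
  also have "\<dots> = (1 / \<epsilon>) powr r * D powr (q + q * r)" by (simp add: powr_add)
  finally show ?thesis using y D \<epsilon> unfolding e by (simp add: r_def powr_mult add_increasing)
qed

context weights
begin

text \<open>The critical exponent makes the term \<open>u \<nabla>tail\<close> small in \<open>L\<^sup>q\<close>: Young's inequality leaves
  \<open>\<nabla>tail\<close> to the power \<open>q P / (P - q) \<ge> N + \<kappa>\<close> on a ball of radius of order \<open>R\<close>.\<close>

lemma tail_slope_small:
  assumes B: "0 \<le> B" and e: "0 < e"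
  shows "\<forall>\<^sub>F R in at_top. \<forall>u :: 'a \<Rightarrow> real. u \<in> borel_measurable lebesgue \<longrightarrow>
    modular lebesgue P u \<le> ennreal B \<longrightarrow> modular lebesgue q (\<lambda>x. u x * tail_slope R x) \<le> ennreal e"
proof (rule tail_slope_bound[where ?'a = 'a])
  fix C assume C: "0 \<le> C" "\<And>R (x::'a). 0 < R \<Longrightarrow> tail_slope R x \<le> C / R"
  define N where "N = real DIM('a)"
  \<comment> \<open>Half of e for each of the two terms; \<epsilon> \<le> 1 makes 1 / \<epsilon>
    \<ge> 1, so that its variable power is bounded by the fixed one in K.\<close>
  define \<epsilon> where "\<epsilon> = min 1 (e / (2 * (B + 1)))"
  have \<epsilon>: "0 < \<epsilon>" "\<epsilon> \<le> 1" using e B by (auto simp: \<epsilon>_def)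
  have \<epsilon>B: "\<epsilon> * B \<le> e / 2"
  proof -
    have "\<epsilon> * B \<le> e / (2 * (B + 1)) * (B + 1)" using e B by (intro mult_mono) (auto simp: \<epsilon>_def)
    also have "\<dots> = e / 2" using B by (simp add: field_simps)
    finally show ?thesis .
  qed
  define K where "K = (1 / \<epsilon>) powr (Pm / \<kappa>)"
  have K: "0 < K" using \<epsilon> by (simp add: K_def)
  define \<omega> where "\<omega> = unit_ball_vol N"
  have \<omega>: "0 \<le> \<omega>" unfolding \<omega>_def N_def by (intro less_imp_le unit_ball_vol_pos) simp
  \<comment> \<open>A power of the slope bound C / R times the volume of the ball of radius 2 N R:
    of order R^(- \<kappa>).\<close>
  define Z where "Z R = (C / R) powr (N + \<kappa>) * (\<omega> * (2 * N * R) ^ DIM('a))" for R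
  have ZR: "Z R = C powr (N + \<kappa>) * \<omega> * (2 * N) powr N * R powr (- \<kappa>)" if R: "1 \<le> R" for R
  proof -
    have "(2 * N * R) ^ DIM('a) = (2 * N) powr N * R powr N"
      using R dim by (simp add: N_def powr_realpow power_mult_distrib)
    moreover have "(C / R) powr (N + \<kappa>) = C powr (N + \<kappa>) * R powr (- (N + \<kappa>))"
      using C(1) R unfolding powr_minus by (simp add: powr_divide divide_inverse powr_mult inverse_powr)
    moreover have "R powr (- (N + \<kappa>)) * R powr N = R powr (- \<kappa>)" by (simp add: powr_add[symmetric])
    ultimately show ?thesis by (simp add: Z_def mult_ac)
  qed
  have lim: "((\<lambda>R. K * (C powr (N + \<kappa>) * \<omega> * (2 * N) powr N * R powr (- \<kappa>))) \<longlongrightarrow> K * (C powr (N + \<kappa>) * \<omega> * (2 * N) powr N * 0)) at_top"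
    by (intro tendsto_intros tendsto_neg_powr filterlim_ident) (use \<kappa> in auto)
  have "\<forall>\<^sub>F R in at_top. K * (C powr (N + \<kappa>) * \<omega> * (2 * N) powr N * R powr (- \<kappa>)) < e / 2"
    by (rule order_tendstoD(2)[OF lim]) (use e in simp)
  \<comment> \<open>C \<le> R makes the slope at most 1, so that larger exponents give smaller
    powers.\<close>
  moreover have "\<forall>\<^sub>F R in at_top. 1 \<le> R \<and> C \<le> R" by (intro eventually_conj eventually_ge_at_top)
  ultimately show ?thesis
  proof eventually_elim
    case (elim R)
    have R: "1 \<le> R" "C \<le> R" and KZ: "K * Z R \<le> e / 2" using elim ZR by auto
    show ?case
    proof (intro allI impI)
      fix u :: "'a \<Rightarrow> real"
      assume um: "u \<in> borel_measurable lebesgue" and uB: "modular lebesgue P u \<le> ennreal B"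
      note [measurable] = um exponents_measurable_lebesgue
      have "modular lebesgue q (\<lambda>x. u x * tail_slope R x) \<le>
        (\<integral>\<^sup>+x. ennreal \<epsilon> * ennreal (\<bar>u x\<bar> powr P x) + ennreal (K * (C / R) powr (N + \<kappa>)) * indicator (cball 0 (2 * N * R)) x \<partial>lebesgue)"
        unfolding modular_def
      proof (rule nn_integral_mono)
        fix x :: 'a
        define D where "D = tail_slope R x"
        have D: "0 \<le> D" "D \<le> C / R" using C(2)[of R x] R tail_slope_nonneg by (auto simp: D_def)
        have CR: "C / R \<le> 1" using R by simp
        have PQ: "\<kappa> \<le> P x - q x" "0 < q x" "0 < P x - q x" using qP[of x] q1[of x] \<kappa> by linarith+
        define s where "s = q x * P x / (P x - q x)"
        have s: "N + \<kappa> \<le> s" using decay[of x] PQ by (simp add: s_def N_def pos_le_divide_eq)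
        have "D powr s \<le> (C / R) powr (N + \<kappa>) * indicat_real (cball 0 (2 * N * R)) x"
        proof (cases "norm x \<le> 2 * N * R")
          case True
          have "D powr s \<le> D powr (N + \<kappa>)" using D CR s by (intro powr_mono') auto
          also have "\<dots> \<le> (C / R) powr (N + \<kappa>)" using D \<kappa> by (intro powr_mono2) (auto simp: N_def)
          finally show ?thesis using True by simp
        next
          case False
          then have "D = 0" using tail_slope_eq_0[of R x] R by (simp add: D_def N_def)
          then show ?thesis by simp
        qed
        moreover have "(1 / \<epsilon>) powr (q x / (P x - q x)) \<le> K"
          unfolding K_def
          by (intro powr_mono frac_le) (use PQ exponents_le_Pm(2)[of x] exponents_le_Pm(6) \<kappa> \<epsilon> in auto)
        ultimately have "(1 / \<epsilon>) powr (q x / (P x - q x)) * D powr s \<le> K * ((C / R) powr (N + \<kappa>) * indicat_real (cball 0 (2 * N * R)) x)"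
          using K by (intro mult_mono) auto
        then have "(\<bar>u x\<bar> * D) powr q x \<le> \<epsilon> * \<bar>u x\<bar> powr P x + K * (C / R) powr (N + \<kappa>) * indicat_real (cball 0 (2 * N * R)) x"
          using power_gap_Young[of "\<bar>u x\<bar>" D \<epsilon> "q x" "P x"] D \<epsilon> PQ by (simp add: s_def mult.assoc)
        then have "ennreal (\<bar>u x * tail_slope R x\<bar> powr q x) \<le> ennreal (\<epsilon> * \<bar>u x\<bar> powr P x + K * (C / R) powr (N + \<kappa>) * indicat_real (cball 0 (2 * N * R)) x)"
          using D(1) by (intro ennreal_leI) (simp add: abs_mult D_def)
        also have "\<dots> = ennreal \<epsilon> * ennreal (\<bar>u x\<bar> powr P x) + ennreal (K * (C / R) powr (N + \<kappa>)) * indicator (cball 0 (2 * N * R)) x"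
          using \<epsilon> K by (simp add: ennreal_mult ennreal_indicator)
        finally show "ennreal (\<bar>u x * tail_slope R x\<bar> powr q x) \<le> ennreal \<epsilon> * ennreal (\<bar>u x\<bar> powr P x) + ennreal (K * (C / R) powr (N + \<kappa>)) * indicator (cball 0 (2 * N * R)) x" .
      qed
      also have "\<dots> = ennreal \<epsilon> * modular lebesgue P u + ennreal (K * (C / R) powr (N + \<kappa>)) * emeasure lebesgue (cball (0::'a) (2 * N * R))"
      proof -
        have c: "cball (0::'a) (2 * N * R) \<in> sets lebesgue" by simp
        have m: "(\<lambda>x. ennreal (\<bar>u x\<bar> powr P x)) \<in> borel_measurable lebesgue" by measurable
        show ?thesis
          unfolding modular_def nn_integral_cmult[OF m, symmetric] nn_integral_cmult_indicator[OF c, symmetric]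
          by (intro nn_integral_add borel_measurable_times_ennreal borel_measurable_const m borel_measurable_indicator c)
      qed
      also have "emeasure lebesgue (cball (0::'a) (2 * N * R)) = ennreal (\<omega> * (2 * N * R) ^ DIM('a))"
        using R by (simp add: emeasure_cball \<omega>_def N_def)
      also have "ennreal (K * (C / R) powr (N + \<kappa>)) * \<dots> = ennreal (K * Z R)"
        using K \<omega> R by (simp add: Z_def ennreal_mult[symmetric] N_def mult.assoc)
      also have "ennreal \<epsilon> * modular lebesgue P u + ennreal (K * Z R) \<le> ennreal \<epsilon> * ennreal B + ennreal (K * Z R)"
        by (intro add_right_mono mult_left_mono uB) simp
      also have "\<dots> = ennreal (\<epsilon> * B + K * Z R)"
        using \<epsilon> B K \<omega> R by (simp add: Z_def ennreal_mult N_def)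
      also have "\<dots> \<le> ennreal e" using \<epsilon>B KZ by (intro ennreal_leI) linarith
      finally show "modular lebesgue q (\<lambda>x. u x * tail_slope R x) \<le> ennreal e" .
    qed
  qed
qed

text \<open>The gradient of the product is tail \<nabla>u + u \<nabla>tail; v and w dominate the
  first summand in the two parts of the sum space, and the second is charged to the q-part.\<close>

lemma tail_mult_X:
  fixes v w :: "'a \<Rightarrow> real"
  assumes u: "u \<in> X" and R: "0 < R"
    and v: "v \<in> Lvar lebesgue p" "\<And>x. 0 \<le> v x" and w: "w \<in> Lvar lebesgue q" "\<And>x. 0 \<le> w x"
    and vw: "AE x in lebesgue. tail R x * norm (wgrad u x) \<le> v x + w x"
    and D: "(\<lambda>x. u x * tail_slope R x) \<in> Lvar lebesgue q"
  shows "(\<lambda>x. tail R x * u x) \<in> X"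
    "X_norm (\<lambda>x. tail R x * u x) \<le> luxemburg (weighted V) \<alpha> (\<lambda>x. tail R x * u x) + luxemburg lebesgue p v
       + luxemburg lebesgue q w + luxemburg lebesgue q (\<lambda>x. u x * tail_slope R x)"
proof -
  let ?f = "\<lambda>x. tail R x * u x"
  obtain u' g where wp: "weak_partials u' g" and uu': "AE x in lebesgue. u x = u' x"
    and gi: "AE x in lebesgue. \<forall>i\<in>Basis. wgrad u x \<bullet> i = g i x" and "wgrad u \<in> borel_measurable lebesgue"
    by (rule has_weak_gradient_partials[OF X_props(3)[OF u]])
  let ?d = "\<lambda>i x. frechet_derivative (tail R) (at x) i"
  have fm: "?f \<in> borel_measurable lebesgue" using measurable_tail X_props(2)[OF u] by (rule borel_measurable_times)
  have ff: "AE x in lebesgue. ?f x = tail R x * u' x" using uu' by eventually_elim simp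
  have G: "has_weak_gradient ?f (\<lambda>x. \<Sum>i\<in>Basis. (tail R x * g i x + u' x * ?d i x) *\<^sub>R i)"
    by (rule partials_has_weak_gradient[OF weak_partials_cong_product[OF wp Ck_tail] fm ff])
  have gm: "wgrad ?f \<in> borel_measurable lebesgue"
  proof (rule has_weak_gradient_partials[OF has_weak_gradient_wgrad[OF G]])
  qed assumption
  have fL: "?f \<in> Lvar (weighted V) \<alpha>"
  proof (rule Lvar_mono[OF exponents_measurable_weighted(1) exponents_ge1(3) X_props(1)[OF u]])
    show "?f \<in> borel_measurable (weighted V)" using fm by (simp add: measurable_weighted)
    show "AE x in weighted V. \<bar>?f x\<bar> \<le> \<bar>u x\<bar>"
    proof (rule AE_I2)
      show "\<bar>?f x\<bar> \<le> \<bar>u x\<bar>" for x using tail_bounds[of R x] by (simp add: abs_mult mult_left_le_one_le)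
    qed
  qed
  define z where "z x = w x + \<bar>u x * tail_slope R x\<bar>" for x
  have DL: "(\<lambda>x. \<bar>u x * tail_slope R x\<bar>) \<in> Lvar lebesgue q" using D by (auto simp: Lvar_def modular_def)
  have z: "z \<in> Lvar lebesgue q"
    unfolding z_def[abs_def]
    by (rule Lvar_add[OF exponents_measurable_lebesgue(2) exponents_ge1(2) w(1) DL exponents_le_Pm(2)])
  have z0: "0 \<le> z x" for x using w(2) by (simp add: z_def)
  have vz: "AE x in lebesgue. norm (wgrad ?f x) \<le> v x + z x"
    using has_weak_gradient_unique[OF has_weak_gradient_wgrad[OF G] G] gi uu' vw
  proof eventually_elim
    case (elim x)
    have "wgrad ?f x = (\<Sum>i\<in>Basis. (tail R x * (wgrad u x \<bullet> i) + u x * ?d i x) *\<^sub>R i)"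
      unfolding elim(1) using elim(2,3) by (intro sum.cong) auto
    also have "\<dots> = tail R x *\<^sub>R (\<Sum>i\<in>Basis. (wgrad u x \<bullet> i) *\<^sub>R i) + (\<Sum>i\<in>Basis. (u x * ?d i x) *\<^sub>R i)"
      by (simp add: scaleR_left_distrib sum.distrib scaleR_sum_right)
    also have "(\<Sum>i\<in>Basis. (wgrad u x \<bullet> i) *\<^sub>R i) = wgrad u x" by (rule euclidean_representation)
    finally have "norm (wgrad ?f x) \<le> norm (tail R x *\<^sub>R wgrad u x) + norm (\<Sum>i\<in>Basis. (u x * ?d i x) *\<^sub>R i)"
      by (simp only: norm_triangle_ineq)
    also have "norm (\<Sum>i\<in>Basis. (u x * ?d i x) *\<^sub>R i) \<le> (\<Sum>i\<in>Basis. \<bar>u x\<bar> * \<bar>?d i x\<bar>)"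
      by (rule order_trans[OF norm_sum]) (simp add: sum_mono abs_mult)
    also have "\<dots> = \<bar>u x * tail_slope R x\<bar>"
      using tail_slope_nonneg[of R x] by (simp add: tail_slope_def sum_distrib_left[symmetric] abs_mult)
    finally show ?case using elim(4) tail_bounds[of R x] by (simp add: z_def)
  qed
  have gm': "(\<lambda>x. norm (wgrad ?f x)) \<in> borel_measurable lebesgue" using gm by measurable
  note S = sum_norm_le[OF exponents_measurable_lebesgue(1) exponents_ge1(1) exponents_measurable_lebesgue(2) exponents_ge1(2)
    gm' norm_ge_zero vz v z z0]
  show "?f \<in> X" using fL G S(1) by (auto simp: sol_space_def)
  have "luxemburg lebesgue q z \<le> luxemburg lebesgue q w + luxemburg lebesgue q (\<lambda>x. \<bar>u x * tail_slope R x\<bar>)"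
    unfolding z_def[abs_def] by (rule luxemburg_add[OF exponents_measurable_lebesgue(2) exponents_ge1(2) w(1) DL])
  moreover have "luxemburg lebesgue q (\<lambda>x. \<bar>u x * tail_slope R x\<bar>) = luxemburg lebesgue q (\<lambda>x. u x * tail_slope R x)"
    by (simp add: luxemburg_def modular_def)
  ultimately show "X_norm ?f \<le> luxemburg (weighted V) \<alpha> ?f + luxemburg lebesgue p v
       + luxemburg lebesgue q w + luxemburg lebesgue q (\<lambda>x. u x * tail_slope R x)"
    unfolding sol_norm_def using S(2) by linarith
qed

end

subsection \<open>Concentration at infinity\<close>

text \<open>The threshold 1 is where the growth estimate changes from the exponent p to q, so this
  is the decomposition for which the energy controls both modulars.\<close>

definition grad_big :: "('a::euclidean_space \<Rightarrow> real) \<Rightarrow> 'a \<Rightarrow> real" where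
  "grad_big u x = (if 1 < norm (wgrad u x) then norm (wgrad u x) else 0)"

definition grad_small :: "('a::euclidean_space \<Rightarrow> real) \<Rightarrow> 'a \<Rightarrow> real" where
  "grad_small u x = (if 1 < norm (wgrad u x) then 0 else norm (wgrad u x))"

lemma grad_split: "norm (wgrad u x) = grad_big u x + grad_small u x" "0 \<le> grad_big u x" "0 \<le> grad_small u x"
  by (auto simp: grad_big_def grad_small_def)

context weights
begin

lemma X_gradient_measurable:
  assumes u: "u \<in> X"
  shows "grad_big u \<in> borel_measurable lebesgue" "grad_small u \<in> borel_measurable lebesgue"
proof -
  have [measurable]: "wgrad u \<in> borel_measurable lebesgue"
  proof (rule has_weak_gradient_partials[OF X_props(3)[OF u]])
  qed assumption
  show "grad_big u \<in> borel_measurable lebesgue" unfolding grad_big_def[abs_def] by measurable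
  show "grad_small u \<in> borel_measurable lebesgue" unfolding grad_small_def[abs_def] by measurable
qed

text \<open>Each modular is dominated pointwise by the energy density on S, up to the factor 1 / M1
  for the gradient parts. The choices are \<phi> = tail R outside a ball and \<phi> = 1 on the whole
  space.\<close>

lemma energy_controls_modulars:
  assumes M1: "0 < M1" and A: "\<And>x \<xi>. M1 * norm \<xi> powr (if 1 < norm \<xi> then p x else q x) \<le> A x \<xi>"
    and u: "u \<in> X" and int: "integrable lebesgue (\<lambda>x. A x (wgrad u x) + V x * \<bar>u x\<bar> powr \<alpha> x)"
    and S: "S \<in> sets lebesgue" and \<phi>: "\<And>x. 0 \<le> \<phi> x" "\<And>x. \<phi> x \<le> 1" "\<And>x. x \<notin> S \<Longrightarrow> \<phi> x = 0"
    and \<phi>m: "\<phi> \<in> borel_measurable lebesgue"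
  defines "E \<equiv> LINT x:S|lebesgue. A x (wgrad u x) + V x * \<bar>u x\<bar> powr \<alpha> x"
  shows "0 \<le> E" "modular (weighted V) \<alpha> (\<lambda>x. \<phi> x * u x) \<le> ennreal E"
    "modular lebesgue p (\<lambda>x. \<phi> x * grad_big u x) \<le> ennreal (E / M1)"
    "modular lebesgue q (\<lambda>x. \<phi> x * grad_small u x) \<le> ennreal (E / M1)"
proof -
  define g where "g x = A x (wgrad u x) + V x * \<bar>u x\<bar> powr \<alpha> x" for x
  have A0: "0 \<le> A x \<xi>" for x \<xi>
    by (rule order_trans[OF _ A]) (use M1 in simp)
  have g0: "AE x in lebesgue. 0 \<le> g x \<and> 0 < V x"
    using V(4)
  proof eventually_elim
    case (elim x)
    then show ?case using A0 V(3) by (simp add: g_def)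
  qed
  have gi: "integrable lebesgue (\<lambda>x. indicat_real S x * g x)"
    using integrable_bounded_mult[OF _ _ int, of "indicat_real S" 1] S by (auto simp: g_def indicator_def)
  have gS: "AE x in lebesgue. 0 \<le> indicat_real S x * g x" using g0 by eventually_elim simp
  have E: "E = (LINT x|lebesgue. indicat_real S x * g x)" by (simp add: E_def g_def set_lebesgue_integral_def)
  show "0 \<le> E" unfolding E by (rule integral_nonneg_AE[OF gS])
  have nn: "(\<integral>\<^sup>+x. ennreal (indicat_real S x * g x) \<partial>lebesgue) = ennreal E"
    unfolding E by (rule nn_integral_eq_integral[OF gi gS])
  have um: "(\<lambda>x. \<phi> x * u x) \<in> borel_measurable lebesgue" using \<phi>m X_props(2)[OF u] by (rule borel_measurable_times)
  have part: "\<bar>\<phi> x * y\<bar> powr e \<le> indicat_real S x * y powr e" if "0 \<le> y" "0 < e" for x y and e :: real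
  proof (cases "x \<in> S")
    case True
    have "\<bar>\<phi> x * y\<bar> \<le> y" using that \<phi>(1,2)[of x] by (simp add: abs_mult mult_left_le_one_le)
    then show ?thesis using True that by (simp add: powr_mono2)
  qed (simp add: \<phi>(3))
  have "modular (weighted V) \<alpha> (\<lambda>x. \<phi> x * u x) \<le> (\<integral>\<^sup>+x. ennreal (indicat_real S x * g x) \<partial>lebesgue)"
    unfolding modular_weighted[OF V(1) um exps_measurable(3)]
  proof (rule nn_integral_mono_AE)
    show "AE x in lebesgue. ennreal (V x) * ennreal (\<bar>\<phi> x * u x\<bar> powr \<alpha> x) \<le> ennreal (indicat_real S x * g x)"
      using g0
    proof eventually_elim
      case (elim x)
      have "\<bar>\<phi> x * u x\<bar> powr \<alpha> x \<le> indicat_real S x * \<bar>u x\<bar> powr \<alpha> x"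
        using part[of "\<bar>u x\<bar>" "\<alpha> x" x] exp_le_Pm(1) by (simp add: abs_mult)
      then have "V x * \<bar>\<phi> x * u x\<bar> powr \<alpha> x \<le> V x * (indicat_real S x * \<bar>u x\<bar> powr \<alpha> x)"
        using elim by (intro mult_left_mono) auto
      also have "\<dots> \<le> indicat_real S x * g x" using A0 by (simp add: g_def indicator_def)
      finally show ?case using elim by (simp add: ennreal_mult[symmetric] ennreal_leI)
    qed
  qed
  then show "modular (weighted V) \<alpha> (\<lambda>x. \<phi> x * u x) \<le> ennreal E" unfolding nn .
  have grad: "modular lebesgue r (\<lambda>x. \<phi> x * f x) \<le> ennreal (E / M1)"
    if r: "\<And>x. 0 < r x" and f: "\<And>x. 0 \<le> f x" "\<And>x. M1 * f x powr r x \<le> A x (wgrad u x)" for f r :: "'a \<Rightarrow> real"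
  proof -
    have "modular lebesgue r (\<lambda>x. \<phi> x * f x) \<le> (\<integral>\<^sup>+x. ennreal (1 / M1) * ennreal (indicat_real S x * g x) \<partial>lebesgue)"
      unfolding modular_def
    proof (rule nn_integral_mono_AE)
      show "AE x in lebesgue. ennreal (\<bar>\<phi> x * f x\<bar> powr r x) \<le> ennreal (1 / M1) * ennreal (indicat_real S x * g x)"
        using g0
      proof eventually_elim
        case (elim x)
        have "M1 * f x powr r x \<le> g x" using f(2)[of x] elim by (simp add: g_def add_increasing2)
        then have "f x powr r x \<le> 1 / M1 * g x" using M1 by (simp add: pos_le_divide_eq mult.commute)
        then have "indicat_real S x * f x powr r x \<le> indicat_real S x * (1 / M1 * g x)" by (rule mult_left_mono) simp
        with part[OF f(1) r, of x x x] have "\<bar>\<phi> x * f x\<bar> powr r x \<le> 1 / M1 * (indicat_real S x * g x)" by simp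
        then show ?case using elim M1 by (simp add: ennreal_mult[symmetric] ennreal_leI del: times_divide_eq_left)
      qed
    qed
    also have "\<dots> = ennreal (1 / M1) * ennreal E"
      unfolding nn[symmetric] by (rule nn_integral_cmult) (use gi in simp)
    also have "\<dots> = ennreal (E / M1)" using M1 \<open>0 \<le> E\<close> by (simp add: ennreal_mult[symmetric])
    finally show ?thesis .
  qed
  have pos: "0 < p x" "0 < q x" for x using p1[of x] q1[of x] by linarith+
  show "modular lebesgue p (\<lambda>x. \<phi> x * grad_big u x) \<le> ennreal (E / M1)"
  proof (rule grad[OF pos(1) grad_split(2)])
    show "M1 * grad_big u x powr p x \<le> A x (wgrad u x)" for x
      using A[of "wgrad u x" x] A0[of x "wgrad u x"] by (simp add: grad_big_def split: if_splits)
  qed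
  show "modular lebesgue q (\<lambda>x. \<phi> x * grad_small u x) \<le> ennreal (E / M1)"
  proof (rule grad[OF pos(2) grad_split(3)])
    show "M1 * grad_small u x powr q x \<le> A x (wgrad u x)" for x
      using A[of "wgrad u x" x] A0[of x "wgrad u x"] by (simp add: grad_small_def split: if_splits)
  qed
qed

text \<open>\<open>Sobolev_bounded\<close> for the split gradient. Applied to u_n itself and not to
  its tail, it gives a bound that does not depend on R, as \<open>tail_slope_small\<close>
  requires.\<close>

lemma critical_modular_bounded:
  assumes m: "0 \<le> m"
  shows "\<exists>B\<ge>0. \<forall>u\<in>X. modular lebesgue \<alpha> u \<le> ennreal m \<longrightarrow> modular lebesgue p (grad_big u) \<le> ennreal m \<longrightarrow>
    modular lebesgue q (grad_small u) \<le> ennreal m \<longrightarrow> modular lebesgue P u \<le> ennreal B"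
proof -
  obtain K where K: "K \<ge> 1" and S: "\<forall>(u :: 'a \<Rightarrow> real) G v w. has_weak_gradient u G \<longrightarrow> v \<in> borel_measurable lebesgue \<longrightarrow> w \<in> borel_measurable lebesgue \<longrightarrow>
    (\<forall>x. 0 \<le> v x) \<longrightarrow> (\<forall>x. 0 \<le> w x) \<longrightarrow> (AE x in lebesgue. norm (G x) \<le> v x + w x) \<longrightarrow>
    modular lebesgue \<alpha> u \<le> ennreal m \<longrightarrow> modular lebesgue p v \<le> ennreal m \<longrightarrow> modular lebesgue q w \<le> ennreal m \<longrightarrow>
    modular lebesgue P (\<lambda>x. u x / K) \<le> 1"
    using Sobolev_bounded[OF m] by blast
  show ?thesis
  proof (intro exI[of _ "K powr Pm"] conjI ballI impI)
    fix u assume u: "u \<in> X" and le: "modular lebesgue \<alpha> u \<le> ennreal m" "modular lebesgue p (grad_big u) \<le> ennreal m"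
      "modular lebesgue q (grad_small u) \<le> ennreal m"
    have ae: "AE x in lebesgue. norm (wgrad u x) \<le> grad_big u x + grad_small u x" by (simp add: grad_split(1))
    have 1: "modular lebesgue P (\<lambda>x. u x / K) \<le> 1"
      using S[rule_format, OF X_props(3)[OF u] X_gradient_measurable[OF u] grad_split(2,3) ae le] .
    have m: "(\<lambda>x. ennreal (\<bar>u x / K\<bar> powr P x)) \<in> borel_measurable lebesgue"
      using X_props(2)[OF u] exponents_measurable_lebesgue(4) by measurable
    have "modular lebesgue P u \<le> (\<integral>\<^sup>+x. ennreal (K powr Pm) * ennreal (\<bar>u x / K\<bar> powr P x) \<partial>lebesgue)"
      unfolding modular_def
    proof (rule nn_integral_mono)
      fix x
      have "\<bar>u x\<bar> powr P x = K powr P x * \<bar>u x / K\<bar> powr P x" using K by (simp add: powr_divide)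
      also have "\<dots> \<le> K powr Pm * \<bar>u x / K\<bar> powr P x" using K PPm by (intro mult_right_mono powr_mono) auto
      finally show "ennreal (\<bar>u x\<bar> powr P x) \<le> ennreal (K powr Pm) * ennreal (\<bar>u x / K\<bar> powr P x)"
        by (simp add: ennreal_mult[symmetric] ennreal_leI)
    qed
    also have "\<dots> = ennreal (K powr Pm) * modular lebesgue P (\<lambda>x. u x / K)"
      unfolding modular_def by (rule nn_integral_cmult[OF m])
    also have "\<dots> \<le> ennreal (K powr Pm) * 1" by (intro mult_left_mono 1) simp
    finally show "modular lebesgue P u \<le> ennreal (K powr Pm)" by simp
  qed simp
qed

lemma mass_le_modular_b:
  assumes u: "u \<in> borel_measurable lebesgue" and int: "integrable lebesgue (\<lambda>x. b x * \<bar>u x\<bar> powr t x)"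
    and S: "S \<in> sets lebesgue" and \<phi>: "\<And>x. x \<in> S \<Longrightarrow> \<phi> x = 1" and \<phi>m: "\<phi> \<in> borel_measurable lebesgue"
  shows "ennreal (LINT x:S|lebesgue. b x * \<bar>u x\<bar> powr t x) \<le> modular (weighted b) t (\<lambda>x. \<phi> x * u x)"
proof -
  have gi: "integrable lebesgue (\<lambda>x. indicat_real S x * (b x * \<bar>u x\<bar> powr t x))"
    using integrable_bounded_mult[OF _ _ int, of "indicat_real S" 1] S by (auto simp: indicator_def)
  have gS: "AE x in lebesgue. 0 \<le> indicat_real S x * (b x * \<bar>u x\<bar> powr t x)" using b(2) by eventually_elim simp
  have "ennreal (LINT x:S|lebesgue. b x * \<bar>u x\<bar> powr t x) = (\<integral>\<^sup>+x. ennreal (indicat_real S x * (b x * \<bar>u x\<bar> powr t x)) \<partial>lebesgue)"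
    unfolding nn_integral_eq_integral[OF gi gS] by (simp add: set_lebesgue_integral_def)
  also have "\<dots> \<le> (\<integral>\<^sup>+x. ennreal (b x) * ennreal (\<bar>\<phi> x * u x\<bar> powr t x) \<partial>lebesgue)"
  proof (rule nn_integral_mono_AE)
    show "AE x in lebesgue. ennreal (indicat_real S x * (b x * \<bar>u x\<bar> powr t x)) \<le> ennreal (b x) * ennreal (\<bar>\<phi> x * u x\<bar> powr t x)"
      using b(2)
    proof eventually_elim
      case (elim x)
      then show ?case using \<phi>[of x] by (auto simp: ennreal_mult[symmetric] indicator_def)
    qed
  qed
  also have "\<dots> = modular (weighted b) t (\<lambda>x. \<phi> x * u x)"
    by (rule modular_weighted[OF b(1) _ t(1), symmetric]) (use u \<phi>m in simp)
  finally show ?thesis .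
qed

end

text \<open>The limit m may be 0, where continuity of the power rests on f staying nonnegative and
  on the limiting exponent 1 / r being positive.\<close>

lemma powr_exponent_limit:
  fixes f :: "real \<Rightarrow> real"
  assumes f: "(f \<longlongrightarrow> m) (at_right 0)" "\<forall>\<^sub>F e in at_right 0. 0 \<le> f e" and r: "0 < r"
  shows "((\<lambda>e. f e powr (1 / (r - e))) \<longlongrightarrow> m powr (1 / r)) (at_right 0)"
    "((\<lambda>e. f e powr (1 / (r + e))) \<longlongrightarrow> m powr (1 / r)) (at_right 0)"
proof -
  have id: "((\<lambda>e::real. e) \<longlongrightarrow> 0) (at_right 0)" by (rule tendsto_ident_at)
  have "((\<lambda>e. 1 / (r - e)) \<longlongrightarrow> 1 / (r - 0)) (at_right 0)" "((\<lambda>e. 1 / (r + e)) \<longlongrightarrow> 1 / (r + 0)) (at_right 0)"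
    by (intro tendsto_intros id; use r in simp)+
  then have l: "((\<lambda>e. 1 / (r - e)) \<longlongrightarrow> 1 / r) (at_right 0)" "((\<lambda>e. 1 / (r + e)) \<longlongrightarrow> 1 / r) (at_right 0)" by simp_all
  show "((\<lambda>e. f e powr (1 / (r - e))) \<longlongrightarrow> m powr (1 / r)) (at_right 0)"
    by (rule tendsto_powr'[OF f(1) l(1)]) (use f(2) r in auto)
  show "((\<lambda>e. f e powr (1 / (r + e))) \<longlongrightarrow> m powr (1 / r)) (at_right 0)"
    by (rule tendsto_powr'[OF f(1) l(2)]) (use f(2) r in auto)
qed

lemma exponent_close_at_infinity:
  fixes r :: "'a::euclidean_space \<Rightarrow> real"
  assumes "(r \<longlongrightarrow> c) at_infinity" "0 < e"
  shows "\<forall>\<^sub>F R in at_top. \<forall>x. R < norm x \<longrightarrow> c - e \<le> r x \<and> r x \<le> c + e"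
proof -
  have "\<forall>\<^sub>F x in at_infinity. dist (r x) c < e" by (rule tendstoD[OF assms])
  then obtain R0 where R0: "\<And>x. R0 \<le> norm x \<Longrightarrow> dist (r x) c < e" unfolding eventually_at_infinity by blast
  show ?thesis
    using eventually_ge_at_top[of R0]
  proof eventually_elim
    case (elim R)
    show ?case
    proof (intro allI impI)
      fix x :: 'a assume "R < norm x"
      then have "dist (r x) c < e" using R0[of x] elim by linarith
      then show "c - e \<le> r x \<and> r x \<le> c + e" unfolding dist_real_def by linarith
    qed
  qed
qed

context weights
begin

text \<open>For each small e first R and then n are chosen, and the product of \<open>tail R\<close>
  and u_n is tested against the best constant. This yields G e \<le> F e, and e tends to 0.\<close>

proposition concentration_at_infinity:
  fixes A :: "'a \<Rightarrow> 'a \<Rightarrow> real" and un :: "nat \<Rightarrow> 'a \<Rightarrow> real"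
  defines "g \<equiv> \<lambda>n x. A x (wgrad (un n) x) + V x * \<bar>un n x\<bar> powr \<alpha> x" and "h \<equiv> \<lambda>n x. b x * \<bar>un n x\<bar> powr t x"
  assumes M1: "0 < M1" and A: "\<And>x \<xi>. M1 * norm \<xi> powr (if 1 < norm \<xi> then p x else q x) \<le> A x \<xi>"
    and un: "\<And>n. un n \<in> X" and gi: "\<And>n. integrable lebesgue (g n)" and hi: "\<And>n. integrable lebesgue (h n)"
    and gC: "\<And>n. (LINT x|lebesgue. g n x) \<le> C" and hC: "\<And>n. (LINT x|lebesgue. h n x) \<le> C'"
    and \<mu>: "mass_at_infinity g = ereal \<mu>i" and \<nu>: "mass_at_infinity h = ereal \<nu>i"
    and pos: "0 < pinf" "0 < qinf" "0 < \<alpha>i" "0 < ti"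
    and lim: "(p \<longlongrightarrow> pinf) at_infinity" "(q \<longlongrightarrow> qinf) at_infinity" "(\<alpha> \<longlongrightarrow> \<alpha>i) at_infinity" "(t \<longlongrightarrow> ti) at_infinity"
  shows "real_of_ereal (best_const V \<alpha> p q b t) * \<nu>i powr (1 / ti)
    \<le> max 1 (M1 powr (- (1 / pinf))) * (\<mu>i powr (1 / pinf) + \<mu>i powr (1 / qinf) + \<mu>i powr (1 / \<alpha>i))"
proof -
  define S where "S = real_of_ereal (best_const V \<alpha> p q b t)"
  have S0: "0 \<le> S" unfolding S_def using best_const_pos_finite by (intro real_of_ereal_pos) auto
  have A0: "0 \<le> A x \<xi>" for x \<xi> by (rule order_trans[OF _ A]) (use M1 in simp)
  have g0: "AE x in lebesgue. 0 \<le> g n x" for n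
    using V(4)
  proof eventually_elim
    case (elim x) then show ?case using A0 V(3) by (simp add: g_def)
  qed
  have h0: "AE x in lebesgue. 0 \<le> h n x" for n
    using b(2) by eventually_elim (simp add: h_def)
  note gm = mass_at_infinity_props[of g, OF gi g0 gC] and hm = mass_at_infinity_props[of h, OF hi h0 hC]
  have \<mu>0: "0 \<le> \<mu>i" and \<nu>0: "0 \<le> \<nu>i" using gm(3) hm(3) by (simp_all add: \<mu> \<nu>)
  define m where "m = max (C / V0) (C / M1)"
  have C0: "0 \<le> C" using order_trans[OF integral_nonneg_AE[OF g0] gC] .
  have m: "0 \<le> m" "C / V0 \<le> m" "C / M1 \<le> m" using C0 V(3) M1 by (auto simp: m_def le_max_iff_disj)
  obtain B where B: "0 \<le> B" and "\<forall>u\<in>X. modular lebesgue \<alpha> u \<le> ennreal m \<longrightarrow> modular lebesgue p (grad_big u) \<le> ennreal m \<longrightarrow>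
    modular lebesgue q (grad_small u) \<le> ennreal m \<longrightarrow> modular lebesgue P u \<le> ennreal B"
    using critical_modular_bounded[OF m(1)] by blast
  note BP = this(2)[rule_format]
  have full: "modular lebesgue P (un n) \<le> ennreal B" for n
  proof -
    have E: "(LINT x:UNIV|lebesgue. A x (wgrad (un n) x) + V x * \<bar>un n x\<bar> powr \<alpha> x) \<le> C"
      using gC[of n] by (simp add: g_def set_lebesgue_integral_def)
    note en = energy_controls_modulars[OF M1 A un gi[unfolded g_def, of n], of UNIV "\<lambda>_. 1", simplified]
    have "modular lebesgue \<alpha> (un n) \<le> ennreal (1 / V0) * modular (weighted V) \<alpha> (un n)"
      by (rule modular_V_bound[OF X_props(2)[OF un]])
    also have "\<dots> \<le> ennreal (1 / V0) * ennreal C"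
      by (intro mult_left_mono order_trans[OF en(2)] ennreal_leI E) simp
    also have "\<dots> = ennreal (C / V0)" using V(3) C0 by (simp add: ennreal_mult[symmetric])
    also have "\<dots> \<le> ennreal m" using m(2) by (rule ennreal_leI)
    finally have a: "modular lebesgue \<alpha> (un n) \<le> ennreal m" .
    have EM: "(LINT x:UNIV|lebesgue. A x (wgrad (un n) x) + V x * \<bar>un n x\<bar> powr \<alpha> x) / M1 \<le> m"
      using divide_right_mono[OF E, of M1] M1 m(3) by linarith
    show ?thesis
      by (rule BP[OF un a order_trans[OF en(3) ennreal_leI[OF EM]] order_trans[OF en(4) ennreal_leI[OF EM]]])
  qed
  define U where "U f r e = max (f e powr (1 / (r - e))) (f e powr (1 / (r + e)))" for f :: "real \<Rightarrow> real" and r e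
  \<comment> \<open>Upper bounds for the four norms in \<open>tail_mult_X\<close>: the exponents are
    known up to e outside a ball, except in the last term, where 1 \<le> q \<le> Pm is enough
    because its modular is at most e.\<close>
  define F where "F e = U (\<lambda>e. \<mu>i + e) \<alpha>i e + U (\<lambda>e. (\<mu>i + e) / M1) pinf e + U (\<lambda>e. (\<mu>i + e) / M1) qinf e
     + max (e powr (1 / 1)) (e powr (1 / Pm))" for e
  define G where "G e = S * min ((\<nu>i - e) powr (1 / (ti - e))) ((\<nu>i - e) powr (1 / (ti + e)))" for e
  have main: "G e \<le> F e" if e: "0 < e" "e < \<nu>i" "e < pinf" "e < qinf" "e < \<alpha>i" "e < ti" for e
  proof -
    \<comment> \<open>The tail is sure to equal 1 only from this radius on, so the energy is taken
      outside R and the mass outside \<open>\<rho> R\<close>; \<open>\<nu>i\<close> is a lower bound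
      for the limsup of the mass at every radius.\<close>
    define \<rho> where "\<rho> R = 2 * real DIM('a) * R" for R
    have "\<forall>\<^sub>F R in at_top. limsup (\<lambda>n. ereal (LINT x:{x. R < norm x}|lebesgue. g n x)) < ereal (\<mu>i + e)"
      by (rule order_tendstoD(2)[OF gm(1)]) (use e \<mu> in simp)
    then have "\<forall>\<^sub>F R in at_top. limsup (\<lambda>n. ereal (LINT x:{x. R < norm x}|lebesgue. g n x)) < ereal (\<mu>i + e) \<and>
      1 \<le> R \<and> (\<forall>u :: 'a \<Rightarrow> real. u \<in> borel_measurable lebesgue \<longrightarrow>
         modular lebesgue P u \<le> ennreal B \<longrightarrow> modular lebesgue q (\<lambda>x. u x * tail_slope R x) \<le> ennreal e) \<and>
      (\<forall>x. R < norm x \<longrightarrow> pinf - e \<le> p x \<and> p x \<le> pinf + e) \<and> (\<forall>x. R < norm x \<longrightarrow> qinf - e \<le> q x \<and> q x \<le> qinf + e) \<and>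
      (\<forall>x. R < norm x \<longrightarrow> \<alpha>i - e \<le> \<alpha> x \<and> \<alpha> x \<le> \<alpha>i + e) \<and> (\<forall>x. R < norm x \<longrightarrow> ti - e \<le> t x \<and> t x \<le> ti + e)"
      by (intro eventually_conj eventually_ge_at_top tail_slope_small B e(1) exponent_close_at_infinity lim)
    from eventually_happens[OF this] obtain R where
      Rg: "limsup (\<lambda>n. ereal (LINT x:{x. R < norm x}|lebesgue. g n x)) < ereal (\<mu>i + e)" and R1: "1 \<le> R" and
      Rs: "\<forall>u :: 'a \<Rightarrow> real. u \<in> borel_measurable lebesgue \<longrightarrow>
         modular lebesgue P u \<le> ennreal B \<longrightarrow> modular lebesgue q (\<lambda>x. u x * tail_slope R x) \<le> ennreal e" and
      Re: "\<And>x. R < norm x \<Longrightarrow> pinf - e \<le> p x \<and> p x \<le> pinf + e" "\<And>x. R < norm x \<Longrightarrow> qinf - e \<le> q x \<and> q x \<le> qinf + e"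
      "\<And>x. R < norm x \<Longrightarrow> \<alpha>i - e \<le> \<alpha> x \<and> \<alpha> x \<le> \<alpha>i + e" "\<And>x. R < norm x \<Longrightarrow> ti - e \<le> t x \<and> t x \<le> ti + e"
      by auto
    have R: "0 < R" using R1 by simp
    \<comment> \<open>The energy bound holds for all large n. If the mass bound failed whenever the
      energy bound holds, the limsup of the masses would be at most \<nu>i - e.\<close>
    have "\<exists>n. (LINT x:{x. R < norm x}|lebesgue. g n x) < \<mu>i + e \<and> \<nu>i - e < (LINT x:{x. \<rho> R < norm x}|lebesgue. h n x)"
    proof (rule ccontr)
      assume neg: "\<not> ?thesis"
      have "\<forall>\<^sub>F n in sequentially. ereal (LINT x:{x. R < norm x}|lebesgue. g n x) < ereal (\<mu>i + e)"
        by (rule Limsup_lessD[OF Rg])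
      then have "\<forall>\<^sub>F n in sequentially. ereal (LINT x:{x. \<rho> R < norm x}|lebesgue. h n x) \<le> ereal (\<nu>i - e)"
      proof (rule eventually_mono)
        fix n assume "ereal (LINT x:{x. R < norm x}|lebesgue. g n x) < ereal (\<mu>i + e)"
        then have "\<not> \<nu>i - e < (LINT x:{x. \<rho> R < norm x}|lebesgue. h n x)" using neg by auto
        then show "ereal (LINT x:{x. \<rho> R < norm x}|lebesgue. h n x) \<le> ereal (\<nu>i - e)" by simp
      qed
      then have "limsup (\<lambda>n. ereal (LINT x:{x. \<rho> R < norm x}|lebesgue. h n x)) \<le> ereal (\<nu>i - e)" by (rule Limsup_bounded)
      with hm(2)[of "\<rho> R"] have "ereal \<nu>i \<le> ereal (\<nu>i - e)" unfolding \<nu> by (rule order_trans)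
      then show False using e(1) by simp
    qed
    then obtain n where n: "(LINT x:{x. R < norm x}|lebesgue. g n x) < \<mu>i + e"
      "\<nu>i - e < (LINT x:{x. \<rho> R < norm x}|lebesgue. h n x)" by blast
    define u where "u = un n"
    define E where "E = (LINT x:{x. R < norm x}|lebesgue. g n x)"
    have uX: "u \<in> X" by (simp add: u_def un)
    note um = X_props(2)[OF uX]
    have gu: "g n = (\<lambda>x. A x (wgrad u x) + V x * \<bar>u x\<bar> powr \<alpha> x)" and hu: "h n = (\<lambda>x. b x * \<bar>u x\<bar> powr t x)"
      by (simp_all add: g_def h_def u_def)
    have out: "{x::'a. c < norm x} \<in> sets lebesgue" for c
    proof -
      have "{x::'a. c < norm x} \<in> sets borel" by measurable
      then show ?thesis by (simp add: sets_completionI_sets)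
    qed
    have t0: "tail R x = 0" if "x \<notin> {x. R < norm x}" for x using tail_eq_0[OF R, of x] that by simp
    note en = energy_controls_modulars[OF M1 A uX gi[of n, unfolded gu] out[of R] tail_bounds t0 measurable_tail, folded gu, folded E_def]
    have E: "0 \<le> E" "E \<le> \<mu>i + e" using en(1) n(1) by (auto simp: E_def)
    have EM: "E / M1 \<le> (\<mu>i + e) / M1" using E(2) M1 by (simp add: divide_right_mono)
    have mp: "0 < \<mu>i + e" "0 < (\<mu>i + e) / M1" using \<mu>0 e(1) M1 by auto
    have sub: "AE x in M. tail R x * y x \<noteq> 0 \<longrightarrow> c - e \<le> r x \<and> r x \<le> c + e"
      if "\<And>x. R < norm x \<Longrightarrow> c - e \<le> r x \<and> r x \<le> c + e" for M :: "'a measure" and y r c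
    proof (rule AE_I2, rule impI)
      fix x assume "tail R x * y x \<noteq> 0"
      then have "R < norm x" using t0[of x] by auto
      then show "c - e \<le> r x \<and> r x \<le> c + e" by (rule that)
    qed
    have fm: "(\<lambda>x. tail R x * u x) \<in> borel_measurable lebesgue" using measurable_tail um by (rule borel_measurable_times)
    have vm: "(\<lambda>x. tail R x * grad_big u x) \<in> borel_measurable lebesgue" "(\<lambda>x. tail R x * grad_small u x) \<in> borel_measurable lebesgue"
      using measurable_tail X_gradient_measurable[OF uX] by (auto intro: borel_measurable_times)
    have l\<alpha>: "luxemburg (weighted V) \<alpha> (\<lambda>x. tail R x * u x) \<le> U (\<lambda>e. \<mu>i + e) \<alpha>i e"
      unfolding U_def
      by (rule luxemburg_le_modular[OF exponents_measurable_weighted(1) exponents_ge1(3) _ order_trans[OF en(2) ennreal_leI[OF E(2)]] mp(1) sub[OF Re(3)]])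
         (use fm e in \<open>auto simp: measurable_weighted\<close>)
    have lp: "luxemburg lebesgue p (\<lambda>x. tail R x * grad_big u x) \<le> U (\<lambda>e. (\<mu>i + e) / M1) pinf e"
      unfolding U_def
      by (rule luxemburg_le_modular[OF exponents_measurable_lebesgue(1) exponents_ge1(1) vm(1) order_trans[OF en(3) ennreal_leI[OF EM]] mp(2) sub[OF Re(1)]])
         (use e in auto)
    have lq: "luxemburg lebesgue q (\<lambda>x. tail R x * grad_small u x) \<le> U (\<lambda>e. (\<mu>i + e) / M1) qinf e"
      unfolding U_def
      by (rule luxemburg_le_modular[OF exponents_measurable_lebesgue(2) exponents_ge1(2) vm(2) order_trans[OF en(4) ennreal_leI[OF EM]] mp(2) sub[OF Re(2)]])
         (use e in auto)
    have Dm: "(\<lambda>x. u x * tail_slope R x) \<in> borel_measurable lebesgue"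
      using um measurable_tail_slope by (rule borel_measurable_times)
    have D: "modular lebesgue q (\<lambda>x. u x * tail_slope R x) \<le> ennreal e"
      using Rs um full[of n] unfolding u_def by blast
    have lD: "luxemburg lebesgue q (\<lambda>x. u x * tail_slope R x) \<le> max (e powr (1 / 1)) (e powr (1 / Pm))"
      by (rule luxemburg_le_modular[OF exponents_measurable_lebesgue(2) exponents_ge1(2) Dm D e(1)])
         (use exponents_ge1(2) exponents_le_Pm(2,6) in auto)
    have L: "(\<lambda>x. tail R x * grad_big u x) \<in> Lvar lebesgue p" "(\<lambda>x. tail R x * grad_small u x) \<in> Lvar lebesgue q"
      "(\<lambda>x. u x * tail_slope R x) \<in> Lvar lebesgue q"
      using vm Dm le_less_trans[OF en(3)] le_less_trans[OF en(4)] le_less_trans[OF D] by (auto simp: Lvar_def)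
    have v0: "0 \<le> tail R x * grad_big u x" "0 \<le> tail R x * grad_small u x" for x
      using tail_bounds(1)[of R x] grad_split(2,3)[of u x] by auto
    have split: "AE x in lebesgue. tail R x * norm (wgrad u x) \<le> tail R x * grad_big u x + tail R x * grad_small u x"
      unfolding grad_split(1) by (simp add: distrib_left)
    note fX = tail_mult_X[OF uX R L(1) v0(1) L(2) v0(2) split L(3)]
    have up: "X_norm (\<lambda>x. tail R x * u x) \<le> F e" using fX(2) l\<alpha> lp lq lD unfolding F_def by linarith
    have one: "tail R x = 1" if "x \<in> {x. \<rho> R < norm x}" for x :: 'a
      using tail_eq_1[OF R, of x] that by (simp add: \<rho>_def)
    have "ennreal (\<nu>i - e) \<le> ennreal (LINT x:{x. \<rho> R < norm x}|lebesgue. b x * \<bar>u x\<bar> powr t x)"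
      using n(2) unfolding hu by (intro ennreal_leI) simp
    also have "\<dots> \<le> modular (weighted b) t (\<lambda>x. tail R x * u x)"
      by (rule mass_le_modular_b[OF um hi[of n, unfolded hu] out one measurable_tail])
    finally have low: "ennreal (\<nu>i - e) \<le> modular (weighted b) t (\<lambda>x. tail R x * u x)" .
    have fL: "(\<lambda>x. tail R x * u x) \<in> Lvar (weighted b) t" by (rule embedding) (use fX(1) in blast)
    have "min ((\<nu>i - e) powr (1 / (ti - e))) ((\<nu>i - e) powr (1 / (ti + e))) \<le> luxemburg (weighted b) t (\<lambda>x. tail R x * u x)"
      by (rule luxemburg_ge_modular[OF exponents_measurable_weighted(2) exponents_ge1(5) fL low _ sub[OF Re(4)]]) (use e in auto)
    then have "G e \<le> S * luxemburg (weighted b) t (\<lambda>x. tail R x * u x)" unfolding G_def using S0 by (rule mult_left_mono)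
    also have "\<dots> \<le> X_norm (\<lambda>x. tail R x * u x)" unfolding S_def by (rule best_const_le[OF fX(1)])
    finally show ?thesis using up by linarith
  qed
  have id: "((\<lambda>e::real. e) \<longlongrightarrow> 0) (at_right 0)" by (rule tendsto_ident_at)
  have near: "\<forall>\<^sub>F e in at_right (0::real). e < c" if "0 < c" for c
    using order_tendstoD(2)[OF id that] .
  have ge: "\<forall>\<^sub>F e in at_right (0::real). 0 < e" by (simp add: eventually_at_right_less)
  have Ulim: "(U f r \<longlongrightarrow> c powr (1 / r)) (at_right 0)"
    if "(f \<longlongrightarrow> c) (at_right 0)" "\<forall>\<^sub>F e in at_right 0. 0 \<le> f e" "0 < r" for f r c
  proof -
    have "((\<lambda>e. max (f e powr (1 / (r - e))) (f e powr (1 / (r + e)))) \<longlongrightarrow> max (c powr (1 / r)) (c powr (1 / r))) (at_right 0)"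
      by (intro tendsto_max powr_exponent_limit that)
    then show ?thesis by (simp add: U_def[abs_def])
  qed
  have "((\<lambda>e. \<mu>i + e) \<longlongrightarrow> \<mu>i + 0) (at_right 0)" "((\<lambda>e. (\<mu>i + e) / M1) \<longlongrightarrow> (\<mu>i + 0) / M1) (at_right 0)"
    by (intro tendsto_intros id; use M1 in simp)+
  then have l: "((\<lambda>e. \<mu>i + e) \<longlongrightarrow> \<mu>i) (at_right 0)" "((\<lambda>e. (\<mu>i + e) / M1) \<longlongrightarrow> \<mu>i / M1) (at_right 0)" by simp_all
  have l0: "\<forall>\<^sub>F e in at_right 0. 0 \<le> \<mu>i + e" "\<forall>\<^sub>F e in at_right 0. 0 \<le> (\<mu>i + e) / M1"
    using ge by (auto elim!: eventually_mono simp: \<mu>0 M1 less_imp_le)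
  have Pm0: "0 < Pm" using exponents_le_Pm(6) by linarith
  have "((\<lambda>e. max (e powr (1 / 1)) (e powr (1 / Pm))) \<longlongrightarrow> max (0 powr (1 / 1)) (0 powr (1 / Pm))) (at_right 0)"
    by (intro tendsto_max tendsto_powr' id tendsto_const) (use Pm0 ge in \<open>auto elim!: eventually_mono\<close>)
  then have l1: "((\<lambda>e. max (e powr (1 / 1)) (e powr (1 / Pm))) \<longlongrightarrow> 0) (at_right 0)" by simp
  have Flim: "(F \<longlongrightarrow> \<mu>i powr (1 / \<alpha>i) + (\<mu>i / M1) powr (1 / pinf) + (\<mu>i / M1) powr (1 / qinf) + 0) (at_right 0)"
    unfolding F_def[abs_def] by (intro tendsto_add l1 Ulim l l0 pos)
  \<comment> \<open>\<open>main\<close> is available only for e < \<nu>i; for \<nu>i = 0 the left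
    side is 0.\<close>
  have key: "S * \<nu>i powr (1 / ti) \<le> \<mu>i powr (1 / \<alpha>i) + (\<mu>i / M1) powr (1 / pinf) + (\<mu>i / M1) powr (1 / qinf)"
  proof (cases "\<nu>i = 0")
    case False
    then have \<nu>p: "0 < \<nu>i" using \<nu>0 by simp
    have "((\<lambda>e. \<nu>i - e) \<longlongrightarrow> \<nu>i - 0) (at_right 0)" by (intro tendsto_intros id)
    then have l2: "((\<lambda>e. \<nu>i - e) \<longlongrightarrow> \<nu>i) (at_right 0)" by simp
    have l3: "\<forall>\<^sub>F e in at_right 0. 0 \<le> \<nu>i - e" using near[OF \<nu>p] by (auto elim!: eventually_mono)
    have "(G \<longlongrightarrow> S * min (\<nu>i powr (1 / ti)) (\<nu>i powr (1 / ti))) (at_right 0)"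
      unfolding G_def[abs_def] by (intro tendsto_mult_left tendsto_min powr_exponent_limit l2 l3 pos)
    then have Glim: "(G \<longlongrightarrow> S * \<nu>i powr (1 / ti)) (at_right 0)" by simp
    have "\<forall>\<^sub>F e in at_right 0. G e \<le> F e"
      using ge near[OF \<nu>p] near[OF pos(1)] near[OF pos(2)] near[OF pos(3)] near[OF pos(4)]
      by eventually_elim (rule main)
    from tendsto_le[OF _ Flim Glim this] show ?thesis by simp
  qed simp
  \<comment> \<open>This serves the case M1 < 1: there the power of M1 with exponent -1/qinf is at
    most the one with exponent -1/pinf, so a single constant covers both gradient terms.\<close>
  have pq_inf: "pinf \<le> qinf"
    by (rule tendsto_le[OF trivial_limit_at_infinity lim(2,1)]) (use pq in simp)
  define c where "c = max 1 (M1 powr (- (1 / pinf)))"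
  have sc: "(\<mu>i / M1) powr (1 / r) = M1 powr (- (1 / r)) * \<mu>i powr (1 / r)" for r
    using \<mu>0 M1 by (simp add: powr_divide powr_minus_divide)
  have "M1 powr (- (1 / qinf)) \<le> c"
  proof (cases "1 \<le> M1")
    case True
    then have "M1 powr (- (1 / qinf)) \<le> M1 powr 0" using pos by (intro powr_mono) auto
    then show ?thesis using M1 by (simp add: c_def)
  next
    case False
    then have "M1 powr (- (1 / qinf)) \<le> M1 powr (- (1 / pinf))"
      using pos pq_inf M1 by (intro powr_mono') (auto simp: frac_le)
    then show ?thesis by (simp add: c_def)
  qed
  then have "(\<mu>i / M1) powr (1 / qinf) \<le> c * \<mu>i powr (1 / qinf)" unfolding sc by (rule mult_right_mono) simp
  moreover have "(\<mu>i / M1) powr (1 / pinf) \<le> c * \<mu>i powr (1 / pinf)" unfolding sc by (rule mult_right_mono) (simp_all add: c_def)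
  moreover have "1 * \<mu>i powr (1 / \<alpha>i) \<le> c * \<mu>i powr (1 / \<alpha>i)" by (rule mult_right_mono) (simp_all add: c_def)
  ultimately have "S * \<nu>i powr (1 / ti) \<le> c * (\<mu>i powr (1 / pinf) + \<mu>i powr (1 / qinf) + \<mu>i powr (1 / \<alpha>i))"
    using key by (simp add: distrib_left)
  then show ?thesis by (simp only: S_def c_def)
qed

end

theorem theorem3p2:
  fixes A :: "'a::euclidean_space \<Rightarrow> 'a \<Rightarrow> real" and a :: "'a \<Rightarrow> 'a \<Rightarrow> 'a"
    and p q s V \<alpha> b t u :: "'a \<Rightarrow> real" and un :: "nat \<Rightarrow> 'a \<Rightarrow> real"
    and \<mu> \<nu> :: "'a set \<Rightarrow> real" and M1 M2 :: real and \<mu>_inf \<nu>_inf S_b :: ereal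
  assumes dim: "DIM('a) \<ge> 2"
    and struct: "structural_assumptions A a p q s V \<alpha>"
    and growth: "growth_estimate A a p q M1 M2"
    and b_Linf: "b \<in> borel_measurable lebesgue" "esssup lebesgue (\<lambda>x. ereal \<bar>b x\<bar>) < \<infinity>"
    and b_pos: "AE x in lebesgue. b x > 0"
    and t_cont: "continuous_on UNIV t"
    and t_range: "\<forall>x. \<alpha> x \<le> t x \<and> t x \<le> sobolev_exp p x"
    and t_crit: "{x. t x = sobolev_exp p x} \<noteq> {}"
    and weak: "weakly_converges (sol_space V \<alpha> p q) (sol_norm V \<alpha> p q) un u"
    and conv_mu: "weak_star_converges
          (\<lambda>n x. A x (wgrad (un n) x) + V x * \<bar>un n x\<bar> powr \<alpha> x) \<mu>"
    and conv_nu: "weak_star_converges (\<lambda>n x. b x * \<bar>un n x\<bar> powr t x) \<nu>"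
    and mu_inf: "\<mu>_inf = mass_at_infinity
          (\<lambda>n x. A x (wgrad (un n) x) + V x * \<bar>un n x\<bar> powr \<alpha> x)"
    and nu_inf: "\<nu>_inf = mass_at_infinity (\<lambda>n x. b x * \<bar>un n x\<bar> powr t x)"
    and S_b: "S_b = best_const V \<alpha> p q b t"
  shows "limsup (\<lambda>n. ereal (LINT x|lebesgue. A x (wgrad (un n) x) + V x * \<bar>un n x\<bar> powr \<alpha> x))
           = ereal (\<mu> UNIV) + \<mu>_inf
       \<and> limsup (\<lambda>n. ereal (LINT x|lebesgue. b x * \<bar>un n x\<bar> powr t x)) = ereal (\<nu> UNIV) + \<nu>_inf
       \<and> S_b \<in> {0<..<\<infinity>}
       \<and> (\<forall>p_inf>0. \<forall>q_inf>0. \<forall>\<alpha>_inf>0. \<forall>t_inf>0.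
            (p \<longlongrightarrow> p_inf) at_infinity \<longrightarrow> (q \<longlongrightarrow> q_inf) at_infinity \<longrightarrow>
            (\<alpha> \<longlongrightarrow> \<alpha>_inf) at_infinity \<longrightarrow> (t \<longlongrightarrow> t_inf) at_infinity \<longrightarrow>
            real_of_ereal S_b * real_of_ereal \<nu>_inf powr (1 / t_inf)
              \<le> max 1 (M1 powr (- (1 / p_inf)))
                * (real_of_ereal \<mu>_inf powr (1 / p_inf) + real_of_ereal \<mu>_inf powr (1 / q_inf)
                   + real_of_ereal \<mu>_inf powr (1 / \<alpha>_inf)))"
proof -
  have A4: "assm_A4 p q" and P1: "assm_P1 p q \<alpha>" and V1: "assm_V1 V"
    using struct by (simp_all add: structural_assumptions_def)
  have M1: "0 < M1" using growth by (simp add: growth_estimate_def)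
  have A: "M1 * norm \<xi> powr (if 1 < norm \<xi> then p x else q x) \<le> A x \<xi>" for x \<xi>
    using growth unfolding growth_estimate_def Let_def by blast
  have Vm: "V \<in> borel_measurable lebesgue"
  proof (rule locally_integrable_locint)
    show "locally_integrable V" using V1 by (simp add: assm_V1_def)
  qed assumption
  \<comment> \<open>A real c strictly between the essential supremum of - V and 0 turns the
    extended-real condition into an almost everywhere bound.\<close>
  obtain V0 where V0: "0 < V0" "AE x in lebesgue. V0 \<le> V x"
  proof -
    have "esssup lebesgue (\<lambda>x. ereal (- V x)) < 0" using V1 by (simp add: assm_V1_def ereal_less_uminus_reorder)
    then obtain c where c: "esssup lebesgue (\<lambda>x. ereal (- V x)) < ereal c" "ereal c < 0"
      using ereal_dense2 by blast
    have "AE x in lebesgue. - c \<le> V x"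
      using esssup_AE[of "\<lambda>x. ereal (- V x)" lebesgue]
    proof eventually_elim
      case (elim x)
      then have "ereal (- V x) < ereal c" using c(1) by (rule le_less_trans)
      then show ?case by simp
    qed
    then show ?thesis using that[of "- c"] c(2) by simp
  qed
  obtain bm where bm: "0 \<le> bm" "AE x in lebesgue. b x \<le> bm"
  proof -
    obtain c where c: "esssup lebesgue (\<lambda>x. ereal \<bar>b x\<bar>) < ereal c" using b_Linf(2) ereal_dense2 by blast
    have "AE x in lebesgue. b x \<le> max 0 c"
      using esssup_AE[of "\<lambda>x. ereal \<bar>b x\<bar>" lebesgue]
    proof eventually_elim
      case (elim x)
      then have "ereal \<bar>b x\<bar> < ereal c" using c(1) by (rule le_less_trans)
      then show ?case by simp
    qed
    then show ?thesis using that[of "max 0 c"] by simp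
  qed
  obtain \<gamma> L \<kappa> Pm where ex: "exponents p q \<alpha> \<gamma> (sobolev_exp p) L \<kappa> Pm"
    and pq: "\<And>x. p x \<le> q x" "\<And>x. q x + \<kappa> \<le> sobolev_exp p x"
      "\<And>x. (real DIM('a) + \<kappa>) * (sobolev_exp p x - q x) \<le> q x * sobolev_exp p x"
  proof (rule exponents_structural[OF dim A4 P1])
    fix \<gamma> L \<kappa> Pm
    assume e: "exponents p q \<alpha> \<gamma> (sobolev_exp p) L \<kappa> Pm" "\<And>x. p x \<le> q x" "\<And>x. q x + \<kappa> \<le> sobolev_exp p x"
      "\<And>x. (real DIM('a) + \<kappa>) * (sobolev_exp p x - q x) \<le> q x * sobolev_exp p x"
    show thesis by (rule that[OF e])
  qed
  interpret weights p q \<alpha> \<gamma> "sobolev_exp p" L \<kappa> Pm V b t V0 bm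
  proof (rule weights.intro[OF ex], unfold_locales)
    show "t \<in> borel_measurable borel" by (rule borel_measurable_continuous_onI[OF t_cont])
    show "locally_integrable V" using V1 by (simp add: assm_V1_def)
  qed (use Vm V0 bm b_Linf(1) b_pos t_range pq in auto)
  define g where "g n x = A x (wgrad (un n) x) + V x * \<bar>un n x\<bar> powr \<alpha> x" for n x
  define h where "h n x = b x * \<bar>un n x\<bar> powr t x" for n x
  have A0: "0 \<le> A x \<xi>" for x \<xi> by (rule order_trans[OF _ A]) (use M1 in simp)
  have g0: "AE x in lebesgue. 0 \<le> g n x" for n
    using V0(2)
  proof eventually_elim
    case (elim x) then show ?case using A0 V0(1) by (simp add: g_def)
  qed
  have h0: "AE x in lebesgue. 0 \<le> h n x" for n
    using b_pos by eventually_elim (simp add: h_def)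
  have wg: "weak_star_converges g \<mu>" and wh: "weak_star_converges h \<nu>"
    using conv_mu conv_nu by (simp_all add: g_def[abs_def] h_def[abs_def])
  have gi: "integrable lebesgue (g n)" and hi: "integrable lebesgue (h n)" for n
    using wg wh by (auto simp: weak_star_converges_def)
  obtain C where C: "\<And>n. (LINT x|lebesgue. g n x) \<le> C" 
  proof (rule weak_star_converges_bounded[OF wg g0])
    fix D assume D: "\<And>n. (LINT x|lebesgue. g n x) \<le> D"
    show thesis by (rule that[OF D])
  qed
  obtain C' where C': "\<And>n. (LINT x|lebesgue. h n x) \<le> C'" 
  proof (rule weak_star_converges_bounded[OF wh h0])
    fix D assume D: "\<And>n. (LINT x|lebesgue. h n x) \<le> D"
    show thesis by (rule that[OF D])
  qed
  have \<mu>g: "\<mu>_inf = mass_at_infinity g" and \<nu>h: "\<nu>_inf = mass_at_infinity h"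
    by (simp_all add: mu_inf nu_inf g_def[abs_def] h_def[abs_def])
  note gm = mass_at_infinity_props[of g, OF gi g0 C] and hm = mass_at_infinity_props[of h, OF hi h0 C']
  \<comment> \<open>Finiteness of both masses at infinity makes \<open>real_of_ereal\<close>
    faithful, so the inequality for reals speaks of the actual values.\<close>
  have fin: "mass_at_infinity g = ereal (real_of_ereal \<mu>_inf)" "mass_at_infinity h = ereal (real_of_ereal \<nu>_inf)"
    using gm(3,4) hm(3,4) unfolding \<mu>g \<nu>h by (auto simp: ereal_real)
  have un: "un n \<in> X" for n using weak by (simp add: weakly_converges_def)
  note final = concentration_at_infinity[OF M1 A un gi[unfolded g_def[abs_def]] hi[unfolded h_def[abs_def]]
    C[unfolded g_def[abs_def]] C'[unfolded h_def[abs_def]] fin[unfolded g_def[abs_def] h_def[abs_def]]]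
  show ?thesis
  proof (intro conjI allI impI)
    show "limsup (\<lambda>n. ereal (LINT x|lebesgue. A x (wgrad (un n) x) + V x * \<bar>un n x\<bar> powr \<alpha> x)) = ereal (\<mu> UNIV) + \<mu>_inf"
      using limsup_total_mass[OF wg g0] by (simp only: \<mu>g g_def[abs_def])
    show "limsup (\<lambda>n. ereal (LINT x|lebesgue. b x * \<bar>un n x\<bar> powr t x)) = ereal (\<nu> UNIV) + \<nu>_inf"
      using limsup_total_mass[OF wh h0] by (simp only: \<nu>h h_def[abs_def])
    show "S_b \<in> {0<..<\<infinity>}" unfolding S_b by (rule best_const_pos_finite)
    fix p_inf q_inf \<alpha>_inf t_inf :: real
    assume pos: "0 < p_inf" "0 < q_inf" "0 < \<alpha>_inf" "0 < t_inf"
      and lim: "(p \<longlongrightarrow> p_inf) at_infinity" "(q \<longlongrightarrow> q_inf) at_infinity" "(\<alpha> \<longlongrightarrow> \<alpha>_inf) at_infinity" "(t \<longlongrightarrow> t_inf) at_infinity"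
    show "real_of_ereal S_b * real_of_ereal \<nu>_inf powr (1 / t_inf)
      \<le> max 1 (M1 powr (- (1 / p_inf))) * (real_of_ereal \<mu>_inf powr (1 / p_inf) + real_of_ereal \<mu>_inf powr (1 / q_inf)
         + real_of_ereal \<mu>_inf powr (1 / \<alpha>_inf))"
      unfolding S_b by (rule final[OF pos lim])
  qed
qed

end
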